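(* The Corona Theorem with bounds holds on $H^\infty+C$. That is: for every integer $n\ge 1$ and every $\delta\in(0,1]$ there is a finite constant $K(n,\delta)$, depending only on $n$ and $\delta$, such that whenever $F_1,\dots,F_n\in H^\infty+C$ satisfy $\|F_j\|_\infty\le 1$ for all $j$ and $\sum_{j=1}^n|\hat F_j(t)|\ge\delta$ for every $t\in M(H^\infty+C)$, there exist $G_1,\dots,G_n\in H^\infty+C$ with $\sum_{j=1}^n G_jF_j=1$ and $\max_{1\le j\le n}\|G_j\|_\infty\le K(n,\delta)$.
   Context: $\mathbb D$ is the open unit disk and $\mathbb T$ the unit circle. $H^\infty$ is the algebra of bounded holomorphic functions on $\mathbb D$, identified via boundary values with a closed subalgebra of $L^\infty(\mathbb T)$ (with the essential supremum norm $\|\cdot\|_\infty$). The Sarason algebra $H^\infty+C=\{f+g: f\in H^\infty,\ g\in C(\mathbb T)\}$ is a uniformly closed subalgebra of $L^\infty(\mathbb T)$; it is the closed algebra generated by $H^\infty$ and $\overline z$. $M(A)$ denotes the maximal ideal space (space of nonzero multiplicative linear functionals) of a commutative unital Banach algebra $A$, and $\hat F$ is the Gelfand transform of $F\in A$. $M(H^\infty+C)$ can be identified with $M(H^\infty)\setminus\mathbb D$. *)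

theory Defs
  imports "HOL-Complex_Analysis.Complex_Analysis" "HOL-Probability.Probability"
begin

text \<open>
  Elements of \<open>L\<^sup>\<infinity>(\<bbbT>)\<close> are represented by Borel functions on the unit circle; two functions
  represent the same element iff they agree almost everywhere. The sets of functions below are
  closed under almost everywhere equality of Borel functions, so they stand for sets of classes.
\<close>

definition circle_measure :: "complex measure"
  where "circle_measure =
    distr (uniform_measure lborel {0..2 * pi}) (restrict_space borel (sphere 0 1)) cis"

definition linf_norm :: "(complex \<Rightarrow> complex) \<Rightarrow> ereal"
  where "linf_norm F = esssup circle_measure (\<lambda>z. ereal (norm (F z)))"

definition Linf :: "(complex \<Rightarrow> complex) set"
  where "Linf = {F \<in> borel_measurable circle_measure. linf_norm F < \<infinity>}"

text \<open>Boundary values are taken as radial limits, which exist almost everywhere by Fatou's theorem.\<close>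

definition Hinf :: "(complex \<Rightarrow> complex) set"
  where "Hinf = {F \<in> Linf. \<exists>h. h holomorphic_on ball 0 1 \<and> bounded (h ` ball 0 1) \<and>
    (AE z in circle_measure. ((\<lambda>r. h (complex_of_real r * z)) \<longlongrightarrow> F z) (at_left 1))}"

definition Hinf_plus_C :: "(complex \<Rightarrow> complex) set"
  where "Hinf_plus_C = {F \<in> Linf. \<exists>f \<in> Hinf. \<exists>g. continuous_on (sphere 0 1) g \<and>
    (AE z in circle_measure. F z = f z + g z)}"

text \<open>
  Here \<open>A\<close> is a set of representatives of a subalgebra of \<open>L\<^sup>\<infinity>(M)\<close>. The first clause makes a
  functional well defined on classes; \<open>extensional\<close> fixes its irrelevant values outside \<open>A\<close>.
  Continuity is automatic for multiplicative functionals on a Banach algebra.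
\<close>

definition maximal_ideal_space ::
    "'a measure \<Rightarrow> ('a \<Rightarrow> complex) set \<Rightarrow> (('a \<Rightarrow> complex) \<Rightarrow> complex) set"
  where "maximal_ideal_space M A = {\<phi> \<in> extensional A.
    (\<forall>F\<in>A. \<forall>G\<in>A. (AE x in M. F x = G x) \<longrightarrow> \<phi> F = \<phi> G) \<and>
    (\<forall>F\<in>A. \<forall>G\<in>A. \<phi> (\<lambda>x. F x + G x) = \<phi> F + \<phi> G) \<and>
    (\<forall>c. \<forall>F\<in>A. \<phi> (\<lambda>x. c * F x) = c * \<phi> F) \<and>
    (\<forall>F\<in>A. \<forall>G\<in>A. \<phi> (\<lambda>x. F x * G x) = \<phi> F * \<phi> G) \<and>
    (\<exists>F\<in>A. \<phi> F \<noteq> 0)}"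

definition gelfand :: "('a \<Rightarrow> complex) \<Rightarrow> (('a \<Rightarrow> complex) \<Rightarrow> complex) \<Rightarrow> complex"
  where "gelfand F = (\<lambda>\<phi>. \<phi> F)"

lemma space_circle_measure [simp]: "space circle_measure = sphere 0 1"
  by (simp add: circle_measure_def space_restrict_space)

lemma sets_circle_measure [measurable_cong]:
  "sets circle_measure = sets (restrict_space borel (sphere 0 1))"
  by (simp add: circle_measure_def)

lemma measurable_cis_circle:
  "cis \<in> uniform_measure lborel {0..2 * pi} \<rightarrow>\<^sub>M restrict_space borel (sphere 0 1)"
proof -
  have "cis \<in> borel_measurable borel"
    by (intro borel_measurable_continuous_onI continuous_intros)
  then show ?thesis
    by (intro measurable_restrict_space2)
       (auto simp: measurable_def sets_uniform_measure space_uniform_measure)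
qed

lemma prob_space_circle_measure: "prob_space circle_measure"
  unfolding circle_measure_def
  by (intro prob_space.prob_space_distr measurable_cis_circle prob_space_uniform_measure) auto

end

theory Submission
  imports Defs "HOL-Probability.Discrete_Topology"
begin

text \<open>
  An element of \<open>H\<^sup>\<infinity> + C\<close> is uniformly close to \<open>cnj z ^ M * f\<close> with \<open>f\<close> bounded analytic, and evaluation of
  Poisson integrals is asymptotically multiplicative at the circle. Limits of these evaluations are
  therefore characters, so the hypothesis on the Gelfand transforms bounds \<open>\<Sum>\<bar>f j\<bar>\<close> from
  below in some annulus \<open>\<rho> \<le> \<bar>z\<bar> < 1\<close>, with a bound depending on \<open>n\<close> and \<open>\<delta>\<close> only.

  Adding a small constant \<open>\<tau>\<close> to the list removes the common zeros in the inner disc. The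
  lower bound there is useless, but \<open>\<Sum> p j * f j = z ^ N\<close> can be solved with bounds independent of
  \<open>\<tau>\<close> and \<open>\<rho>\<close> if \<open>N\<close> is large: by duality this reduces to a Wolff-type estimate, in which \<open>z ^ N\<close> suppresses
  the inner disc. Since \<open>z ^ N\<close> is invertible in \<open>H\<^sup>\<infinity> + C\<close>, this solves the corona problem up to an
  error of norm at most \<open>1/2\<close>, which a Neumann series removes.
\<close>

section \<open>Wirtinger derivatives and circular means\<close>

text \<open>The radius \<rho> comes out of a compactness argument on characters, so nothing controls
  it in terms of n and \<delta>; a constant that saw the behaviour of the data on the whole disc
  would depend on it. What saves the bound is that \<rho> may enter the exponent N freely:
  multiplication by \<open>cnj z ^ N\<close> preserves the essential supremum norm. Likewise \<tau>
  has to be chosen after the constant K, because it contributes an error \<tau> * K that must be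
  small; so K must be blind to \<tau>, while N need not be. The quantitative reason why this is
  possible is that N * \<rho> ^ (N - 1) tends to 0 and thus beats any fixed power of 1 / \<tau>.

  Two devices keep the analysis elementary. Carleson measures are replaced by explicit functions
  whose Laplacian dominates the required density and whose circular means are bounded. Functionals
  on continuous functions are handled through their Poisson extensions instead of representing
  measures.\<close>

definition has_wirtinger :: "(complex \<Rightarrow> complex) \<Rightarrow> complex \<Rightarrow> complex \<Rightarrow> complex \<Rightarrow> bool"
  where "has_wirtinger f a b z \<longleftrightarrow> (f has_derivative (\<lambda>h. a * h + b * cnj h)) (at z)"

lemma has_wirtinger_const: "has_wirtinger (\<lambda>z. c) 0 0 z"
  by (simp add: has_wirtinger_def)

lemma has_wirtinger_add:
  assumes "has_wirtinger f a b z" "has_wirtinger g c d z"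
  shows "has_wirtinger (\<lambda>z. f z + g z) (a + c) (b + d) z"
  using has_derivative_add[OF assms[unfolded has_wirtinger_def]]
  by (simp add: has_wirtinger_def algebra_simps)

lemma has_wirtinger_diff:
  assumes "has_wirtinger f a b z" "has_wirtinger g c d z"
  shows "has_wirtinger (\<lambda>z. f z - g z) (a - c) (b - d) z"
  using has_derivative_diff[OF assms[unfolded has_wirtinger_def]]
  by (simp add: has_wirtinger_def algebra_simps)

lemma has_wirtinger_mult:
  assumes "has_wirtinger f a b z" "has_wirtinger g c d z"
  shows "has_wirtinger (\<lambda>z. f z * g z) (a * g z + f z * c) (b * g z + f z * d) z"
  using has_derivative_mult[OF assms[unfolded has_wirtinger_def]]
  by (simp add: has_wirtinger_def algebra_simps)

lemma has_wirtinger_sum: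
  assumes "\<And>i. i \<in> I \<Longrightarrow> has_wirtinger (f i) (a i) (b i) z"
  shows "has_wirtinger (\<lambda>z. \<Sum>i\<in>I. f i z) (\<Sum>i\<in>I. a i) (\<Sum>i\<in>I. b i) z"
  using has_derivative_sum[of I f "\<lambda>i h. a i * h + b i * cnj h" "at z"] assms
  by (simp add: has_wirtinger_def sum.distrib sum_distrib_right)

lemma has_wirtinger_holomorphic:
  assumes "(f has_field_derivative f') (at z)"
  shows "has_wirtinger f f' 0 z"
  using assms by (simp add: has_wirtinger_def has_field_derivative_def)

lemma has_wirtinger_cnj:
  assumes "has_wirtinger f a b z"
  shows "has_wirtinger (\<lambda>z. cnj (f z)) (cnj b) (cnj a) z"
  using has_derivative_cnj[OF assms[unfolded has_wirtinger_def]]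
  by (simp add: has_wirtinger_def algebra_simps)

lemma has_wirtinger_chain:
  assumes "(g has_field_derivative g') (at (f z))" "has_wirtinger f a b z"
  shows "has_wirtinger (\<lambda>z. g (f z)) (g' * a) (g' * b) z"
  using has_derivative_compose[OF assms(2)[unfolded has_wirtinger_def] assms(1)[unfolded has_field_derivative_def]]
  by (simp add: has_wirtinger_def algebra_simps)

lemma has_wirtinger_eq_rhs:
  assumes "has_wirtinger f a b z" "a = a'" "b = b'"
  shows "has_wirtinger f a' b' z"
  using assms by simp

lemma has_wirtinger_continuous_on:
  assumes "\<And>z. z \<in> S \<Longrightarrow> has_wirtinger f (a z) (b z) z"
  shows "continuous_on S f"
  using assms unfolding has_wirtinger_def
  by (meson continuous_at_imp_continuous_on has_derivative_continuous)

section \<open>Circular means and Green's formula in polar coordinates\<close>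

definition circle_mean :: "real \<Rightarrow> (complex \<Rightarrow> 'a) \<Rightarrow> 'a::real_normed_vector"
  where "circle_mean r f = integral {0..2*pi} (\<lambda>t. f (of_real r * cis t)) /\<^sub>R (2*pi)"

lemma vector_derivative_wirtinger_radial:
  assumes "has_wirtinger f a b (of_real r * cis t)"
  shows "((\<lambda>r. f (of_real r * cis t)) has_vector_derivative a * cis t + b * cis (-t)) (at r within S)"
proof -
  have "((\<lambda>r. of_real r * cis t) has_derivative (\<lambda>h. of_real h * cis t)) (at r within S)"
    by (auto intro!: derivative_eq_intros)
  from has_derivative_compose[OF this assms[unfolded has_wirtinger_def]]
  show ?thesis
    by (simp add: has_vector_derivative_def scaleR_conv_of_real algebra_simps cis_cnj)
qed

lemma vector_derivative_wirtinger_angular: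
  assumes "has_wirtinger f a b (of_real r * cis t)"
  shows "((\<lambda>t. f (of_real r * cis t)) has_vector_derivative
    \<i> * of_real r * (a * cis t - b * cis (-t))) (at t within S)"
proof -
  have "((\<lambda>t. of_real r * cis t) has_derivative (\<lambda>h. of_real r * (of_real h * (\<i> * cis t)))) (at t within S)"
    by (auto intro!: derivative_eq_intros simp: scaleR_conv_of_real algebra_simps)
  from has_derivative_compose[OF this assms[unfolded has_wirtinger_def]]
  show ?thesis
    by (simp add: has_vector_derivative_def scaleR_conv_of_real algebra_simps cis_cnj)
qed

lemma integral_periodic_derivative_zero:
  fixes g :: "real \<Rightarrow> complex"
  assumes "\<And>t. (g has_vector_derivative g' t) (at t within {0..2*pi})" "g 0 = g (2*pi)"
  shows "(g' has_integral 0) {0..2*pi}"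
  using fundamental_theorem_of_calculus[of 0 "2*pi" g g'] assms by simp

lemma continuous_on_polar:
  assumes "continuous_on S f" "\<And>r t. r \<in> T \<Longrightarrow> of_real r * cis t \<in> S"
  shows "continuous_on (T \<times> U) (\<lambda>(r,t). f (of_real r * cis t))"
  unfolding split_beta
  by (intro continuous_on_compose2[OF assms(1)] continuous_intros) (use assms(2) in auto)

lemma continuous_on_polar':
  assumes "continuous_on S f" "\<And>t. of_real r * cis t \<in> S"
  shows "continuous_on U (\<lambda>t. f (of_real r * cis t))"
  by (intro continuous_on_compose2[OF assms(1)] continuous_intros) (use assms(2) in auto)

text \<open>The radial derivative of \<open>f\<close> is \<open>fz * cis t + fb * cis (-t)\<close>;
  the angular one is a multiple of the difference of the same terms and integrates to 0 over a
  period. So both terms have equal integrals and either may be kept. The second formula is the same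
  argument for \<open>f * cis (-t)\<close>, keeping \<open>fz\<close>. Applied to a function and
  then to its conjugate derivative, the two formulas turn information on the Laplacian into
  information on means.\<close>

lemma radial_derivative_mean:
  assumes ab: "0 \<le> a" "a < r" "r < b"
    and S: "\<And>r t. a < r \<Longrightarrow> r < b \<Longrightarrow> of_real r * cis t \<in> S"
    and w: "\<And>z. z \<in> S \<Longrightarrow> has_wirtinger f (fz z) (fb z) z"
    and c: "continuous_on S fz" "continuous_on S fb"
  shows "((\<lambda>r. integral {0..2*pi} (\<lambda>t. f (of_real r * cis t))) has_vector_derivative
      2 * integral {0..2*pi} (\<lambda>t. fb (of_real r * cis t) * cis (-t))) (at r)"
    and "((\<lambda>r. of_real r * integral {0..2*pi} (\<lambda>t. f (of_real r * cis t) * cis (-t))) has_vector_derivative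
      2 * of_real r * integral {0..2*pi} (\<lambda>t. fz (of_real r * cis t))) (at r)"
proof -
  have cf: "continuous_on S f" by (rule has_wirtinger_continuous_on[OF w])
  have oo: "(at r within {a<..<b}) = at r" using ab by (intro at_within_open) auto
  note pol = continuous_on_polar[of S _ "{a<..<b}" "cbox 0 (2*pi)", unfolded split_beta]
  note pol' = continuous_on_polar'[of S]
  have Sr: "of_real r * cis t \<in> S" for t using S ab by auto
  have i: "(\<lambda>t. g (of_real r * cis t) * cis (c * t)) integrable_on {0..2*pi}" if "continuous_on S g" for g c
    by (intro integrable_continuous_interval continuous_intros pol' that) (use Sr in auto)
  have i0: "(\<lambda>t. g (of_real r * cis t)) integrable_on {0..2*pi}" if "continuous_on S g" for g :: "complex \<Rightarrow> complex"
    by (intro integrable_continuous_interval continuous_on_polar'[OF that]) (use Sr in auto)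
  have a1: "integral {0..2*pi} (\<lambda>t. fz (of_real r * cis t) * cis t) = integral {0..2*pi} (\<lambda>t. fb (of_real r * cis t) * cis (-t))"
  proof -
    have "((\<lambda>t. \<i> * of_real r * (fz (of_real r * cis t) * cis t - fb (of_real r * cis t) * cis (-t))) has_integral 0) {0..2*pi}"
      by (rule integral_periodic_derivative_zero[of "\<lambda>t. f (of_real r * cis t)"])
         (auto intro!: vector_derivative_wirtinger_angular w Sr)
    then have "integral {0..2*pi} (\<lambda>t. \<i> * of_real r * (fz (of_real r * cis t) * cis t - fb (of_real r * cis t) * cis (-t))) = 0"
      by (rule integral_unique)
    then have "integral {0..2*pi} (\<lambda>t. fz (of_real r * cis t) * cis t - fb (of_real r * cis t) * cis (-t)) = 0"
      using ab by simp
    then show ?thesis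
      using integral_diff[OF i[OF c(1), of 1] i[OF c(2), of "-1"]] by simp
  qed
  have D1: "((\<lambda>r. integral (cbox 0 (2*pi)) (\<lambda>t. f (of_real r * cis t))) has_vector_derivative
     integral (cbox 0 (2*pi)) (\<lambda>t. fz (of_real r * cis t) * cis t + fb (of_real r * cis t) * cis (-t))) (at r within {a<..<b})"
  proof (rule leibniz_rule_vector_derivative)
    show "continuous_on ({a<..<b} \<times> cbox 0 (2*pi)) (\<lambda>(r, t). fz (of_real r * cis t) * cis t + fb (of_real r * cis t) * cis (-t))"
      unfolding split_beta
      by (intro continuous_intros pol c) (use S in auto)
    show "(\<lambda>t. f (of_real r * cis t)) integrable_on cbox 0 (2*pi)" if "r \<in> {a<..<b}" for r
      by (intro integrable_continuous continuous_on_polar'[OF cf]) (use S that in auto)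
    show "((\<lambda>r. f (of_real r * cis t)) has_vector_derivative fz (of_real r * cis t) * cis t + fb (of_real r * cis t) * cis (-t)) (at r within {a<..<b})"
      if "r \<in> {a<..<b}" for r t
      by (intro vector_derivative_wirtinger_radial w S) (use that in auto)
  qed (use ab in auto)
  then show "((\<lambda>r. integral {0..2*pi} (\<lambda>t. f (of_real r * cis t))) has_vector_derivative
      2 * integral {0..2*pi} (\<lambda>t. fb (of_real r * cis t) * cis (-t))) (at r)"
  proof -
    have "integral {0..2*pi} (\<lambda>t. fz (of_real r * cis t) * cis t + fb (of_real r * cis t) * cis (-t)) =
        2 * integral {0..2*pi} (\<lambda>t. fb (of_real r * cis t) * cis (-t))"
      using integral_add[OF i[OF c(1), of 1] i[OF c(2), of "-1"]] unfolding mult_1 mult_minus1 a1 by (simp only: mult_2)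
    then show ?thesis
      using D1 unfolding oo cbox_interval by (simp only:)
  qed
  \<comment> \<open>Integrate the angular derivative of \<open>f * cis (-t)\<close> over a period;
    differentiating the factor \<open>cis (-t)\<close> contributes the undifferentiated
    term.\<close>
  have a2: "integral {0..2*pi} (\<lambda>t. f (of_real r * cis t) * cis (-t)) =
     of_real r * integral {0..2*pi} (\<lambda>t. fz (of_real r * cis t) - fb (of_real r * cis t) * cis (-(2 * t)))"
  proof -
    have d: "((\<lambda>t. f (of_real r * cis t) * cis (-t)) has_vector_derivative
       \<i> * (of_real r * (fz (of_real r * cis t) - fb (of_real r * cis t) * cis (-(2*t))) - f (of_real r * cis t) * cis (-t)))
         (at t within {0..2*pi})" for t
    proof -
      have e: "((\<lambda>t. cis (-t)) has_vector_derivative - \<i> * cis (-t)) (at t within {0..2*pi})"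
        by (auto intro!: derivative_eq_intros simp: has_vector_derivative_def scaleR_conv_of_real)
      have c2: "cis (-t) * cis t = 1" "cis (-t) * cis (-t) = cis (-(2*t))" by (simp_all add: cis_mult)
      have eq: "F * (- \<i> * cis (-t)) + \<i> * of_real r * (A * cis t - B * cis (-t)) * cis (-t) =
        \<i> * (of_real r * (A - B * cis (-(2*t))) - F * cis (-t))" for A B F
        unfolding c2(2)[symmetric] using c2(1) by algebra
      show ?thesis
        using has_vector_derivative_mult[OF vector_derivative_wirtinger_angular[OF w[OF Sr]] e]
        unfolding eq .
    qed
    have "((\<lambda>t. \<i> * (of_real r * (fz (of_real r * cis t) - fb (of_real r * cis t) * cis (-(2*t))) - f (of_real r * cis t) * cis (-t)))
       has_integral 0) {0..2*pi}"
      by (rule integral_periodic_derivative_zero[OF d]) (simp add: cis_2pi flip: cis_inverse)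
    then have "integral {0..2*pi} (\<lambda>t. \<i> * (of_real r * (fz (of_real r * cis t) - fb (of_real r * cis t) * cis (-(2*t))) - f (of_real r * cis t) * cis (-t))) = 0"
      by (rule integral_unique)
    then have "integral {0..2*pi} (\<lambda>t. of_real r * (fz (of_real r * cis t) - fb (of_real r * cis t) * cis (-(2*t))) - f (of_real r * cis t) * cis (-t)) = 0"
      by simp
    moreover have "(\<lambda>t. of_real r * (fz (of_real r * cis t) - fb (of_real r * cis t) * cis (-(2*t)))) integrable_on {0..2*pi}"
      by (intro integrable_continuous_interval continuous_intros pol' c) (use Sr in auto)
    ultimately show ?thesis
      using integral_diff[OF _ i[OF cf, of "-1"]] by fastforce
  qed
  have e: "((\<lambda>r. of_real r * f (of_real r * cis t) * cis (-t)) has_vector_derivative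
      f (of_real r * cis t) * cis (-t) + of_real r * (fz (of_real r * cis t) + fb (of_real r * cis t) * cis (-(2*t))))
        (at r within {a<..<b})" if "of_real r * cis t \<in> S" for r t
  proof -
    have "((\<lambda>r. complex_of_real r) has_vector_derivative 1) (at r within {a<..<b})"
      by (auto intro!: derivative_eq_intros simp: has_vector_derivative_def scaleR_conv_of_real)
    from has_vector_derivative_mult[OF this vector_derivative_wirtinger_radial[OF w[OF that]]]
    have "((\<lambda>r. of_real r * f (of_real r * cis t) * cis (-t)) has_vector_derivative
      (of_real r * (fz (of_real r * cis t) * cis t + fb (of_real r * cis t) * cis (-t)) + f (of_real r * cis t)) * cis (-t))
        (at r within {a<..<b})"
      by (intro has_vector_derivative_mult_left) simp
    moreover have c2: "cis (-t) * cis t = 1" "cis (-t) * cis (-t) = cis (-(2*t))" by (simp_all add: cis_mult)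
    have "(of_real r * (A * cis t + B * cis (-t)) + F) * cis (-t) = F * cis (-t) + of_real r * (A + B * cis (-(2*t)))" for A B F
      unfolding c2(2)[symmetric] using c2(1) by algebra
    ultimately show ?thesis
      by simp
  qed
  have D2: "((\<lambda>r. integral (cbox 0 (2*pi)) (\<lambda>t. of_real r * f (of_real r * cis t) * cis (-t))) has_vector_derivative
     integral (cbox 0 (2*pi)) (\<lambda>t. f (of_real r * cis t) * cis (-t) + of_real r * (fz (of_real r * cis t) + fb (of_real r * cis t) * cis (-(2*t)))))
       (at r within {a<..<b})"
  proof (rule leibniz_rule_vector_derivative)
    show "continuous_on ({a<..<b} \<times> cbox 0 (2*pi)) (\<lambda>(r, t). f (of_real r * cis t) * cis (-t) + of_real r * (fz (of_real r * cis t) + fb (of_real r * cis t) * cis (-(2*t))))"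
      unfolding split_beta
      by (intro continuous_intros pol c cf) (use S in auto)
    show "(\<lambda>t. of_real r * f (of_real r * cis t) * cis (-t)) integrable_on cbox 0 (2*pi)" if "r \<in> {a<..<b}" for r
      by (intro integrable_continuous continuous_intros continuous_on_polar'[OF cf]) (use S that in auto)
  qed (use ab S in \<open>auto intro!: e\<close>)
  have E1: "integral {0..2*pi} (\<lambda>t. of_real r * f (of_real r * cis t) * cis (-t)) =
      of_real r * integral {0..2*pi} (\<lambda>t. f (of_real r * cis t) * cis (-t))" for r
    by (simp add: mult.assoc)
  have E2: "integral {0..2*pi} (\<lambda>t. f (of_real r * cis t) * cis (-t) + of_real r * (fz (of_real r * cis t) + fb (of_real r * cis t) * cis (-(2*t))))
    = 2 * of_real r * integral {0..2*pi} (\<lambda>t. fz (of_real r * cis t))"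
  proof -
    have j: "(\<lambda>t. of_real r * (fz (of_real r * cis t) + fb (of_real r * cis t) * cis (-(2*t)))) integrable_on {0..2*pi}"
      "(\<lambda>t. of_real r * (fz (of_real r * cis t) - fb (of_real r * cis t) * cis (-(2*t)))) integrable_on {0..2*pi}"
      by (intro integrable_continuous_interval continuous_intros pol' c; use Sr in auto)+
    have "integral {0..2*pi} (\<lambda>t. f (of_real r * cis t) * cis (-t) + of_real r * (fz (of_real r * cis t) + fb (of_real r * cis t) * cis (-(2*t))))
      = integral {0..2*pi} (\<lambda>t. of_real r * (fz (of_real r * cis t) - fb (of_real r * cis t) * cis (-(2*t)))) +
        integral {0..2*pi} (\<lambda>t. of_real r * (fz (of_real r * cis t) + fb (of_real r * cis t) * cis (-(2*t))))"
      using integral_add[OF i[OF cf, of "-1"] j(1)] a2 by simp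
    also have "\<dots> = integral {0..2*pi} (\<lambda>t. of_real r * (fz (of_real r * cis t) - fb (of_real r * cis t) * cis (-(2*t))) +
        of_real r * (fz (of_real r * cis t) + fb (of_real r * cis t) * cis (-(2*t))))"
      by (rule integral_add[symmetric, OF j(2,1)])
    also have "\<dots> = integral {0..2*pi} (\<lambda>t. 2 * of_real r * fz (of_real r * cis t))"
      by (simp add: algebra_simps)
    finally show ?thesis by simp
  qed
  show "((\<lambda>r. of_real r * integral {0..2*pi} (\<lambda>t. f (of_real r * cis t) * cis (-t))) has_vector_derivative
      2 * of_real r * integral {0..2*pi} (\<lambda>t. fz (of_real r * cis t))) (at r)"
    using D2 unfolding oo cbox_interval E1 E2 .
qed

lemma circle_mean_integrable:
  fixes f :: "complex \<Rightarrow> 'a::banach"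
  assumes "0 \<le> r" "continuous_on (sphere 0 r) f"
  shows "(\<lambda>t. f (of_real r * cis t)) integrable_on {a..b}"
  by (intro integrable_continuous_interval continuous_on_compose2[OF assms(2)] continuous_intros)
     (use assms(1) in \<open>auto simp: norm_mult\<close>)

lemma circle_mean_add:
  fixes f g :: "complex \<Rightarrow> 'a::banach"
  assumes "0 \<le> r" "continuous_on (sphere 0 r) f" "continuous_on (sphere 0 r) g"
  shows "circle_mean r (\<lambda>z. f z + g z) = circle_mean r f + circle_mean r g"
  unfolding circle_mean_def
  by (subst integral_add) (auto intro!: circle_mean_integrable assms simp: scaleR_right_distrib)

lemma circle_mean_diff:
  fixes f g :: "complex \<Rightarrow> 'a::banach"
  assumes "0 \<le> r" "continuous_on (sphere 0 r) f" "continuous_on (sphere 0 r) g"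
  shows "circle_mean r (\<lambda>z. f z - g z) = circle_mean r f - circle_mean r g"
  unfolding circle_mean_def
  by (subst integral_diff) (auto intro!: circle_mean_integrable assms simp: scaleR_right_diff_distrib)

lemma circle_mean_sum:
  fixes f :: "'i \<Rightarrow> complex \<Rightarrow> 'a::banach"
  assumes "0 \<le> r" "finite I" "\<And>i. i \<in> I \<Longrightarrow> continuous_on (sphere 0 r) (f i)"
  shows "circle_mean r (\<lambda>z. \<Sum>i\<in>I. f i z) = (\<Sum>i\<in>I. circle_mean r (f i))"
  unfolding circle_mean_def
  by (subst integral_sum) (auto intro!: circle_mean_integrable assms simp: scaleR_right.sum)

lemma circle_mean_cmult:
  fixes f :: "complex \<Rightarrow> 'a::{real_normed_field,banach}"
  shows "circle_mean r (\<lambda>z. c * f z) = c * circle_mean r f"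
  by (simp add: circle_mean_def)

lemma circle_mean_const [simp]: "circle_mean r (\<lambda>z. c :: 'a::euclidean_space) = c"
  by (simp add: circle_mean_def)

lemma circle_mean_cong:
  assumes "0 \<le> r" "\<And>z. norm z = r \<Longrightarrow> f z = g z"
  shows "circle_mean r f = circle_mean r g"
proof -
  have "f (of_real r * cis t) = g (of_real r * cis t)" for t
    by (rule assms(2)) (use assms(1) in \<open>simp add: norm_mult\<close>)
  then show ?thesis by (simp add: circle_mean_def)
qed

lemma circle_mean_mono:
  fixes f g :: "complex \<Rightarrow> real"
  assumes "0 \<le> r" "continuous_on (sphere 0 r) f" "continuous_on (sphere 0 r) g"
    and "\<And>z. norm z = r \<Longrightarrow> f z \<le> g z"
  shows "circle_mean r f \<le> circle_mean r g"
proof -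
  have "integral {0..2*pi} (\<lambda>t. f (of_real r * cis t)) \<le> integral {0..2*pi} (\<lambda>t. g (of_real r * cis t))"
    by (intro integral_le circle_mean_integrable assms) (use assms(1) in \<open>simp add: norm_mult\<close>)
  then show ?thesis by (simp add: circle_mean_def divide_right_mono)
qed

lemma circle_mean_norm_le:
  fixes f :: "complex \<Rightarrow> complex"
  assumes "0 \<le> r" "continuous_on (sphere 0 r) f" "continuous_on (sphere 0 r) g"
    and "\<And>z. norm z = r \<Longrightarrow> norm (f z) \<le> g z"
  shows "norm (circle_mean r f) \<le> circle_mean r g"
proof -
  have "norm (integral {0..2*pi} (\<lambda>t. f (of_real r * cis t))) \<le> integral {0..2*pi} (\<lambda>t. g (of_real r * cis t))"
    by (intro integral_norm_bound_integral circle_mean_integrable assms) (use assms(1) in \<open>simp add: norm_mult\<close>)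
  then show ?thesis by (simp add: circle_mean_def divide_right_mono)
qed

lemma circle_mean_Re:
  assumes "0 \<le> r" "continuous_on (sphere 0 r) f"
  shows "Re (circle_mean r f) = circle_mean r (\<lambda>z. Re (f z))"
  using integral_linear[OF circle_mean_integrable[OF assms] bounded_linear_Re, of 0 "2*pi"]
  by (simp add: circle_mean_def o_def)

lemma circle_mean_cnj:
  assumes "0 \<le> r" "continuous_on (sphere 0 r) f"
  shows "circle_mean r (\<lambda>z. cnj (f z)) = cnj (circle_mean r f)"
  using integral_linear[OF circle_mean_integrable[OF assms] bounded_linear_cnj, of 0 "2*pi"]
  by (simp add: circle_mean_def o_def)

lemma circle_mean_of_real:
  assumes "0 \<le> r" "continuous_on (sphere 0 r) f"
  shows "circle_mean r (\<lambda>z. of_real (f z) :: complex) = of_real (circle_mean r f)"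
  using integral_linear[OF circle_mean_integrable[OF assms] bounded_linear_of_real, of 0 "2*pi"]
  by (simp add: circle_mean_def o_def scaleR_conv_of_real)

lemma continuous_on_circle_mean:
  fixes f :: "complex \<Rightarrow> complex"
  assumes "continuous_on S f" "\<And>r t. r \<in> T \<Longrightarrow> of_real r * cis t \<in> S"
  shows "continuous_on T (\<lambda>r. integral {0..2*pi} (\<lambda>t. f (of_real r * cis t)))"
  using integral_continuous_on_param[OF continuous_on_polar[OF assms, of T "cbox 0 (2*pi)"]]
  by simp

lemma DERIV_Re_vector:
  assumes "(f has_vector_derivative d) (at x)"
  shows "((\<lambda>x. Re (f x)) has_field_derivative Re d) (at x)"
  using has_derivative_Re[OF assms[unfolded has_vector_derivative_def]]
  by (simp add: has_field_derivative_def mult.commute[of _ "Re d"] fun_eq_iff)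

text \<open>\<open>v\<close> is the mixed derivative of \<open>u\<close>, a quarter of its
  Laplacian. Its integral is, up to a positive factor, the derivative of \<open>r * N r\<close>,
  which vanishes at 0; hence \<open>N\<close> has nonnegative real part, and \<open>2 * N\<close> is
  the derivative of the mean. Only real parts are constrained because the comparison below rotates a
  complex function.\<close>

lemma circle_mean_subharmonic_mono:
  assumes s: "0 \<le> s'" "s' \<le> s" "s < R"
    and w: "\<And>z. z \<in> ball 0 R \<Longrightarrow> has_wirtinger u (uz z) (ub z) z"
      "\<And>z. z \<in> ball 0 R \<Longrightarrow> has_wirtinger ub (v z) (v' z) z"
    and c: "continuous_on (ball 0 R) uz" "continuous_on (ball 0 R) v" "continuous_on (ball 0 R) v'"
    and pos: "\<And>z. z \<in> ball 0 R \<Longrightarrow> 0 \<le> Re (v z)"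
  shows "Re (circle_mean s' u) \<le> Re (circle_mean s u)"
proof -
  have cu: "continuous_on (ball 0 R) u" by (rule has_wirtinger_continuous_on[OF w(1)])
  have cb: "continuous_on (ball 0 R) ub" by (rule has_wirtinger_continuous_on[OF w(2)])
  define M where "M = (\<lambda>r. integral {0..2*pi} (\<lambda>t. u (of_real r * cis t)))"
  define N where "N = (\<lambda>r. integral {0..2*pi} (\<lambda>t. ub (of_real r * cis t) * cis (-t)))"
  define L where "L = (\<lambda>r. integral {0..2*pi} (\<lambda>t. v (of_real r * cis t)))"
  have inb: "of_real r * cis t \<in> ball 0 R" if "0 \<le> r" "r < R" for r t
    using that by (simp add: norm_mult)
  have cN: "continuous_on {0..r} (\<lambda>r. of_real r * N r)" if "r < R" for r
  proof -
    have "continuous_on ({0..r} \<times> cbox 0 (2*pi)) (\<lambda>(r,t). ub (of_real r * cis t) * cis (-t))"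
      using continuous_on_polar[OF cb, of "{0..r}" "cbox 0 (2*pi)"] inb that
      unfolding split_beta by (intro continuous_intros) auto
    from integral_continuous_on_param[OF this] have "continuous_on {0..r} N"
      by (simp add: N_def)
    then show ?thesis by (intro continuous_intros)
  qed
  have N0: "0 \<le> Re (of_real r * N r)" if r: "0 < r" "r < R" for r
  proof -
    have "Re (of_real 0 * N 0) \<le> Re (of_real r * N r)"
    proof (rule DERIV_nonneg_imp_increasing_open[of 0 r "\<lambda>r. Re (of_real r * N r)"])
      show "continuous_on {0..r} (\<lambda>r. Re (of_real r * N r))"
        by (intro continuous_intros cN r)
      fix x assume x: "0 < x" "x < r"
      have "((\<lambda>r. of_real r * N r) has_vector_derivative 2 * of_real x * L x) (at x)"
        unfolding N_def L_def
        by (rule radial_derivative_mean(2)[where a=0 and b=R and S="ball 0 R" and fb=v'])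
           (use w c x r inb in auto)
      then have "((\<lambda>r. Re (of_real r * N r)) has_field_derivative Re (2 * of_real x * L x)) (at x)"
        by (rule DERIV_Re_vector)
      moreover have "0 \<le> Re (L x)"
      proof -
        have cv: "continuous_on (sphere 0 x) v"
          by (rule continuous_on_subset[OF c(2)]) (use x r in auto)
        have "0 \<le> integral {0..2*pi} (\<lambda>t. Re (v (of_real x * cis t)))"
          by (intro integral_nonneg circle_mean_integrable continuous_intros cv) (use x r inb pos in auto)
        also have "\<dots> = Re (L x)"
          using integral_linear[OF circle_mean_integrable[OF _ cv] bounded_linear_Re, of 0 "2*pi"] x
          by (simp add: L_def o_def)
        finally show ?thesis .
      qed
      moreover have "Re (2 * of_real x * L x) = 2 * x * Re (L x)" by simp
      ultimately show "\<exists>y. ((\<lambda>r. Re (of_real r * N r)) has_real_derivative y) (at x) \<and> 0 \<le> y"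
        using x by (metis mult_nonneg_nonneg less_imp_le zero_le_numeral)
    qed (use r in auto)
    then show ?thesis by simp
  qed
  have "Re (M s') \<le> Re (M s)"
  proof (rule DERIV_nonneg_imp_increasing_open[of s' s "\<lambda>r. Re (M r)"])
    show "continuous_on {s'..s} (\<lambda>r. Re (M r))"
      unfolding M_def by (intro continuous_intros continuous_on_circle_mean[OF cu]) (use s inb in auto)
    fix x assume x: "s' < x" "x < s"
    have "(M has_vector_derivative 2 * N x) (at x)"
      unfolding N_def M_def
      by (rule radial_derivative_mean(1)[where a=0 and b=R and S="ball 0 R" and fz=uz])
         (use w c x s inb cb in auto)
    then have "((\<lambda>r. Re (M r)) has_field_derivative Re (2 * N x)) (at x)"
      by (rule DERIV_Re_vector)
    moreover have "0 \<le> Re (2 * N x)"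
      using N0[of x] x s by (simp add: zero_le_mult_iff)
    ultimately show "\<exists>y. ((\<lambda>r. Re (M r)) has_real_derivative y) (at x) \<and> 0 \<le> y"
      by blast
  qed (use s in auto)
  moreover have "Re (circle_mean r u) = Re (M r) / (2*pi)" for r by (simp add: circle_mean_def M_def field_simps)
  ultimately show ?thesis by (simp add: divide_right_mono)
qed

text \<open>Monotonicity of the means of \<open>U - c * u\<close> between radius 0 and
  \<open>s\<close>, where the constant \<open>c\<close> turns the deviation of \<open>u\<close> into
  its modulus. This takes the place of Green potentials: a density dominating \<open>v\<close> need
  only be the mixed derivative of some \<open>U\<close> with controlled means.\<close>

lemma circle_mean_compare:
  assumes s: "0 \<le> s" "s < R"
    and u: "\<And>z. z \<in> ball 0 R \<Longrightarrow> has_wirtinger u (uz z) (ub z) z"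
      "\<And>z. z \<in> ball 0 R \<Longrightarrow> has_wirtinger ub (v z) (v' z) z"
      "continuous_on (ball 0 R) uz" "continuous_on (ball 0 R) v" "continuous_on (ball 0 R) v'"
    and U: "\<And>z. z \<in> ball 0 R \<Longrightarrow> has_wirtinger U (Uz z) (Ub z) z"
      "\<And>z. z \<in> ball 0 R \<Longrightarrow> has_wirtinger Ub (V z) (V' z) z"
      "continuous_on (ball 0 R) Uz" "continuous_on (ball 0 R) V" "continuous_on (ball 0 R) V'"
    and le: "\<And>z. z \<in> ball 0 R \<Longrightarrow> norm (v z) \<le> Re (V z)"
  shows "norm (circle_mean s u - u 0) \<le> Re (circle_mean s U - U 0)"
proof -
  define x where "x = circle_mean s u - u 0"
  define c where "c = cnj (sgn x)"
  have cx: "c * x = of_real (norm x)"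
    by (simp add: c_def sgn_div_norm scaleR_conv_of_real complex_norm_square[symmetric] power2_eq_square field_simps)
  have nc: "norm c \<le> 1" by (simp add: c_def norm_sgn)
  have cs: "continuous_on (sphere 0 s) f" if "continuous_on (ball 0 R) f" for f :: "complex \<Rightarrow> complex"
    by (rule continuous_on_subset[OF that]) (use s in auto)
  have "Re (circle_mean 0 (\<lambda>z. U z - c * u z)) \<le> Re (circle_mean s (\<lambda>z. U z - c * u z))"
  proof (rule circle_mean_subharmonic_mono[OF order_refl s])
    show "has_wirtinger (\<lambda>z. U z - c * u z) (Uz z - c * uz z) (Ub z - c * ub z) z" if "z \<in> ball 0 R" for z
      by (rule has_wirtinger_eq_rhs[OF has_wirtinger_diff[OF U(1)[OF that] has_wirtinger_mult[OF has_wirtinger_const u(1)[OF that]]]]) auto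
    show "has_wirtinger (\<lambda>z. Ub z - c * ub z) (V z - c * v z) (V' z - c * v' z) z" if "z \<in> ball 0 R" for z
      by (rule has_wirtinger_eq_rhs[OF has_wirtinger_diff[OF U(2)[OF that] has_wirtinger_mult[OF has_wirtinger_const u(2)[OF that]]]]) auto
    show "0 \<le> Re (V z - c * v z)" if "z \<in> ball 0 R" for z
    proof -
      have "Re (c * v z) \<le> norm (c * v z)" by (rule complex_Re_le_cmod)
      also have "\<dots> \<le> norm (v z)" using nc by (simp add: norm_mult mult_left_le_one_le)
      finally show ?thesis using le[OF that] by simp
    qed
  qed (auto intro!: continuous_intros u U)
  also have "circle_mean s (\<lambda>z. U z - c * u z) = circle_mean s U - c * circle_mean s u"
    by (subst circle_mean_diff)
       (auto intro!: s continuous_intros cs has_wirtinger_continuous_on[OF u(1)] has_wirtinger_continuous_on[OF U(1)] simp: circle_mean_cmult)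
  also have "circle_mean 0 (\<lambda>z. U z - c * u z) = U 0 - c * u 0" by (simp add: circle_mean_def)
  finally have "Re (c * x) \<le> Re (circle_mean s U - U 0)"
    by (simp add: x_def algebra_simps)
  then show ?thesis unfolding cx by (simp add: x_def)
qed

text \<open>The case \<open>U = 0\<close> of the comparison, since the conjugate derivative
  vanishes.\<close>

lemma mean_value_holomorphic:
  assumes "f holomorphic_on ball 0 R" "0 \<le> s" "s < R"
  shows "circle_mean s f = f 0"
proof -
  have "norm (circle_mean s f - f 0) \<le> Re (circle_mean s (\<lambda>_. 0) - 0)"
  proof (rule circle_mean_compare[where R=R and ub="\<lambda>_. 0" and v="\<lambda>_. 0" and v'="\<lambda>_. 0" and uz="deriv f"
        and Ub="\<lambda>_. 0" and V="\<lambda>_. 0" and V'="\<lambda>_. 0" and Uz="\<lambda>_. 0"])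
    show "has_wirtinger f (deriv f z) 0 z" if "z \<in> ball 0 R" for z
      using assms(1) that by (intro has_wirtinger_holomorphic holomorphic_derivI) auto
    show "continuous_on (ball 0 R) (deriv f)"
      using assms(1) by (intro holomorphic_on_imp_continuous_on holomorphic_deriv) auto
  qed (use assms in \<open>auto intro!: has_wirtinger_const\<close>)
  then show ?thesis by simp
qed

section \<open>The Poisson kernel\<close>

definition poisson :: "complex \<Rightarrow> complex \<Rightarrow> real"
  where "poisson w z = (1 - (norm w)\<^sup>2) / (norm (z - w))\<^sup>2"

lemma poisson_nonneg: "norm w \<le> 1 \<Longrightarrow> 0 \<le> poisson w z"
  by (simp add: poisson_def power_le_one)

text \<open>The kernel sees only the angle between two points of the circle. This lets averages over
  the interior point be computed as averages over the boundary point.\<close>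

lemma poisson_swap:
  assumes "norm z = 1" "norm u = 1"
  shows "poisson (of_real s * u) z = poisson (of_real s * z) u"
proof -
  have "norm (z - of_real s * u) = norm (u - of_real s * z)"
  proof -
    have "(norm (z - of_real s * u))\<^sup>2 = (norm (u - of_real s * z))\<^sup>2"
    proof -
      have "(Re z)\<^sup>2 + (Im z)\<^sup>2 = 1" "(Re u)\<^sup>2 + (Im u)\<^sup>2 = 1"
        using assms cmod_power2[of z] cmod_power2[of u] by auto
      then show ?thesis
        unfolding cmod_power2 minus_complex.sel times_complex.sel Re_complex_of_real Im_complex_of_real by algebra
    qed
    then show ?thesis by simp
  qed
  then show ?thesis using assms by (simp add: poisson_def norm_mult)
qed

text \<open>The analytic and the conjugate analytic part of the kernel in \<open>z\<close>, the
  second without constant term. The denominators multiply to the squared distance because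
  \<open>z * cnj z = 1\<close>.\<close>

lemma poisson_decomp:
  assumes "norm z = 1" "norm w < 1"
  shows "of_real (poisson w z) = 1 / (1 - cnj w * z) + w * cnj z / (1 - w * cnj z)"
proof -
  have zz: "z * cnj z = 1" using assms(1) complex_norm_square[of z] by simp
  have n1: "1 - cnj w * z \<noteq> 0" "1 - w * cnj z \<noteq> 0"
    using norm_triangle_ineq2[of 1 "cnj w * z"] norm_triangle_ineq2[of 1 "w * cnj z"] assms
    by (auto simp: norm_mult)
  have e: "(1 - cnj w * z) * (1 - w * cnj z) = of_real ((norm (z - w))\<^sup>2)"
    unfolding complex_norm_square complex_cnj_diff using zz by algebra
  have "1 / (1 - cnj w * z) + w * cnj z / (1 - w * cnj z) =
     (1 - w * cnj w * (z * cnj z)) / ((1 - cnj w * z) * (1 - w * cnj z))"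
    using n1 by (simp add: divide_simps) (simp add: algebra_simps)
  also have "\<dots> = (1 - of_real ((norm w)\<^sup>2)) / of_real ((norm (z - w))\<^sup>2)"
    unfolding e zz by (simp only: complex_norm_square) simp
  finally show ?thesis by (simp add: poisson_def)
qed

lemma continuous_on_poisson:
  assumes "continuous_on S f" "continuous_on S g" "\<And>x. x \<in> S \<Longrightarrow> g x \<noteq> f x"
  shows "continuous_on S (\<lambda>x. poisson (f x) (g x))"
  unfolding poisson_def by (intro continuous_intros assms) (use assms(3) in auto)

text \<open>On the circle \<open>w * cnj z / (1 - w * cnj z)\<close> equals
  \<open>w / (z - w)\<close>. Writing \<open>f z = f w + (z - w) * g z\<close> therefore splits the
  integrand into a holomorphic part with mean \<open>f 0\<close>, the part \<open>w * g\<close> with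
  mean \<open>f w - f 0\<close>, and a conjugate holomorphic part that vanishes at 0. The mean value
  property handles all three.\<close>

lemma poisson_formula:
  assumes f: "f holomorphic_on ball 0 R" and R: "1 < R" and w: "norm w < 1"
  shows "circle_mean 1 (\<lambda>z. of_real (poisson w z) * f z) = f w"
proof -
  define g where "g = (\<lambda>z. if z = w then deriv f w else (f z - f w) / (z - w))"
  have g: "g holomorphic_on ball 0 R"
    unfolding g_def by (rule pole_lemma[OF f]) (use w R in auto)
  have nz: "1 - cnj w * z \<noteq> 0" if "norm z * norm w < 1" for z
    using norm_triangle_ineq2[of 1 "cnj w * z"] that by (auto simp: norm_mult mult.commute)
  \<comment> \<open>Shrink the radius, still beyond 1, so that the pole of
    \<open>1 / (1 - cnj w * z)\<close>, of modulus \<open>1 / norm w\<close>, stays outside.\<close>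
  obtain R' where R': "1 < R'" "R' \<le> R" "R' * norm w < 1"
  proof (cases "w = 0")
    case True then show ?thesis using that[of R] R by simp
  next
    case False
    have "1 < 1 / norm w" using w False by simp
    then obtain q where "1 < q" "q < min R (1 / norm w)" using R dense[of 1 "min R (1 / norm w)"] by auto
    then show ?thesis using that[of q] False by (auto simp: field_simps)
  qed
  have hol: "(\<lambda>z. h z / (1 - cnj w * z)) holomorphic_on ball 0 R'" if "h holomorphic_on ball 0 R" for h
  proof (intro holomorphic_intros holomorphic_on_subset[OF that])
    fix z assume "z \<in> ball (0::complex) R'"
    then have "norm z * norm w \<le> R' * norm w" by (intro mult_right_mono) auto
    then show "1 - cnj w * z \<noteq> 0" using nz R' by auto
  qed (use R' in auto)
  have m1: "circle_mean 1 (\<lambda>z. f z / (1 - cnj w * z)) = f 0"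
    using mean_value_holomorphic[OF hol[OF f], of 1] R' by simp
  have m2: "circle_mean 1 (\<lambda>z. (cnj w * z) / (1 - cnj w * z)) = 0"
    using mean_value_holomorphic[OF hol[of "\<lambda>z. cnj w * z"], of 1] R' by (auto intro!: holomorphic_intros)
  have cs: "continuous_on (sphere 0 1) h" if "h holomorphic_on ball 0 R'" for h
    by (rule continuous_on_subset[OF holomorphic_on_imp_continuous_on[OF that]]) (use R' in auto)
  have m3: "circle_mean 1 (\<lambda>z. w * cnj z / (1 - w * cnj z)) = 0"
    using circle_mean_cnj[of 1 "\<lambda>z. (cnj w * z) / (1 - cnj w * z)"] m2 cs[OF hol[of "\<lambda>z. cnj w * z"]]
    by (auto intro!: holomorphic_intros)
  have gR: "g holomorphic_on ball 0 R'" "f holomorphic_on ball 0 R'"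
    using g f R' by (auto elim!: holomorphic_on_subset)
  have m4: "circle_mean 1 (\<lambda>z. w * g z) = f w - f 0"
    using mean_value_holomorphic[OF g, of 1] R unfolding circle_mean_cmult by (simp add: g_def field_simps)
  have c1: "continuous_on (sphere 0 1) (\<lambda>z. f z / (1 - cnj w * z))" by (intro cs hol f)
  have c4: "continuous_on (sphere 0 1) (\<lambda>z. w * g z)" by (intro cs holomorphic_intros gR)
  have c3: "continuous_on (sphere 0 1) (\<lambda>z. f w * (w * cnj z / (1 - w * cnj z)))"
  proof (intro continuous_intros)
    show "\<forall>z\<in>sphere 0 1. 1 - w * cnj z \<noteq> 0"
      using nz[of "z" for z] w by (metis complex_cnj_cnj complex_cnj_diff complex_cnj_mult complex_cnj_one complex_cnj_zero mem_sphere_0 mult_1)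
  qed
  have "circle_mean 1 (\<lambda>z. of_real (poisson w z) * f z) =
     circle_mean 1 (\<lambda>z. f z / (1 - cnj w * z) + (w * g z + f w * (w * cnj z / (1 - w * cnj z))))"
  proof (rule circle_mean_cong)
    fix z :: complex assume z: "norm z = 1"
    have zz: "z * cnj z = 1" using z complex_norm_square[of z] by simp
    have zw: "z \<noteq> w" using z w by auto
    have "w * cnj z / (1 - w * cnj z) = w / (z - w)"
    proof -
      have "w * cnj z * (z - w) = w * (1 - w * cnj z)" using zz by (simp add: algebra_simps)
      moreover have "1 - w * cnj z \<noteq> 0"
        using nz[of z] w z by (metis complex_cnj_cnj complex_cnj_diff complex_cnj_mult complex_cnj_one complex_cnj_zero mult_1)
      ultimately show ?thesis using zw by (simp add: divide_simps)
    qed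
    moreover have "w * g z = f z * (w / (z - w)) - f w * (w / (z - w))"
      using zw by (simp add: g_def right_diff_distrib diff_divide_distrib mult.commute)
    ultimately show "of_real (poisson w z) * f z = f z / (1 - cnj w * z) + (w * g z + f w * (w * cnj z / (1 - w * cnj z)))"
      unfolding poisson_decomp[OF z w] by (simp add: algebra_simps)
  qed simp
  also have "\<dots> = f 0 + ((f w - f 0) + 0)"
  proof -
    have "circle_mean 1 (\<lambda>z. f w * (w * cnj z / (1 - w * cnj z))) = 0"
      by (simp only: circle_mean_cmult m3 mult_zero_right)
    then show ?thesis
      using circle_mean_add[OF _ c1 continuous_on_add[OF c4 c3]] circle_mean_add[OF _ c4 c3] m1 m4 by simp
  qed
  finally show ?thesis by simp
qed

lemma poisson_mean: "norm w < 1 \<Longrightarrow> circle_mean 1 (poisson w) = 1"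
proof -
  assume w: "norm w < 1"
  have "circle_mean 1 (\<lambda>z. of_real (poisson w z) :: complex) = 1"
    using poisson_formula[of "\<lambda>_. 1" 2 w] w by simp
  moreover have "continuous_on (sphere 0 1) (poisson w)"
    by (intro continuous_on_poisson continuous_intros) (use w in auto)
  ultimately show ?thesis using circle_mean_of_real[of 1 "poisson w"]
    by (metis of_real_eq_1_iff zero_le_one)
qed

lemma poisson_le_far:
  assumes "norm w \<le> 1" "0 < d" "d \<le> norm (z - w)"
  shows "poisson w z \<le> (1 - (norm w)\<^sup>2) / d\<^sup>2"
  unfolding poisson_def using assms
  by (intro divide_left_mono power_mono mult_pos_pos) (auto simp: power_le_one)

section \<open>Wolff's estimate by Uchiyama-type majorants\<close>

text \<open>The substitute for a Carleson measure: \<open>g\<close> is dominated by the mixed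
  derivative, a quarter of the Laplacian, of some \<open>U\<close> whose circular means are bounded
  by \<open>b\<close>. Hiding \<open>U\<close> behind an existential makes the notion stable under
  sums and nonnegative multiples, so densities can be treated one at a time. The sign of
  \<open>U 0\<close> allows that value to be dropped in the comparison.\<close>

definition majorized :: "(complex \<Rightarrow> real) \<Rightarrow> (real \<Rightarrow> real) \<Rightarrow> bool"
  where "majorized g b \<longleftrightarrow> (\<exists>U Uz Ub V V'.
    (\<forall>z\<in>ball 0 1. has_wirtinger U (Uz z) (Ub z) z \<and> has_wirtinger Ub (V z) (V' z) z \<and> g z \<le> Re (V z)) \<and>
    continuous_on (ball 0 1) Uz \<and> continuous_on (ball 0 1) V \<and> continuous_on (ball 0 1) V' \<and>
    0 \<le> Re (U 0) \<and> (\<forall>s\<in>{0..<1}. Re (circle_mean s U) \<le> b s))"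

lemma majorizedI:
  assumes "\<And>z. z \<in> ball 0 1 \<Longrightarrow> has_wirtinger U (Uz z) (Ub z) z"
    "\<And>z. z \<in> ball 0 1 \<Longrightarrow> has_wirtinger Ub (V z) (V' z) z"
    "\<And>z. z \<in> ball 0 1 \<Longrightarrow> g z \<le> Re (V z)"
    "continuous_on (ball 0 1) Uz" "continuous_on (ball 0 1) V" "continuous_on (ball 0 1) V'"
    "0 \<le> Re (U 0)" "\<And>s. s \<in> {0..<1} \<Longrightarrow> Re (circle_mean s U) \<le> b s"
  shows "majorized g b"
  unfolding majorized_def using assms by blast

lemma majorized_zero: "majorized (\<lambda>_. 0) (\<lambda>_. 0)"
  by (rule majorizedI[where U="\<lambda>_. 0" and Uz="\<lambda>_. 0" and Ub="\<lambda>_. 0" and V="\<lambda>_. 0" and V'="\<lambda>_. 0"])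
     (auto intro: has_wirtinger_const)

lemma majorized_add:
  assumes "majorized g b" "majorized g' b'"
  shows "majorized (\<lambda>z. g z + g' z) (\<lambda>s. b s + b' s)"
proof -
  from assms(1) obtain U Uz Ub V V' where 1:
    "\<And>z. z \<in> ball 0 1 \<Longrightarrow> has_wirtinger U (Uz z) (Ub z) z"
    "\<And>z. z \<in> ball 0 1 \<Longrightarrow> has_wirtinger Ub (V z) (V' z) z"
    "\<And>z. z \<in> ball 0 1 \<Longrightarrow> g z \<le> Re (V z)"
    "continuous_on (ball 0 1) Uz" "continuous_on (ball 0 1) V" "continuous_on (ball 0 1) V'"
    "0 \<le> Re (U 0)" "\<And>s. s \<in> {0..<1} \<Longrightarrow> Re (circle_mean s U) \<le> b s"
    unfolding majorized_def by blast
  from assms(2) obtain W Wz Wb X X' where 2: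
    "\<And>z. z \<in> ball 0 1 \<Longrightarrow> has_wirtinger W (Wz z) (Wb z) z"
    "\<And>z. z \<in> ball 0 1 \<Longrightarrow> has_wirtinger Wb (X z) (X' z) z"
    "\<And>z. z \<in> ball 0 1 \<Longrightarrow> g' z \<le> Re (X z)"
    "continuous_on (ball 0 1) Wz" "continuous_on (ball 0 1) X" "continuous_on (ball 0 1) X'"
    "0 \<le> Re (W 0)" "\<And>s. s \<in> {0..<1} \<Longrightarrow> Re (circle_mean s W) \<le> b' s"
    unfolding majorized_def by blast
  have c: "continuous_on (ball 0 1) U" "continuous_on (ball 0 1) W"
    by (rule has_wirtinger_continuous_on[OF 1(1)] has_wirtinger_continuous_on[OF 2(1)]; simp)+
  show ?thesis
  proof (rule majorizedI[where U="\<lambda>z. U z + W z" and Uz="\<lambda>z. Uz z + Wz z" and Ub="\<lambda>z. Ub z + Wb z"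
        and V="\<lambda>z. V z + X z" and V'="\<lambda>z. V' z + X' z"])
    fix s :: real assume s: "s \<in> {0..<1}"
    have "circle_mean s (\<lambda>z. U z + W z) = circle_mean s U + circle_mean s W"
      by (rule circle_mean_add) (use s in \<open>auto intro!: continuous_on_subset[OF c(1)] continuous_on_subset[OF c(2)]\<close>)
    then show "Re (circle_mean s (\<lambda>z. U z + W z)) \<le> b s + b' s"
      using 1(8)[OF s] 2(8)[OF s] by simp
  qed (use 1(1-7) 2(1-7) in \<open>auto intro!: has_wirtinger_add continuous_intros add_mono\<close>)
qed

lemma majorized_sum:
  assumes "finite I" "\<And>i. i \<in> I \<Longrightarrow> majorized (g i) (b i)"
  shows "majorized (\<lambda>z. \<Sum>i\<in>I. g i z) (\<lambda>s. \<Sum>i\<in>I. b i s)"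
  using assms by (induction I rule: finite_induct) (simp_all add: majorized_zero majorized_add)

lemma majorized_scale:
  assumes "majorized g b" "0 \<le> c"
  shows "majorized (\<lambda>z. c * g z) (\<lambda>s. c * b s)"
proof -
  from assms(1) obtain U Uz Ub V V' where 1:
    "\<And>z. z \<in> ball 0 1 \<Longrightarrow> has_wirtinger U (Uz z) (Ub z) z"
    "\<And>z. z \<in> ball 0 1 \<Longrightarrow> has_wirtinger Ub (V z) (V' z) z"
    "\<And>z. z \<in> ball 0 1 \<Longrightarrow> g z \<le> Re (V z)"
    "continuous_on (ball 0 1) Uz" "continuous_on (ball 0 1) V" "continuous_on (ball 0 1) V'"
    "0 \<le> Re (U 0)" "\<And>s. s \<in> {0..<1} \<Longrightarrow> Re (circle_mean s U) \<le> b s"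
    unfolding majorized_def by blast
  have w: "has_wirtinger (\<lambda>z. of_real c * f z) (of_real c * a) (of_real c * d) z"
    if "has_wirtinger f a d z" for f a d z
    by (rule has_wirtinger_eq_rhs[OF has_wirtinger_mult[OF has_wirtinger_const that]]) auto
  show ?thesis
    by (rule majorizedI[where U="\<lambda>z. of_real c * U z" and Uz="\<lambda>z. of_real c * Uz z" and Ub="\<lambda>z. of_real c * Ub z"
        and V="\<lambda>z. of_real c * V z" and V'="\<lambda>z. of_real c * V' z"])
       (use 1 assms(2) in \<open>auto intro!: w continuous_intros mult_left_mono simp: circle_mean_cmult\<close>)
qed

lemma circle_mean_le_majorant:
  assumes s: "s \<in> {0..<1}"
    and u: "\<And>z. z \<in> ball 0 1 \<Longrightarrow> has_wirtinger u (uz z) (ub z) z"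
      "\<And>z. z \<in> ball 0 1 \<Longrightarrow> has_wirtinger ub (v z) (v' z) z"
      "continuous_on (ball 0 1) uz" "continuous_on (ball 0 1) v" "continuous_on (ball 0 1) v'"
    and m: "majorized g b" and le: "\<And>z. z \<in> ball 0 1 \<Longrightarrow> norm (v z) \<le> g z"
  shows "norm (circle_mean s u - u 0) \<le> b s"
proof -
  from m obtain U Uz Ub V V' where 1:
    "\<And>z. z \<in> ball 0 1 \<Longrightarrow> has_wirtinger U (Uz z) (Ub z) z"
    "\<And>z. z \<in> ball 0 1 \<Longrightarrow> has_wirtinger Ub (V z) (V' z) z"
    "\<And>z. z \<in> ball 0 1 \<Longrightarrow> g z \<le> Re (V z)"
    "continuous_on (ball 0 1) Uz" "continuous_on (ball 0 1) V" "continuous_on (ball 0 1) V'"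
    "0 \<le> Re (U 0)" "\<And>s. s \<in> {0..<1} \<Longrightarrow> Re (circle_mean s U) \<le> b s"
    unfolding majorized_def by blast
  have "norm (circle_mean s u - u 0) \<le> Re (circle_mean s U - U 0)"
    by (rule circle_mean_compare[OF _ _ u 1(1,2,4,5,6)]) (use s le 1(3) in \<open>auto intro: order_trans\<close>)
  then show ?thesis using 1(7) 1(8)[OF s] by simp
qed

text \<open>Cauchy-Schwarz for \<open>card I + 1\<close> numbers; the extra 1 stands for the
  derivative of the coordinate function, which joins the family in the weight below.\<close>

lemma sum_cmod_plus_one_sq:
  assumes "finite I"
  shows "((\<Sum>i\<in>I. x i) + 1)\<^sup>2 \<le> (real (card I) + 1) * ((\<Sum>i\<in>I. (x i)\<^sup>2) + 1)"
proof -
  have "(\<Sum>i\<in>I. x i)\<^sup>2 \<le> real (card I) * (\<Sum>i\<in>I. (x i)\<^sup>2)"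
    using sum_squared_le_sum_of_squares[of x I] assms by (simp add: mult.commute)
  moreover have "(\<Sum>i\<in>I. 2 * x i) \<le> (\<Sum>i\<in>I. 1 + (x i)\<^sup>2)"
  proof (rule sum_mono)
    fix i show "2 * x i \<le> 1 + (x i)\<^sup>2" using zero_le_power2[of "1 - x i"] by (simp add: power2_diff)
  qed
  then have "2 * (\<Sum>i\<in>I. x i) \<le> real (card I) + (\<Sum>i\<in>I. (x i)\<^sup>2)"
    by (simp add: sum_distrib_left sum.distrib)
  ultimately show ?thesis by (simp add: power2_sum algebra_simps)
qed

text \<open>
  The majorant is \<open>exp \<phi> * sqrt (\<bar>Q\<bar>\<^sup>2 + \<eta>)\<close> with \<open>\<phi>\<close> a small multiple of
  \<open>\<Sum>\<bar>f i\<bar>\<^sup>2 + \<bar>z\<bar>\<^sup>2\<close>; \<open>\<eta> > 0\<close> keeps it smooth at the zeros of \<open>Q\<close>.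
\<close>

lemma majorized_weighted_modulus:
  fixes f :: "'i \<Rightarrow> complex \<Rightarrow> complex"
  assumes I: "finite I" and f: "\<And>i. i \<in> I \<Longrightarrow> f i holomorphic_on ball 0 1"
    "\<And>i z. i \<in> I \<Longrightarrow> z \<in> ball 0 1 \<Longrightarrow> norm (f i z) \<le> 1"
    and Q: "Q holomorphic_on ball 0 1" and \<eta>: "0 < \<eta>"
  defines "M \<equiv> \<lambda>z. sqrt ((norm (Q z))\<^sup>2 + \<eta>)"
  shows "majorized (\<lambda>z. (M z * (1 + (\<Sum>i\<in>I. (norm (deriv (f i) z))\<^sup>2)) + (norm (deriv Q z))\<^sup>2 / M z) / (8 * (real (card I) + 1)))
    (\<lambda>s. 2 * circle_mean s M)"
proof -
  define m where "m = real (card I)"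
  \<comment> \<open>Used twice: it keeps the exponent of the weight at most 1/2, so that the weight
    lies between 1 and 2, and it makes the squared modulus of the first derivative of
    \<open>\<phi>\<close> at most half of its mixed derivative.\<close>
  define c where "c = 1 / (2 * (m + 1))"
  have m0: "0 \<le> m" by (simp add: m_def)
  have c0: "0 < c" "c * (m + 1) = 1/2" using m0 by (auto simp: c_def)
  have dd: "(f has_field_derivative deriv f z) (at z)" "(deriv f has_field_derivative deriv (deriv f) z) (at z)"
    "continuous_on (ball 0 1) f" "continuous_on (ball 0 1) (deriv f)" "continuous_on (ball 0 1) (deriv (deriv f))"
    if "f holomorphic_on ball 0 1" "z \<in> ball 0 1" for f :: "complex \<Rightarrow> complex" and z
    using that by (auto intro!: holomorphic_derivI[of _ "ball 0 1"] holomorphic_deriv holomorphic_on_imp_continuous_on)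
  define Dz where "Dz = (\<lambda>z. \<Sum>i\<in>I. deriv (f i) z * cnj (f i z))"
  define Db where "Db = (\<lambda>z. \<Sum>i\<in>I. f i z * cnj (deriv (f i) z))"
  define S2 where "S2 = (\<lambda>z. \<Sum>i\<in>I. (norm (deriv (f i) z))\<^sup>2)"
  define \<phi> where "\<phi> = (\<lambda>z. of_real c * ((\<Sum>i\<in>I. f i z * cnj (f i z)) + z * cnj z))"
  define W where "W = (\<lambda>z. Q z * cnj (Q z) + of_real \<eta>)"
  define v where "v = (\<lambda>z. 1/2 * Ln (W z))"
  define vz where "vz = (\<lambda>z. 1/2 * (deriv Q z * cnj (Q z) / W z))"
  define vb where "vb = (\<lambda>z. 1/2 * (Q z * cnj (deriv Q z) / W z))"
  define vbb where "vbb = (\<lambda>z. 1/2 * (Q z * cnj (deriv (deriv Q) z) / W z - (Q z * cnj (deriv Q z) / W z)\<^sup>2))"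
  \<comment> \<open>\<open>a\<close> and \<open>b\<close> are the logarithmic derivatives of
    \<open>E\<close>, so the mixed derivative of \<open>E\<close> is \<open>E\<close> times the sum
    of \<open>a * b\<close> and the mixed derivative of \<open>\<phi> + v\<close>.\<close>
  define a where "a = (\<lambda>z. of_real c * (Dz z + cnj z) + vz z)"
  define b where "b = (\<lambda>z. of_real c * (Db z + z) + vb z)"
  define E where "E = (\<lambda>z. exp (\<phi> z + v z))"
  define V where "V = (\<lambda>z. E z * (a z * b z + of_real (c * (S2 z + 1)) + of_real (1/2 * \<eta> * (norm (deriv Q z))\<^sup>2) / (W z)\<^sup>2))"
  define V' where "V' = (\<lambda>z. E z * ((b z)\<^sup>2 + of_real c * (\<Sum>i\<in>I. f i z * cnj (deriv (deriv (f i)) z)) + vbb z))"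
  have W: "W z = of_real ((norm (Q z))\<^sup>2 + \<eta>)" for z
    unfolding W_def of_real_add complex_norm_square ..
  have Wp: "0 < (norm (Q z))\<^sup>2 + \<eta>" for z using \<eta> by (simp add: add_nonneg_pos)
  have W0: "W z \<noteq> 0" for z unfolding W using Wp[of z] by (metis less_irrefl of_real_eq_0_iff)
  have Wnp: "W z \<notin> \<real>\<^sub>\<le>\<^sub>0" for z unfolding W using Wp[of z] by (simp del: of_real_add)
  have M2: "(M z)\<^sup>2 = (norm (Q z))\<^sup>2 + \<eta>" "0 < M z" for z
    using Wp[of z] by (auto simp: M_def)
  have wQ: "has_wirtinger Q (deriv Q z) 0 z" "has_wirtinger (\<lambda>z. cnj (Q z)) 0 (cnj (deriv Q z)) z"
     "has_wirtinger (\<lambda>z. cnj (deriv Q z)) 0 (cnj (deriv (deriv Q) z)) z" if "z \<in> ball 0 1" for z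
    using has_wirtinger_holomorphic[OF dd(1)[OF Q that]] has_wirtinger_cnj[OF has_wirtinger_holomorphic[OF dd(1)[OF Q that]]]
      has_wirtinger_cnj[OF has_wirtinger_holomorphic[OF dd(2)[OF Q that]]] by simp_all
  have wf: "has_wirtinger (f i) (deriv (f i) z) 0 z" "has_wirtinger (\<lambda>z. cnj (f i z)) 0 (cnj (deriv (f i) z)) z"
     "has_wirtinger (\<lambda>z. cnj (deriv (f i) z)) 0 (cnj (deriv (deriv (f i)) z)) z" if "z \<in> ball 0 1" "i \<in> I" for z i
    using has_wirtinger_holomorphic[OF dd(1)[OF f(1) that(1)]] has_wirtinger_cnj[OF has_wirtinger_holomorphic[OF dd(1)[OF f(1) that(1)]]]
      has_wirtinger_cnj[OF has_wirtinger_holomorphic[OF dd(2)[OF f(1) that(1)]]] that by simp_all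
  have wz: "has_wirtinger (\<lambda>z. z) 1 0 z" "has_wirtinger cnj 0 1 z" for z
    using has_wirtinger_holomorphic[of "\<lambda>z. z" 1 z] has_wirtinger_cnj[of "\<lambda>z. z" 1 0 z] by simp_all
  have w\<phi>: "has_wirtinger \<phi> (of_real c * (Dz z + cnj z)) (of_real c * (Db z + z)) z" if z: "z \<in> ball 0 1" for z
    unfolding \<phi>_def
    by (rule has_wirtinger_eq_rhs[OF has_wirtinger_mult[OF has_wirtinger_const has_wirtinger_add[OF has_wirtinger_sum has_wirtinger_mult[OF wz]]]])
       (rule has_wirtinger_mult[OF wf(1,2)[OF z]] | simp add: Dz_def Db_def)+
  have w\<phi>b: "has_wirtinger (\<lambda>z. of_real c * (Db z + z)) (of_real (c * (S2 z + 1)))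
       (of_real c * (\<Sum>i\<in>I. f i z * cnj (deriv (deriv (f i)) z))) z" if z: "z \<in> ball 0 1" for z
  proof -
    have S2: "of_real (S2 z) = (\<Sum>i\<in>I. deriv (f i) z * cnj (deriv (f i) z))"
      by (simp only: S2_def of_real_sum complex_norm_square)
    show ?thesis unfolding Db_def of_real_mult of_real_add S2
      by (rule has_wirtinger_eq_rhs[OF has_wirtinger_mult[OF has_wirtinger_const has_wirtinger_add[OF has_wirtinger_sum wz(1)]]])
         (rule has_wirtinger_mult[OF wf(1,3)[OF z]] | simp)+
  qed
  have wW: "has_wirtinger W (deriv Q z * cnj (Q z)) (Q z * cnj (deriv Q z)) z" if z: "z \<in> ball 0 1" for z
    unfolding W_def
    by (rule has_wirtinger_eq_rhs[OF has_wirtinger_add[OF has_wirtinger_mult[OF wQ(1,2)[OF z]] has_wirtinger_const]]) auto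
  have wv: "has_wirtinger v (vz z) (vb z) z" if z: "z \<in> ball 0 1" for z
    unfolding v_def
    by (rule has_wirtinger_eq_rhs[OF has_wirtinger_mult[OF has_wirtinger_const has_wirtinger_chain[OF has_field_derivative_Ln[OF Wnp] wW[OF z]]]])
       (auto simp: vz_def vb_def field_simps)
  have wiW: "has_wirtinger (\<lambda>z. inverse (W z)) (- (inverse (W z) * inverse (W z)) * (deriv Q z * cnj (Q z))) (- (inverse (W z) * inverse (W z)) * (Q z * cnj (deriv Q z))) z"
    if z: "z \<in> ball 0 1" for z
    by (rule has_wirtinger_chain[OF _ wW[OF z], of inverse]) (use W0 DERIV_inverse[of "W z" UNIV] in \<open>simp add: power2_eq_square\<close>)
  \<comment> \<open>The numerator collapses to a multiple of \<open>\<eta>\<close> because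
    \<open>W - Q * cnj Q\<close> is constant. What remains is nonnegative and serves near the zeros
    of \<open>Q\<close>.\<close>
  have wvb: "has_wirtinger vb (of_real (1/2 * \<eta> * (norm (deriv Q z))\<^sup>2) / (W z)\<^sup>2) (vbb z) z" if z: "z \<in> ball 0 1" for z
  proof -
    have vb: "vb = (\<lambda>z. 1/2 * (Q z * cnj (deriv Q z) * inverse (W z)))" by (simp only: vb_def divide_inverse)
    have e: "of_real ((norm (deriv Q z))\<^sup>2) = deriv Q z * cnj (deriv Q z)" by (simp only: complex_norm_square)
    have iW: "inverse (W z) * W z = 1" using W0 by simp
    have d2: "x / (W z)\<^sup>2 = x * (inverse (W z) * inverse (W z))" "x / W z = x * inverse (W z)" for x
      by (simp_all only: divide_inverse power2_eq_square inverse_mult_distrib)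
    have "1/2 * (d * cnj d * inverse (W z) + Q z * cnj d * (- (inverse (W z) * inverse (W z)) * (d * cnj (Q z)))) =
       of_real (1/2) * of_real \<eta> * (d * cnj d) / (W z)\<^sup>2" for d
    proof -
      have "of_real \<eta> = W z - Q z * cnj (Q z)" by (simp add: W_def)
      moreover have "1/2 * (dd * i + q * cd * (- (i * i) * (d * cq))) = of_real (1/2) * (w - q * cq) * dd * (i * i)"
        if "i * w = 1" "dd = d * cd" for i w q cq cd dd :: complex
        using that by (simp add: algebra_simps)
      ultimately show ?thesis unfolding d2 using iW by simp
    qed
    note e1 = this[of "deriv Q z"]
    have e2: "vbb z = 1/2 * (Q z * cnj (deriv (deriv Q) z) * inverse (W z) +
        Q z * cnj (deriv Q z) * (- (inverse (W z) * inverse (W z)) * (Q z * cnj (deriv Q z))))"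
      unfolding vbb_def d2 power2_eq_square by algebra
    show ?thesis unfolding vb e2 of_real_mult e e1[symmetric]
      by (rule has_wirtinger_eq_rhs[OF has_wirtinger_mult[OF has_wirtinger_const has_wirtinger_mult[OF has_wirtinger_mult[OF wQ(1,3)[OF z]] wiW[OF z]]]])
         (simp_all only: mult_zero_left mult_zero_right add_0_left add_0_right)
  qed
  have wE: "has_wirtinger E (E z * a z) (E z * b z) z" if z: "z \<in> ball 0 1" for z
    unfolding E_def a_def b_def
    by (rule has_wirtinger_chain[OF DERIV_exp has_wirtinger_add[OF w\<phi>[OF z] wv[OF z]]])
  have wb: "has_wirtinger b (of_real (c * (S2 z + 1)) + of_real (1/2 * \<eta> * (norm (deriv Q z))\<^sup>2) / (W z)\<^sup>2)
     (of_real c * (\<Sum>i\<in>I. f i z * cnj (deriv (deriv (f i)) z)) + vbb z) z" if z: "z \<in> ball 0 1" for z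
    unfolding b_def by (rule has_wirtinger_add[OF w\<phi>b[OF z] wvb[OF z]])
  have wEb: "has_wirtinger (\<lambda>z. E z * b z) (V z) (V' z) z" if z: "z \<in> ball 0 1" for z
    by (rule has_wirtinger_eq_rhs[OF has_wirtinger_mult[OF wE[OF z] wb[OF z]]])
       (simp_all add: V_def V'_def algebra_simps power2_eq_square)
  have z0: "(0::complex) \<in> ball 0 1" by simp
  have cQ: "continuous_on (ball 0 1) Q" "continuous_on (ball 0 1) (deriv Q)" "continuous_on (ball 0 1) (deriv (deriv Q))"
    using dd(3-5)[OF Q z0] .
  have cf: "continuous_on (ball 0 1) (f i)" "continuous_on (ball 0 1) (deriv (f i))" "continuous_on (ball 0 1) (deriv (deriv (f i)))" if "i \<in> I" for i
    using dd(3-5)[OF f(1)[OF that] z0] .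
  have cE: "continuous_on (ball 0 1) E" by (rule has_wirtinger_continuous_on[OF wE])
  have cb: "continuous_on (ball 0 1) b" by (rule has_wirtinger_continuous_on[OF wb])
  have cW: "continuous_on (ball 0 1) W" by (rule has_wirtinger_continuous_on[OF wW])
  have ca: "continuous_on (ball 0 1) a" unfolding a_def Dz_def vz_def
    by (intro continuous_intros cQ cf cW) (use W0 in auto)
  have cV: "continuous_on (ball 0 1) V" unfolding V_def S2_def
    by (intro continuous_intros cE ca cb cQ cf cW) (use W0 in auto)
  have cV': "continuous_on (ball 0 1) V'" unfolding V'_def vbb_def
    by (intro continuous_intros cE ca cb cQ cf cW) (use W0 in auto)
  define p where "p = (\<lambda>z. exp (c * ((\<Sum>i\<in>I. (norm (f i z))\<^sup>2) + (norm z)\<^sup>2)))"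
  have Ep: "E z = of_real (p z * M z)" for z
  proof -
    have "\<phi> z = of_real (c * ((\<Sum>i\<in>I. (norm (f i z))\<^sup>2) + (norm z)\<^sup>2))"
      by (simp only: \<phi>_def of_real_mult of_real_add of_real_sum complex_norm_square)
    moreover have "v z = of_real (1/2 * ln ((norm (Q z))\<^sup>2 + \<eta>))"
      unfolding v_def W Ln_of_real'[OF less_imp_neq[OF Wp, symmetric]] using Wp[of z] by (simp add: Ln_of_real)
    moreover have "exp (1/2 * ln ((norm (Q z))\<^sup>2 + \<eta>)) = M z"
      unfolding M_def using Wp[of z] by (simp add: ln_sqrt[symmetric] exp_ln)
    ultimately show ?thesis
      unfolding E_def p_def of_real_mult[of "exp _"] by (metis exp_add exp_of_real)
  qed
  have p1: "1 \<le> p z" for z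
    unfolding p_def using c0 by (intro one_le_exp_iff[THEN iffD2] mult_nonneg_nonneg add_nonneg_nonneg sum_nonneg) auto
  have p2: "p z \<le> 2" if z: "z \<in> ball 0 1" for z
  proof -
    have "(\<Sum>i\<in>I. (norm (f i z))\<^sup>2) \<le> (\<Sum>i\<in>I. 1)"
      by (intro sum_mono) (use f(2)[OF _ z] in \<open>auto simp: power_le_one\<close>)
    moreover have "(norm z)\<^sup>2 \<le> 1" using z by (auto simp: power_le_one)
    ultimately have "c * ((\<Sum>i\<in>I. (norm (f i z))\<^sup>2) + (norm z)\<^sup>2) \<le> c * (m + 1)"
      using c0 by (intro mult_left_mono) (auto simp: m_def)
    then have "p z \<le> exp (1/2)" unfolding p_def c0(2) by simp
    also have "\<dots> \<le> 2" by (rule exp_half_le2)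
    finally show ?thesis .
  qed
  have low: "(M z * (1 + S2 z) + (norm (deriv Q z))\<^sup>2 / M z) / (8 * (m + 1)) \<le> Re (V z)" if z: "z \<in> ball 0 1" for z
  proof -
    define q where "q = norm (deriv Q z)"
    have ab: "a z * b z = of_real ((norm (a z))\<^sup>2)"
    proof -
      have "cnj (a z) = b z"
        by (simp add: a_def b_def Dz_def Db_def vz_def vb_def W mult.commute)
      then show ?thesis by (metis complex_norm_square)
    qed
    have "V z = of_real (p z * M z * ((norm (a z))\<^sup>2 + c * (S2 z + 1) + 1/2 * \<eta> * q\<^sup>2 / (M z)^4))"
      unfolding V_def ab Ep W M2(1)[symmetric] q_def by simp
    then have ReV: "Re (V z) = p z * (M z * ((norm (a z))\<^sup>2 + c * (S2 z + 1) + 1/2 * \<eta> * q\<^sup>2 / (M z)^4))"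
      by simp
    have S0: "0 \<le> S2 z" unfolding S2_def by (intro sum_nonneg) auto
    have h1: "(norm (of_real c * (Dz z + cnj z)))\<^sup>2 \<le> c / 2 * (S2 z + 1)"
    proof -
      have "norm (Dz z + cnj z) \<le> (\<Sum>i\<in>I. norm (deriv (f i) z)) + 1"
        unfolding Dz_def
        by (rule order_trans[OF norm_triangle_ineq] add_mono order_trans[OF norm_sum] sum_mono)+
           (use z f(2)[OF _ z] in \<open>auto simp: norm_mult mult_left_le\<close>)
      then have "(norm (Dz z + cnj z))\<^sup>2 \<le> ((\<Sum>i\<in>I. norm (deriv (f i) z)) + 1)\<^sup>2"
        by (intro power_mono) auto
      also have "\<dots> \<le> (m + 1) * (S2 z + 1)"
        unfolding m_def S2_def by (rule sum_cmod_plus_one_sq[OF I])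
      finally have "c\<^sup>2 * (norm (Dz z + cnj z))\<^sup>2 \<le> c\<^sup>2 * ((m + 1) * (S2 z + 1))"
        by (intro mult_left_mono) auto
      also have "\<dots> = c * (c * (m + 1)) * (S2 z + 1)" by (simp add: power2_eq_square)
      finally show ?thesis unfolding c0(2) using c0(1) by (simp add: norm_mult power_mult_distrib)
    qed
    \<comment> \<open>The two parts of \<open>a\<close> may cancel; half of the square of
      \<open>vz\<close> survives at the price of the square of the other part, which
      \<open>h1\<close> bounds by half of what the weight contributes.\<close>
    have h2: "(norm (vz z))\<^sup>2 / 2 \<le> (norm (a z))\<^sup>2 + (norm (of_real c * (Dz z + cnj z)))\<^sup>2"
    proof -
      have "norm (vz z) \<le> norm (a z) + norm (of_real c * (Dz z + cnj z))"
        using norm_triangle_ineq4[of "a z" "of_real c * (Dz z + cnj z)"] by (simp add: a_def)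
      then have "(norm (vz z))\<^sup>2 \<le> (norm (a z) + norm (of_real c * (Dz z + cnj z)))\<^sup>2"
        by (intro power_mono) auto
      also have "\<dots> \<le> 2 * (norm (a z))\<^sup>2 + 2 * (norm (of_real c * (Dz z + cnj z)))\<^sup>2"
        using sum_squares_bound[of "norm (a z)" "norm (of_real c * (Dz z + cnj z))"] by (simp add: power2_sum)
      finally show ?thesis by simp
    qed
    have h3: "(norm (vz z))\<^sup>2 = 1/4 * q\<^sup>2 * (norm (Q z))\<^sup>2 / (M z)^4"
    proof -
      have "norm (W z) = (M z)\<^sup>2" unfolding W M2(1)[symmetric] by (simp add: norm_power)
      then show ?thesis by (simp add: vz_def norm_mult norm_divide power_mult_distrib power_divide q_def)
    qed
    \<comment> \<open>At zeros of \<open>Q\<close> the term \<open>vz\<close> degenerates; the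
      \<open>\<eta>\<close> term supplies more than the missing share of
      \<open>M^2 = norm (Q z)^2 + \<eta>\<close>.\<close>
    have h4: "q\<^sup>2 / (8 * (M z)\<^sup>2) \<le> (norm (vz z))\<^sup>2 / 2 + 1/2 * \<eta> * q\<^sup>2 / (M z)^4"
    proof -
      have e4: "(M z)^4 = (M z)\<^sup>2 * (M z)\<^sup>2" by (simp add: power4_eq_xxxx power2_eq_square)
      have "q\<^sup>2 / (8 * (M z)\<^sup>2) = (q\<^sup>2 * (norm (Q z))\<^sup>2 + q\<^sup>2 * \<eta>) / (8 * (M z)^4)"
        unfolding e4 distrib_left[symmetric] M2(1)[symmetric] using M2(2)[of z]
        by (simp add: divide_simps power2_eq_square)
      also have "\<dots> \<le> (q\<^sup>2 * (norm (Q z))\<^sup>2 + 4 * (q\<^sup>2 * \<eta>)) / (8 * (M z)^4)"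
        using \<eta> M2(2)[of z] by (intro divide_right_mono) auto
      also have "\<dots> = (norm (vz z))\<^sup>2 / 2 + 1/2 * \<eta> * q\<^sup>2 / (M z)^4"
        unfolding h3 by (simp add: add_divide_distrib)
      finally show ?thesis .
    qed
    have "q\<^sup>2 / (8 * (M z)\<^sup>2) + c / 2 * (S2 z + 1) \<le> (norm (a z))\<^sup>2 + c * (S2 z + 1) + 1/2 * \<eta> * q\<^sup>2 / (M z)^4"
    proof -
      have "x + y \<le> A + 2 * y + e" if "n \<le> y" "w \<le> A + n" "x \<le> w + e" for x y A e n w :: real
        using that by linarith
      from this[OF h1 h2 h4] show ?thesis by simp
    qed
    then have k: "M z * (q\<^sup>2 / (8 * (M z)\<^sup>2) + c / 2 * (S2 z + 1)) \<le> M z * ((norm (a z))\<^sup>2 + c * (S2 z + 1) + 1/2 * \<eta> * q\<^sup>2 / (M z)^4)" (is "_ \<le> ?r")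
      using M2(2)[of z] by (intro mult_left_mono) auto
    have "0 \<le> ?r" using M2(2)[of z] c0(1) S0 \<eta> by (intro mult_nonneg_nonneg add_nonneg_nonneg divide_nonneg_nonneg) auto
    then have "?r \<le> Re (V z)" unfolding ReV using p1[of z] by (simp add: mult_le_cancel_right1)
    \<comment> \<open>Both 1/8 and \<open>c / 2 = 1 / (4 * (m + 1))\<close> are at least
      \<open>1 / (8 * (m + 1))\<close>, the common normalisation.\<close>
    moreover have "(M z * (1 + S2 z) + q\<^sup>2 / M z) / (8 * (m + 1)) \<le> M z * (q\<^sup>2 / (8 * (M z)\<^sup>2) + c / 2 * (S2 z + 1))"
    proof -
      have "q\<^sup>2 / M z / (8 * (m + 1)) \<le> q\<^sup>2 / M z / 8"
        using m0 M2(2)[of z] by (intro divide_left_mono) auto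
      moreover have "M z * (1 + S2 z) / (8 * (m + 1)) \<le> M z * (1 + S2 z) / (4 * (m + 1))"
        using m0 M2(2)[of z] S0 by (intro divide_left_mono) auto
      moreover have "M z * (q\<^sup>2 / (8 * (M z)\<^sup>2)) = q\<^sup>2 / M z / 8"
        using M2(2)[of z] by (simp add: power2_eq_square)
      moreover have "M z * (c / 2 * (S2 z + 1)) = M z * (1 + S2 z) / (4 * (m + 1))"
        by (simp add: c_def algebra_simps)
      ultimately show ?thesis by (simp add: add_divide_distrib distrib_left)
    qed
    ultimately show ?thesis using k by (simp add: q_def)
  qed
  show ?thesis unfolding m_def[symmetric]
  proof (rule majorizedI[where U=E and Uz="\<lambda>z. E z * a z" and Ub="\<lambda>z. E z * b z" and V=V and V'=V'])
    show "(M z * (1 + (\<Sum>i\<in>I. (norm (deriv (f i) z))\<^sup>2)) + (norm (deriv Q z))\<^sup>2 / M z) / (8 * (m + 1)) \<le> Re (V z)"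
      if "z \<in> ball 0 1" for z using low[OF that] by (simp add: S2_def)
    show "0 \<le> Re (E 0)" unfolding Ep using p1[of 0] M2(2)[of 0] by simp
    fix s :: real assume s: "s \<in> {0..<1}"
    have sub: "sphere 0 s \<subseteq> ball (0::complex) 1" using s by auto
    have "Re (circle_mean s E) = circle_mean s (\<lambda>z. Re (E z))"
      using s by (intro circle_mean_Re continuous_on_subset[OF cE sub]) auto
    also have "\<dots> \<le> circle_mean s (\<lambda>z. 2 * M z)"
    proof (rule circle_mean_mono)
      show "continuous_on (sphere 0 s) (\<lambda>z. 2 * M z)"
        unfolding M_def by (intro continuous_intros continuous_on_subset[OF cQ(1) sub])
      show "Re (E z) \<le> 2 * M z" if "norm z = s" for z
        unfolding Ep using p2[of z] M2(2)[of z] s that by (simp add: mult_right_mono)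
    qed (use s in \<open>auto intro!: continuous_intros continuous_on_subset[OF cE sub]\<close>)
    also have "\<dots> = 2 * circle_mean s M" by (rule circle_mean_cmult)
    finally show "Re (circle_mean s E) \<le> 2 * circle_mean s M" .
  qed (use wE wEb cE ca cV cV' in \<open>auto intro!: continuous_intros\<close>)
qed

text \<open>The Binet-Cauchy identity. It expresses the numerator of the conjugate derivative of the
  quotient of \<open>\<Sum>h j * cnj (f j)\<close> by \<open>\<Sum>f j * cnj (f j)\<close> through
  the combinations \<open>h j * f k - h k * f j\<close>, which are the ones the duality argument
  controls.\<close>

lemma sum_antisymmetrized:
  fixes h f d g :: "'i \<Rightarrow> 'a::comm_ring_1"
  shows "(\<Sum>j\<in>I. \<Sum>k\<in>I. (h j * f k - h k * f j) * (d j * g k - g j * d k)) =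
    2 * ((\<Sum>j\<in>I. h j * d j) * (\<Sum>k\<in>I. f k * g k) - (\<Sum>j\<in>I. h j * g j) * (\<Sum>k\<in>I. f k * d k))"
proof -
  have "(\<Sum>j\<in>I. \<Sum>k\<in>I. (h j * f k - h k * f j) * (d j * g k - g j * d k)) =
    (\<Sum>j\<in>I. \<Sum>k\<in>I. (h j * d j) * (f k * g k)) - (\<Sum>j\<in>I. \<Sum>k\<in>I. (h j * g j) * (f k * d k))
    - (\<Sum>j\<in>I. \<Sum>k\<in>I. (h k * g k) * (f j * d j)) + (\<Sum>j\<in>I. \<Sum>k\<in>I. (h k * d k) * (f j * g j))"
    unfolding sum.distrib[symmetric] sum_subtractf[symmetric]
    by (intro sum.cong refl) (simp add: algebra_simps)
  also have "(\<Sum>j\<in>I. \<Sum>k\<in>I. (h k * g k) * (f j * d j)) = (\<Sum>j\<in>I. \<Sum>k\<in>I. (h j * g j) * (f k * d k))"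
    by (rule sum.swap)
  also have "(\<Sum>j\<in>I. \<Sum>k\<in>I. (h k * d k) * (f j * g j)) = (\<Sum>j\<in>I. \<Sum>k\<in>I. (h j * d j) * (f k * g k))"
    by (rule sum.swap)
  finally show ?thesis by (simp add: sum_product)
qed

text \<open>The products that arise in the mixed derivative of the quotient are absorbed into the
  one density that has a majorant. The first is the inequality of arithmetic and geometric means
  weighted by \<open>M\<close>; the others rest on \<open>\<bar>q\<bar> \<le> M\<close>.\<close>

lemma product_le_majorant_terms:
  fixes S M p q :: real
  assumes "0 < M" "\<bar>q\<bar> \<le> M" "0 \<le> S" "0 \<le> p"
  shows "S * p \<le> M * (1 + S\<^sup>2) + p\<^sup>2 / M" "S * \<bar>q\<bar> \<le> M * (1 + S\<^sup>2) + p\<^sup>2 / M" "S\<^sup>2 * \<bar>q\<bar> \<le> M * (1 + S\<^sup>2) + p\<^sup>2 / M"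
proof -
  have pm: "0 \<le> p\<^sup>2 / M" using assms by simp
  have "2 * (S * M) * p \<le> (S * M)\<^sup>2 + p\<^sup>2" by (rule sum_squares_bound)
  then have "2 * (S * p) * M \<le> (M * S\<^sup>2 + p\<^sup>2 / M) * M"
    using assms by (simp add: power2_eq_square algebra_simps)
  then have "2 * (S * p) \<le> M * S\<^sup>2 + p\<^sup>2 / M" using assms by simp
  moreover have "0 \<le> S * p" using assms by simp
  ultimately have "S * p \<le> M * S\<^sup>2 + p\<^sup>2 / M" by linarith
  then show "S * p \<le> M * (1 + S\<^sup>2) + p\<^sup>2 / M" using assms(1) by (simp add: distrib_left)
  have "S * 2 \<le> 1 + S\<^sup>2" using zero_le_power2[of "1 - S"] by (simp add: power2_diff)
  then have "S \<le> 1 + S\<^sup>2" using assms by simp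
  then have "S * \<bar>q\<bar> \<le> (1 + S\<^sup>2) * M" using assms by (intro mult_mono) auto
  then show "S * \<bar>q\<bar> \<le> M * (1 + S\<^sup>2) + p\<^sup>2 / M" using pm by (simp add: mult.commute)
  have "S\<^sup>2 * \<bar>q\<bar> \<le> (1 + S\<^sup>2) * M" using assms by (intro mult_mono) auto
  then show "S\<^sup>2 * \<bar>q\<bar> \<le> M * (1 + S\<^sup>2) + p\<^sup>2 / M" using pm by (simp add: mult.commute)
qed

text \<open>
  The factor \<open>z ^ N\<close> makes the constant independent of the lower bound \<open>\<tau>\<close> on the inner disc.
\<close>

lemma wolff_estimate:
  fixes m :: nat and \<delta> :: real
  assumes \<delta>: "0 < \<delta>" "\<delta> \<le> 1"
  obtains C where "0 < C" and
    "\<And>\<tau> \<rho>. \<lbrakk>0 < \<tau>; \<tau> \<le> 1; 0 < \<rho>; \<rho> < 1\<rbrakk> \<Longrightarrow> \<exists>N. \<forall>f h s.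
      (\<forall>i<m. f i holomorphic_on ball 0 1 \<and> h i holomorphic_on ball 0 1 \<and> h i 0 = 0 \<and> (\<forall>z\<in>ball 0 1. norm (f i z) \<le> 1)) \<longrightarrow>
      (\<forall>z\<in>ball 0 1. \<tau>\<^sup>2 \<le> (\<Sum>i<m. (norm (f i z))\<^sup>2) \<and> (\<rho> \<le> norm z \<longrightarrow> \<delta>\<^sup>2 \<le> (\<Sum>i<m. (norm (f i z))\<^sup>2))) \<longrightarrow>
      s \<in> {0..<1} \<longrightarrow>
      norm (circle_mean s (\<lambda>z. z ^ N * (\<Sum>i<m. h i z * cnj (f i z)) / (\<Sum>i<m. f i z * cnj (f i z))))
        \<le> C * (\<Sum>j<m. \<Sum>k<m. circle_mean s (\<lambda>z. norm (h j z * f k z - h k z * f j z)))"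
proof -
  \<comment> \<open>The sixth power comes from the cube of \<open>inverse (D z)\<close>, with
    \<open>D z\<close> at least the square of \<delta>. \<open>c2\<close> below is the analogue for
    the lower bound \<tau>.\<close>
  define c1 where "c1 = (1 + 2 * real m) / \<delta>^6"
  define C1 where "C1 = c1 * (8 * (real m + 1))"
  have c1: "0 < c1" using \<delta> by (simp add: c1_def)
  have C1: "0 < C1" using c1 by (simp add: C1_def)
  show thesis
  proof (rule that[of "8 * C1"])
    fix \<tau> \<rho> :: real
    assume \<tau>: "0 < \<tau>" "\<tau> \<le> 1" and \<rho>: "0 < \<rho>" "\<rho> < 1"
    define c2 where "c2 = (1 + 2 * real m) / \<tau>^6 * 2"
    have c2: "0 < c2" using \<tau> by (simp add: c2_def)
    \<comment> \<open>\<open>N\<close> is chosen so that on the inner disc both \<open>z ^ N\<close>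
      and its derivative \<open>N * z ^ (N - 1)\<close> are small enough to compensate the loss from
      \<delta> to \<tau>, that is, the ratio of \<open>c2\<close> to \<open>c1\<close>.\<close>
    have "(\<lambda>n. real n * \<rho> ^ n) \<longlonglongrightarrow> 0"
      using powser_times_n_limit_0[of \<rho>] \<rho> by simp
    moreover have "0 < c1 / c2 * \<rho>" using c1 c2 \<rho> by simp
    ultimately have "\<forall>\<^sub>F n in sequentially. real n * \<rho> ^ n < c1 / c2 * \<rho>"
      by (rule order_tendstoD)
    then have "\<forall>\<^sub>F n in sequentially. real n * \<rho> ^ n < c1 / c2 * \<rho> \<and> 1 \<le> n"
      by (intro eventually_conj eventually_ge_at_top)
    then obtain N where N: "real N * \<rho> ^ N < c1 / c2 * \<rho>" "1 \<le> N"
      using eventually_happens'[OF sequentially_bot] by blast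
    have N': "real N * \<rho> ^ (N - 1) * c2 \<le> c1"
    proof -
      have "\<rho> ^ N = \<rho> ^ (N - 1) * \<rho>" using N(2) by (metis Suc_diff_1 less_le_trans power_Suc2 zero_less_one)
      then have "(real N * \<rho> ^ (N - 1)) * \<rho> < c1 / c2 * \<rho>" using N(1) by (simp only: mult.assoc)
      then have "real N * \<rho> ^ (N - 1) < c1 / c2" using \<rho>(1) by (simp only: mult_less_cancel_right_pos)
      then show ?thesis using c2 by (simp add: field_simps)
    qed
    show "\<exists>N. \<forall>f h s.
      (\<forall>i<m. f i holomorphic_on ball 0 1 \<and> h i holomorphic_on ball 0 1 \<and> h i 0 = 0 \<and> (\<forall>z\<in>ball 0 1. norm (f i z) \<le> 1)) \<longrightarrow>
      (\<forall>z\<in>ball 0 1. \<tau>\<^sup>2 \<le> (\<Sum>i<m. (norm (f i z))\<^sup>2) \<and> (\<rho> \<le> norm z \<longrightarrow> \<delta>\<^sup>2 \<le> (\<Sum>i<m. (norm (f i z))\<^sup>2))) \<longrightarrow>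
      s \<in> {0..<1} \<longrightarrow>
      norm (circle_mean s (\<lambda>z. z ^ N * (\<Sum>i<m. h i z * cnj (f i z)) / (\<Sum>i<m. f i z * cnj (f i z))))
        \<le> 8 * C1 * (\<Sum>j<m. \<Sum>k<m. circle_mean s (\<lambda>z. norm (h j z * f k z - h k z * f j z)))"
    proof (intro exI[of _ N] allI impI)
      fix f h :: "nat \<Rightarrow> complex \<Rightarrow> complex" and s :: real
      assume A1: "\<forall>i<m. f i holomorphic_on ball 0 1 \<and> h i holomorphic_on ball 0 1 \<and> h i 0 = 0 \<and> (\<forall>z\<in>ball 0 1. norm (f i z) \<le> 1)"
        and A2: "\<forall>z\<in>ball 0 1. \<tau>\<^sup>2 \<le> (\<Sum>i<m. (norm (f i z))\<^sup>2) \<and> (\<rho> \<le> norm z \<longrightarrow> \<delta>\<^sup>2 \<le> (\<Sum>i<m. (norm (f i z))\<^sup>2))"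
        and s: "s \<in> {0..<1}"
      let ?D = "ball (0::complex) 1"
      have f: "f i holomorphic_on ?D" and h: "h i holomorphic_on ?D" and h0: "h i 0 = 0"
        and f1: "z \<in> ?D \<Longrightarrow> norm (f i z) \<le> 1" if "i < m" for i z using A1 that by auto
      define D where "D = (\<lambda>z. \<Sum>i<m. f i z * cnj (f i z))"
      define A where "A = (\<lambda>z. \<Sum>i<m. h i z * cnj (f i z))"
      define Dz where "Dz = (\<lambda>z. \<Sum>i<m. deriv (f i) z * cnj (f i z))"
      define Db where "Db = (\<lambda>z. \<Sum>i<m. f i z * cnj (deriv (f i) z))"
      define Az where "Az = (\<lambda>z. \<Sum>i<m. deriv (h i) z * cnj (f i z))"
      define Ab where "Ab = (\<lambda>z. \<Sum>i<m. h i z * cnj (deriv (f i) z))"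
      define H where "H = (\<lambda>j k z. h j z * f k z - h k z * f j z)"
      define Q where "Q = (\<lambda>j k z. z ^ N * H j k z)"
      define B where "B = (\<lambda>j k z. deriv (f j) z * f k z - f j z * deriv (f k) z)"
      define u where "u = (\<lambda>z. z ^ N * A z * inverse (D z))"
      define i2 where "i2 = (\<lambda>z. inverse (D z) * inverse (D z))"
      define uz where "uz = (\<lambda>z. (of_nat N * z ^ (N - 1) * A z + z ^ N * Az z) * inverse (D z) + z ^ N * A z * (- i2 z * Dz z))"
      \<comment> \<open>The conjugate derivative of \<open>u\<close>, already rewritten by
        antisymmetry. Up to \<open>i2\<close> it is a sum of products of a holomorphic and a
        conjugate holomorphic function, so a further derivative in \<open>z\<close> falls on
        \<open>Q j k\<close> or on \<open>i2\<close> only.\<close>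
      define ub where "ub = (\<lambda>z. 1/2 * ((\<Sum>j<m. \<Sum>k<m. Q j k z * cnj (B j k z)) * i2 z))"
      define i2z where "i2z = (\<lambda>z. - (2 * inverse (D z) * i2 z) * Dz z)"
      define i2b where "i2b = (\<lambda>z. - (2 * inverse (D z) * i2 z) * Db z)"
      define v where "v = (\<lambda>z. 1/2 * ((\<Sum>j<m. \<Sum>k<m. deriv (Q j k) z * cnj (B j k z)) * i2 z + (\<Sum>j<m. \<Sum>k<m. Q j k z * cnj (B j k z)) * i2z z))"
      define v' where "v' = (\<lambda>z. 1/2 * ((\<Sum>j<m. \<Sum>k<m. Q j k z * cnj (deriv (B j k) z)) * i2 z + (\<Sum>j<m. \<Sum>k<m. Q j k z * cnj (B j k z)) * i2b z))"
      have hH: "H j k holomorphic_on ?D" and hQ: "Q j k holomorphic_on ?D" and hB: "B j k holomorphic_on ?D"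
        if "j < m" "k < m" for j k
        unfolding Q_def H_def B_def using f h that by (auto intro!: holomorphic_intros holomorphic_deriv)
      have Dr: "D z = of_real (\<Sum>i<m. (norm (f i z))\<^sup>2)" for z
        unfolding D_def of_real_sum complex_norm_square ..
      have Dpos: "0 < (\<Sum>i<m. (norm (f i z))\<^sup>2)" if "z \<in> ?D" for z
        using A2 that \<tau> by (meson less_le_trans zero_less_power)
      have D0: "D z \<noteq> 0" if "z \<in> ?D" for z
        unfolding Dr using Dpos[OF that] by (metis less_irrefl of_real_eq_0_iff)
      have wh: "has_wirtinger g (deriv g z) 0 z" "has_wirtinger (\<lambda>z. cnj (g z)) 0 (cnj (deriv g z)) z"
        if "g holomorphic_on ?D" "z \<in> ?D" for g z
      proof -
        show 1: "has_wirtinger g (deriv g z) 0 z"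
          using that by (intro has_wirtinger_holomorphic holomorphic_derivI[of _ ?D]) auto
        show "has_wirtinger (\<lambda>z. cnj (g z)) 0 (cnj (deriv g z)) z"
          using has_wirtinger_cnj[OF 1] by simp
      qed
      have wD: "has_wirtinger D (Dz z) (Db z) z" if z: "z \<in> ?D" for z
        unfolding D_def Dz_def Db_def
        by (rule has_wirtinger_eq_rhs[OF has_wirtinger_sum])
           (rule has_wirtinger_mult[OF wh(1)[OF f z] wh(2)[OF f z]] | simp)+
      have wA: "has_wirtinger A (Az z) (Ab z) z" if z: "z \<in> ?D" for z
        unfolding A_def Az_def Ab_def
        by (rule has_wirtinger_eq_rhs[OF has_wirtinger_sum])
           (rule has_wirtinger_mult[OF wh(1)[OF h z] wh(2)[OF f z]] | simp)+
      have wiD: "has_wirtinger (\<lambda>z. inverse (D z)) (- i2 z * Dz z) (- i2 z * Db z) z" if z: "z \<in> ?D" for z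
        by (rule has_wirtinger_chain[OF _ wD[OF z], of inverse])
           (use D0[OF z] DERIV_inverse[of "D z" UNIV] in \<open>simp add: power2_eq_square i2_def\<close>)
      have wi2: "has_wirtinger i2 (i2z z) (i2b z) z" if z: "z \<in> ?D" for z
      proof -
        note has_wirtinger_mult[OF wiD[OF z] wiD[OF z], folded i2_def]
        moreover have "(\<lambda>z. inverse (D z) * inverse (D z)) = i2" by (simp add: i2_def fun_eq_iff)
        ultimately have "has_wirtinger i2 (- i2 z * Dz z * inverse (D z) + inverse (D z) * (- i2 z * Dz z))
           (- i2 z * Db z * inverse (D z) + inverse (D z) * (- i2 z * Db z)) z" by simp
        then show ?thesis by (rule has_wirtinger_eq_rhs) (simp_all add: i2z_def i2b_def)
      qed
      have wu: "has_wirtinger u (uz z) (ub z) z" if z: "z \<in> ?D" for z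
      proof -
        have "((\<lambda>z. z ^ N) has_field_derivative of_nat N * z ^ (N - 1)) (at z)"
          by (auto intro!: derivative_eq_intros)
        then have zN: "has_wirtinger (\<lambda>z. z ^ N) (of_nat N * z ^ (N - 1)) 0 z"
          by (rule has_wirtinger_holomorphic)
        have "ub z = z ^ N * ((Ab z * D z - A z * Db z) * i2 z)"
        proof -
          have "(\<Sum>j<m. \<Sum>k<m. Q j k z * cnj (B j k z)) = z ^ N * (\<Sum>j<m. \<Sum>k<m. (h j z * f k z - h k z * f j z) *
              (cnj (deriv (f j) z) * cnj (f k z) - cnj (f j z) * cnj (deriv (f k) z)))"
            by (simp add: Q_def H_def B_def sum_distrib_left mult.assoc)
          then show ?thesis
            unfolding ub_def sum_antisymmetrized by (simp add: A_def Ab_def D_def Db_def)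
        qed
        also have "\<dots> = z ^ N * Ab z * inverse (D z) + z ^ N * A z * (- i2 z * Db z)"
        proof -
          have D2: "D z * i2 z = inverse (D z)" using D0[OF z] by (simp add: i2_def)
          show ?thesis unfolding D2[symmetric] by algebra
        qed
        finally show ?thesis unfolding u_def uz_def
          by (intro has_wirtinger_eq_rhs[OF has_wirtinger_mult[OF has_wirtinger_mult[OF zN wA[OF z]] wiD[OF z]]]) simp_all
      qed
      have wub: "has_wirtinger ub (v z) (v' z) z" if z: "z \<in> ?D" for z
      proof -
        have "has_wirtinger (\<lambda>z. \<Sum>j<m. \<Sum>k<m. Q j k z * cnj (B j k z)) (\<Sum>j<m. \<Sum>k<m. deriv (Q j k) z * cnj (B j k z))
          (\<Sum>j<m. \<Sum>k<m. Q j k z * cnj (deriv (B j k) z)) z"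
        proof (intro has_wirtinger_sum)
          fix j k assume "j \<in> {..<m}" "k \<in> {..<m}"
          then have jk: "j < m" "k < m" by auto
          show "has_wirtinger (\<lambda>z. Q j k z * cnj (B j k z)) (deriv (Q j k) z * cnj (B j k z)) (Q j k z * cnj (deriv (B j k) z)) z"
            by (rule has_wirtinger_eq_rhs[OF has_wirtinger_mult[OF wh(1)[OF hQ[OF jk] z] wh(2)[OF hB[OF jk] z]]]) simp_all
        qed
        from has_wirtinger_mult[OF has_wirtinger_const[of "1/2"] has_wirtinger_mult[OF this wi2[OF z]]]
        show ?thesis unfolding ub_def v_def v'_def by (rule has_wirtinger_eq_rhs) simp_all
      qed
      have ch: "continuous_on ?D g" "continuous_on ?D (deriv g)" if "g holomorphic_on ?D" for g
        using that by (auto intro!: holomorphic_on_imp_continuous_on holomorphic_deriv)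
      have cc: "continuous_on ?D A" "continuous_on ?D D" "continuous_on ?D i2" "continuous_on ?D (\<lambda>z. inverse (D z))"
        by (rule has_wirtinger_continuous_on[OF wA] has_wirtinger_continuous_on[OF wD] has_wirtinger_continuous_on[OF wi2]
             has_wirtinger_continuous_on[OF wiD]; assumption)+
      have c3: "continuous_on ?D Dz" "continuous_on ?D Db" "continuous_on ?D Az"
        unfolding Dz_def Db_def Az_def by (intro continuous_intros ch f h; simp)+
      have cuz: "continuous_on ?D uz"
        unfolding uz_def by (intro continuous_intros cc c3)
      have cv: "continuous_on ?D v"
        unfolding v_def i2z_def by (intro continuous_intros cc c3 ch hQ hB; simp)
      have cv': "continuous_on ?D v'"
        unfolding v'_def i2b_def by (intro continuous_intros cc c3 ch hQ hB; simp)
      define S where "S = (\<lambda>z. sqrt (\<Sum>i<m. (norm (deriv (f i) z))\<^sup>2))"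
      have S0: "0 \<le> S z" and S2: "(S z)\<^sup>2 = (\<Sum>i<m. (norm (deriv (f i) z))\<^sup>2)" for z
        unfolding S_def by (simp_all add: sum_nonneg)
      have fS: "norm (deriv (f i) z) \<le> S z" if "i < m" for i z
        unfolding S_def by (rule real_le_rsqrt) (use that in \<open>auto intro!: member_le_sum[of i _ "\<lambda>i. (norm (deriv (f i) z))\<^sup>2"]\<close>)
      \<comment> \<open>Each \<open>B j k\<close> and each \<open>Dz\<close> carries one factor
        \<open>S\<close>, so the first sum in \<open>v\<close> has density
        \<open>S * norm (deriv Q)\<close> and the second the square of \<open>S\<close> times
        \<open>norm Q\<close>. \<open>L\<close> will be \<delta> in the annulus and \<tau> in the
        inner disc.\<close>
      have vle: "norm (v z) \<le> (1 + 2 * real m) / L^6 * (\<Sum>j<m. \<Sum>k<m. S z * norm (deriv (Q j k) z) + (S z)\<^sup>2 * norm (Q j k z))"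
        if z: "z \<in> ?D" and L: "0 < L" "L \<le> 1" "L\<^sup>2 \<le> (\<Sum>i<m. (norm (f i z))\<^sup>2)" for z L
      proof -
        have nD: "norm (D z) = (\<Sum>i<m. (norm (f i z))\<^sup>2)"
          unfolding Dr norm_of_real by (simp add: sum_nonneg)
        have iD: "norm (inverse (D z)) \<le> 1 / L\<^sup>2"
        proof -
          have "norm (inverse (D z)) = inverse (\<Sum>i<m. (norm (f i z))\<^sup>2)" by (simp add: norm_inverse nD)
          also have "\<dots> \<le> inverse (L\<^sup>2)" using L by (intro le_imp_inverse_le) auto
          finally show ?thesis by (simp add: inverse_eq_divide)
        qed
        have ni2: "norm (i2 z) \<le> 1 / L^4"
        proof -
          have "norm (i2 z) \<le> (1 / L\<^sup>2) * (1 / L\<^sup>2)"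
            unfolding i2_def norm_mult by (intro mult_mono iD) auto
          then show ?thesis by (simp add: power4_eq_xxxx power2_eq_square mult.assoc)
        qed
        have nDz: "norm (Dz z) \<le> real m * S z"
        proof -
          have "norm (Dz z) \<le> (\<Sum>i<m. S z)"
            unfolding Dz_def
          proof (rule sum_norm_le)
            fix i assume "i \<in> {..<m}"
            then have "norm (deriv (f i) z) * norm (f i z) \<le> S z * 1"
              using f1[OF _ z] by (intro mult_mono fS S0) auto
            then show "norm (deriv (f i) z * cnj (f i z)) \<le> S z" by (simp add: norm_mult)
          qed
          then show ?thesis by simp
        qed
        have ni2z: "norm (i2z z) \<le> 2 * real m * S z / L^6"
        proof -
          have "norm (i2z z) = 2 * norm (inverse (D z)) * norm (i2 z) * norm (Dz z)"
            by (simp add: i2z_def norm_mult)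
          also have "\<dots> \<le> 2 * (1 / L\<^sup>2) * (1 / L^4) * (real m * S z)"
            by (intro mult_mono iD ni2 nDz) (auto intro!: mult_nonneg_nonneg)
          also have "\<dots> = 2 * real m * S z / L^6" by (simp add: power_add[of L 2 4, simplified])
          finally show ?thesis .
        qed
        have nB: "norm (B j k z) \<le> 2 * S z" if "j < m" "k < m" for j k
        proof -
          have "norm (B j k z) \<le> norm (deriv (f j) z) * norm (f k z) + norm (f j z) * norm (deriv (f k) z)"
            unfolding B_def by (rule order_trans[OF norm_triangle_ineq4]) (simp add: norm_mult)
          also have "\<dots> \<le> S z * 1 + 1 * S z"
            by (intro add_mono mult_mono fS f1 z that S0) auto
          finally show ?thesis by simp
        qed
        have BB: "norm (\<Sum>j<m. \<Sum>k<m. q j k * cnj (B j k z)) \<le> (\<Sum>j<m. \<Sum>k<m. norm (q j k) * (2 * S z))" for q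
        proof (intro sum_norm_le)
          fix j k assume "j \<in> {..<m}" "k \<in> {..<m}"
          then have "norm (q j k) * norm (B j k z) \<le> norm (q j k) * (2 * S z)"
            by (intro mult_left_mono nB) auto
          then show "norm (q j k * cnj (B j k z)) \<le> norm (q j k) * (2 * S z)" by (simp add: norm_mult)
        qed
        have t1: "norm ((\<Sum>j<m. \<Sum>k<m. deriv (Q j k) z * cnj (B j k z)) * i2 z)
          \<le> (\<Sum>j<m. \<Sum>k<m. norm (deriv (Q j k) z) * (2 * S z)) * (1 / L^4)"
          unfolding norm_mult by (intro mult_mono ni2 BB) (auto intro!: sum_nonneg mult_nonneg_nonneg S0)
        have t2: "norm ((\<Sum>j<m. \<Sum>k<m. Q j k z * cnj (B j k z)) * i2z z)
          \<le> (\<Sum>j<m. \<Sum>k<m. norm (Q j k z) * (2 * S z)) * (2 * real m * S z / L^6)"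
          unfolding norm_mult by (intro mult_mono ni2z BB) (auto intro!: sum_nonneg mult_nonneg_nonneg S0)
        have L46: "1 / L^4 \<le> 1 / L^6"
          using L by (intro divide_left_mono power_decreasing) auto
        have "norm (v z) \<le> 1/2 * ((\<Sum>j<m. \<Sum>k<m. norm (deriv (Q j k) z) * (2 * S z)) * (1 / L^4) +
           (\<Sum>j<m. \<Sum>k<m. norm (Q j k z) * (2 * S z)) * (2 * real m * S z / L^6))"
        proof -
          have "norm (v z) \<le> 1/2 * (norm ((\<Sum>j<m. \<Sum>k<m. deriv (Q j k) z * cnj (B j k z)) * i2 z) + norm ((\<Sum>j<m. \<Sum>k<m. Q j k z * cnj (B j k z)) * i2z z))"
            unfolding v_def norm_mult[of "1/2"] by (intro mult_mono norm_triangle_ineq) auto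
          moreover have "x \<le> 1/2 * (a' + b')" if "x \<le> 1/2 * (a + b)" "a \<le> a'" "b \<le> b'" for x a b a' b' :: real
            using that by simp
          ultimately show ?thesis using t1 t2 by blast
        qed
        also have "\<dots> = (1 / L^4) * (\<Sum>j<m. \<Sum>k<m. S z * norm (deriv (Q j k) z)) + (2 * real m / L^6) * (\<Sum>j<m. \<Sum>k<m. (S z)\<^sup>2 * norm (Q j k z))"
          unfolding sum_distrib_right[symmetric] sum_distrib_left[symmetric] by (simp add: algebra_simps power2_eq_square)
        also have "\<dots> \<le> ((1 + 2 * real m) / L^6) * (\<Sum>j<m. \<Sum>k<m. S z * norm (deriv (Q j k) z)) + ((1 + 2 * real m) / L^6) * (\<Sum>j<m. \<Sum>k<m. (S z)\<^sup>2 * norm (Q j k z))"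
        proof (intro add_mono mult_right_mono sum_nonneg mult_nonneg_nonneg S0)
          show "1 / L^4 \<le> (1 + 2 * real m) / L^6"
            using L46 L by (intro order_trans[OF L46] divide_right_mono) auto
          show "2 * real m / L^6 \<le> (1 + 2 * real m) / L^6"
            using L by (intro divide_right_mono) auto
        qed auto
        finally show ?thesis by (simp add: sum.distrib distrib_left)
      qed
      define X where "X = (\<Sum>j<m. \<Sum>k<m. circle_mean s (\<lambda>z. norm (H j k z)))"
      \<comment> \<open>The modulus is regularised by \<epsilon>, because the majorant has to be
        smooth at zeros; \<epsilon> is sent to 0 at the end.\<close>
      have key: "norm (circle_mean s u) \<le> 8 * C1 * (X + (real m)\<^sup>2 * \<epsilon>)" if \<epsilon>: "0 < \<epsilon>" for \<epsilon>
      proof -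
        define \<eta> where "\<eta> = \<epsilon>\<^sup>2"
        have \<eta>: "0 < \<eta>" using \<epsilon> by (simp add: \<eta>_def)
        define M where "M = (\<lambda>(q :: complex \<Rightarrow> complex) z. sqrt ((norm (q z))\<^sup>2 + \<eta>))"
        have M: "0 < M q z" "\<bar>norm (q z)\<bar> \<le> M q z" "M q z \<le> norm (q z) + \<epsilon>" for q z
        proof -
          show "0 < M q z" using \<eta> by (simp add: M_def add_nonneg_pos)
          show "\<bar>norm (q z)\<bar> \<le> M q z" unfolding M_def using \<eta> by (intro real_le_rsqrt) auto
          show "M q z \<le> norm (q z) + \<epsilon>" unfolding M_def \<eta>_def using \<epsilon>
            by (intro real_le_lsqrt) (auto simp: power2_sum)
        qed
        define T where "T = (\<lambda>q z. M q z * (1 + (S z)\<^sup>2) + (norm (deriv q z))\<^sup>2 / M q z)"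
        have T0: "0 \<le> T q z" for q z
          unfolding T_def using M(1)[of q z] by (intro add_nonneg_nonneg mult_nonneg_nonneg divide_nonneg_pos) auto
        have maj: "majorized (T q) (\<lambda>s. 8 * (real m + 1) * (2 * circle_mean s (M q)))" if q: "q holomorphic_on ?D" for q
        proof -
          have "majorized (\<lambda>z. 8 * (real m + 1) * (T q z / (8 * (real m + 1)))) (\<lambda>s. 8 * (real m + 1) * (2 * circle_mean s (M q)))"
            unfolding T_def M_def S2
            by (rule majorized_scale[OF majorized_weighted_modulus[where I="{..<m}" and f=f, OF _ _ _ q \<eta>, simplified card_lessThan]])
               (use f f1 in auto)
          moreover have "8 * (real m + 1) * (x / (8 * (real m + 1))) = x" for x :: real by simp
          ultimately show ?thesis by (simp only:)
        qed
        have bound: "norm (v z) \<le> 2 * c1 * (\<Sum>j<m. \<Sum>k<m. T (Q j k) z + T (H j k) z)" if z: "z \<in> ?D" for z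
        proof -
          have pT: "S z * norm (deriv q z) \<le> T q z" "S z * norm (q z) \<le> T q z" "(S z)\<^sup>2 * norm (q z) \<le> T q z" for q
            unfolding T_def using product_le_majorant_terms[OF M(1,2)[of q z] S0[of z] norm_ge_zero[of "deriv q z"]] by simp_all
          show ?thesis
          \<comment> \<open>In the annulus the densities of the \<open>Q j k\<close> suffice.
            Inside, differentiating \<open>z ^ N * H j k\<close> also produces
            \<open>N * z ^ (N - 1) * H j k\<close>, so there the densities of the
            \<open>H j k\<close> take over. One bound contains both kinds.\<close>
          proof (cases "\<rho> \<le> norm z")
            case True
            have "norm (v z) \<le> c1 * (\<Sum>j<m. \<Sum>k<m. S z * norm (deriv (Q j k) z) + (S z)\<^sup>2 * norm (Q j k z))"
              unfolding c1_def by (rule vle[OF z \<delta>]) (use A2 z True in blast)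
            also have "\<dots> \<le> c1 * (\<Sum>j<m. \<Sum>k<m. 2 * (T (Q j k) z + T (H j k) z))"
            proof (intro mult_left_mono sum_mono)
              fix j k
              show "S z * norm (deriv (Q j k) z) + (S z)\<^sup>2 * norm (Q j k z) \<le> 2 * (T (Q j k) z + T (H j k) z)"
                using pT(1,3)[of "Q j k"] T0[of "H j k" z] by simp
            qed (use c1 in simp)
            finally show ?thesis unfolding sum_distrib_left[symmetric] by (simp only: mult_ac)
          next
            case False
            define t where "t = real N * \<rho> ^ (N - 1)"
            have "norm (v z) \<le> c2 / 2 * (\<Sum>j<m. \<Sum>k<m. S z * norm (deriv (Q j k) z) + (S z)\<^sup>2 * norm (Q j k z))"
            proof -
              have c2': "c2 / 2 = (1 + 2 * real m) / \<tau>^6" unfolding c2_def by (rule nonzero_mult_div_cancel_right) simp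
              show ?thesis unfolding c2' by (rule vle[OF z \<tau>]) (use A2 z in blast)
            qed
            also have "\<dots> \<le> c2 / 2 * (\<Sum>j<m. \<Sum>k<m. t * (3 * T (H j k) z))"
            proof (intro mult_left_mono sum_mono)
              fix j k assume "j \<in> {..<m}" "k \<in> {..<m}"
              then have jk: "j < m" "k < m" by auto
              have z1: "norm z ^ (N - 1) \<le> \<rho> ^ (N - 1)" using False by (intro power_mono) auto
              have t0: "norm z ^ (N - 1) \<le> t" "0 \<le> t"
              proof -
                have "1 * \<rho> ^ (N - 1) \<le> t" unfolding t_def using N(2) \<rho> by (intro mult_right_mono) auto
                then show "norm z ^ (N - 1) \<le> t" using z1 by simp
                show "0 \<le> t" using \<rho> by (simp add: t_def)
              qed
              have zN: "norm z ^ N \<le> t"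
              proof -
                have "norm z ^ N \<le> norm z ^ (N - 1)" using z by (intro power_decreasing) auto
                then show ?thesis using t0 by simp
              qed
              have dQ: "deriv (Q j k) z = of_nat N * z ^ (N - 1) * H j k z + z ^ N * deriv (H j k) z"
                unfolding Q_def
                by (rule DERIV_imp_deriv)
                   (rule derivative_eq_intros holomorphic_derivI[OF hH[OF jk] open_ball z] refl | simp add: algebra_simps)+
              have "norm (deriv (Q j k) z) \<le> real N * norm z ^ (N - 1) * norm (H j k z) + norm z ^ N * norm (deriv (H j k) z)"
                unfolding dQ by (rule order_trans[OF norm_triangle_ineq]) (simp add: norm_mult norm_power)
              also have "\<dots> \<le> t * norm (H j k z) + t * norm (deriv (H j k) z)"
                using z1 zN by (intro add_mono mult_right_mono) (auto simp: t_def intro!: mult_left_mono)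
              finally have "S z * norm (deriv (Q j k) z) \<le> t * (S z * norm (H j k z) + S z * norm (deriv (H j k) z))"
                using S0[of z] by (metis (no_types, opaque_lifting) distrib_left mult.left_commute mult_left_mono)
              moreover have "(S z)\<^sup>2 * norm (Q j k z) \<le> t * ((S z)\<^sup>2 * norm (H j k z))"
                unfolding Q_def norm_mult norm_power using mult_right_mono[OF zN, of "(S z)\<^sup>2 * norm (H j k z)"]
                by (simp add: mult_ac)
              moreover have "t * (S z * norm (H j k z) + S z * norm (deriv (H j k) z) + (S z)\<^sup>2 * norm (H j k z)) \<le> t * (3 * T (H j k) z)"
                using pT[of "H j k"] t0(2) by (intro mult_left_mono) auto
              ultimately show "S z * norm (deriv (Q j k) z) + (S z)\<^sup>2 * norm (Q j k z) \<le> t * (3 * T (H j k) z)"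
                by (simp add: distrib_left)
            qed (use c2 in simp)
            also have "\<dots> = (t * c2 * (3 / 2)) * (\<Sum>j<m. \<Sum>k<m. T (H j k) z)"
              unfolding sum_distrib_left[symmetric] by simp
            also have "\<dots> \<le> (2 * c1) * (\<Sum>j<m. \<Sum>k<m. T (Q j k) z + T (H j k) z)"
            proof (rule mult_mono)
              show "t * c2 * (3 / 2) \<le> 2 * c1" using N' c1 unfolding t_def by linarith
              show "(\<Sum>j<m. \<Sum>k<m. T (H j k) z) \<le> (\<Sum>j<m. \<Sum>k<m. T (Q j k) z + T (H j k) z)"
                using T0 by (intro sum_mono) simp
            qed (use c1 T0 in \<open>auto intro!: sum_nonneg\<close>)
            finally show ?thesis .
          qed
        qed
        have u0: "u 0 = 0" using h0 by (simp add: u_def A_def)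
        have mm: "majorized (\<lambda>z. 2 * c1 * (\<Sum>j<m. \<Sum>k<m. T (Q j k) z + T (H j k) z))
          (\<lambda>s. 2 * c1 * (\<Sum>j<m. \<Sum>k<m. 8 * (real m + 1) * (2 * circle_mean s (M (Q j k))) + 8 * (real m + 1) * (2 * circle_mean s (M (H j k)))))"
          by (intro majorized_scale majorized_sum majorized_add maj hQ hH) (use c1 in auto)
        have "norm (circle_mean s u) \<le> 2 * c1 * (\<Sum>j<m. \<Sum>k<m. 8 * (real m + 1) * (2 * circle_mean s (M (Q j k))) + 8 * (real m + 1) * (2 * circle_mean s (M (H j k))))"
          using circle_mean_le_majorant[OF s wu wub cuz cv cv' mm bound] unfolding u0 by simp
        \<comment> \<open>Since \<open>z ^ N\<close> has modulus at most 1, the means of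
          \<open>M (Q j k)\<close> and of \<open>M (H j k)\<close> are both at most the mean of
          \<open>norm (H j k z)\<close> plus \<epsilon>.\<close>
        also have "\<dots> \<le> 2 * c1 * (\<Sum>j<m. \<Sum>k<m. 8 * (real m + 1) * (4 * (circle_mean s (\<lambda>z. norm (H j k z)) + \<epsilon>)))"
        proof (intro mult_left_mono sum_mono)
          fix j k assume "j \<in> {..<m}" "k \<in> {..<m}"
          then have jk: "j < m" "k < m" by auto
          have sub: "sphere 0 s \<subseteq> ?D" using s by auto
          have cH: "continuous_on (sphere 0 s) (H j k)" "continuous_on (sphere 0 s) (Q j k)"
            using continuous_on_subset[OF ch(1)[OF hH[OF jk]] sub] continuous_on_subset[OF ch(1)[OF hQ[OF jk]] sub] by auto
          have cM: "continuous_on (sphere 0 s) (M q)" if "continuous_on (sphere 0 s) q" for q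
            unfolding M_def by (intro continuous_intros that)
          have "circle_mean s (M q) \<le> circle_mean s (\<lambda>z. norm (H j k z)) + \<epsilon>"
            if "continuous_on (sphere 0 s) q" "\<And>z. norm z = s \<Longrightarrow> norm (q z) \<le> norm (H j k z)" for q
          proof -
            have "circle_mean s (M q) \<le> circle_mean s (\<lambda>z. norm (H j k z) + \<epsilon>)"
            proof (rule circle_mean_mono)
              show "M q z \<le> norm (H j k z) + \<epsilon>" if "norm z = s" for z
                using M(3)[of q z] \<open>\<And>z. norm z = s \<Longrightarrow> norm (q z) \<le> norm (H j k z)\<close>[OF that] by linarith
            qed (use s in \<open>auto intro!: cM \<open>continuous_on (sphere 0 s) q\<close> continuous_intros cH\<close>)
            also have "\<dots> = circle_mean s (\<lambda>z. norm (H j k z)) + \<epsilon>"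
              using s by (subst circle_mean_add) (auto intro!: continuous_intros cH)
            finally show ?thesis .
          qed
          moreover have "norm (Q j k z) \<le> norm (H j k z)" if "norm z = s" for z
            unfolding Q_def norm_mult norm_power using s that by (intro mult_left_le_one_le power_le_one) auto
          ultimately have "circle_mean s (M (H j k)) \<le> circle_mean s (\<lambda>z. norm (H j k z)) + \<epsilon>"
            "circle_mean s (M (Q j k)) \<le> circle_mean s (\<lambda>z. norm (H j k z)) + \<epsilon>"
            using cH by auto
          then have "2 * circle_mean s (M (Q j k)) + 2 * circle_mean s (M (H j k)) \<le> 4 * (circle_mean s (\<lambda>z. norm (H j k z)) + \<epsilon>)"
            by simp
          from mult_left_mono[OF this, of "8 * (real m + 1)"]
          show "8 * (real m + 1) * (2 * circle_mean s (M (Q j k))) + 8 * (real m + 1) * (2 * circle_mean s (M (H j k)))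
            \<le> 8 * (real m + 1) * (4 * (circle_mean s (\<lambda>z. norm (H j k z)) + \<epsilon>))"
            by (simp only: distrib_left)
        qed (use c1 in simp)
        also have "\<dots> = 8 * C1 * (X + (real m)\<^sup>2 * \<epsilon>)"
        proof -
          have "(\<Sum>j<m. \<Sum>k<m. circle_mean s (\<lambda>z. norm (H j k z)) + \<epsilon>) = X + (real m)\<^sup>2 * \<epsilon>"
            by (simp add: X_def sum.distrib power2_eq_square)
          moreover have "2 * c1 * (\<Sum>j<m. \<Sum>k<m. 8 * (real m + 1) * (4 * (circle_mean s (\<lambda>z. norm (H j k z)) + \<epsilon>)))
            = 8 * C1 * (\<Sum>j<m. \<Sum>k<m. circle_mean s (\<lambda>z. norm (H j k z)) + \<epsilon>)"
            by (simp only: sum_distrib_left[symmetric] C1_def)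
          ultimately show ?thesis by simp
        qed
        finally show ?thesis .
      qed
      have "norm (circle_mean s u) \<le> 8 * C1 * X"
      proof (rule field_le_epsilon)
        fix e :: real assume e: "0 < e"
        define \<epsilon> where "\<epsilon> = e / (8 * C1 * ((real m)\<^sup>2 + 1))"
        have den: "0 < 8 * C1 * ((real m)\<^sup>2 + 1)" using C1 by (intro mult_pos_pos add_nonneg_pos) auto
        have "0 < \<epsilon>" using e den by (simp add: \<epsilon>_def)
        then have "norm (circle_mean s u) \<le> 8 * C1 * X + 8 * C1 * (real m)\<^sup>2 * \<epsilon>"
          using key[of \<epsilon>] by (simp add: distrib_left mult.assoc)
        also have "8 * C1 * (real m)\<^sup>2 * \<epsilon> \<le> 8 * C1 * ((real m)\<^sup>2 + 1) * \<epsilon>"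
          using C1 \<open>0 < \<epsilon>\<close> by (intro mult_right_mono mult_left_mono) auto
        also have "\<dots> = e" using den unfolding \<epsilon>_def
          by (metis less_irrefl nonzero_mult_div_cancel_left times_divide_eq_right)
        finally show "norm (circle_mean s u) \<le> 8 * C1 * X + e" by simp
      qed
      then show "norm (circle_mean s (\<lambda>z. z ^ N * (\<Sum>i<m. h i z * cnj (f i z)) / (\<Sum>i<m. f i z * cnj (f i z))))
        \<le> 8 * C1 * (\<Sum>j<m. \<Sum>k<m. circle_mean s (\<lambda>z. norm (h j z * f k z - h k z * f j z)))"
        by (simp only: u_def A_def D_def X_def H_def divide_inverse)
    qed
  qed (use C1 in simp)
qed

section \<open>Hahn-Banach separation for functionals on the circle\<close>

definition sublinear :: "('a::real_vector \<Rightarrow> real) \<Rightarrow> bool"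
  where "sublinear p \<longleftrightarrow> (\<forall>x y. p (x + y) \<le> p x + p y) \<and> (\<forall>c x. 0 \<le> c \<longrightarrow> p (c *\<^sub>R x) = c * p x)"

lemma sublinearI:
  assumes "\<And>x y. p (x + y) \<le> p x + p y" "p 0 = 0" "\<And>c x. 0 < c \<Longrightarrow> p (c *\<^sub>R x) \<le> c * p x"
  shows "sublinear p"
proof -
  have "p (c *\<^sub>R x) = c * p x" if "0 \<le> c" for c x
  proof (cases "c = 0")
    case False
    then have c: "0 < c" using that by simp
    have "p x \<le> inverse c * p (c *\<^sub>R x)"
      using assms(3)[of "inverse c" "c *\<^sub>R x"] c by simp
    then have "c * p x \<le> p (c *\<^sub>R x)" using c by (simp add: field_simps)
    then show ?thesis using assms(3)[OF c, of x] by simp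
  qed (simp add: assms(2))
  then show ?thesis using assms(1) by (simp add: sublinear_def)
qed

lemma sublinearD:
  assumes "sublinear p"
  shows "p (x + y) \<le> p x + p y" "0 \<le> c \<Longrightarrow> p (c *\<^sub>R x) = c * p x" "p 0 = 0" "- p (- x) \<le> p x"
proof -
  show a: "p (x + y) \<le> p x + p y" and b: "0 \<le> c \<Longrightarrow> p (c *\<^sub>R x) = c * p x" for x y c
    using assms by (auto simp: sublinear_def)
  show c: "p 0 = 0" using b[of 0 0] by simp
  show "- p (- x) \<le> p x" using a[of x "- x"] c by simp
qed

text \<open>The device of the proof of Hahn-Banach by minimal sublinear functionals: moving along
  the ray in direction \<open>y\<close> and subtracting \<open>p y\<close> per unit lowers
  \<open>p\<close> until \<open>- y\<close> has value at most \<open>- p y\<close>. A functional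
  that this cannot lower is additive in direction \<open>y\<close>.\<close>

definition sublinear_shift :: "('a::real_vector \<Rightarrow> real) \<Rightarrow> 'a \<Rightarrow> 'a \<Rightarrow> real"
  where "sublinear_shift p y x = (INF t\<in>{0..}. p (x + t *\<^sub>R y) - t * p y)"

lemma sublinear_shift:
  assumes p: "sublinear p"
  shows "sublinear (sublinear_shift p y)" "sublinear_shift p y x \<le> p x" "sublinear_shift p y (- y) \<le> - p y"
    "sublinear_shift p y x \<le> p (x + y) - p y"
proof -
  note [simp] = sublinearD(2)[OF p] sublinearD(3)[OF p]
  have lb: "- p (- x) \<le> p (x + t *\<^sub>R y) - t * p y" if "0 \<le> t" for x t
    using sublinearD(1)[OF p, of "x + t *\<^sub>R y" "- x"] that by simp
  have le: "sublinear_shift p y x \<le> p (x + t *\<^sub>R y) - t * p y" if "0 \<le> t" for x t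
    unfolding sublinear_shift_def by (rule cINF_lower) (use lb that in \<open>auto intro!: bdd_belowI2[of _ "- p (- x)"]\<close>)
  have ge: "c \<le> sublinear_shift p y x" if "\<And>t. 0 \<le> t \<Longrightarrow> c \<le> p (x + t *\<^sub>R y) - t * p y" for c x
    unfolding sublinear_shift_def by (rule cINF_greatest) (use that in auto)
  show "sublinear (sublinear_shift p y)"
  proof (rule sublinearI)
    fix x x'
    have "sublinear_shift p y (x + x') - sublinear_shift p y x \<le> sublinear_shift p y x'"
    proof (rule ge)
      fix t' :: real assume t': "0 \<le> t'"
      have "sublinear_shift p y (x + x') - (p (x' + t' *\<^sub>R y) - t' * p y) \<le> sublinear_shift p y x"
      proof (rule ge)
        fix t :: real assume t: "0 \<le> t"
        have "sublinear_shift p y (x + x') \<le> p (x + x' + (t + t') *\<^sub>R y) - (t + t') * p y"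
          using t t' by (intro le) auto
        also have "p (x + x' + (t + t') *\<^sub>R y) \<le> p (x + t *\<^sub>R y) + p (x' + t' *\<^sub>R y)"
          using sublinearD(1)[OF p, of "x + t *\<^sub>R y" "x' + t' *\<^sub>R y"] by (simp add: scaleR_left_distrib add_ac)
        finally show "sublinear_shift p y (x + x') - (p (x' + t' *\<^sub>R y) - t' * p y) \<le> p (x + t *\<^sub>R y) - t * p y"
          by (simp add: distrib_right)
      qed
      then show "sublinear_shift p y (x + x') - sublinear_shift p y x \<le> p (x' + t' *\<^sub>R y) - t' * p y" by simp
    qed
    then show "sublinear_shift p y (x + x') \<le> sublinear_shift p y x + sublinear_shift p y x'" by simp
  next
    have "sublinear_shift p y 0 \<le> 0" using le[of 0 0] by simp
    moreover have "0 \<le> sublinear_shift p y 0" by (rule ge) simp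
    ultimately show "sublinear_shift p y 0 = 0" by simp
  next
    fix c :: real and x assume c: "0 < c"
    have "inverse c * sublinear_shift p y (c *\<^sub>R x) \<le> sublinear_shift p y x"
    proof (rule ge)
      fix t :: real assume t: "0 \<le> t"
      have "sublinear_shift p y (c *\<^sub>R x) \<le> p (c *\<^sub>R x + (c * t) *\<^sub>R y) - (c * t) * p y"
        using t c by (intro le) auto
      also have "p (c *\<^sub>R x + (c * t) *\<^sub>R y) = c * p (x + t *\<^sub>R y)"
        using c sublinearD(2)[OF p, of c "x + t *\<^sub>R y"] by (simp add: scaleR_right_distrib)
      finally show "inverse c * sublinear_shift p y (c *\<^sub>R x) \<le> p (x + t *\<^sub>R y) - t * p y"
        using c by (simp add: field_simps)
    qed
    then show "sublinear_shift p y (c *\<^sub>R x) \<le> c * sublinear_shift p y x"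
      using c by (simp add: field_simps)
  qed
  show "sublinear_shift p y x \<le> p x" using le[of 0 x] by simp
  show "sublinear_shift p y (- y) \<le> - p y" using le[of 1 "- y"] by simp
  show "sublinear_shift p y x \<le> p (x + y) - p y" using le[of 1 x] by simp
qed

text \<open>Zorn's lemma downwards. Along a chain the pointwise infimum is finite because every
  sublinear \<open>q\<close> below \<open>p\<close> satisfies \<open>- p (- x) \<le> q x\<close>,
  and it is subadditive because the smaller of two members of the chain serves both
  arguments.\<close>

lemma exists_minimal_sublinear:
  assumes p: "sublinear p"
  obtains q where "sublinear q" "q \<le> p" "\<And>r. sublinear r \<Longrightarrow> r \<le> q \<Longrightarrow> r = q"
proof -
  define A where "A = {q. sublinear q \<and> q \<le> p}"
  have "\<exists>m\<in>A. \<forall>a\<in>A. a \<le> m \<longrightarrow> a = m"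
  proof (rule predicate_Zorn[of A "\<lambda>a b. b \<le> a"])
    show "partial_order_on A (relation_of (\<lambda>a b. b \<le> a) A)"
      by (intro partial_order_on_relation_ofI) auto
    fix C assume "C \<in> Chains (relation_of (\<lambda>a b. b \<le> a) A)"
    then have CA: "C \<subseteq> A" and ch: "\<And>a b. a \<in> C \<Longrightarrow> b \<in> C \<Longrightarrow> a \<le> b \<or> b \<le> a"
      by (auto simp: Chains_def relation_of_def)
    show "\<exists>u\<in>A. \<forall>a\<in>C. u \<le> a"
    proof (cases "C = {}")
      case True then show ?thesis using p by (auto simp: A_def)
    next
      case False
      define u where "u = (\<lambda>x. INF q\<in>C. q x)"
      have sl: "sublinear q" and qp: "q x \<le> p x" if "q \<in> C" for q x
        using that CA by (auto simp: A_def le_fun_def)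
      have le: "u x \<le> q x" if "q \<in> C" for q x
        unfolding u_def
      proof (rule cINF_lower[OF _ that])
        show "bdd_below ((\<lambda>q. q x) ` C)"
        proof (rule bdd_belowI2)
          fix q assume "q \<in> C"
          then show "- p (- x) \<le> q x" using sublinearD(4)[OF sl, of q x] qp[of q "- x"] by simp
        qed
      qed
      have ge: "c \<le> u x" if "\<And>q. q \<in> C \<Longrightarrow> c \<le> q x" for c x
        unfolding u_def by (rule cINF_greatest[OF False that])
      have "sublinear u"
      proof (rule sublinearI)
        fix x y
        have *: "u (x + y) \<le> q x + q' y" if "q \<in> C" "q' \<in> C" for q q'
          using ch[OF that]
        proof
          assume "q \<le> q'"
          then show ?thesis using le[OF that(1), of "x + y"] sublinearD(1)[OF sl[OF that(1)], of x y]
            by (smt (verit) le_funD)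
        next
          assume "q' \<le> q"
          then show ?thesis using le[OF that(2), of "x + y"] sublinearD(1)[OF sl[OF that(2)], of x y]
            by (smt (verit) le_funD)
        qed
        have "u (x + y) - q y \<le> u x" if "q \<in> C" for q
          by (rule ge) (use *[OF _ that] in \<open>simp add: algebra_simps\<close>)
        then have "u (x + y) - u x \<le> u y"
          by (intro ge) (simp add: algebra_simps)
        then show "u (x + y) \<le> u x + u y" by simp
      next
        obtain q where q: "q \<in> C" using False by auto
        then have "u 0 \<le> 0" using le[OF q, of 0] sublinearD(3)[OF sl[OF q]] by simp
        moreover have "0 \<le> u 0" by (rule ge) (simp add: sublinearD(3)[OF sl])
        ultimately show "u 0 = 0" by simp
      next
        fix c :: real and x assume c: "0 < c"
        have "inverse c * u (c *\<^sub>R x) \<le> u x"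
        proof (rule ge)
          fix q assume q: "q \<in> C"
          have "u (c *\<^sub>R x) \<le> c * q x" using le[OF q, of "c *\<^sub>R x"] sublinearD(2)[OF sl[OF q]] c by simp
          then show "inverse c * u (c *\<^sub>R x) \<le> q x" using c by (simp add: field_simps)
        qed
        then show "u (c *\<^sub>R x) \<le> c * u x" using c by (simp add: field_simps)
      qed
      moreover have "u \<le> p"
      proof (rule le_funI)
        fix x
        obtain q where "q \<in> C" using False by auto
        then show "u x \<le> p x" using le[of q x] qp[of q x] by simp
      qed
      ultimately show ?thesis using le by (auto simp: A_def le_fun_def)
    qed
  qed
  then show thesis using that by (auto simp: A_def intro: order_trans)
qed

text \<open>A minimal sublinear functional equals each of its shifts, which gives
  \<open>l x + l z \<le> l (x + z)\<close> and hence additivity. Taking a minimal one below the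
  shift of \<open>p\<close> along \<open>y\<close> forces equality at \<open>y\<close>.\<close>

lemma hahn_banach_sublinear:
  assumes p: "sublinear p"
  obtains l where "linear l" "\<And>x. l x \<le> p x" "l y = p y"
proof -
  note s = sublinear_shift[OF p, of y]
  obtain l where l: "sublinear l" "l \<le> sublinear_shift p y" "\<And>r. sublinear r \<Longrightarrow> r \<le> l \<Longrightarrow> r = l"
    using exists_minimal_sublinear[OF s(1)] by blast
  have add: "l (x + z) = l x + l z" for x z
  proof -
    note t = sublinear_shift[OF l(1), of z]
    have "sublinear_shift l z = l" by (rule l(3)[OF t(1)]) (use t(2) in \<open>auto simp: le_fun_def\<close>)
    then have "l x \<le> l (x + z) - l z" using t(4)[of x] by simp
    then show ?thesis using sublinearD(1)[OF l(1), of x z] by simp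
  qed
  have neg: "l (- x) = - l x" for x using add[of x "- x"] sublinearD(3)[OF l(1)] by simp
  have "linear l"
  proof (rule linearI)
    fix c x
    show "l (c *\<^sub>R x) = c *\<^sub>R l x"
    proof (cases "0 \<le> c")
      case False
      then show ?thesis using sublinearD(2)[OF l(1), of "- c" x] neg[of "c *\<^sub>R x"] by simp
    qed (simp add: sublinearD(2)[OF l(1)])
  qed (rule add)
  moreover have lp: "l x \<le> p x" for x using l(2) s(2)[of x] by (auto simp: le_fun_def intro: order_trans)
  moreover have "l y = p y"
  proof (rule antisym[OF lp])
    have "l (- y) \<le> - p y" using l(2) s(3) by (auto simp: le_fun_def intro: order_trans)
    then show "p y \<le> l y" by (simp add: neg)
  qed
  ultimately show thesis using that by blast
qed

text \<open>A bounded functional on the continuous functions of the circle, kept abstract instead of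
  being written as a measure. Arguments are functions on the whole plane; the bound, applied to a
  difference with \<open>B = 0\<close>, makes the value depend on the restriction to the circle
  only.\<close>

locale circle_functional =
  fixes L :: "(complex \<Rightarrow> complex) \<Rightarrow> complex" and C :: real
  assumes add: "\<lbrakk>continuous_on (sphere 0 1) u; continuous_on (sphere 0 1) v\<rbrakk> \<Longrightarrow> L (\<lambda>z. u z + v z) = L u + L v"
    and scale: "continuous_on (sphere 0 1) u \<Longrightarrow> L (\<lambda>z. c * u z) = c * L u"
    and bound: "\<lbrakk>continuous_on (sphere 0 1) u; \<And>z. norm z = 1 \<Longrightarrow> norm (u z) \<le> B\<rbrakk> \<Longrightarrow> norm (L u) \<le> C * B"

text \<open>Hahn-Banach for the distance from the subspace \<open>V\<close> in the maximum norm of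
  tuples. The real functional so obtained is split along the coordinates, and each component is made
  complex linear.\<close>

lemma separation_on_circle:
  fixes V :: "(nat \<Rightarrow> complex \<Rightarrow> complex) set" and n :: nat
  assumes V0: "(\<lambda>i z. 0) \<in> V"
    and Vadd: "\<And>v w. v \<in> V \<Longrightarrow> w \<in> V \<Longrightarrow> (\<lambda>i z. v i z + w i z) \<in> V"
    and Vscale: "\<And>c v. v \<in> V \<Longrightarrow> (\<lambda>i z. c * v i z) \<in> V"
    and Vcont: "\<And>v i. v \<in> V \<Longrightarrow> i < n \<Longrightarrow> continuous_on (sphere 0 1) (v i)"
    and ycont: "\<And>i. i < n \<Longrightarrow> continuous_on (sphere 0 1) (y i)"
    and far: "\<And>v. v \<in> V \<Longrightarrow> \<exists>i<n. \<exists>z. norm z = 1 \<and> 1 \<le> norm (y i z - v i z)"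
  obtains L where "\<And>i. i < n \<Longrightarrow> circle_functional (L i) 1" "\<And>v. v \<in> V \<Longrightarrow> (\<Sum>i<n. L i (v i)) = 0"
    "1 \<le> Re (\<Sum>i<n. L i (y i))"
proof -
  \<comment> \<open>A tuple becomes one bounded function on the discrete space of pairs of index and
    point, where continuity is automatic. In the resulting normed space the supremum norm is the
    maximum norm of tuples; all other pairs get the value 0.\<close>
  define \<Phi>' where "\<Phi>' = (\<lambda>(u :: nat \<Rightarrow> complex \<Rightarrow> complex) d. case of_discrete d of (i, z) \<Rightarrow> if i < n \<and> norm z = 1 then u i z else (0::complex))"
  define \<Phi> :: "(nat \<Rightarrow> complex \<Rightarrow> complex) \<Rightarrow> (nat \<times> complex) discrete \<Rightarrow>\<^sub>C complex"
    where "\<Phi> = (\<lambda>u. Bcontfun (\<Phi>' u))"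
  define ct where "ct = (\<lambda>u :: nat \<Rightarrow> complex \<Rightarrow> complex. \<forall>i<n. continuous_on (sphere 0 1) (u i))"
  have ap: "apply_bcontfun (\<Phi> u) = \<Phi>' u" if "ct u" for u
  proof -
    have "\<exists>B. \<forall>z\<in>sphere 0 1. norm (u i z) \<le> B" if "i < n" for i
    proof -
      have "compact (u i ` sphere 0 1)"
        using \<open>ct u\<close> that unfolding ct_def by (intro compact_continuous_image) auto
      then show ?thesis using compact_imp_bounded[of "u i ` sphere 0 1"] unfolding bounded_iff by auto
    qed
    then obtain B where B: "\<And>i z. i < n \<Longrightarrow> z \<in> sphere 0 1 \<Longrightarrow> norm (u i z) \<le> B i" by metis
    have B0: "0 \<le> B i" if "i < n" for i by (rule order_trans[OF norm_ge_zero B[OF that, of 1]]) simp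
    have "bounded (range (\<Phi>' u))"
      unfolding bounded_iff
    proof (intro exI ballI)
      fix x assume "x \<in> range (\<Phi>' u)"
      then obtain d where x: "x = \<Phi>' u d" by auto
      show "norm x \<le> (\<Sum>i<n. B i)"
      proof (cases "of_discrete d")
        case (Pair i z)
        show ?thesis
        proof (cases "i < n \<and> norm z = 1")
          case True
          then have "norm x \<le> B i" using B[of i z] by (simp add: x \<Phi>'_def Pair)
          also have "\<dots> \<le> (\<Sum>i<n. B i)" using True B0 by (intro member_le_sum) auto
          finally show ?thesis .
        next
          case False
          then show ?thesis using B0 by (auto simp: x \<Phi>'_def Pair intro!: sum_nonneg)
        qed
      qed
    qed
    moreover have "continuous_on UNIV (\<Phi>' u)"
      by (simp add: continuous_on_open_vimage open_discrete)
    ultimately show ?thesis unfolding \<Phi>_def by (intro Bcontfun_inverse) (simp add: bcontfun_def)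
  qed
  have ctI: "ct (\<lambda>i z. u i z + v i z)" if "ct u" "ct v" for u v
    using that unfolding ct_def by (auto intro!: continuous_intros)
  have ctI': "ct (\<lambda>i z. c * u i z)" if "ct u" for u c
    using that unfolding ct_def by (auto intro!: continuous_intros)
  have \<Phi>add: "\<Phi> (\<lambda>i z. u i z + v i z) = \<Phi> u + \<Phi> v" if "ct u" "ct v" for u v
    by (rule bcontfun_eqI) (simp add: ap that ctI plus_bcontfun.rep_eq, simp add: \<Phi>'_def split: prod.split)
  have \<Phi>scale: "\<Phi> (\<lambda>i z. of_real r * u i z) = r *\<^sub>R \<Phi> u" if "ct u" for u r
    by (rule bcontfun_eqI) (simp add: ap that ctI' scaleR_bcontfun.rep_eq, simp add: \<Phi>'_def scaleR_conv_of_real split: prod.split)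
  have \<Phi>norm: "norm (\<Phi> u) \<le> B" if "ct u" "\<And>i z. i < n \<Longrightarrow> norm z = 1 \<Longrightarrow> norm (u i z) \<le> B" "0 \<le> B" for u B
    by (rule norm_bound) (use that in \<open>auto simp: ap \<Phi>'_def split: prod.split\<close>)
  have \<Phi>norm_ge: "norm (u i z) \<le> norm (\<Phi> u)" if "ct u" "i < n" "norm z = 1" for u i z
    using norm_bounded[of "\<Phi> u" "discrete (i, z)"] that by (simp add: ap \<Phi>'_def discrete_inverse)
  have Vct: "ct v" if "v \<in> V" for v using Vcont[OF that] by (simp add: ct_def)
  have yct: "ct y" using ycont by (simp add: ct_def)
  define p where "p = (\<lambda>x. INF v\<in>V. norm (x - \<Phi> v))"
  have ple: "p x \<le> norm (x - \<Phi> v)" if "v \<in> V" for x v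
    unfolding p_def by (rule cINF_lower[OF _ that]) (auto intro!: bdd_belowI2[of _ 0])
  have pge: "c \<le> p x" if "\<And>v. v \<in> V \<Longrightarrow> c \<le> norm (x - \<Phi> v)" for c x
    unfolding p_def by (rule cINF_greatest) (use V0 that in auto)
  have \<Phi>0: "\<Phi> (\<lambda>i z. 0) = 0" using \<Phi>scale[OF Vct[OF V0], of 0] by simp
  have psub: "sublinear p"
  proof (rule sublinearI)
    fix x x'
    have *: "p (x + x') \<le> norm (x - \<Phi> v) + norm (x' - \<Phi> w)" if "v \<in> V" "w \<in> V" for v w
    proof -
      have "p (x + x') \<le> norm ((x - \<Phi> v) + (x' - \<Phi> w))"
        using ple[OF Vadd[OF that], of "x + x'"] \<Phi>add[OF Vct Vct, OF that] by (simp add: algebra_simps)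
      then show ?thesis using norm_triangle_ineq order_trans by blast
    qed
    have "p (x + x') - norm (x' - \<Phi> w) \<le> p x" if "w \<in> V" for w
      by (rule pge) (use *[OF _ that] in \<open>simp add: algebra_simps\<close>)
    then have "p (x + x') - p x \<le> p x'" by (intro pge) (simp add: algebra_simps)
    then show "p (x + x') \<le> p x + p x'" by simp
  next
    have "p 0 \<le> 0" using ple[OF V0, of 0] by (simp add: \<Phi>0)
    moreover have "0 \<le> p 0" by (rule pge) simp
    ultimately show "p 0 = 0" by simp
  next
    fix c :: real and x assume c: "0 < c"
    have "inverse c * p (c *\<^sub>R x) \<le> p x"
    proof (rule pge)
      fix v assume v: "v \<in> V"
      have "p (c *\<^sub>R x) \<le> norm (c *\<^sub>R x - c *\<^sub>R \<Phi> v)"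
        using ple[OF Vscale[OF v, of "of_real c"], of "c *\<^sub>R x"] \<Phi>scale[OF Vct[OF v]] by simp
      also have "\<dots> = c * norm (x - \<Phi> v)" using c by (simp flip: scaleR_right_diff_distrib)
      finally show "inverse c * p (c *\<^sub>R x) \<le> norm (x - \<Phi> v)" using c by (simp add: field_simps)
    qed
    then show "p (c *\<^sub>R x) \<le> c * p x" using c by (simp add: field_simps)
  qed
  obtain l where l: "linear l" "\<And>x. l x \<le> p x" "l (\<Phi> y) = p (\<Phi> y)"
    using hahn_banach_sublinear[OF psub] by blast
  have lV: "l (\<Phi> v) = 0" if v: "v \<in> V" for v
  proof -
    have "l (\<Phi> v) \<le> 0" if "v \<in> V" for v using l(2)[of "\<Phi> v"] ple[OF that, of "\<Phi> v"] by simp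
    moreover have "\<Phi> (\<lambda>i z. - 1 * v i z) = - \<Phi> v" using \<Phi>scale[OF Vct[OF v], of "-1"] by simp
    moreover have "l (- \<Phi> v) = - l (\<Phi> v)" using l(1) by (rule linear_neg)
    ultimately show ?thesis using v Vscale[OF v, of "-1"] by (metis neg_le_0_iff_le order_antisym)
  qed
  have ly: "1 \<le> l (\<Phi> y)" unfolding l(3)
  proof (rule pge)
    fix v assume v: "v \<in> V"
    from far[OF v] obtain i z where iz: "i < n" "norm z = 1" "1 \<le> norm (y i z - v i z)" by blast
    have "ct (\<lambda>i z. y i z + - 1 * v i z)" by (intro ctI ctI' yct Vct[OF v])
    from \<Phi>norm_ge[OF this iz(1,2)] iz(3)
    have "1 \<le> norm (\<Phi> (\<lambda>i z. y i z + - 1 * v i z))" by simp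
    moreover have "\<Phi> (\<lambda>i z. y i z + - 1 * v i z) = \<Phi> y - \<Phi> v"
      using \<Phi>add[OF yct ctI'[OF Vct[OF v]], of "-1"] \<Phi>scale[OF Vct[OF v], of "-1"] by simp
    ultimately show "1 \<le> norm (\<Phi> y - \<Phi> v)" by simp
  qed
  have ln: "l x \<le> norm x" for x using l(2)[of x] ple[OF V0, of x] by (simp add: \<Phi>0)
  define K where "K = (\<lambda>i u. \<Phi> (\<lambda>j z. if j = i then u z else 0))"
  \<comment> \<open>The usual complexification: \<open>l\<close> gives the real part, and the
    imaginary part is read off from \<open>l\<close> at \<i> times the argument.\<close>
  define L where "L = (\<lambda>i u. Complex (l (K i u)) (- l (K i (\<lambda>z. \<i> * u z))))"
  have ctK: "ct (\<lambda>j z. if j = i then u z else 0)" if "continuous_on (sphere 0 1) u" for i u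
    unfolding ct_def
  proof (intro allI impI)
    fix j show "continuous_on (sphere 0 1) (\<lambda>z. if j = i then u z else 0)"
      by (cases "j = i") (use that in simp_all)
  qed
  have Kadd: "K i (\<lambda>z. u z + v z) = K i u + K i v" if "continuous_on (sphere 0 1) u" "continuous_on (sphere 0 1) v" for i u v
    unfolding K_def \<Phi>add[OF ctK ctK, OF that, symmetric] by (intro arg_cong[where f=\<Phi>]) (auto simp: fun_eq_iff)
  have Kscale: "K i (\<lambda>z. of_real r * u z) = r *\<^sub>R K i u" if "continuous_on (sphere 0 1) u" for i u r
    unfolding K_def \<Phi>scale[OF ctK, OF that, symmetric] by (intro arg_cong[where f=\<Phi>]) (auto simp: fun_eq_iff)
  have Ladd: "L i (\<lambda>z. u z + v z) = L i u + L i v" if "continuous_on (sphere 0 1) u" "continuous_on (sphere 0 1) v" for i u v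
  proof -
    have "K i (\<lambda>z. \<i> * (u z + v z)) = K i (\<lambda>z. \<i> * u z) + K i (\<lambda>z. \<i> * v z)"
      unfolding distrib_left by (intro Kadd continuous_intros that)
    then show ?thesis using that by (simp add: L_def Kadd linear_add[OF l(1)] complex_eq_iff)
  qed
  have Lreal: "L i (\<lambda>z. of_real r * u z) = of_real r * L i u" if "continuous_on (sphere 0 1) u" for i u r
  proof -
    have "K i (\<lambda>z. \<i> * (of_real r * u z)) = r *\<^sub>R K i (\<lambda>z. \<i> * u z)"
      using Kscale[of "\<lambda>z. \<i> * u z" i r] that by (simp add: mult.left_commute continuous_intros)
    then show ?thesis using that by (simp add: L_def Kscale linear_scale[OF l(1)] complex_eq_iff)
  qed
  have Li: "L i (\<lambda>z. \<i> * u z) = \<i> * L i u" if "continuous_on (sphere 0 1) u" for i u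
  proof -
    have "K i (\<lambda>z. \<i> * (\<i> * u z)) = - K i u"
      using Kscale[OF that, of i "-1"] by (simp flip: mult.assoc)
    then show ?thesis by (simp add: L_def linear_neg[OF l(1)] complex_eq_iff)
  qed
  have Lscale: "L i (\<lambda>z. c * u z) = c * L i u" if u: "continuous_on (sphere 0 1) u" for i u c
  proof -
    have "(\<lambda>z. c * u z) = (\<lambda>z. of_real (Re c) * u z + of_real (Im c) * (\<i> * u z))"
      by (rule ext) (subst complex_eq[of c], simp add: algebra_simps)
    then have "L i (\<lambda>z. c * u z) = of_real (Re c) * L i u + of_real (Im c) * (\<i> * L i u)"
      using u by (simp only:) (subst Ladd; simp add: Lreal Li continuous_intros)
    also have "\<dots> = c * L i u" by (subst (3) complex_eq[of c]) (simp add: algebra_simps)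
    finally show ?thesis .
  qed
  have sumK: "(\<Sum>i<n. l (K i (u i))) = l (\<Phi> u)" if "ct u" for u
  proof -
    have "(\<Sum>i<n. l (K i (u i))) = l (\<Sum>i<n. K i (u i))" by (simp add: linear_sum[OF l(1)])
    also have "(\<Sum>i<n. K i (u i)) = \<Phi> u"
    proof (rule bcontfun_eqI)
      fix d
      have "apply_bcontfun (\<Sum>i<k. K i (u i)) d = (\<Sum>i<k. apply_bcontfun (K i (u i)) d)" for k
        by (induction k) (simp_all add: plus_bcontfun.rep_eq)
      moreover have "(\<Sum>i<n. apply_bcontfun (K i (u i)) d) = (\<Sum>i<n. \<Phi>' (\<lambda>j z. if j = i then u i z else 0) d)"
      proof (intro sum.cong refl)
        fix i assume "i \<in> {..<n}"
        then have "continuous_on (sphere 0 1) (u i)" using that by (simp add: ct_def)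
        from ap[OF ctK[OF this]]
        show "apply_bcontfun (K i (u i)) d = \<Phi>' (\<lambda>j z. if j = i then u i z else 0) d" by (simp add: K_def)
      qed
      moreover have "\<dots> = \<Phi>' u d"
      proof (cases "of_discrete d")
        case (Pair a b)
        show ?thesis
        proof (cases "a < n \<and> norm b = 1")
          case True
          then show ?thesis by (simp add: \<Phi>'_def Pair)
        next
          case False
          then have "\<Phi>' w d = 0" for w by (auto simp: \<Phi>'_def Pair)
          then show ?thesis by simp
        qed
      qed
      ultimately show "apply_bcontfun (\<Sum>i<n. K i (u i)) d = apply_bcontfun (\<Phi> u) d"
        using that by (simp add: ap)
    qed
    finally show ?thesis .
  qed
  have cf: "circle_functional (L i) 1" if "i < n" for i
  proof
    fix u :: "complex \<Rightarrow> complex" and B assume u: "continuous_on (sphere 0 1) u" and B: "\<And>z. norm z = 1 \<Longrightarrow> norm (u z) \<le> B"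
    define c where "c = cnj (sgn (L i u))"
    have cL: "c * L i u = of_real (norm (L i u))"
      by (simp add: c_def sgn_div_norm scaleR_conv_of_real complex_norm_square[symmetric] power2_eq_square field_simps)
    have nc: "norm c \<le> 1" by (simp add: c_def norm_sgn)
    have B0: "0 \<le> B" by (rule order_trans[OF norm_ge_zero B[of 1]]) simp
    have "norm (L i u) = Re (L i (\<lambda>z. c * u z))" by (simp add: Lscale u cL)
    also have "\<dots> = l (K i (\<lambda>z. c * u z))" by (simp add: L_def)
    also have "\<dots> \<le> norm (K i (\<lambda>z. c * u z))" by (rule ln)
    also have "\<dots> \<le> B" unfolding K_def
    proof (rule \<Phi>norm)
      show "norm (if j = i then c * u z else 0) \<le> B" if "norm z = 1" for j z
        using mult_mono[OF nc B[OF that]] B0 by (simp add: norm_mult)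
    qed (use B0 in \<open>auto intro!: ctK continuous_intros u\<close>)
    finally show "norm (L i u) \<le> 1 * B" by simp
  qed (use Ladd Lscale in auto)
  have "(\<Sum>i<n. L i (v i)) = 0" if v: "v \<in> V" for v
  proof -
    have "Re (\<Sum>i<n. L i (v i)) = 0" using sumK[OF Vct[OF v]] lV[OF v] by (simp add: L_def)
    moreover have "Im (\<Sum>i<n. L i (v i)) = 0"
      using sumK[OF Vct[OF Vscale[OF v]], of "\<i>"] lV[OF Vscale[OF v], of "\<i>"] by (simp add: L_def sum_negf)
    ultimately show ?thesis by (simp add: complex_eq_iff)
  qed
  moreover have "1 \<le> Re (\<Sum>i<n. L i (y i))" using sumK[OF yct] ly by (simp add: L_def)
  ultimately show thesis using that cf by blast
qed

section \<open>Duality\<close>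

lemma continuous_on_joint:
  assumes "continuous_on (S \<times> T) (\<lambda>(x, y). G x y)" "continuous_on U f" "continuous_on U g"
    "\<And>u. u \<in> U \<Longrightarrow> f u \<in> S" "\<And>u. u \<in> U \<Longrightarrow> g u \<in> T"
  shows "continuous_on U (\<lambda>u. G (f u) (g u))"
  using continuous_on_compose2[OF assms(1) continuous_on_Pair[OF assms(2,3)]] assms(4,5) by auto

context circle_functional
begin

lemma zero: "L (\<lambda>z. 0) = 0"
  using scale[of "\<lambda>z. 0" 0] by simp

lemma diff:
  assumes "continuous_on (sphere 0 1) u" "continuous_on (sphere 0 1) v"
  shows "L (\<lambda>z. u z - v z) = L u - L v"
  using add[OF assms(1), of "\<lambda>z. - 1 * v z"] scale[OF assms(2), of "-1"] assms
  by (simp add: continuous_intros)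

lemma cong:
  assumes "continuous_on (sphere 0 1) u" "continuous_on (sphere 0 1) v" "\<And>z. norm z = 1 \<Longrightarrow> u z = v z"
  shows "L u = L v"
  using bound[of "\<lambda>z. u z - v z" 0] diff[OF assms(1,2)] assms by (simp add: continuous_intros)

lemma sum:
  assumes "\<And>i. i \<in> I \<Longrightarrow> continuous_on (sphere 0 1) (u i)"
  shows "L (\<lambda>z. \<Sum>i\<in>I. u i z) = (\<Sum>i\<in>I. L (u i))"
  using assms
proof (induction I rule: infinite_finite_induct)
  case (insert x F)
  then show ?case by (simp add: add continuous_on_sum)
qed (simp_all add: zero)

lemma nonneg_const: "0 \<le> C"
  using order_trans[OF norm_ge_zero bound[of "\<lambda>z. 1" 1]] by simp

text \<open>Joint continuity on a compact product is uniform, so nearby parameters give uniformly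
  close functions on the circle and \<open>bound\<close> applies to their difference.\<close>

lemma continuous_param:
  fixes G :: "'x::metric_space \<Rightarrow> complex \<Rightarrow> complex"
  assumes S: "compact S" and G: "continuous_on (S \<times> sphere 0 1) (\<lambda>(t, z). G t z)"
  shows "continuous_on S (\<lambda>t. L (G t))"
    and "e > 0 \<Longrightarrow> \<exists>d>0. \<forall>t\<in>S. \<forall>t'\<in>S. dist t t' < d \<longrightarrow> (\<forall>z\<in>sphere 0 1. norm (G t z - G t' z) < e)"
proof -
  have c: "continuous_on (sphere 0 1) (G t)" if "t \<in> S" for t
    by (rule continuous_on_joint[OF G]) (use that in \<open>auto intro!: continuous_intros\<close>)
  have uc: "\<exists>d>0. \<forall>t\<in>S. \<forall>t'\<in>S. dist t t' < d \<longrightarrow> (\<forall>z\<in>sphere 0 1. norm (G t z - G t' z) < e)" if e: "e > 0" for e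
  proof -
    have "uniformly_continuous_on (S \<times> sphere 0 1) (\<lambda>(t, z). G t z)"
      by (rule compact_uniformly_continuous[OF G]) (intro compact_Times S compact_sphere)
    then obtain d where d: "d > 0" "\<And>x x'. x \<in> S \<times> sphere 0 1 \<Longrightarrow> x' \<in> S \<times> sphere 0 1 \<Longrightarrow> dist x' x < d \<Longrightarrow> dist ((\<lambda>(t, z). G t z) x') ((\<lambda>(t, z). G t z) x) < e"
      using e unfolding uniformly_continuous_on_def by metis
    show ?thesis
      using d(2)[of "(t', z)" "(t, z)" for t t' z] d(1) by (intro exI[of _ d]) (auto simp: dist_Pair_Pair dist_norm)
  qed
  then show "e > 0 \<Longrightarrow> \<exists>d>0. \<forall>t\<in>S. \<forall>t'\<in>S. dist t t' < d \<longrightarrow> (\<forall>z\<in>sphere 0 1. norm (G t z - G t' z) < e)" .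
  show "continuous_on S (\<lambda>t. L (G t))"
    unfolding continuous_on_iff
  proof (intro ballI allI impI)
    fix t and e :: real assume t: "t \<in> S" and e: "0 < e"
    have C1: "0 < C + 1" using nonneg_const by simp
    obtain d where d: "d > 0" "\<forall>t\<in>S. \<forall>t'\<in>S. dist t t' < d \<longrightarrow> (\<forall>z\<in>sphere 0 1. norm (G t z - G t' z) < e / (C + 1))"
      using uc[of "e / (C + 1)"] e C1 by auto
    show "\<exists>d>0. \<forall>x'\<in>S. dist x' t < d \<longrightarrow> dist (L (G x')) (L (G t)) < e"
    proof (intro exI conjI ballI impI)
      fix t' assume t': "t' \<in> S" "dist t' t < d"
      have "norm (L (\<lambda>z. G t' z - G t z)) \<le> C * (e / (C + 1))"
        using d(2) t t' by (intro bound continuous_intros c) (auto intro!: less_imp_le)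
      also have "\<dots> < e" using C1 e nonneg_const by (simp add: field_simps)
      finally show "dist (L (G t')) (L (G t)) < e" using diff[OF c c, OF t'(1) t] by (simp add: dist_norm)
    qed (rule d(1))
  qed
qed

text \<open>Fubini for a functional that is not given as an integral: as functions of the upper
  limit both sides vanish at \<open>a\<close> and have derivative \<open>L (G x)\<close>, by uniform
  continuity of \<open>G\<close> and the bound on \<open>L\<close>.\<close>

lemma integral_swap:
  fixes G :: "real \<Rightarrow> complex \<Rightarrow> complex"
  assumes ab: "a \<le> b" and G: "continuous_on ({a..b} \<times> sphere 0 1) (\<lambda>(t, z). G t z)"
  shows "L (\<lambda>z. integral {a..b} (\<lambda>t. G t z)) = integral {a..b} (\<lambda>t. L (G t))"
    and "continuous_on (sphere 0 1) (\<lambda>z. integral {a..b} (\<lambda>t. G t z))"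
proof -
  have c: "continuous_on (sphere 0 1) (G t)" if "t \<in> {a..b}" for t
    by (rule continuous_on_joint[OF G]) (use that in \<open>auto intro!: continuous_intros\<close>)
  have ct: "continuous_on {a..b} (\<lambda>t. G t z)" if "z \<in> sphere 0 1" for z
    by (rule continuous_on_joint[OF G]) (use that in \<open>auto intro!: continuous_intros\<close>)
  have int: "(\<lambda>t. G t z) integrable_on {x..y}" if "z \<in> sphere 0 1" "a \<le> x" "y \<le> b" for x y z
    by (rule integrable_continuous_interval[OF continuous_on_subset[OF ct[OF that(1)]]]) (use that in auto)
  have cI: "continuous_on (sphere 0 1) (\<lambda>z. integral {a..x} (\<lambda>t. G t z))" if "x \<le> b" for x
  proof -
    have "continuous_on (sphere 0 1 \<times> cbox a x) (\<lambda>(z, t). G t z)"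
      unfolding split_beta
      by (rule continuous_on_joint[OF G]) (use that in \<open>auto intro!: continuous_intros\<close>)
    from integral_continuous_on_param[OF this] show ?thesis by simp
  qed
  then show "continuous_on (sphere 0 1) (\<lambda>z. integral {a..b} (\<lambda>t. G t z))" by simp
  define A where "A = (\<lambda>x. L (\<lambda>z. integral {a..x} (\<lambda>t. G t z)))"
  have C1: "0 < C + 1" using nonneg_const by simp
  have "(A has_vector_derivative L (G x)) (at x within {a..b})" if x: "x \<in> {a..b}" for x
    unfolding has_vector_derivative_def has_derivative_within_alt
  proof (intro conjI allI impI)
    show "bounded_linear (\<lambda>h. h *\<^sub>R L (G x))" by (rule bounded_linear_scaleR_left)
    fix e :: real assume e: "0 < e"
    obtain d where d: "d > 0" "\<forall>t\<in>{a..b}. \<forall>t'\<in>{a..b}. dist t t' < d \<longrightarrow> (\<forall>z\<in>sphere 0 1. norm (G t z - G t' z) < e / (C + 1))"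
      using continuous_param(2)[OF compact_Icc G, of "e / (C + 1)"] e C1 by auto
    show "\<exists>d>0. \<forall>y\<in>{a..b}. norm (y - x) < d \<longrightarrow> norm (A y - A x - (y - x) *\<^sub>R L (G x)) \<le> e * norm (y - x)"
    proof (intro exI conjI ballI impI)
      fix y assume y: "y \<in> {a..b}" "norm (y - x) < d"
      have est: "norm (integral {a..y} (\<lambda>t. G t z) - integral {a..x} (\<lambda>t. G t z) - of_real (y - x) * G x z) \<le> e / (C + 1) * \<bar>y - x\<bar>"
        if z: "z \<in> sphere 0 1" for z
      proof -
        have B: "norm (integral {p..q} (\<lambda>t. G t z - G x z)) \<le> e / (C + 1) * (q - p)"
          if "p \<le> q" "{p..q} \<subseteq> {a..b}" "\<And>t. t \<in> {p..q} \<Longrightarrow> dist t x < d" for p q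
          using that d(2) x z by (intro integral_bound continuous_intros continuous_on_subset[OF ct[OF z]]) (auto intro!: less_imp_le)
        have S: "integral {p..q} (\<lambda>t. G t z - G x z) = integral {p..q} (\<lambda>t. G t z) - of_real (q - p) * G x z"
          if "p \<le> q" "a \<le> p" "q \<le> b" for p q
          using that int[OF z] by (subst integral_diff) (auto simp: scaleR_conv_of_real)
        show ?thesis
        proof (cases "x \<le> y")
          case True
          have "integral {a..x} (\<lambda>t. G t z) + integral {x..y} (\<lambda>t. G t z) = integral {a..y} (\<lambda>t. G t z)"
            using x y True by (intro Henstock_Kurzweil_Integration.integral_combine int z) auto
          then have "integral {a..y} (\<lambda>t. G t z) - integral {a..x} (\<lambda>t. G t z) - of_real (y - x) * G x z = integral {x..y} (\<lambda>t. G t z - G x z)"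
          proof -
            have "integral {x..y} (\<lambda>t. G t z - G x z) = integral {x..y} (\<lambda>t. G t z) - of_real (y - x) * G x z"
              using True x y by (intro S) auto
            moreover have "Iy - Ix - g = K" if "Ix + J = Iy" "K = J - g" for Ix Iy J K g :: complex
              using that by auto
            ultimately show ?thesis using \<open>_ + _ = integral {a..y} _\<close> by blast
          qed
          then show ?thesis using B[of x y] True x y by (auto simp: dist_real_def)
        next
          case False
          have "integral {a..y} (\<lambda>t. G t z) + integral {y..x} (\<lambda>t. G t z) = integral {a..x} (\<lambda>t. G t z)"
            using x y False by (intro Henstock_Kurzweil_Integration.integral_combine int z) auto
          moreover have "integral {y..x} (\<lambda>t. G t z - G x z) = integral {y..x} (\<lambda>t. G t z) - of_real (x - y) * G x z"
            using False x y by (intro S) auto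
          ultimately have "integral {a..y} (\<lambda>t. G t z) - integral {a..x} (\<lambda>t. G t z) - of_real (y - x) * G x z = - integral {y..x} (\<lambda>t. G t z - G x z)"
          proof -
            have "Iy - Ix - of_real (y - x) * g = - K" if "Iy + J = Ix" "K = J - of_real (x - y) * g" for Ix Iy J K g :: complex
              using that by (auto simp: algebra_simps)
            then show "integral {a..y} (\<lambda>t. G t z) + integral {y..x} (\<lambda>t. G t z) = integral {a..x} (\<lambda>t. G t z) \<Longrightarrow>
              integral {y..x} (\<lambda>t. G t z - G x z) = integral {y..x} (\<lambda>t. G t z) - of_real (x - y) * G x z \<Longrightarrow> ?thesis"
              by blast
          qed
          then have "norm (integral {a..y} (\<lambda>t. G t z) - integral {a..x} (\<lambda>t. G t z) - of_real (y - x) * G x z) = norm (integral {y..x} (\<lambda>t. G t z - G x z))"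
            by (simp only: norm_minus_cancel)
          then show ?thesis using B[of y x] False x y by (auto simp: dist_real_def)
        qed
      qed
      have "A y - A x - (y - x) *\<^sub>R L (G x) =
        L (\<lambda>z. integral {a..y} (\<lambda>t. G t z) - integral {a..x} (\<lambda>t. G t z) - of_real (y - x) * G x z)"
        using x y by (subst diff scale | auto intro!: continuous_intros cI c simp: A_def scaleR_conv_of_real)+
      also have "norm \<dots> \<le> C * (e / (C + 1) * \<bar>y - x\<bar>)"
        by (rule bound) (use est x y in \<open>auto intro!: continuous_intros cI c\<close>)
      also have "\<dots> = (C / (C + 1)) * (e * \<bar>y - x\<bar>)" by simp
      also have "\<dots> \<le> 1 * (e * \<bar>y - x\<bar>)" using C1 e by (intro mult_right_mono) auto
      finally show "norm (A y - A x - (y - x) *\<^sub>R L (G x)) \<le> e * norm (y - x)" by simp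
    qed (rule d(1))
  qed
  then have "((\<lambda>t. L (G t)) has_integral A b - A a) {a..b}"
    by (intro fundamental_theorem_of_calculus ab)
  moreover have "A a = 0" by (simp add: A_def zero)
  ultimately show "L (\<lambda>z. integral {a..b} (\<lambda>t. G t z)) = integral {a..b} (\<lambda>t. L (G t))"
    by (simp add: A_def integral_unique)
qed

lemma circle_mean_swap:
  assumes s: "0 \<le> s" and G: "continuous_on (sphere 0 s \<times> sphere 0 1) (\<lambda>(w, z). G w z)"
  shows "circle_mean s (\<lambda>w. L (G w)) = L (\<lambda>z. circle_mean s (\<lambda>w. G w z))"
proof -
  have G': "continuous_on ({0..2*pi} \<times> sphere 0 1) (\<lambda>(t, z). G (of_real s * cis t) z)"
    unfolding split_beta
    by (rule continuous_on_joint[OF G]) (use s in \<open>auto intro!: continuous_intros simp: norm_mult\<close>)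
  show ?thesis
    using integral_swap[OF _ G'] scale[OF integral_swap(2)[OF _ G'], of "of_real (inverse (2*pi))"]
    by (simp add: circle_mean_def scaleR_conv_of_real)
qed

text \<open>Multiply \<open>L (G w)\<close> by a continuous function \<open>c\<close> of modulus at
  most 1 that nearly turns it into its modulus. The factor moves inside \<open>L\<close> and the
  mean is interchanged with \<open>L\<close>, after which only the mean of
  \<open>norm (G w z)\<close> for fixed \<open>z\<close> matters.\<close>

lemma circle_mean_norm_swap:
  assumes s: "0 \<le> s" and G: "continuous_on (sphere 0 s \<times> sphere 0 1) (\<lambda>(w, z). G w z)"
    and B: "\<And>z. norm z = 1 \<Longrightarrow> circle_mean s (\<lambda>w. norm (G w z)) \<le> B"
  shows "circle_mean s (\<lambda>w. norm (L (G w))) \<le> C * B"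
proof (rule field_le_epsilon)
  fix e :: real assume e: "0 < e"
  have cL: "continuous_on (sphere 0 s) (\<lambda>w. L (G w))" by (rule continuous_param(1)[OF compact_sphere G])
  \<comment> \<open>A zero-free version of the modulus, so that the phase \<open>c\<close> stays
    continuous where \<open>L (G w)\<close> vanishes; the cost is at most \<open>e\<close>.\<close>
  define q where "q = (\<lambda>w. sqrt ((norm (L (G w)))\<^sup>2 + e\<^sup>2))"
  have q: "0 < q w" "norm (L (G w)) \<le> q w" "q w \<le> norm (L (G w)) + e" "(q w)\<^sup>2 = (norm (L (G w)))\<^sup>2 + e\<^sup>2" for w
  proof -
    show "0 < q w" using e by (simp add: q_def add_nonneg_pos)
    show "norm (L (G w)) \<le> q w" unfolding q_def by (intro real_le_rsqrt) auto
    show "q w \<le> norm (L (G w)) + e" unfolding q_def using e by (intro real_le_lsqrt) (auto simp: power2_sum)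
    show "(q w)\<^sup>2 = (norm (L (G w)))\<^sup>2 + e\<^sup>2" by (simp add: q_def)
  qed
  define c where "c = (\<lambda>w. cnj (L (G w)) / of_real (q w))"
  have cq: "continuous_on (sphere 0 s) q" unfolding q_def by (intro continuous_intros cL)
  have q0: "q w \<noteq> 0" for w using q(1)[of w] by simp
  have cc: "continuous_on (sphere 0 s) c" unfolding c_def by (intro continuous_intros cL cq) (use q0 in auto)
  have nc: "norm (c w) \<le> 1" for w using q(1,2)[of w] by (simp add: c_def norm_divide)
  have cG: "continuous_on (sphere 0 1) (G w)" if "w \<in> sphere 0 s" for w
    by (rule continuous_on_joint[OF G]) (use that in \<open>auto intro!: continuous_intros\<close>)
  have cG': "continuous_on (sphere 0 s) (\<lambda>w. G w z)" if "z \<in> sphere 0 1" for z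
    by (rule continuous_on_joint[OF G]) (use that in \<open>auto intro!: continuous_intros\<close>)
  have ccG: "continuous_on (sphere 0 s \<times> sphere 0 1) (\<lambda>(w, z). c w * G w z)"
    using G unfolding split_beta by (intro continuous_intros continuous_on_compose2[OF cc]) auto
  have "circle_mean s (\<lambda>w. norm (L (G w))) \<le> circle_mean s (\<lambda>w. Re (c w * L (G w)) + e)"
  proof (rule circle_mean_mono[OF s])
    fix w
    have "c w * L (G w) = of_real ((norm (L (G w)))\<^sup>2 / q w)"
      unfolding c_def of_real_divide complex_norm_square by simp
    moreover have "norm (L (G w)) - e \<le> (norm (L (G w)))\<^sup>2 / q w"
    proof -
      have "(norm (L (G w)))\<^sup>2 = (q w - e) * (q w + e)" using q(4)[of w] by (simp add: power2_eq_square algebra_simps)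
      also have "\<dots> \<ge> (norm (L (G w)) - e) * q w"
      proof (cases "norm (L (G w)) \<le> e")
        case True
        then have "(norm (L (G w)) - e) * q w \<le> 0" using q(1)[of w] by (intro mult_nonpos_nonneg) auto
        also have "0 \<le> (q w - e) * (q w + e)"
          using q(4)[of w] by (simp add: power2_eq_square algebra_simps)
        finally show ?thesis .
      next
        case False
        then show ?thesis using q(1,2)[of w] e by (intro mult_mono) auto
      qed
      finally show ?thesis using q(1)[of w] by (simp add: pos_le_divide_eq)
    qed
    ultimately show "norm (L (G w)) \<le> Re (c w * L (G w)) + e" by simp
  qed (intro continuous_intros cL cc)+
  also have "\<dots> = circle_mean s (\<lambda>w. Re (c w * L (G w))) + circle_mean s (\<lambda>w. e)"
    by (rule circle_mean_add) (use s in \<open>auto intro!: continuous_intros cL cc\<close>)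
  also have "\<dots> = Re (circle_mean s (\<lambda>w. c w * L (G w))) + e"
    using circle_mean_Re[OF s, of "\<lambda>w. c w * L (G w)"] cL cc by (simp only: circle_mean_const continuous_on_mult)
  also have "circle_mean s (\<lambda>w. c w * L (G w)) = circle_mean s (\<lambda>w. L (\<lambda>z. c w * G w z))"
    by (rule circle_mean_cong[OF s]) (simp add: scale cG)
  also have "\<dots> = L (\<lambda>z. circle_mean s (\<lambda>w. c w * G w z))"
    by (rule circle_mean_swap[OF s ccG])
  also have "Re \<dots> \<le> norm \<dots>" by (rule complex_Re_le_cmod)
  also have "\<dots> \<le> C * B"
  proof (rule bound)
    have G': "continuous_on ({0..2*pi} \<times> sphere 0 1) (\<lambda>(t, z). c (of_real s * cis t) * G (of_real s * cis t) z)"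
      unfolding split_beta
      by (rule continuous_on_joint[OF ccG]) (use s in \<open>auto intro!: continuous_intros simp: norm_mult\<close>)
    show "continuous_on (sphere 0 1) (\<lambda>z. circle_mean s (\<lambda>w. c w * G w z))"
      unfolding circle_mean_def by (intro continuous_intros integral_swap(2)[OF _ G']) simp
    fix z :: complex assume z: "norm z = 1"
    have "norm (circle_mean s (\<lambda>w. c w * G w z)) \<le> circle_mean s (\<lambda>w. norm (G w z))"
      by (rule circle_mean_norm_le[OF s])
         (use z nc in \<open>auto intro!: continuous_intros cG' cc simp: norm_mult mult_left_le_one_le\<close>)
    then show "norm (circle_mean s (\<lambda>w. c w * G w z)) \<le> B" using B[OF z] by simp
  qed
  finally show "circle_mean s (\<lambda>w. norm (L (G w))) \<le> C * B + e" by simp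
qed

text \<open>This plays the role of the theorem of F. and M. Riesz. The Poisson kernel is a series in
  \<open>cnj w * z\<close> and \<open>w * cnj z\<close>, and annihilating all powers of
  \<open>z\<close> removes the terms with \<open>cnj w\<close>, so a power series in
  \<open>w\<close> remains.\<close>

lemma holomorphic_if_annihilates_powers:
  assumes ann: "\<And>n. L (\<lambda>z. z ^ n) = 0"
  shows "(\<lambda>w. L (\<lambda>z. of_real (poisson w z))) holomorphic_on ball 0 1"
    and "L (\<lambda>z. of_real (poisson 0 z)) = 0"
proof -
  \<comment> \<open>The term of index 0 is absent because the constant \<open>z ^ 0\<close> is
    annihilated too.\<close>
  define a where "a = (\<lambda>n. if n = 0 then 0 else L (\<lambda>z. cnj z ^ n))"
  have sums: "(\<lambda>n. a n * (w - 0) ^ n) sums L (\<lambda>z. of_real (poisson w z))" if w: "w \<in> ball 0 1" for w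
  proof -
    have w1: "norm w < 1" using w by simp
    define S where "S = (\<lambda>N z. (\<Sum>n<N. (cnj w * z) ^ n) + w * cnj z * (\<Sum>n<N. (w * cnj z) ^ n))"
    have cS: "continuous_on (sphere 0 1) (S N)" for N unfolding S_def by (intro continuous_intros)
    have cP: "continuous_on (sphere 0 1) (\<lambda>z. complex_of_real (poisson w z))"
      by (intro continuous_intros continuous_on_poisson) (use w1 in auto)
    have LS: "L (S N) = (\<Sum>n<Suc N. a n * w ^ n)" for N
    proof -
      have "L (S N) = L (\<lambda>z. \<Sum>n<N. cnj w ^ n * z ^ n) + L (\<lambda>z. \<Sum>n<N. w ^ Suc n * cnj z ^ Suc n)"
        unfolding S_def power_mult_distrib
        by (subst add) (auto intro!: continuous_intros simp: sum_distrib_left mult_ac)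
      also have "L (\<lambda>z. \<Sum>n<N. cnj w ^ n * z ^ n) = (\<Sum>n<N. cnj w ^ n * L (\<lambda>z. z ^ n))"
        by (subst sum) (auto intro!: continuous_intros sum.cong scale)
      also have "\<dots> = 0" by (simp add: ann)
      also have "L (\<lambda>z. \<Sum>n<N. w ^ Suc n * cnj z ^ Suc n) = (\<Sum>n<N. w ^ Suc n * L (\<lambda>z. cnj z ^ Suc n))"
        by (subst sum) (auto intro!: continuous_intros sum.cong scale simp del: power_Suc)
      also have "\<dots> = (\<Sum>n<N. a (Suc n) * w ^ Suc n)" by (simp add: a_def mult.commute)
      finally show ?thesis by (subst sum.lessThan_Suc_shift) (simp add: a_def)
    qed
    have err: "norm (S N z - of_real (poisson w z)) \<le> 2 * norm w ^ N / (1 - norm w)" if z: "norm z = 1" for N z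
    proof -
      have g: "norm ((\<Sum>n<N. q ^ n) - 1 / (1 - q)) \<le> norm w ^ N / (1 - norm w)" if q: "norm q = norm w" for q :: complex
      proof -
        have q1: "q \<noteq> 1" using q w1 by auto
        have "(\<Sum>n<N. q ^ n) - 1 / (1 - q) = - (q ^ N / (1 - q))"
          using q1 by (simp add: sum_gp_strict diff_divide_distrib)
        also have "norm \<dots> = norm w ^ N / norm (1 - q)" by (simp add: norm_divide norm_power q)
        also have "\<dots> \<le> norm w ^ N / (1 - norm w)"
          using w1 q norm_triangle_ineq2[of 1 q] q1 by (intro divide_left_mono mult_pos_pos) auto
        finally show ?thesis .
      qed
      have "S N z - of_real (poisson w z) = ((\<Sum>n<N. (cnj w * z) ^ n) - 1 / (1 - cnj w * z)) +
         w * cnj z * ((\<Sum>n<N. (w * cnj z) ^ n) - 1 / (1 - w * cnj z))"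
        unfolding S_def poisson_decomp[OF z w1] by (simp add: algebra_simps)
      also have "norm \<dots> \<le> norm w ^ N / (1 - norm w) + 1 * (norm w ^ N / (1 - norm w))"
        by (rule order_trans[OF norm_triangle_ineq add_mono[OF g]], simp add: norm_mult z,
            unfold norm_mult[of "_ * _" "_ - _"], rule mult_mono[OF _ g])
           (use w1 z in \<open>auto simp: norm_mult\<close>)
      finally show ?thesis by simp
    qed
    have "(\<lambda>N. \<Sum>n<Suc N. a n * w ^ n) \<longlonglongrightarrow> L (\<lambda>z. of_real (poisson w z))"
    proof (rule LIM_zero_cancel, rule Lim_null_comparison)
      show "\<forall>\<^sub>F N in sequentially. norm ((\<Sum>n<Suc N. a n * w ^ n) - L (\<lambda>z. of_real (poisson w z))) \<le> C * (2 * norm w ^ N / (1 - norm w))"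
      proof (rule always_eventually, rule allI)
        fix N show "norm ((\<Sum>n<Suc N. a n * w ^ n) - L (\<lambda>z. of_real (poisson w z))) \<le> C * (2 * norm w ^ N / (1 - norm w))"
          unfolding LS[symmetric] diff[OF cS cP, symmetric] by (rule bound) (auto intro!: continuous_intros cS cP err)
      qed
      have "(\<lambda>N. norm w ^ N) \<longlonglongrightarrow> 0" using w1 by (intro LIMSEQ_realpow_zero) auto
      then show "(\<lambda>N. C * (2 * norm w ^ N / (1 - norm w))) \<longlonglongrightarrow> 0"
        by (intro tendsto_mult_right_zero tendsto_divide_zero)
    qed
    then show ?thesis unfolding sums_def diff_zero by (rule LIMSEQ_imp_Suc)
  qed
  show "(\<lambda>w. L (\<lambda>z. of_real (poisson w z))) holomorphic_on ball 0 1"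
    by (rule power_series_holomorphic[OF sums])
  have "L (\<lambda>z. of_real (poisson 0 z)) = L (\<lambda>z. z ^ 0)"
    by (rule cong) (auto intro!: continuous_intros continuous_on_poisson simp: poisson_def)
  then show "L (\<lambda>z. of_real (poisson 0 z)) = 0" using ann[of 0] by simp
qed

end

lemma circle_mean_rescale: "circle_mean s f = circle_mean 1 (\<lambda>w. f (of_real s * w))"
  by (simp add: circle_mean_def)

lemma poisson_mean_swapped:
  assumes "norm z = 1" "0 \<le> s" "s < 1"
  shows "circle_mean s (\<lambda>w. poisson w z) = 1"
proof -
  have "circle_mean s (\<lambda>w. poisson w z) = circle_mean 1 (poisson (of_real s * z))"
    unfolding circle_mean_rescale[of s]
    by (rule circle_mean_cong) (use assms in \<open>auto intro: poisson_swap\<close>)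
  also have "\<dots> = 1" by (rule poisson_mean) (use assms in \<open>simp add: norm_mult\<close>)
  finally show ?thesis .
qed

text \<open>After the angles are exchanged this is the Poisson formula for the polynomial
  \<open>(s * u) ^ N\<close> in \<open>u\<close> at the point \<open>s * z\<close>; polynomial and
  point supply one factor \<open>s ^ N\<close> each.\<close>

lemma poisson_mean_power:
  assumes z: "norm z = 1" and s: "0 \<le> s" "s < 1"
  shows "circle_mean s (\<lambda>w. w ^ N * of_real (poisson w z)) = of_real (s ^ (2 * N)) * z ^ N"
proof -
  have "circle_mean s (\<lambda>w. w ^ N * of_real (poisson w z)) =
     circle_mean 1 (\<lambda>u. of_real (poisson (of_real s * z) u) * (of_real s * u) ^ N)"
    unfolding circle_mean_rescale[of s]
  proof (rule circle_mean_cong)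
    fix u :: complex assume "norm u = 1"
    from poisson_swap[OF z this, of s]
    show "(of_real s * u) ^ N * of_real (poisson (of_real s * u) z) = of_real (poisson (of_real s * z) u) * (of_real s * u) ^ N"
      by simp
  qed simp
  also have "\<dots> = (of_real s * (of_real s * z)) ^ N"
    by (rule poisson_formula[where R=2]) (use z s in \<open>auto intro!: holomorphic_intros simp: norm_mult\<close>)
  finally show ?thesis by (simp add: power_mult_distrib power_mult power2_eq_square mult_ac)
qed

text \<open>Estimates the commutator of multiplication by \<open>f\<close> with Poisson extension.
  Near \<open>z\<close> the values of \<open>f\<close> are close by uniform continuity, and away
  from \<open>z\<close> the kernel is of order \<open>1 - s^2\<close>; both hold uniformly in
  \<open>z\<close>.\<close>

lemma poisson_mean_oscillation:
  fixes f :: "complex \<Rightarrow> complex"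
  assumes f: "continuous_on (cball 0 1) f" "\<And>z. norm z \<le> 1 \<Longrightarrow> norm (f z) \<le> 1" and e: "0 < e"
  obtains s0 where "s0 < 1" "0 \<le> s0"
    "\<And>s z. s0 < s \<Longrightarrow> s < 1 \<Longrightarrow> norm z = 1 \<Longrightarrow> circle_mean s (\<lambda>w. norm ((f w - f z) * of_real (poisson w z))) \<le> e"
proof -
  have "uniformly_continuous_on (cball 0 1) f"
    by (rule compact_uniformly_continuous[OF f(1)]) auto
  then obtain d where d: "0 < d" "\<And>x y. x \<in> cball 0 1 \<Longrightarrow> y \<in> cball 0 1 \<Longrightarrow> dist y x < d \<Longrightarrow> dist (f y) (f x) < e / 2"
    using e unfolding uniformly_continuous_on_def by (metis half_gt_zero)
  have "((\<lambda>s::real. 2 * ((1 - s\<^sup>2) / d\<^sup>2)) \<longlongrightarrow> 2 * ((1 - 1\<^sup>2) / d\<^sup>2)) (at_left 1)"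
    by (intro tendsto_intros) (use d in auto)
  then have "\<forall>\<^sub>F s::real in at_left 1. 2 * ((1 - s\<^sup>2) / d\<^sup>2) < e / 2"
    by (rule order_tendstoD) (use e in simp)
  then obtain s1 where s1: "s1 < 1" "\<And>s. s1 < s \<Longrightarrow> s < 1 \<Longrightarrow> 2 * ((1 - s\<^sup>2) / d\<^sup>2) < e / 2"
    unfolding eventually_at_left_field by blast
  show thesis
  proof (rule that[of "max 0 s1"])
    fix s :: real and z :: complex assume s: "max 0 s1 < s" "s < 1" and z: "norm z = 1"
    have cp: "continuous_on (sphere 0 s) (\<lambda>w. poisson w z)"
      by (intro continuous_on_poisson continuous_intros) (use s z in auto)
    have cf: "continuous_on (sphere 0 s) f" by (rule continuous_on_subset[OF f(1)]) (use s in auto)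
    have "circle_mean s (\<lambda>w. norm ((f w - f z) * of_real (poisson w z))) \<le> circle_mean s (\<lambda>w. e / 2 * poisson w z + e / 2)"
    proof (rule circle_mean_mono)
      fix w :: complex assume w: "norm w = s"
      have p0: "0 \<le> poisson w z" by (rule poisson_nonneg) (use w s in simp)
      have "norm (f w - f z) * poisson w z \<le> e / 2 * poisson w z + e / 2"
      proof (cases "norm (z - w) < d")
        case True
        then have "norm (f w - f z) \<le> e / 2"
          using d(2)[of z w] w z s by (auto simp: dist_norm norm_minus_commute intro!: less_imp_le)
        then have "norm (f w - f z) * poisson w z \<le> e / 2 * poisson w z" using p0 by (rule mult_right_mono)
        then show ?thesis using e by simp
      next
        case False
        have "norm (f w - f z) \<le> 2"
          using norm_triangle_ineq4[of "f w" "f z"] f(2)[of w] f(2)[of z] w z s by simp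
        moreover have "poisson w z \<le> (1 - s\<^sup>2) / d\<^sup>2"
          using poisson_le_far[of w d z] False d w s by simp
        ultimately have "norm (f w - f z) * poisson w z \<le> 2 * ((1 - s\<^sup>2) / d\<^sup>2)"
          using p0 by (intro mult_mono) auto
        also have "\<dots> \<le> e / 2" using s1(2)[of s] s by simp
        finally show ?thesis using p0 e by (simp add: add_increasing)
      qed
      then show "norm ((f w - f z) * of_real (poisson w z)) \<le> e / 2 * poisson w z + e / 2"
        using p0 by (simp add: norm_mult)
    qed (use s in \<open>auto intro!: continuous_intros cp cf\<close>)
    also have "\<dots> = circle_mean s (\<lambda>w. e / 2 * poisson w z) + circle_mean s (\<lambda>w. e / 2)"
      by (rule circle_mean_add) (use s in \<open>auto intro!: continuous_intros cp\<close>)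
    also have "\<dots> = e / 2 * circle_mean s (\<lambda>w. poisson w z) + e / 2"
      by (simp only: circle_mean_cmult circle_mean_const)
    also have "\<dots> = e" using s z by (simp add: poisson_mean_swapped)
    finally show "circle_mean s (\<lambda>w. norm ((f w - f z) * of_real (poisson w z))) \<le> e" .
  qed (use s1 in auto)
qed

section \<open>The corona theorem with a power on the right-hand side\<close>

lemma circle_functional_cmult:
  assumes "circle_functional L C"
  shows "circle_functional (\<lambda>u. c * L u) (norm c * C)"
proof -
  interpret circle_functional L C by fact
  show ?thesis
    by unfold_locales (auto simp: add scale distrib_left norm_mult mult.assoc intro!: mult_left_mono bound)
qed

lemma circle_functional_diff:
  assumes "circle_functional L C" "circle_functional M D"
  shows "circle_functional (\<lambda>u. L u - M u) (C + D)"
proof -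
  interpret L: circle_functional L C by fact
  interpret M: circle_functional M D by fact
  show ?thesis
  proof unfold_locales
    fix u :: "complex \<Rightarrow> complex" and B assume "continuous_on (sphere 0 1) u" "\<And>z. norm z = 1 \<Longrightarrow> norm (u z) \<le> B"
    then have "norm (L u) \<le> C * B" "norm (M u) \<le> D * B" by (auto intro: L.bound M.bound)
    then show "norm (L u - M u) \<le> (C + D) * B"
      using norm_triangle_ineq4[of "L u" "M u"] by (simp add: distrib_right)
  qed (auto simp: L.add M.add L.scale M.scale algebra_simps)
qed

lemma circle_functional_mult:
  assumes "circle_functional L C" "continuous_on (sphere 0 1) f" "\<And>z. norm z = 1 \<Longrightarrow> norm (f z) \<le> 1"
  shows "circle_functional (\<lambda>u. L (\<lambda>z. f z * u z)) C"
proof -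
  interpret circle_functional L C by fact
  show ?thesis
  proof unfold_locales
    fix u v :: "complex \<Rightarrow> complex" assume "continuous_on (sphere 0 1) u" "continuous_on (sphere 0 1) v"
    then show "L (\<lambda>z. f z * (u z + v z)) = L (\<lambda>z. f z * u z) + L (\<lambda>z. f z * v z)"
      unfolding distrib_left by (intro add continuous_intros assms(2))
  next
    fix u :: "complex \<Rightarrow> complex" and c assume "continuous_on (sphere 0 1) u"
    then have "L (\<lambda>z. c * (f z * u z)) = c * L (\<lambda>z. f z * u z)"
      by (intro scale continuous_intros assms(2))
    then show "L (\<lambda>z. f z * (c * u z)) = c * L (\<lambda>z. f z * u z)" by (simp add: mult.left_commute)
  next
    fix u :: "complex \<Rightarrow> complex" and B assume u: "continuous_on (sphere 0 1) u" "\<And>z. norm z = 1 \<Longrightarrow> norm (u z) \<le> B"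
    show "norm (L (\<lambda>z. f z * u z)) \<le> C * B"
    proof (rule bound)
      fix z :: complex assume z: "norm z = 1"
      have "norm (f z) * norm (u z) \<le> 1 * B" using assms(3)[OF z] u(2)[OF z] by (intro mult_mono) auto
      then show "norm (f z * u z) \<le> B" by (simp add: norm_mult)
    qed (intro continuous_intros u assms(2))
  qed
qed

lemma continuous_on_poisson_pairs:
  assumes "s < 1"
  shows "continuous_on (sphere 0 s \<times> sphere 0 1) (\<lambda>(w, z). complex_of_real (poisson w z))"
  unfolding split_beta
  by (intro continuous_intros continuous_on_poisson) (use assms in auto)

text \<open>
  If bounded approximate solutions did not exist, separation would give functionals \<open>\<Lambda>\<close> and \<open>e j\<close>
  such that \<open>u \<mapsto> \<Lambda> (f j * u) - e j u\<close> annihilates the analytic polynomials. Its Poisson extension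
  \<open>h j\<close> is then holomorphic, and \<open>h j * f k - h k * f j\<close> is controlled by the \<open>e j\<close> alone up
  to a commutator that vanishes at the boundary, so Wolff's estimate bounds \<open>\<Lambda> (z ^ N)\<close>.
\<close>

lemma duality_bound:
  fixes m :: nat and f h :: "nat \<Rightarrow> complex \<Rightarrow> complex"
  assumes \<Lambda>: "circle_functional \<Lambda> A" and e: "\<And>i. i < m \<Longrightarrow> circle_functional (e i) B"
    and f: "\<And>i. i < m \<Longrightarrow> f i holomorphic_on ball 0 1" "\<And>i. i < m \<Longrightarrow> continuous_on (cball 0 1) (f i)"
      "\<And>i z. i < m \<Longrightarrow> norm z \<le> 1 \<Longrightarrow> norm (f i z) \<le> 1"
    and ann: "\<And>i n. i < m \<Longrightarrow> \<Lambda> (\<lambda>z. f i z * z ^ n) = e i (\<lambda>z. z ^ n)"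
    and low: "\<And>z. z \<in> ball 0 1 \<Longrightarrow> \<rho> \<le> norm z \<Longrightarrow> \<delta>\<^sup>2 \<le> (\<Sum>i<m. (norm (f i z))\<^sup>2)"
    and \<rho>: "\<rho> < 1" and \<delta>: "0 < \<delta>" and C: "0 \<le> C"
    and wolff: "\<And>h s. (\<And>i. i < m \<Longrightarrow> h i holomorphic_on ball 0 1 \<and> h i 0 = 0) \<Longrightarrow> s \<in> {0..<1} \<Longrightarrow>
      norm (circle_mean s (\<lambda>z. z ^ N * (\<Sum>i<m. h i z * cnj (f i z)) / (\<Sum>i<m. f i z * cnj (f i z))))
        \<le> C * (\<Sum>j<m. \<Sum>k<m. circle_mean s (\<lambda>z. norm (h j z * f k z - h k z * f j z)))"
  shows "norm (\<Lambda> (\<lambda>z. z ^ N)) \<le> (real m / \<delta>\<^sup>2 + 2 * C * (real m)\<^sup>2) * B"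
proof -
  interpret \<Lambda>: circle_functional \<Lambda> A by fact
  define M where "M = real m / \<delta>\<^sup>2 + 2 * C * (real m)\<^sup>2"
  have M0: "0 \<le> M" using C by (simp add: M_def)
  have fs: "continuous_on (sphere 0 1) (f i)" "\<And>z. norm z = 1 \<Longrightarrow> norm (f i z) \<le> 1" if "i < m" for i
    using continuous_on_subset[OF f(2)[OF that]] f(3)[OF that] by auto
  define P where "P = (\<lambda>w z. complex_of_real (poisson w z))"
  define k where "k = (\<lambda>w. \<Lambda> (P w))"
  define E where "E = (\<lambda>i w. e i (P w))"
  \<comment> \<open>\<open>k\<close> and \<open>E i\<close> are the Poisson extensions of
    \<open>\<Lambda>\<close> and \<open>e i\<close>, and \<open>h i\<close> is that of the
    annihilating functional. Up to the commutator \<open>r i\<close> and the error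
    \<open>E i\<close> it equals \<open>f i * k\<close>.\<close>
  define h where "h = (\<lambda>i w. \<Lambda> (\<lambda>z. f i z * P w z) - e i (P w))"
  define r where "r = (\<lambda>i w. \<Lambda> (\<lambda>z. (f i w - f i z) * P w z))"
  have cP: "continuous_on (sphere 0 1) (P w)" if "norm w < 1" for w
    unfolding P_def by (intro continuous_intros continuous_on_poisson) (use that in auto)
  have hh: "h i holomorphic_on ball 0 1 \<and> h i 0 = 0" if i: "i < m" for i
  proof -
    interpret \<eta>: circle_functional "\<lambda>u. \<Lambda> (\<lambda>z. f i z * u z) - e i u" "A + B"
      by (intro circle_functional_diff circle_functional_mult \<Lambda> e fs i)
    show ?thesis
      using \<eta>.holomorphic_if_annihilates_powers ann[OF i] unfolding h_def P_def by simp
  qed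
  have hr: "h i w = f i w * k w - r i w - E i w" if i: "i < m" and w: "norm w < 1" for i w
  proof -
    have "r i w = \<Lambda> (\<lambda>z. f i w * P w z) - \<Lambda> (\<lambda>z. f i z * P w z)"
      unfolding r_def left_diff_distrib by (intro \<Lambda>.diff continuous_intros fs cP i w)
    also have "\<Lambda> (\<lambda>z. f i w * P w z) = f i w * k w" unfolding k_def by (rule \<Lambda>.scale[OF cP[OF w]])
    finally show ?thesis by (simp add: h_def E_def)
  qed
  \<comment> \<open>The power of \<open>s\<close> comes from recovering the value of
    \<open>\<Lambda>\<close> at \<open>z ^ N\<close> as the mean of \<open>w ^ N * k w\<close> over
    the circle of radius \<open>s\<close>.\<close>
  have main: "\<exists>s0<1. \<forall>s. s0 < s \<and> s < 1 \<longrightarrow> s ^ (2 * N) * norm (\<Lambda> (\<lambda>z. z ^ N)) \<le> M * (B + \<kappa>)" if \<kappa>: "0 < \<kappa>" for \<kappa>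
  proof -
    \<comment> \<open>The oscillation of the \<open>f i\<close> is made small relative to the norm
      bound \<open>A\<close>, so that however large \<open>A\<close> is, the commutator contributes
      at most \<kappa>.\<close>
    define \<theta> where "\<theta> = \<kappa> / (A + 1)"
    have A0: "0 \<le> A" by (rule \<Lambda>.nonneg_const)
    have \<theta>: "0 < \<theta>" "A * \<theta> \<le> \<kappa>" using \<kappa> A0 by (auto simp: \<theta>_def field_simps)
    have "\<exists>s0. s0 < 1 \<and> (\<forall>s z. s0 < s \<longrightarrow> s < 1 \<longrightarrow> norm z = 1 \<longrightarrow> circle_mean s (\<lambda>w. norm ((f i w - f i z) * of_real (poisson w z))) \<le> \<theta>)" if "i < m" for i
      using poisson_mean_oscillation[OF f(2)[OF that] f(3)[OF that] \<theta>(1)] by metis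
    then obtain s1 where s1: "\<And>i. i < m \<Longrightarrow> s1 i < 1"
      "\<And>i s z. i < m \<Longrightarrow> s1 i < s \<Longrightarrow> s < 1 \<Longrightarrow> norm z = 1 \<Longrightarrow> circle_mean s (\<lambda>w. norm ((f i w - f i z) * of_real (poisson w z))) \<le> \<theta>"
      by metis
    \<comment> \<open>Beyond the largest of these thresholds the circle lies in the annulus of the
      good lower bound and all commutators are small.\<close>
    define S where "S = {0, \<rho>} \<union> s1 ` {..<m}"
    define s0 where "s0 = Max S"
    have S: "finite S" "S \<noteq> {}" "\<And>x. x \<in> S \<Longrightarrow> x < 1" using \<rho> s1(1) by (auto simp: S_def)
    have "s0 < 1" unfolding s0_def by (rule S(3)[OF Max_in[OF S(1,2)]])
    moreover have "x \<le> s0" if "x \<in> S" for x unfolding s0_def by (rule Max_ge[OF S(1) that])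
    ultimately have s0: "s0 < 1" "0 \<le> s0" "\<rho> \<le> s0" "\<And>i. i < m \<Longrightarrow> s1 i \<le> s0"
      by (simp_all add: S_def)
    show ?thesis
    proof (intro exI conjI allI impI)
      fix s assume "s0 < s \<and> s < 1"
      then have s: "s0 < s" "s < 1" "0 \<le> s" "s \<in> {0..<1}" using s0 by auto
      have sub: "sphere 0 s \<subseteq> ball (0::complex) 1" "sphere 0 s \<subseteq> cball (0::complex) 1" using s by auto
      have cf: "continuous_on (sphere 0 s) (f i)" if "i < m" for i by (rule continuous_on_subset[OF f(2)[OF that] sub(2)])
      have ch: "continuous_on (sphere 0 s) (h i)" if "i < m" for i
        using hh[OF that] by (intro continuous_on_subset[OF holomorphic_on_imp_continuous_on sub(1)]) auto
      have cPP: "continuous_on (sphere 0 s \<times> sphere 0 1) (\<lambda>(w, z). P w z)"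
        unfolding P_def by (rule continuous_on_poisson_pairs[OF s(2)])
      have ck: "continuous_on (sphere 0 s) k"
        unfolding k_def by (rule \<Lambda>.continuous_param(1)[OF compact_sphere cPP])
      have cE: "continuous_on (sphere 0 s) (E i)" if "i < m" for i
        unfolding E_def by (rule circle_functional.continuous_param(1)[OF e[OF that] compact_sphere cPP])
      have cr': "continuous_on (sphere 0 s \<times> sphere 0 1) (\<lambda>(w, z). (f i w - f i z) * P w z)" if "i < m" for i
        using cPP unfolding split_beta
        by (intro continuous_intros continuous_on_compose2[OF cf[OF that]] continuous_on_compose2[OF fs(1)[OF that]]) auto
      have cr: "continuous_on (sphere 0 s) (r i)" if "i < m" for i
        unfolding r_def by (rule \<Lambda>.continuous_param(1)[OF compact_sphere cr'[OF that]])
      have mE: "circle_mean s (\<lambda>w. norm (E i w)) \<le> B" if "i < m" for i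
      proof -
        have "circle_mean s (\<lambda>w. norm (E i w)) \<le> B * 1"
          unfolding E_def
        proof (rule circle_functional.circle_mean_norm_swap[OF e[OF that] s(3) cPP])
          fix z :: complex assume z: "norm z = 1"
          have "circle_mean s (\<lambda>w. norm (P w z)) = circle_mean s (\<lambda>w. poisson w z)"
            by (rule circle_mean_cong[OF s(3)]) (use s in \<open>simp add: P_def poisson_nonneg\<close>)
          then show "circle_mean s (\<lambda>w. norm (P w z)) \<le> 1" using poisson_mean_swapped[OF z s(3,2)] by simp
        qed
        then show ?thesis by simp
      qed
      have mr: "circle_mean s (\<lambda>w. norm (r i w)) \<le> \<kappa>" if i: "i < m" for i
      proof -
        have "circle_mean s (\<lambda>w. norm (r i w)) \<le> A * \<theta>"
          unfolding r_def
          by (rule \<Lambda>.circle_mean_norm_swap[OF s(3) cr'[OF i]])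
             (use s1(2)[OF i] s0(4)[OF i] s in \<open>auto simp: P_def\<close>)
        then show ?thesis using \<theta> by simp
      qed
      define q where "q = (\<lambda>i w. norm (r i w) + norm (E i w))"
      have cq: "continuous_on (sphere 0 s) (q i)" if "i < m" for i
        unfolding q_def by (intro continuous_intros cr cE that)
      have mq: "circle_mean s (q i) \<le> B + \<kappa>" if "i < m" for i
        unfolding q_def using mr[OF that] mE[OF that] s(3)
        by (subst circle_mean_add) (auto intro!: continuous_intros cr cE that)
      define D where "D = (\<lambda>w. \<Sum>i<m. f i w * cnj (f i w))"
      have Dn: "\<delta>\<^sup>2 \<le> norm (D w)" if "norm w = s" for w
      proof -
        have "D w = of_real (\<Sum>i<m. (norm (f i w))\<^sup>2)" unfolding D_def of_real_sum complex_norm_square ..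
        then have "norm (D w) = \<bar>\<Sum>i<m. (norm (f i w))\<^sup>2\<bar>" by (simp only: norm_of_real)
        moreover have "\<delta>\<^sup>2 \<le> (\<Sum>i<m. (norm (f i w))\<^sup>2)" by (rule low) (use that s s0 in auto)
        ultimately show ?thesis by linarith
      qed
      have D0: "D w \<noteq> 0" if "norm w = s" for w using Dn[OF that] \<delta> by auto
      have cD: "continuous_on (sphere 0 s) D" unfolding D_def by (intro continuous_intros cf) auto
      define u1 where "u1 = (\<lambda>w. w ^ N * (\<Sum>i<m. h i w * cnj (f i w)) / D w)"
      define u2 where "u2 = (\<lambda>w. w ^ N * (\<Sum>i<m. (r i w + E i w) * cnj (f i w)) / D w)"
      have c1: "continuous_on (sphere 0 s) u1" unfolding u1_def by (intro continuous_intros ch cf cD) (use D0 in auto)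
      have c2: "continuous_on (sphere 0 s) u2" unfolding u2_def by (intro continuous_intros cr cE cf cD) (use D0 in auto)
      \<comment> \<open>Multiply \<open>f i * k = h i + r i + E i\<close> by
        \<open>cnj (f i)\<close>, sum over \<open>i\<close> and divide by \<open>D\<close>. The
        first part has holomorphic \<open>h i\<close> and falls under the Wolff estimate; the second
        is estimated directly, as \<open>D\<close> is bounded below on this circle.\<close>
      have split: "w ^ N * k w = u1 w + u2 w" if w: "norm w = s" for w
      proof -
        have "(\<Sum>i<m. h i w * cnj (f i w)) + (\<Sum>i<m. (r i w + E i w) * cnj (f i w)) = k w * D w"
          unfolding sum.distrib[symmetric] D_def sum_distrib_left
        proof (intro sum.cong refl)
          fix i assume "i \<in> {..<m}"
          then have "i < m" "norm w < 1" using w s by auto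
          from hr[OF this]
          show "h i w * cnj (f i w) + (r i w + E i w) * cnj (f i w) = k w * (f i w * cnj (f i w))"
            by (simp only:) (simp add: algebra_simps)
        qed
        then have "u1 w + u2 w = w ^ N * (k w * D w) / D w"
          unfolding u1_def u2_def add_divide_distrib[symmetric] distrib_left[symmetric] by simp
        then show ?thesis using D0[OF w] by simp
      qed
      have "circle_mean s (\<lambda>w. w ^ N * k w) = circle_mean s u1 + circle_mean s u2"
        using circle_mean_cong[OF s(3) split] circle_mean_add[OF s(3) c1 c2] by simp
      moreover have "circle_mean s (\<lambda>w. w ^ N * k w) = of_real (s ^ (2 * N)) * \<Lambda> (\<lambda>z. z ^ N)"
      proof -
        have "circle_mean s (\<lambda>w. w ^ N * k w) = circle_mean s (\<lambda>w. \<Lambda> (\<lambda>z. w ^ N * P w z))"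
          unfolding k_def by (rule circle_mean_cong[OF s(3)]) (rule \<Lambda>.scale[symmetric, OF cP], use s in simp)
        also have "\<dots> = \<Lambda> (\<lambda>z. circle_mean s (\<lambda>w. w ^ N * P w z))"
          by (rule \<Lambda>.circle_mean_swap[OF s(3)]) (use cPP in \<open>auto simp: split_beta intro!: continuous_intros\<close>)
        also have "\<dots> = \<Lambda> (\<lambda>z. of_real (s ^ (2 * N)) * z ^ N)"
        proof (rule \<Lambda>.cong)
          have e: "circle_mean s (\<lambda>w. w ^ N * P w z) = of_real (s ^ (2 * N)) * z ^ N" if "norm z = 1" for z
            unfolding P_def by (rule poisson_mean_power[OF that s(3,2)])
          then show "\<And>z. norm z = 1 \<Longrightarrow> circle_mean s (\<lambda>w. w ^ N * P w z) = of_real (s ^ (2 * N)) * z ^ N" .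
          show "continuous_on (sphere 0 1) (\<lambda>z::complex. of_real (s ^ (2 * N)) * z ^ N)" by (intro continuous_intros)
          then show "continuous_on (sphere 0 1) (\<lambda>z. circle_mean s (\<lambda>w. w ^ N * P w z))"
            by (rule continuous_on_eq) (use e in auto)
        qed
        also have "\<dots> = of_real (s ^ (2 * N)) * \<Lambda> (\<lambda>z. z ^ N)" by (intro \<Lambda>.scale continuous_intros)
        finally show ?thesis .
      qed
      ultimately have "s ^ (2 * N) * norm (\<Lambda> (\<lambda>z. z ^ N)) \<le> norm (circle_mean s u1) + norm (circle_mean s u2)"
        using norm_triangle_ineq[of "circle_mean s u1" "circle_mean s u2"] s
        by (metis abs_of_nonneg norm_mult norm_of_real zero_le_power)
      also have "norm (circle_mean s u1) \<le> C * (\<Sum>j<m. \<Sum>k<m. circle_mean s (\<lambda>z. norm (h j z * f k z - h k z * f j z)))"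
        unfolding u1_def D_def by (rule wolff[OF hh s(4)])
      also have "\<dots> \<le> C * (\<Sum>j<m. \<Sum>k<m. 2 * (B + \<kappa>))"
      proof (intro mult_left_mono sum_mono C)
        fix i j assume "i \<in> {..<m}" "j \<in> {..<m}"
        then have ij: "i < m" "j < m" by auto
        have "circle_mean s (\<lambda>z. norm (h i z * f j z - h j z * f i z)) \<le> circle_mean s (\<lambda>z. q i z + q j z)"
        proof (rule circle_mean_mono[OF s(3)])
          fix w :: complex assume w: "norm w = s"
          then have w1: "norm w < 1" using s by simp
          \<comment> \<open>The term with \<open>k\<close> is symmetric in the two indices and
            cancels, so the unknown size of \<open>k\<close> disappears.\<close>
          have "h i w * f j w - h j w * f i w = (r j w + E j w) * f i w - (r i w + E i w) * f j w"
            unfolding hr[OF ij(1) w1] hr[OF ij(2) w1] by (simp add: algebra_simps)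
          also have "norm \<dots> \<le> norm (r j w + E j w) * norm (f i w) + norm (r i w + E i w) * norm (f j w)"
            by (rule order_trans[OF norm_triangle_ineq4]) (simp add: norm_mult)
          also have "\<dots> \<le> q j w * 1 + q i w * 1"
            unfolding q_def by (intro add_mono mult_mono norm_triangle_ineq f(3) ij) (use w1 in auto)
          finally show "norm (h i w * f j w - h j w * f i w) \<le> q i w + q j w" by simp
        qed (intro continuous_intros ch cf cq ij)+
        also have "\<dots> = circle_mean s (q i) + circle_mean s (q j)" by (intro circle_mean_add s cq ij)
        also have "\<dots> \<le> 2 * (B + \<kappa>)" using mq[OF ij(1)] mq[OF ij(2)] by simp
        finally show "circle_mean s (\<lambda>z. norm (h i z * f j z - h j z * f i z)) \<le> 2 * (B + \<kappa>)" .
      qed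
      also have "norm (circle_mean s u2) \<le> circle_mean s (\<lambda>w. (\<Sum>i<m. q i w) / \<delta>\<^sup>2)"
      proof (rule circle_mean_norm_le[OF s(3) c2])
        show "continuous_on (sphere 0 s) (\<lambda>w. (\<Sum>i<m. q i w) / \<delta>\<^sup>2)" by (intro continuous_intros cq) (use \<delta> in auto)
        fix w :: complex assume w: "norm w = s"
        then have w1: "norm w < 1" using s by simp
        have "norm (\<Sum>i<m. (r i w + E i w) * cnj (f i w)) \<le> (\<Sum>i<m. q i w)"
        proof (rule sum_norm_le)
          fix i assume "i \<in> {..<m}"
          then have "norm (r i w + E i w) * norm (f i w) \<le> q i w * 1"
            unfolding q_def by (intro mult_mono norm_triangle_ineq f(3)) (use w1 in auto)
          then show "norm ((r i w + E i w) * cnj (f i w)) \<le> q i w" by (simp add: norm_mult)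
        qed
        moreover have "norm w ^ N \<le> 1" using w1 by (intro power_le_one) auto
        ultimately have "norm w ^ N * norm (\<Sum>i<m. (r i w + E i w) * cnj (f i w)) \<le> 1 * (\<Sum>i<m. q i w)"
          by (intro mult_mono) auto
        then have "norm (u2 w) \<le> (\<Sum>i<m. q i w) / norm (D w)"
          unfolding u2_def norm_divide norm_mult norm_power by (intro divide_right_mono) auto
        also have "\<dots> \<le> (\<Sum>i<m. q i w) / \<delta>\<^sup>2"
          using Dn[OF w] \<delta> D0[OF w] by (intro divide_left_mono mult_pos_pos sum_nonneg) (auto simp: q_def)
        finally show "norm (u2 w) \<le> (\<Sum>i<m. q i w) / \<delta>\<^sup>2" .
      qed
      also have "\<dots> = (\<Sum>i<m. circle_mean s (q i)) / \<delta>\<^sup>2"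
        using circle_mean_sum[OF s(3), of "{..<m}" q] cq circle_mean_cmult[of s "inverse (\<delta>\<^sup>2)" "\<lambda>w. \<Sum>i<m. q i w"]
        by (simp add: divide_inverse mult.commute)
      also have "\<dots> \<le> (\<Sum>i<m. B + \<kappa>) / \<delta>\<^sup>2"
        by (intro divide_right_mono sum_mono mq) auto
      finally show "s ^ (2 * N) * norm (\<Lambda> (\<lambda>z. z ^ N)) \<le> M * (B + \<kappa>)"
        by (simp add: M_def power2_eq_square algebra_simps)
    qed (rule s0(1))
  qed
  have lim: "norm (\<Lambda> (\<lambda>z. z ^ N)) \<le> M * (B + \<kappa>)" if \<kappa>: "0 < \<kappa>" for \<kappa>
  proof -
    obtain s0 where s0: "s0 < 1" "\<And>s. s0 < s \<Longrightarrow> s < 1 \<Longrightarrow> s ^ (2 * N) * norm (\<Lambda> (\<lambda>z. z ^ N)) \<le> M * (B + \<kappa>)"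
      using main[OF \<kappa>] by blast
    have "((\<lambda>s. s ^ (2 * N) * norm (\<Lambda> (\<lambda>z. z ^ N))) \<longlongrightarrow> 1 ^ (2 * N) * norm (\<Lambda> (\<lambda>z. z ^ N))) (at_left 1)"
      by (intro tendsto_intros)
    moreover have "\<forall>\<^sub>F s in at_left 1. s ^ (2 * N) * norm (\<Lambda> (\<lambda>z. z ^ N)) \<le> M * (B + \<kappa>)"
      unfolding eventually_at_left_field using s0 by blast
    ultimately have "1 ^ (2 * N) * norm (\<Lambda> (\<lambda>z. z ^ N)) \<le> M * (B + \<kappa>)"
      by (rule tendsto_upperbound) simp
    then show ?thesis by simp
  qed
  have "norm (\<Lambda> (\<lambda>z. z ^ N)) \<le> M * B"
  proof (rule field_le_epsilon)
    fix x :: real assume x: "0 < x"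
    have "norm (\<Lambda> (\<lambda>z. z ^ N)) \<le> M * (B + x / (M + 1))" by (rule lim) (use x M0 in simp)
    also have "\<dots> \<le> M * B + x" using x M0 by (simp add: field_simps)
    finally show "norm (\<Lambda> (\<lambda>z. z ^ N)) \<le> M * B + x" .
  qed
  then show ?thesis by (simp add: M_def)
qed

text \<open>Failure of the approximation means that the tuple with entries 0 and a last entry
  \<open>z ^ N / \<epsilon>\<close> has distance at least 1 from a subspace built from polynomials,
  and the separating functionals then violate the duality bound. \<open>N\<close> is fixed before
  \<open>f\<close> and \<epsilon>, which later allows a limit over dilations.\<close>

lemma corona_polynomial_approximation:
  fixes m :: nat and \<delta> :: real
  assumes \<delta>: "0 < \<delta>" "\<delta> \<le> 1"
  obtains K where "0 < K" and
    "\<And>\<tau> \<rho>. \<lbrakk>0 < \<tau>; \<tau> \<le> 1; 0 < \<rho>; \<rho> < 1\<rbrakk> \<Longrightarrow> \<exists>N. \<forall>f \<epsilon>.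
      (\<forall>i<m. f i holomorphic_on ball 0 1 \<and> continuous_on (cball 0 1) (f i) \<and> (\<forall>z\<in>cball 0 1. norm (f i z) \<le> 1)) \<longrightarrow>
      (\<forall>z\<in>ball 0 1. \<tau>\<^sup>2 \<le> (\<Sum>i<m. (norm (f i z))\<^sup>2) \<and> (\<rho> \<le> norm z \<longrightarrow> \<delta>\<^sup>2 \<le> (\<Sum>i<m. (norm (f i z))\<^sup>2))) \<longrightarrow>
      0 < \<epsilon> \<longrightarrow>
      (\<exists>p :: nat \<Rightarrow> complex poly. \<forall>z. norm z = 1 \<longrightarrow> (\<forall>i<m. norm (poly (p i) z) \<le> K) \<and>
        norm (z ^ N - (\<Sum>i<m. poly (p i) z * f i z)) \<le> \<epsilon>)"
proof -
  obtain C where C: "0 < C" and wolff: "\<And>\<tau> \<rho>. \<lbrakk>0 < \<tau>; \<tau> \<le> 1; 0 < \<rho>; \<rho> < 1\<rbrakk> \<Longrightarrow> \<exists>N. \<forall>f h s.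
      (\<forall>i<m. f i holomorphic_on ball 0 1 \<and> h i holomorphic_on ball 0 1 \<and> h i 0 = 0 \<and> (\<forall>z\<in>ball 0 1. norm (f i z) \<le> 1)) \<longrightarrow>
      (\<forall>z\<in>ball 0 1. \<tau>\<^sup>2 \<le> (\<Sum>i<m. (norm (f i z))\<^sup>2) \<and> (\<rho> \<le> norm z \<longrightarrow> \<delta>\<^sup>2 \<le> (\<Sum>i<m. (norm (f i z))\<^sup>2))) \<longrightarrow>
      s \<in> {0..<1} \<longrightarrow>
      norm (circle_mean s (\<lambda>z. z ^ N * (\<Sum>i<m. h i z * cnj (f i z)) / (\<Sum>i<m. f i z * cnj (f i z))))
        \<le> C * (\<Sum>j<m. \<Sum>k<m. circle_mean s (\<lambda>z. norm (h j z * f k z - h k z * f j z)))"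
    using wolff_estimate[OF \<delta>, of m] by blast
  define M where "M = real m / \<delta>\<^sup>2 + 2 * C * (real m)\<^sup>2"
  \<comment> \<open>Strictly larger than the duality constant, so the separating functional would
    have modulus at most \<open>M / K < 1\<close> at \<open>z ^ N\<close>.\<close>
  define K where "K = M + 1"
  have M0: "0 \<le> M" and K: "0 < K" using C by (auto simp: M_def K_def add_nonneg_pos)
  show thesis
  proof (rule that[OF K])
    fix \<tau> \<rho> :: real
    assume tr: "0 < \<tau>" "\<tau> \<le> 1" "0 < \<rho>" "\<rho> < 1"
    from wolff[OF tr] obtain N where N: "\<And>f h s.
      (\<And>i. i < m \<Longrightarrow> f i holomorphic_on ball 0 1 \<and> h i holomorphic_on ball 0 1 \<and> h i 0 = 0 \<and> (\<forall>z\<in>ball 0 1. norm (f i z) \<le> 1)) \<Longrightarrow>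
      (\<And>z. z\<in>ball 0 1 \<Longrightarrow> \<tau>\<^sup>2 \<le> (\<Sum>i<m. (norm (f i z))\<^sup>2) \<and> (\<rho> \<le> norm z \<longrightarrow> \<delta>\<^sup>2 \<le> (\<Sum>i<m. (norm (f i z))\<^sup>2))) \<Longrightarrow>
      s \<in> {0..<1} \<Longrightarrow>
      norm (circle_mean s (\<lambda>z. z ^ N * (\<Sum>i<m. h i z * cnj (f i z)) / (\<Sum>i<m. f i z * cnj (f i z))))
        \<le> C * (\<Sum>j<m. \<Sum>k<m. circle_mean s (\<lambda>z. norm (h j z * f k z - h k z * f j z)))"
      by blast
    show "\<exists>N. \<forall>f \<epsilon>.
      (\<forall>i<m. f i holomorphic_on ball 0 1 \<and> continuous_on (cball 0 1) (f i) \<and> (\<forall>z\<in>cball 0 1. norm (f i z) \<le> 1)) \<longrightarrow>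
      (\<forall>z\<in>ball 0 1. \<tau>\<^sup>2 \<le> (\<Sum>i<m. (norm (f i z))\<^sup>2) \<and> (\<rho> \<le> norm z \<longrightarrow> \<delta>\<^sup>2 \<le> (\<Sum>i<m. (norm (f i z))\<^sup>2))) \<longrightarrow>
      0 < \<epsilon> \<longrightarrow>
      (\<exists>p :: nat \<Rightarrow> complex poly. \<forall>z. norm z = 1 \<longrightarrow> (\<forall>i<m. norm (poly (p i) z) \<le> K) \<and>
        norm (z ^ N - (\<Sum>i<m. poly (p i) z * f i z)) \<le> \<epsilon>)"
    proof (intro exI[of _ N] allI impI, rule ccontr)
      fix f :: "nat \<Rightarrow> complex \<Rightarrow> complex" and \<epsilon> :: real
      assume f: "\<forall>i<m. f i holomorphic_on ball 0 1 \<and> continuous_on (cball 0 1) (f i) \<and> (\<forall>z\<in>cball 0 1. norm (f i z) \<le> 1)"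
        and low: "\<forall>z\<in>ball 0 1. \<tau>\<^sup>2 \<le> (\<Sum>i<m. (norm (f i z))\<^sup>2) \<and> (\<rho> \<le> norm z \<longrightarrow> \<delta>\<^sup>2 \<le> (\<Sum>i<m. (norm (f i z))\<^sup>2))"
        and \<epsilon>: "0 < \<epsilon>"
        and no: "\<nexists>p :: nat \<Rightarrow> complex poly. \<forall>z. norm z = 1 \<longrightarrow> (\<forall>i<m. norm (poly (p i) z) \<le> K) \<and>
           norm (z ^ N - (\<Sum>i<m. poly (p i) z * f i z)) \<le> \<epsilon>"
      have fs: "continuous_on (sphere 0 1) (f i)" if "i < m" for i
        using f that by (auto intro: continuous_on_subset[of "cball 0 1"])
      \<comment> \<open>Scaling by \<open>K\<close> and \<epsilon> turns both requirements, the
        bound on the coefficients and the size of the error, into one condition comparing a distance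
        with 1.\<close>
      define tup where "tup = (\<lambda>(p :: nat \<Rightarrow> complex poly) i z. if i < m then poly (p i) z / of_real K else (\<Sum>j<m. poly (p j) z * f j z) / of_real \<epsilon>)"
      define y where "y = (\<lambda>i z. if i < m then 0 else z ^ N / complex_of_real \<epsilon>)"
      obtain L where L: "\<And>i. i < Suc m \<Longrightarrow> circle_functional (L i) 1" "\<And>v. v \<in> range tup \<Longrightarrow> (\<Sum>i<Suc m. L i (v i)) = 0"
        "1 \<le> Re (\<Sum>i<Suc m. L i (y i))"
      proof (rule separation_on_circle[of "range tup" "Suc m" y])
        show "(\<lambda>i z. 0) \<in> range tup"
          by (rule range_eqI[of _ _ "\<lambda>_. 0"]) (simp add: tup_def fun_eq_iff)
        show "(\<lambda>i z. v i z + w i z) \<in> range tup" if vw: "v \<in> range tup" "w \<in> range tup" for v w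
        proof -
          from vw obtain p q where "v = tup p" "w = tup q" by auto
          then show ?thesis
            by (intro range_eqI[of _ _ "\<lambda>i. p i + q i"])
               (auto simp: tup_def fun_eq_iff add_divide_distrib distrib_right sum.distrib)
        qed
        show "(\<lambda>i z. c * v i z) \<in> range tup" if v: "v \<in> range tup" for c v
        proof -
          from v obtain p where "v = tup p" by auto
          then show ?thesis
            by (intro range_eqI[of _ _ "\<lambda>i. Polynomial.smult c (p i)"])
               (auto simp: tup_def fun_eq_iff sum_distrib_left mult.assoc)
        qed
        show "continuous_on (sphere 0 1) (v i)" if "v \<in> range tup" for v i
        proof -
          from that obtain p where "v = tup p" by auto
          then show ?thesis using K \<epsilon> fs by (cases "i < m") (auto simp: tup_def intro!: continuous_intros)
        qed
        show "continuous_on (sphere 0 1) (y i)" for i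
          using \<epsilon> by (cases "i < m") (auto simp: y_def intro!: continuous_intros)
        show "\<exists>i<Suc m. \<exists>z. norm z = 1 \<and> 1 \<le> norm (y i z - v i z)" if "v \<in> range tup" for v
        proof -
          from that obtain p where v: "v = tup p" by auto
          from no obtain z where z: "norm z = 1" "(\<exists>i<m. K < norm (poly (p i) z)) \<or> \<epsilon> < norm (z ^ N - (\<Sum>i<m. poly (p i) z * f i z))"
            by (metis not_le)
          from z(2) show ?thesis
          proof
            assume "\<exists>i<m. K < norm (poly (p i) z)"
            then obtain i where i: "i < m" "K < norm (poly (p i) z)" by auto
            then have "1 \<le> norm (y i z - v i z)" using K by (simp add: v y_def tup_def norm_divide)
            then show ?thesis using i(1) z(1) less_SucI by blast
          next
            assume a: "\<epsilon> < norm (z ^ N - (\<Sum>i<m. poly (p i) z * f i z))"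
            then have "1 \<le> norm (y m z - v m z)"
              using \<epsilon> unfolding v y_def tup_def by (simp add: norm_divide flip: diff_divide_distrib)
            then show ?thesis using z(1) by blast
          qed
        qed
      qed blast
      define \<Lambda> where "\<Lambda> = (\<lambda>u. of_real (1 / \<epsilon>) * L m u)"
      \<comment> \<open>The sign turns vanishing on the subspace into the equality of
        \<open>\<Lambda> (f i * z ^ n)\<close> with \<open>e i (z ^ n)\<close>. The norm
        \<open>1 / K\<close> of \<open>e i\<close> is what enters the duality bound as
        \<open>B\<close>.\<close>
      define e where "e = (\<lambda>i u. of_real (- (1 / K)) * L i u)"
      have c\<Lambda>: "circle_functional \<Lambda> (1 / \<epsilon>)"
        using circle_functional_cmult[OF L(1)[of m], of "of_real (1 / \<epsilon>)"] \<epsilon> by (simp add: \<Lambda>_def norm_divide)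
      have ce: "circle_functional (e i) (1 / K)" if "i < m" for i
        using circle_functional_cmult[OF L(1)[of i], of "of_real (- (1 / K))"] K that by (simp add: e_def norm_divide)
      have Lsc: "L i (\<lambda>z. u z / of_real c) = of_real (1 / c) * L i u" if "i < Suc m" "continuous_on (sphere 0 1) u" for i u c
        using circle_functional.scale[OF L(1)[OF that(1)] that(2), of "of_real (1 / c)"] by (simp add: divide_inverse mult.commute)
      have L0: "L i (\<lambda>z. 0) = 0" if "i < Suc m" for i by (rule circle_functional.zero[OF L(1)[OF that]])
      have ann: "\<Lambda> (\<lambda>z. f i z * z ^ n) = e i (\<lambda>z. z ^ n)" if i: "i < m" for i n
      proof -
        define p where "p = (\<lambda>j. if j = i then monom (1::complex) n else 0)"
        have pz: "poly (p j) z = (if j = i then z ^ n else 0)" for j z by (simp add: p_def poly_monom)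
        have t1: "L j (tup p j) = (if j = i then of_real (1 / K) * L i (\<lambda>z. z ^ n) else 0)" if "j < m" for j
        proof -
          have "tup p j = (if j = i then (\<lambda>z. z ^ n / of_real K) else (\<lambda>z. 0))" using that by (auto simp: tup_def pz fun_eq_iff)
          then show ?thesis using Lsc[of i "\<lambda>z. z ^ n" K] L0[of j] that i by (simp add: continuous_intros)
        qed
        have t2: "L m (tup p m) = of_real (1 / \<epsilon>) * L m (\<lambda>z. f i z * z ^ n)"
        proof -
          have "(\<Sum>j<m. poly (p j) z * f j z) = f i z * z ^ n" for z
          proof -
            have "(\<Sum>j<m. poly (p j) z * f j z) = (\<Sum>j<m. if j = i then f i z * z ^ n else 0)"
              by (intro sum.cong) (auto simp: pz)
            then show ?thesis using i by simp
          qed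
          then have "tup p m = (\<lambda>z. f i z * z ^ n / of_real \<epsilon>)" by (simp add: tup_def fun_eq_iff)
          then show ?thesis using Lsc[of m "\<lambda>z. f i z * z ^ n" \<epsilon>] fs[OF i] by (simp add: continuous_intros)
        qed
        have "(\<Sum>j<Suc m. L j (tup p j)) = of_real (1 / K) * L i (\<lambda>z. z ^ n) + of_real (1 / \<epsilon>) * L m (\<lambda>z. f i z * z ^ n)"
          using i by (simp add: t1 t2)
        then have "of_real (1 / K) * L i (\<lambda>z. z ^ n) + of_real (1 / \<epsilon>) * L m (\<lambda>z. f i z * z ^ n) = 0"
          using L(2)[of "tup p"] by simp
        then show ?thesis by (simp add: \<Lambda>_def e_def add_eq_0_iff)
      qed
      have "norm (\<Lambda> (\<lambda>z. z ^ N)) \<le> (real m / \<delta>\<^sup>2 + 2 * C * (real m)\<^sup>2) * (1 / K)"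
      proof (rule duality_bound[OF c\<Lambda> ce _ _ _ ann _ tr(4) \<delta>(1)])
        fix h :: "nat \<Rightarrow> complex \<Rightarrow> complex" and s :: real
        assume h: "\<And>i. i < m \<Longrightarrow> h i holomorphic_on ball 0 1 \<and> h i 0 = 0" and s: "s \<in> {0..<1}"
        show "norm (circle_mean s (\<lambda>z. z ^ N * (\<Sum>i<m. h i z * cnj (f i z)) / (\<Sum>i<m. f i z * cnj (f i z))))
          \<le> C * (\<Sum>j<m. \<Sum>k<m. circle_mean s (\<lambda>z. norm (h j z * f k z - h k z * f j z)))"
          by (rule N[OF _ _ s]) (use f low h in auto)
      qed (use f low C in auto)
      also have "\<dots> < 1" unfolding M_def[symmetric] using K by (simp add: K_def)
      finally have "norm (\<Lambda> (\<lambda>z. z ^ N)) < 1" .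
      moreover have "1 \<le> Re (\<Lambda> (\<lambda>z. z ^ N))"
      proof -
        have "L i (y i) = 0" if "i < m" for i using that L0[of i] by (simp add: y_def)
        moreover have "L m (y m) = \<Lambda> (\<lambda>z. z ^ N)"
          using Lsc[of m "\<lambda>z. z ^ N" \<epsilon>] by (simp add: y_def \<Lambda>_def continuous_intros)
        ultimately show ?thesis using L(3) by simp
      qed
      ultimately show False using complex_Re_le_cmod[of "\<Lambda> (\<lambda>z. z ^ N)"] by linarith
    qed
  qed
qed

lemma Montel_finite_family:
  fixes P :: "nat \<Rightarrow> nat \<Rightarrow> complex \<Rightarrow> complex"
  assumes "\<And>n i. i < m \<Longrightarrow> P n i holomorphic_on ball 0 1"
    and "\<And>n i z. i < m \<Longrightarrow> z \<in> ball 0 1 \<Longrightarrow> norm (P n i z) \<le> K"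
  shows "\<exists>\<phi> g. strict_mono (\<phi> :: nat \<Rightarrow> nat) \<and> (\<forall>i<m. g i holomorphic_on ball 0 1 \<and>
    (\<forall>z\<in>ball 0 1. (\<lambda>n. P (\<phi> n) i z) \<longlonglongrightarrow> g i z))"
  using assms
proof (induction m)
  case 0
  show ?case by (rule exI[of _ id]) (simp add: strict_mono_def)
next
  case (Suc m)
  obtain \<phi> g where \<phi>: "strict_mono (\<phi> :: nat \<Rightarrow> nat)"
    and g: "\<And>i. i < m \<Longrightarrow> g i holomorphic_on ball 0 1"
      "\<And>i z. i < m \<Longrightarrow> z \<in> ball 0 1 \<Longrightarrow> (\<lambda>n. P (\<phi> n) i z) \<longlonglongrightarrow> g i z"
    using Suc.IH Suc.prems by (metis less_SucI)
  obtain g' \<psi> where g': "g' holomorphic_on ball 0 1" "strict_mono (\<psi> :: nat \<Rightarrow> nat)"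
      "\<And>z. z \<in> ball 0 1 \<Longrightarrow> (\<lambda>n. P (\<phi> (\<psi> n)) m z) \<longlonglongrightarrow> g' z"
  proof (rule Montel[of "ball 0 1" "range (\<lambda>n. P (\<phi> n) m)" "\<lambda>n. P (\<phi> n) m"])
    show "\<exists>B. \<forall>h\<in>range (\<lambda>n. P (\<phi> n) m). \<forall>z\<in>X. norm (h z) \<le> B" if "X \<subseteq> ball 0 1" for X
      using Suc.prems(2)[of m] that by (intro exI[of _ K]) auto
  qed (use Suc.prems(1)[of m] in auto)
  show ?case
  proof (intro exI conjI allI impI ballI)
    show "strict_mono (\<phi> \<circ> \<psi>)" using \<phi> g'(2) by (rule strict_mono_o)
    fix i assume "i < Suc m"
    show "(if i < m then g i else g') holomorphic_on ball 0 1" using g(1) g'(1) by auto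
    fix z :: complex assume z: "z \<in> ball 0 1"
    show "(\<lambda>n. P ((\<phi> \<circ> \<psi>) n) i z) \<longlonglongrightarrow> (if i < m then g i else g') z"
    proof (cases "i < m")
      case True
      then show ?thesis using LIMSEQ_subseq_LIMSEQ[OF g(2)[OF True z] g'(2)] by (simp add: o_def)
    next
      case False
      then have "i = m" using \<open>i < Suc m\<close> by simp
      then show ?thesis using g'(3)[OF z] by simp
    qed
  qed
qed

lemma norm_le_on_disc:
  assumes "f holomorphic_on ball 0 R" "1 < R" "\<And>z. norm z = 1 \<Longrightarrow> norm (f z) \<le> B" "norm z < 1"
  shows "norm (f z) \<le> B"
proof (rule maximum_modulus_frontier[of f "ball 0 1"])
  show "f holomorphic_on interior (ball 0 1)"
    using assms(1,2) by (auto elim!: holomorphic_on_subset)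
  show "continuous_on (closure (ball 0 1)) f"
    by (rule continuous_on_subset[OF holomorphic_on_imp_continuous_on[OF assms(1)]]) (use assms(2) in auto)
qed (use assms(3,4) in auto)

text \<open>Dilations make \<open>f\<close> continuous up to the circle, and the exponent found for
  \<tau> and a fixed radius serves all dilations at once. By the maximum principle the polynomial
  solutions are bounded by \<open>K\<close> in the disc, so a subsequence converges to an exact
  solution.\<close>

lemma corona_power:
  fixes m :: nat and \<delta> :: real
  assumes \<delta>: "0 < \<delta>" "\<delta> \<le> 1"
  obtains K where "0 < K" and
    "\<And>\<tau> \<rho> f. \<lbrakk>0 < \<tau>; \<tau> \<le> 1; 0 < \<rho>; \<rho> < 1;
      \<And>i. i < m \<Longrightarrow> f i holomorphic_on ball 0 1; \<And>i z. i < m \<Longrightarrow> z \<in> ball 0 1 \<Longrightarrow> norm (f i z) \<le> 1;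
      \<And>z. z \<in> ball 0 1 \<Longrightarrow> \<tau>\<^sup>2 \<le> (\<Sum>i<m. (norm (f i z))\<^sup>2);
      \<And>z. z \<in> ball 0 1 \<Longrightarrow> \<rho> \<le> norm z \<Longrightarrow> \<delta>\<^sup>2 \<le> (\<Sum>i<m. (norm (f i z))\<^sup>2)\<rbrakk> \<Longrightarrow>
      \<exists>N p. (\<forall>i<m. p i holomorphic_on ball 0 1 \<and> (\<forall>z\<in>ball 0 1. norm (p i z) \<le> K)) \<and>
        (\<forall>z\<in>ball 0 1. (\<Sum>i<m. p i z * f i z) = z ^ N)"
proof -
  obtain K where K: "0 < K" and pol: "\<And>\<tau> \<rho>. \<lbrakk>0 < \<tau>; \<tau> \<le> 1; 0 < \<rho>; \<rho> < 1\<rbrakk> \<Longrightarrow> \<exists>N. \<forall>f \<epsilon>.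
      (\<forall>i<m. f i holomorphic_on ball 0 1 \<and> continuous_on (cball 0 1) (f i) \<and> (\<forall>z\<in>cball 0 1. norm (f i z) \<le> 1)) \<longrightarrow>
      (\<forall>z\<in>ball 0 1. \<tau>\<^sup>2 \<le> (\<Sum>i<m. (norm (f i z))\<^sup>2) \<and> (\<rho> \<le> norm z \<longrightarrow> \<delta>\<^sup>2 \<le> (\<Sum>i<m. (norm (f i z))\<^sup>2))) \<longrightarrow>
      0 < \<epsilon> \<longrightarrow>
      (\<exists>p :: nat \<Rightarrow> complex poly. \<forall>z. norm z = 1 \<longrightarrow> (\<forall>i<m. norm (poly (p i) z) \<le> K) \<and>
        norm (z ^ N - (\<Sum>i<m. poly (p i) z * f i z)) \<le> \<epsilon>)"
    using corona_polynomial_approximation[OF \<delta>, of m] by blast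
  show thesis
  proof (rule that[OF K])
    fix \<tau> \<rho> :: real and f :: "nat \<Rightarrow> complex \<Rightarrow> complex"
    assume tr: "0 < \<tau>" "\<tau> \<le> 1" "0 < \<rho>" "\<rho> < 1"
      and hf: "\<And>i. i < m \<Longrightarrow> f i holomorphic_on ball 0 1" and f1: "\<And>i z. i < m \<Longrightarrow> z \<in> ball 0 1 \<Longrightarrow> norm (f i z) \<le> 1"
      and low: "\<And>z. z \<in> ball 0 1 \<Longrightarrow> \<tau>\<^sup>2 \<le> (\<Sum>i<m. (norm (f i z))\<^sup>2)"
        "\<And>z. z \<in> ball 0 1 \<Longrightarrow> \<rho> \<le> norm z \<Longrightarrow> \<delta>\<^sup>2 \<le> (\<Sum>i<m. (norm (f i z))\<^sup>2)"
    \<comment> \<open>The annulus shrinks from radius \<rho> to its square root: if the dilation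
      factor and the modulus are both at least \<sigma>, the dilated point has modulus at least
      \<rho>.\<close>
    define \<sigma> where "\<sigma> = sqrt \<rho>"
    have \<sigma>: "0 < \<sigma>" "\<sigma> < 1" "\<sigma> * \<sigma> = \<rho>" using tr by (auto simp: \<sigma>_def)
    from pol[OF tr(1,2) \<sigma>(1,2)] obtain N where N0: "\<forall>f \<epsilon>.
      (\<forall>i<m. f i holomorphic_on ball 0 1 \<and> continuous_on (cball 0 1) (f i) \<and> (\<forall>z\<in>cball 0 1. norm (f i z) \<le> 1)) \<longrightarrow>
      (\<forall>z\<in>ball 0 1. \<tau>\<^sup>2 \<le> (\<Sum>i<m. (norm (f i z))\<^sup>2) \<and> (\<sigma> \<le> norm z \<longrightarrow> \<delta>\<^sup>2 \<le> (\<Sum>i<m. (norm (f i z))\<^sup>2))) \<longrightarrow>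
      0 < \<epsilon> \<longrightarrow>
      (\<exists>p :: nat \<Rightarrow> complex poly. \<forall>z. norm z = 1 \<longrightarrow> (\<forall>i<m. norm (poly (p i) z) \<le> K) \<and>
        norm (z ^ N - (\<Sum>i<m. poly (p i) z * f i z)) \<le> \<epsilon>)" ..
    define r where "r = (\<lambda>n. 1 - (1 - \<sigma>) / real (Suc n))"
    have r: "\<sigma> \<le> r n" "r n < 1" "0 < r n" for n
    proof -
      have "(1 - \<sigma>) / real (Suc n) \<le> (1 - \<sigma>) / 1" using \<sigma> by (intro divide_left_mono) auto
      then show "\<sigma> \<le> r n" by (simp add: r_def)
      then show "0 < r n" using \<sigma> by simp
      show "r n < 1" using \<sigma> by (simp add: r_def)
    qed
    have rlim: "(\<lambda>n. complex_of_real (r n)) \<longlonglongrightarrow> 1"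
    proof -
      have "(\<lambda>n. (1 - \<sigma>) * inverse (real (Suc n))) \<longlonglongrightarrow> (1 - \<sigma>) * 0"
        by (intro tendsto_intros LIMSEQ_inverse_real_of_nat)
      from tendsto_diff[OF tendsto_const[of 1] this] have "r \<longlonglongrightarrow> 1" by (simp add: r_def divide_inverse)
      from tendsto_of_real[OF this] show ?thesis by simp
    qed
    define F where "F = (\<lambda>n i z. f i (of_real (r n) * z))"
    have rz: "of_real (r n) * z \<in> ball 0 1" if "z \<in> ball 0 (1 / r n)" for n and z :: complex
      using that r[of n] by (simp add: norm_mult field_simps)
    have R1: "1 < 1 / r n" for n using r[of n] by simp
    have hF: "F n i holomorphic_on ball 0 (1 / r n)" if "i < m" for n i
      unfolding F_def using rz
      by (intro holomorphic_on_compose_gen[of "\<lambda>z. of_real (r n) * z" _ "f i" "ball 0 1", unfolded o_def] holomorphic_intros hf[OF that]) auto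
    have sub: "cball 0 1 \<subseteq> ball (0::complex) (1 / r n)" "ball 0 1 \<subseteq> ball (0::complex) (1 / r n)" for n
    proof -
      show "cball 0 1 \<subseteq> ball (0::complex) (1 / r n)" using R1[of n] by (auto simp del: divide_le_eq less_divide_eq)
      then show "ball 0 1 \<subseteq> ball (0::complex) (1 / r n)" using ball_subset_cball by blast
    qed
    have "\<exists>p :: nat \<Rightarrow> complex poly. \<forall>z. norm z = 1 \<longrightarrow> (\<forall>i<m. norm (poly (p i) z) \<le> K) \<and>
        norm (z ^ N - (\<Sum>i<m. poly (p i) z * F n i z)) \<le> 1 / real (Suc n)" for n
    proof (rule N0[THEN spec, THEN spec, THEN mp, THEN mp, THEN mp]; (intro allI ballI impI)?)
      fix i assume i: "i < m"
      show "F n i holomorphic_on ball 0 1 \<and> continuous_on (cball 0 1) (F n i) \<and> (\<forall>z\<in>cball 0 1. norm (F n i z) \<le> 1)"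
      proof (intro conjI ballI)
        show "F n i holomorphic_on ball 0 1" by (rule holomorphic_on_subset[OF hF[OF i] sub(2)])
        show "continuous_on (cball 0 1) (F n i)"
          by (rule continuous_on_subset[OF holomorphic_on_imp_continuous_on[OF hF[OF i]] sub(1)])
        fix z :: complex assume "z \<in> cball 0 1"
        then show "norm (F n i z) \<le> 1" unfolding F_def using rz sub(1)[of n] by (intro f1[OF i]) blast
      qed
    next
      fix z :: complex assume z: "z \<in> ball 0 1"
      then have z': "of_real (r n) * z \<in> ball 0 1" using rz sub(2)[of n] by blast
      have "\<rho> \<le> norm (of_real (r n) * z)" if "\<sigma> \<le> norm z"
        using mult_mono[OF r(1)[of n] that] \<sigma> r(3)[of n] by (simp add: norm_mult)
      then show "\<tau>\<^sup>2 \<le> (\<Sum>i<m. (norm (F n i z))\<^sup>2) \<and> (\<sigma> \<le> norm z \<longrightarrow> \<delta>\<^sup>2 \<le> (\<Sum>i<m. (norm (F n i z))\<^sup>2))"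
        unfolding F_def using low(1)[OF z'] low(2)[OF z'] by blast
    qed simp
    then obtain p :: "nat \<Rightarrow> nat \<Rightarrow> complex poly" where p: "\<And>n z. norm z = 1 \<Longrightarrow> (\<forall>i<m. norm (poly (p n i) z) \<le> K) \<and>
        norm (z ^ N - (\<Sum>i<m. poly (p n i) z * F n i z)) \<le> 1 / real (Suc n)"
      by metis
    have pK: "norm (poly (p n i) z) \<le> K" if "i < m" "z \<in> ball 0 1" for n i z
      by (rule norm_le_on_disc[of _ 2]) (use that p in \<open>auto intro!: holomorphic_intros\<close>)
    have pe: "norm (z ^ N - (\<Sum>i<m. poly (p n i) z * F n i z)) \<le> 1 / real (Suc n)" if "z \<in> ball 0 1" for n z
      by (rule norm_le_on_disc[of "\<lambda>z. z ^ N - (\<Sum>i<m. poly (p n i) z * F n i z)", OF _ R1[of n]])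
         (use that p hF in \<open>auto intro!: holomorphic_intros\<close>)
    obtain \<phi> g where \<phi>: "strict_mono (\<phi> :: nat \<Rightarrow> nat)"
      and g: "\<And>i. i < m \<Longrightarrow> g i holomorphic_on ball 0 1"
        "\<And>i z. i < m \<Longrightarrow> z \<in> ball 0 1 \<Longrightarrow> (\<lambda>n. poly (p (\<phi> n) i) z) \<longlonglongrightarrow> g i z"
    proof -
      have "poly (p n i) holomorphic_on ball 0 1" for n i
        unfolding holomorphic_on_def field_differentiable_def
        using has_field_derivative_at_within[OF poly_DERIV] by blast
      then show thesis using Montel_finite_family[of m "\<lambda>n i. poly (p n i)" K, OF _ pK] that by blast
    qed
    show "\<exists>N p. (\<forall>i<m. p i holomorphic_on ball 0 1 \<and> (\<forall>z\<in>ball 0 1. norm (p i z) \<le> K)) \<and>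
        (\<forall>z\<in>ball 0 1. (\<Sum>i<m. p i z * f i z) = z ^ N)"
    proof (intro exI conjI allI impI ballI)
      fix i assume i: "i < m"
      show "g i holomorphic_on ball 0 1" by (rule g(1)[OF i])
      fix z :: complex assume z: "z \<in> ball 0 1"
      show "norm (g i z) \<le> K"
        by (rule LIMSEQ_le_const2[OF tendsto_norm[OF g(2)[OF i z]]]) (use pK[OF i z] in auto)
    next
      fix z :: complex assume z: "z \<in> ball 0 1"
      have Fl: "(\<lambda>n. F (\<phi> n) i z) \<longlonglongrightarrow> f i z" if i: "i < m" for i
      proof -
        have "(\<lambda>n. of_real (r (\<phi> n)) * z) \<longlonglongrightarrow> 1 * z"
          using LIMSEQ_subseq_LIMSEQ[OF rlim \<phi>] by (intro tendsto_intros) (simp add: o_def)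
        moreover have "isCont (f i) z"
          by (rule DERIV_isCont[OF holomorphic_derivI[OF hf[OF i] open_ball z]])
        ultimately show ?thesis unfolding F_def by (intro isCont_tendsto_compose[of z "f i"]) auto
      qed
      have "(\<lambda>n. z ^ N - (\<Sum>i<m. poly (p (\<phi> n) i) z * F (\<phi> n) i z)) \<longlonglongrightarrow> z ^ N - (\<Sum>i<m. g i z * f i z)"
        by (intro tendsto_intros g(2) Fl z) auto
      moreover have "(\<lambda>n. z ^ N - (\<Sum>i<m. poly (p (\<phi> n) i) z * F (\<phi> n) i z)) \<longlonglongrightarrow> 0"
      proof (rule Lim_null_comparison)
        show "\<forall>\<^sub>F n in sequentially. norm (z ^ N - (\<Sum>i<m. poly (p (\<phi> n) i) z * F (\<phi> n) i z)) \<le> inverse (real (Suc (\<phi> n)))"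
          using pe[OF z] by (simp add: inverse_eq_divide)
        show "(\<lambda>n. inverse (real (Suc (\<phi> n)))) \<longlonglongrightarrow> 0"
          using LIMSEQ_subseq_LIMSEQ[OF LIMSEQ_inverse_real_of_nat \<phi>] by (simp add: o_def)
      qed
      ultimately show "(\<Sum>i<m. g i z * f i z) = z ^ N"
        using LIMSEQ_unique by fastforce
    qed
  qed
qed

section \<open>Fatou's theorem on radial limits\<close>

lemma one_minus_mult_nonzero:
  assumes "norm (z::complex) \<le> 1" "norm w < 1"
  shows "1 - w * z \<noteq> 0"
proof
  assume "1 - w * z = 0"
  then have "norm w * norm z = 1" by (metis eq_iff_diff_eq_0 norm_mult norm_one)
  moreover have "norm w * norm z \<le> norm w * 1" using assms by (intro mult_left_mono) auto
  ultimately show False using assms by simp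
qed

text \<open>The integrand is holomorphic beyond the closed disc and vanishes at 0. Such terms may be
  added to a kernel without changing its action on analytic functions.\<close>

lemma anticauchy_mean:
  assumes f: "f holomorphic_on ball 0 R" "1 < R" and w: "norm w < 1"
  shows "circle_mean 1 (\<lambda>z. f z * (cnj w * z / (1 - cnj w * z) ^ k)) = 0"
proof -
  obtain R' where R': "1 < R'" "R' \<le> R" "R' * norm w < 1"
  proof (cases "w = 0")
    case True then show ?thesis using that[of R] f by simp
  next
    case False
    have "1 < 1 / norm w" using w False by simp
    then obtain q where "1 < q" "q < min R (1 / norm w)" using f dense[of 1 "min R (1 / norm w)"] by auto
    then show ?thesis using that[of q] False by (auto simp: field_simps)
  qed
  have nz: "1 - cnj w * z \<noteq> 0" if z: "z \<in> ball 0 R'" for z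
  proof
    assume "1 - cnj w * z = 0"
    then have "norm w * norm z = 1" by (metis complex_mod_cnj eq_iff_diff_eq_0 norm_mult norm_one)
    moreover have "norm w * norm z \<le> norm w * R'" using z by (intro mult_left_mono) auto
    ultimately show False using R' by (simp add: mult.commute)
  qed
  have "(\<lambda>z. f z * (cnj w * z / (1 - cnj w * z) ^ k)) holomorphic_on ball 0 R'"
    using R' nz by (intro holomorphic_intros holomorphic_on_subset[OF f(1)]) auto
  from mean_value_holomorphic[OF this, of 1] R' show ?thesis by simp
qed

text \<open>The Poisson formula minus the part of the kernel that \<open>anticauchy_mean\<close>
  annihilates.\<close>

lemma cauchy_mean:
  assumes f: "f holomorphic_on ball 0 R" "1 < R" and w: "norm w < 1"
  shows "circle_mean 1 (\<lambda>z. f z * (z / (z - w))) = f w"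
proof -
  have cf: "continuous_on (sphere 0 1) f"
    by (rule continuous_on_subset[OF holomorphic_on_imp_continuous_on[OF f(1)]]) (use f in auto)
  have n: "1 - cnj w * z \<noteq> 0" if "norm z = 1" for z
    using one_minus_mult_nonzero[of z "cnj w"] that w by simp
  have cP: "continuous_on (sphere 0 1) (\<lambda>z. complex_of_real (poisson w z))"
    by (intro continuous_intros continuous_on_poisson) (use w in auto)
  have "circle_mean 1 (\<lambda>z. f z * (z / (z - w))) =
      circle_mean 1 (\<lambda>z. of_real (poisson w z) * f z - f z * (cnj w * z / (1 - cnj w * z) ^ 1))"
  proof (rule circle_mean_cong)
    fix z :: complex assume z: "norm z = 1"
    have zz: "z * cnj z = 1" using z complex_norm_square[of z] by simp
    have zw: "z - w \<noteq> 0" using z w by auto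
    have n2: "1 - w * cnj z \<noteq> 0" using one_minus_mult_nonzero[of "cnj z" w] z w by simp
    have e1: "z / (z - w) = 1 + w * cnj z / (1 - w * cnj z)"
    proof -
      have "z * (1 - w * cnj z) = z - w" using zz by (simp add: algebra_simps)
      then have "z / (z - w) = 1 / (1 - w * cnj z)" using n2 zw by (metis mult_cancel_left1 nonzero_divide_mult_cancel_left right_minus_eq times_divide_eq_left mult_zero_left)
      then show ?thesis using n2 by (simp add: divide_simps)
    qed
    have e2: "1 / (1 - cnj w * z) = 1 + cnj w * z / (1 - cnj w * z)" using n[OF z] by (simp add: divide_simps)
    show "f z * (z / (z - w)) = of_real (poisson w z) * f z - f z * (cnj w * z / (1 - cnj w * z) ^ 1)"
      unfolding poisson_decomp[OF z w] e1 e2 by (simp add: algebra_simps)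
  qed simp
  also have "\<dots> = circle_mean 1 (\<lambda>z. of_real (poisson w z) * f z) - circle_mean 1 (\<lambda>z. f z * (cnj w * z / (1 - cnj w * z) ^ 1))"
    by (rule circle_mean_diff) (use n in \<open>auto intro!: continuous_intros cP cf\<close>)
  also have "\<dots> = f w" using poisson_formula[OF f w] anticauchy_mean[OF f w, of 1] by simp
  finally show ?thesis .
qed

text \<open>Subtracting \<open>f w\<close> leaves the difference quotient \<open>g\<close> against
  the Cauchy kernel, which reproduces \<open>g w\<close>, the derivative. The squared kernel itself
  has mean 0, being on the circle the conjugate of a function holomorphic on the disc and zero at
  the origin.\<close>

lemma cauchy_mean_deriv:
  assumes f: "f holomorphic_on ball 0 R" "1 < R" and w: "norm w < 1"
  shows "circle_mean 1 (\<lambda>z. f z * (z / (z - w)\<^sup>2)) = deriv f w"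
proof -
  define g where "g = (\<lambda>z. if z = w then deriv f w else (f z - f w) / (z - w))"
  have g: "g holomorphic_on ball 0 R"
    unfolding g_def by (rule pole_lemma[OF f(1)]) (use w f in auto)
  have cg: "continuous_on (sphere 0 1) g"
    by (rule continuous_on_subset[OF holomorphic_on_imp_continuous_on[OF g]]) (use f in auto)
  have zw: "z - w \<noteq> 0" if "norm z = 1" for z using that w by auto
  have n: "1 - cnj w * z \<noteq> 0" if "norm z = 1" for z
    using one_minus_mult_nonzero[of z "cnj w"] that w by simp
  have z0: "circle_mean 1 (\<lambda>z. z / (z - w)\<^sup>2) = 0"
  proof -
    have "circle_mean 1 (\<lambda>z. z / (z - w)\<^sup>2) = circle_mean 1 (\<lambda>z. cnj (z / (1 - cnj w * z)\<^sup>2))"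
    proof (rule circle_mean_cong)
      fix z :: complex assume z: "norm z = 1"
      have zz: "z * cnj z = 1" using z complex_norm_square[of z] by simp
      have "1 - w * cnj z = cnj z * (z - w)" using zz by (simp add: algebra_simps)
      then have "cnj (z / (1 - cnj w * z)\<^sup>2) = cnj z / (cnj z * (z - w))\<^sup>2" by simp
      also have "\<dots> = z / (z - w)\<^sup>2"
      proof -
        have "cnj z \<noteq> 0" using zz by auto
        then have "cnj z / (cnj z * (z - w))\<^sup>2 = (z * cnj z) * (cnj z / (cnj z * (z - w))\<^sup>2)" using zz by simp
        also have "\<dots> = z / (z - w)\<^sup>2" using \<open>cnj z \<noteq> 0\<close> zw[OF z] by (simp add: power2_eq_square divide_simps)
        finally show ?thesis .
      qed
      finally show "z / (z - w)\<^sup>2 = cnj (z / (1 - cnj w * z)\<^sup>2)" by simp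
    qed simp
    also have "\<dots> = cnj (circle_mean 1 (\<lambda>z. z / (1 - cnj w * z)\<^sup>2))"
      by (rule circle_mean_cnj) (use n in \<open>auto intro!: continuous_intros\<close>)
    also have "circle_mean 1 (\<lambda>z. z / (1 - cnj w * z)\<^sup>2) = 0"
    proof (cases "w = 0")
      case True
      then show ?thesis using mean_value_holomorphic[of "\<lambda>z. z" 2 1] by (simp add: holomorphic_intros)
    next
      case False
      have "circle_mean 1 (\<lambda>z. cnj w * (z / (1 - cnj w * z)\<^sup>2)) = 0"
        using anticauchy_mean[of "\<lambda>z. 1" R w 2] f w by simp
      then show ?thesis using False unfolding circle_mean_cmult by simp
    qed
    finally show ?thesis by simp
  qed
  have "circle_mean 1 (\<lambda>z. f z * (z / (z - w)\<^sup>2)) = circle_mean 1 (\<lambda>z. g z * (z / (z - w)) + f w * (z / (z - w)\<^sup>2))"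
  proof (rule circle_mean_cong)
    fix z :: complex assume z: "norm z = 1"
    then show "f z * (z / (z - w)\<^sup>2) = g z * (z / (z - w)) + f w * (z / (z - w)\<^sup>2)"
      using zw[OF z] by (simp add: g_def power2_eq_square add_divide_distrib[symmetric] distrib_right[symmetric])
  qed simp
  also have "\<dots> = circle_mean 1 (\<lambda>z. g z * (z / (z - w))) + circle_mean 1 (\<lambda>z. f w * (z / (z - w)\<^sup>2))"
    by (rule circle_mean_add) (use zw in \<open>auto intro!: continuous_intros cg\<close>)
  also have "\<dots> = deriv f w" unfolding circle_mean_cmult z0 cauchy_mean[OF g f(2) w] by (simp add: g_def)
  finally show ?thesis .
qed

text \<open>The first summand reproduces \<open>w * deriv f w\<close>, the second annihilates
  analytic functions. It is subtracted because the difference gains a factor \<open>1 - r^2\<close>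
  on the ray of radius \<open>r\<close>, as the comparison with the Poisson kernel requires.\<close>

definition conjugate_derivative_kernel :: "complex \<Rightarrow> complex \<Rightarrow> complex"
  where "conjugate_derivative_kernel w z = w * (z / (z - w)\<^sup>2) - cnj w * z / (1 - cnj w * z)\<^sup>2"

lemma conjugate_derivative_kernel_mean:
  assumes f: "f holomorphic_on ball 0 R" "1 < R" and w: "norm w < 1"
  shows "circle_mean 1 (\<lambda>z. f z * conjugate_derivative_kernel w z) = w * deriv f w"
proof -
  have cf: "continuous_on (sphere 0 1) f"
    by (rule continuous_on_subset[OF holomorphic_on_imp_continuous_on[OF f(1)]]) (use f in auto)
  have n: "1 - cnj w * z \<noteq> 0" "z - w \<noteq> 0" if "norm z = 1" for z
    using one_minus_mult_nonzero[of z "cnj w"] that w by auto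
  have "circle_mean 1 (\<lambda>z. f z * conjugate_derivative_kernel w z) =
    circle_mean 1 (\<lambda>z. w * (f z * (z / (z - w)\<^sup>2))) - circle_mean 1 (\<lambda>z. f z * (cnj w * z / (1 - cnj w * z)\<^sup>2))"
    unfolding conjugate_derivative_kernel_def
    by (subst circle_mean_diff[symmetric]) (use n in \<open>auto intro!: continuous_intros cf simp: algebra_simps\<close>)
  then show ?thesis
    unfolding circle_mean_cmult cauchy_mean_deriv[OF f w] anticauchy_mean[OF f w, of 2] by simp
qed

lemma continuous_conjugate_derivative_kernel:
  assumes "norm w < 1"
  shows "continuous_on (sphere 0 1) (conjugate_derivative_kernel w)"
proof -
  have "1 - cnj w * z \<noteq> 0" "z - w \<noteq> 0" if "norm z = 1" for z
    using one_minus_mult_nonzero[of z "cnj w"] that assms by auto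
  then show ?thesis unfolding conjugate_derivative_kernel_def by (intro continuous_intros) auto
qed

text \<open>
  On the circle the kernel is \<open>2 * \<i> * Im (w * cnj z / (1 - w * cnj z)\<^sup>2)\<close>: the angular derivative
  of the Poisson kernel. It vanishes at the radial point, which gains the factor needed below.
\<close>

lemma conjugate_derivative_kernel_bound:
  assumes z: "norm z = 1" and z0: "norm z0 = 1" and r: "0 \<le> r" "r < 1"
  shows "norm (conjugate_derivative_kernel (of_real r * z0) z) * norm (z - z0) \<le> 8 * poisson (of_real r * z0) z"
proof -
  define w where "w = of_real r * z0"
  \<comment> \<open>By rotation only the angle between \<open>z\<close> and \<open>z0\<close>
    matters; on the circle the two summands of the kernel become conjugate expressions in
    \<open>u\<close>.\<close>
  define u where "u = z0 * cnj z"
  have zz: "z * cnj z = 1" using z complex_norm_square[of z] by simp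
  have uu: "u * cnj u = 1" using z z0 complex_norm_square[of u] by (simp add: u_def norm_mult)
  have w1: "norm w < 1" using r z0 by (simp add: w_def norm_mult)
  have n: "1 - of_real r * u \<noteq> 0" "1 - of_real r * cnj u \<noteq> 0"
    using one_minus_mult_nonzero[of u "of_real r"] one_minus_mult_nonzero[of "cnj u" "of_real r"] r z z0 by (auto simp: u_def norm_mult)
  have d1: "1 - of_real r * u = cnj z * (z - w)" using zz by (simp add: u_def w_def algebra_simps)
  have "w * (z / (z - w)\<^sup>2) = of_real r * u / (1 - of_real r * u)\<^sup>2"
  proof -
    have cz: "cnj z \<noteq> 0" "z - w \<noteq> 0" using zz z w1 by auto
    have "of_real r * u / (1 - of_real r * u)\<^sup>2 = (z * cnj z) * (w * cnj z / (cnj z * (z - w))\<^sup>2)"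
      unfolding d1 zz by (simp add: u_def w_def mult_ac)
    also have "\<dots> = w * (z / (z - w)\<^sup>2)" using cz by (simp add: power2_eq_square divide_simps)
    finally show ?thesis by simp
  qed
  moreover have "cnj w * z = of_real r * cnj u" by (simp add: u_def w_def)
  ultimately have K: "conjugate_derivative_kernel w z = of_real r * u / (1 - of_real r * u)\<^sup>2 - of_real r * cnj u / (1 - of_real r * cnj u)\<^sup>2"
    by (simp add: conjugate_derivative_kernel_def)
  also have "\<dots> = of_real r * (1 - of_real r ^ 2) * (u - cnj u) / ((1 - of_real r * u) * (1 - of_real r * cnj u))\<^sup>2"
  proof -
    have "of_real r * u * (1 - of_real r * cnj u)\<^sup>2 - of_real r * cnj u * (1 - of_real r * u)\<^sup>2 = of_real r * (1 - of_real r ^ 2) * (u - cnj u)"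
      using uu by algebra
    then show ?thesis using n by (simp add: diff_frac_eq power_mult_distrib)
  qed
  finally have "norm (conjugate_derivative_kernel w z) = r * (1 - r\<^sup>2) * norm (u - cnj u) / (norm (1 - of_real r * u) * norm (1 - of_real r * cnj u))\<^sup>2"
  proof -
    have "norm (1 - complex_of_real r ^ 2) = 1 - r\<^sup>2"
    proof -
      have "1 - complex_of_real r ^ 2 = of_real (1 - r\<^sup>2)" by simp
      then have "norm (1 - complex_of_real r ^ 2) = \<bar>1 - r\<^sup>2\<bar>" by (simp only: norm_of_real)
      then show ?thesis using power_le_one[OF r(1), of 2] r by simp
    qed
    then show "conjugate_derivative_kernel w z = of_real r * (1 - of_real r ^ 2) * (u - cnj u) / ((1 - of_real r * u) * (1 - of_real r * cnj u))\<^sup>2 \<Longrightarrow> ?thesis"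
      using r by (simp add: norm_mult norm_divide norm_power)
  qed
  moreover have "norm (1 - of_real r * cnj u) = norm (1 - of_real r * u)"
    by (metis complex_cnj_complex_of_real complex_cnj_diff complex_cnj_mult complex_cnj_one complex_mod_cnj)
  moreover have "norm (1 - of_real r * u) = norm (z - w)" unfolding d1 using z by (simp add: norm_mult)
  ultimately have nK: "norm (conjugate_derivative_kernel w z) = r * (1 - r\<^sup>2) * norm (u - cnj u) / norm (z - w) ^ 4"
    by (simp add: power4_eq_xxxx power2_eq_square mult_ac)
  have nu: "norm (u - cnj u) \<le> 2 * norm (z - z0)"
  proof -
    have "u - 1 = - (cnj z * (z - z0))" using zz by (simp add: u_def algebra_simps)
    then have "norm (u - 1) = norm (z - z0)" using z by (metis complex_mod_cnj mult_1 norm_minus_cancel norm_mult)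
    moreover have "norm (u - cnj u) \<le> norm (u - 1) + norm (cnj (u - 1))"
      using norm_triangle_ineq4[of "u - 1" "cnj (u - 1)"] by simp
    ultimately show ?thesis by (simp only: complex_mod_cnj)
  qed
  \<comment> \<open>Together with \<open>nu\<close> this absorbs two of the four powers of
    \<open>norm (z - w)\<close>; the other two and \<open>1 - r^2\<close> form the Poisson
    kernel.\<close>
  have dz: "norm (z - z0) \<le> 2 * norm (z - w)"
  proof -
    have "norm (w - z0) = 1 - r"
    proof -
      have "w - z0 = of_real (r - 1) * z0" by (simp add: w_def algebra_simps)
      then show ?thesis using z0 r by (simp only: norm_mult norm_of_real) simp
    qed
    moreover have "1 - r \<le> norm (z - w)" using norm_triangle_ineq2[of z w] z z0 r by (simp add: w_def norm_mult)
    moreover have "norm (z - z0) \<le> norm (z - w) + norm (w - z0)" using norm_triangle_ineq[of "z - w" "w - z0"] by simp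
    ultimately show ?thesis by simp
  qed
  have zw: "0 < norm (z - w)" using z w1 by auto
  have "norm (conjugate_derivative_kernel w z) * norm (z - z0) = r * (1 - r\<^sup>2) * (norm (u - cnj u) * norm (z - z0)) / norm (z - w) ^ 4"
    unfolding nK by simp
  also have "\<dots> \<le> 1 * (1 - r\<^sup>2) * ((2 * (2 * norm (z - w))) * (2 * norm (z - w))) / norm (z - w) ^ 4"
    using r nu dz zw by (intro divide_right_mono mult_mono order_trans[OF nu]) (auto simp: power_le_one)
  also have "\<dots> = 8 * poisson w z"
    using zw r z0 by (simp add: poisson_def w_def norm_mult power4_eq_xxxx power2_eq_square)
  finally show ?thesis by (simp add: w_def)
qed

text \<open>Subtract the linear approximation, so that \<open>g\<close> is small relative to
  \<open>norm (z - z0)\<close> near \<open>z0\<close>. The kernel times this distance is at most 8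
  Poisson kernels, so the part near \<open>z0\<close> contributes little by total mass 1, while the
  rest tends to 0 with \<open>1 - r^2\<close>.\<close>

lemma radial_limit_of_derivative:
  assumes cG: "continuous_on (cball 0 1) G" and hG: "G holomorphic_on ball 0 1" and z0: "norm z0 = 1"
    and diff: "\<And>e. 0 < e \<Longrightarrow> \<exists>d>0. \<forall>z. norm z = 1 \<longrightarrow> norm (z - z0) < d \<longrightarrow> norm (G z - G z0 - a * (z - z0)) \<le> e * norm (z - z0)"
  shows "((\<lambda>r. deriv G (of_real r * z0)) \<longlongrightarrow> a) (at_left 1)"
proof -
  define g where "g = (\<lambda>z. G z - G z0 - a * (z - z0))"
  have cg: "continuous_on (cball 0 1) g" unfolding g_def by (intro continuous_intros cG)
  have hg: "g holomorphic_on ball 0 1" unfolding g_def by (intro holomorphic_intros hG)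
  have dg: "deriv g z = deriv G z - a" if "z \<in> ball 0 1" for z
    unfolding g_def
    by (rule DERIV_imp_deriv) (rule derivative_eq_intros holomorphic_derivI[OF hG open_ball that] refl | simp)+
  obtain B where "\<forall>x\<in>g ` cball 0 1. norm x \<le> B"
    using compact_imp_bounded[OF compact_continuous_image[OF cg compact_cball]] unfolding bounded_iff by blast
  then have B: "norm (g z) \<le> B" if "norm z \<le> 1" for z using that by auto
  \<comment> \<open>The kernel formula asks for holomorphy beyond the closed disc, whereas
    \<open>g\<close> is only continuous there. It is applied to dilations, and uniform continuity
    passes to the limit.\<close>
  have formula: "circle_mean 1 (\<lambda>z. g z * conjugate_derivative_kernel w z) = w * deriv g w" if w: "norm w < 1" for w
  proof -
    define K where "K = conjugate_derivative_kernel w"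
    have cK: "continuous_on (sphere 0 1) K" unfolding K_def by (rule continuous_conjugate_derivative_kernel[OF w])
    define \<rho> where "\<rho> = (\<lambda>n. 1 - inverse (real (Suc (Suc n))))"
    have \<rho>: "0 < \<rho> n" "\<rho> n < 1" for n
      by (auto simp: \<rho>_def inverse_eq_divide)
    have \<rho>1: "\<rho> \<longlonglongrightarrow> 1"
      using tendsto_diff[OF tendsto_const[of 1] LIMSEQ_Suc[OF LIMSEQ_inverse_real_of_nat]] by (simp add: \<rho>_def)
    have e: "circle_mean 1 (\<lambda>z. g (of_real (\<rho> n) * z) * K z) = w * (of_real (\<rho> n) * deriv g (of_real (\<rho> n) * w))" for n
    proof -
      have in1: "of_real (\<rho> n) * z \<in> ball 0 1" if "z \<in> ball 0 (1 / \<rho> n)" for z :: complex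
        using that \<rho>[of n] by (simp add: norm_mult field_simps)
      have "(\<lambda>z. g (of_real (\<rho> n) * z)) holomorphic_on ball 0 (1 / \<rho> n)"
        using in1 by (intro holomorphic_on_compose_gen[of "\<lambda>z. of_real (\<rho> n) * z" _ g "ball 0 1", unfolded o_def] holomorphic_intros hg) auto
      moreover have "1 < 1 / \<rho> n" using \<rho>[of n] by simp
      moreover have "deriv (\<lambda>z. g (of_real (\<rho> n) * z)) w = of_real (\<rho> n) * deriv g (of_real (\<rho> n) * w)"
      proof -
        have "of_real (\<rho> n) * w \<in> ball 0 1"
        proof (rule in1)
          show "w \<in> ball 0 (1 / \<rho> n)" using w \<open>1 < 1 / \<rho> n\<close> by simp
        qed
        from holomorphic_derivI[OF hg open_ball this]
        have "(g has_field_derivative deriv g (of_real (\<rho> n) * w)) (at (of_real (\<rho> n) * w))" .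
        from DERIV_chain2[where f=g and g="\<lambda>z. of_real (\<rho> n) * z" and x=w and Db="of_real (\<rho> n)" and s=UNIV, OF this]
        have "((\<lambda>z. g (of_real (\<rho> n) * z)) has_field_derivative deriv g (of_real (\<rho> n) * w) * of_real (\<rho> n)) (at w)"
          by (auto intro!: derivative_eq_intros)
        then show ?thesis by (simp add: DERIV_imp_deriv mult.commute)
      qed
      ultimately show ?thesis
        using conjugate_derivative_kernel_mean[of "\<lambda>z. g (of_real (\<rho> n) * z)" "1 / \<rho> n" w] w by (simp add: K_def)
    qed
    have L1: "(\<lambda>n. circle_mean 1 (\<lambda>z. g (of_real (\<rho> n) * z) * K z)) \<longlonglongrightarrow> circle_mean 1 (\<lambda>z. g z * K z)"
    proof -
      obtain C where "\<forall>x\<in>K ` sphere 0 1. norm x \<le> C"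
        using compact_imp_bounded[OF compact_continuous_image[OF cK compact_sphere]] unfolding bounded_iff by blast
      then have C: "norm (K z) \<le> C" if "norm z = 1" for z using that by auto
      have C0: "0 \<le> C" by (rule order_trans[OF norm_ge_zero C[of 1]]) simp
      have uc: "uniformly_continuous_on (cball 0 1) g" by (rule compact_uniformly_continuous[OF cg compact_cball])
      show ?thesis
      proof (rule LIMSEQ_I)
        fix e :: real assume e: "0 < e"
        obtain d where d: "0 < d" "\<And>x y. x \<in> cball 0 1 \<Longrightarrow> y \<in> cball 0 1 \<Longrightarrow> dist y x < d \<Longrightarrow> dist (g y) (g x) < e / (C + 1)"
          using uc e C0 unfolding uniformly_continuous_on_def by (metis add_nonneg_pos divide_pos_pos zero_less_one)
        obtain n0 where n0: "\<And>n. n0 \<le> n \<Longrightarrow> norm (\<rho> n - 1) < d"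
          using LIMSEQ_D[OF \<rho>1 d(1)] by blast
        show "\<exists>n0. \<forall>n\<ge>n0. norm (circle_mean 1 (\<lambda>z. g (of_real (\<rho> n) * z) * K z) - circle_mean 1 (\<lambda>z. g z * K z)) < e"
        proof (intro exI allI impI)
          fix n assume n: "n0 \<le> n"
          have sub: "of_real (\<rho> n) * z \<in> cball 0 1" if "norm z = 1" for z :: complex
            using \<rho>[of n] that by (simp add: norm_mult)
          have cgr: "continuous_on (sphere 0 1) (\<lambda>z. g (of_real (\<rho> n) * z))"
            by (intro continuous_on_compose2[OF cg] continuous_intros) (use sub in auto)
          have cgs: "continuous_on (sphere 0 1) g" by (rule continuous_on_subset[OF cg]) auto
          have "circle_mean 1 (\<lambda>z. g (of_real (\<rho> n) * z) * K z) - circle_mean 1 (\<lambda>z. g z * K z) =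
            circle_mean 1 (\<lambda>z. g (of_real (\<rho> n) * z) * K z - g z * K z)"
            by (rule circle_mean_diff[symmetric]) (auto intro!: continuous_intros cgr cK cgs)
          also have "norm \<dots> \<le> circle_mean 1 (\<lambda>z. e / (C + 1) * C)"
          proof (rule circle_mean_norm_le)
            fix z :: complex assume z: "norm z = 1"
            have "dist (of_real (\<rho> n) * z) z < d"
            proof -
              have "of_real (\<rho> n) * z - z = of_real (\<rho> n - 1) * z" by (simp add: algebra_simps)
              then show ?thesis using n0[OF n] z by (simp add: dist_norm norm_mult del: of_real_diff)
            qed
            then have "norm (g (of_real (\<rho> n) * z) - g z) \<le> e / (C + 1)"
              using d(2)[of z "of_real (\<rho> n) * z"] sub[OF z] z by (auto simp: dist_norm intro: less_imp_le)
            then have "norm (g (of_real (\<rho> n) * z) - g z) * norm (K z) \<le> e / (C + 1) * C"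
              using C[OF z] e C0 by (intro mult_mono) auto
            then show "norm (g (of_real (\<rho> n) * z) * K z - g z * K z) \<le> e / (C + 1) * C"
              by (simp add: norm_mult flip: left_diff_distrib)
          qed (auto intro!: continuous_intros cgr cK cgs)
          also have "\<dots> < e" using e C0 by (simp add: field_simps)
          finally show "norm (circle_mean 1 (\<lambda>z. g (of_real (\<rho> n) * z) * K z) - circle_mean 1 (\<lambda>z. g z * K z)) < e" .
        qed
      qed
    qed
    have L2: "(\<lambda>n. w * (of_real (\<rho> n) * deriv g (of_real (\<rho> n) * w))) \<longlonglongrightarrow> w * (1 * deriv g w)"
    proof (intro tendsto_intros)
      show r1: "(\<lambda>n. complex_of_real (\<rho> n)) \<longlonglongrightarrow> 1" using tendsto_of_real[OF \<rho>1] by simp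
      have "isCont (deriv g) w"
        by (rule DERIV_isCont[OF holomorphic_derivI[OF holomorphic_deriv[OF hg open_ball] open_ball]]) (use w in simp)
      moreover have "(\<lambda>n. of_real (\<rho> n) * w) \<longlonglongrightarrow> 1 * w" by (intro tendsto_intros r1)
      ultimately show "(\<lambda>n. deriv g (of_real (\<rho> n) * w)) \<longlonglongrightarrow> deriv g w"
        by (intro isCont_tendsto_compose[of w "deriv g"]) auto
    qed
    show ?thesis using LIMSEQ_unique[OF L1[unfolded e] L2] by (simp only: K_def mult_1)
  qed
  have est: "\<forall>\<^sub>F r in at_left 1. norm (of_real r * z0 * (deriv G (of_real r * z0) - a)) < e" if e: "0 < e" for e
  proof -
    have B0: "0 \<le> B" by (rule order_trans[OF norm_ge_zero B[of 0]]) simp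
    \<comment> \<open>16 because the kernel costs a factor 8 and half of \<open>e\<close> is
      reserved for the far part.\<close>
    obtain d where d: "0 < d" "\<And>z. norm z = 1 \<Longrightarrow> norm (z - z0) < d \<Longrightarrow> norm (g z) \<le> e / 16 * norm (z - z0)"
      using diff[of "e / 16"] e unfolding g_def by auto
    \<comment> \<open>For \<open>z\<close> at distance at least \<open>d\<close> from
      \<open>z0\<close>: \<open>B / d\<close> turns the bound \<open>B\<close> into a multiple of
      \<open>norm (z - z0)\<close>, and \<open>4 / d^2\<close> bounds the Poisson kernel,
      \<open>z\<close> being then at distance at least \<open>d / 2\<close> from
      \<open>w\<close>.\<close>
    define C where "C = 8 * (B / d) * (4 / d\<^sup>2)"
    have "((\<lambda>r::real. C * (1 - r\<^sup>2)) \<longlongrightarrow> C * (1 - 1\<^sup>2)) (at_left 1)" by (intro tendsto_intros)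
    then have "\<forall>\<^sub>F r in at_left 1. C * (1 - r\<^sup>2) < e / 2" by (rule order_tendstoD) (use e in simp)
    moreover have "\<forall>\<^sub>F r::real in at_left 1. 0 < r \<and> r < 1"
      unfolding eventually_at_left_field by (intro exI[of _ 0]) auto
    ultimately show ?thesis
    proof eventually_elim
      case (elim r)
      then have r: "0 \<le> r" "r < 1" by auto
      define w where "w = of_real r * z0"
      have w1: "norm w < 1" using r z0 by (simp add: w_def norm_mult)
      have cP: "continuous_on (sphere 0 1) (poisson w)"
        by (intro continuous_on_poisson continuous_intros) (use w1 in auto)
      have "norm (w * deriv g w) \<le> circle_mean 1 (\<lambda>z. e / 2 * poisson w z + C * (1 - r\<^sup>2))"
        unfolding formula[OF w1, symmetric]
      proof (rule circle_mean_norm_le)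
        show "continuous_on (sphere 0 1) (\<lambda>z. g z * conjugate_derivative_kernel w z)"
          by (intro continuous_intros continuous_conjugate_derivative_kernel w1 continuous_on_subset[OF cg]) auto
        show "continuous_on (sphere 0 1) (\<lambda>z. e / 2 * poisson w z + C * (1 - r\<^sup>2))" by (intro continuous_intros cP)
        fix z :: complex assume z: "norm z = 1"
        have P0: "0 \<le> poisson w z" using w1 by (intro poisson_nonneg) simp
        have C0: "0 \<le> C * (1 - r\<^sup>2)" unfolding C_def using B0 d r by (intro mult_nonneg_nonneg) (auto simp: power_le_one)
        have kb: "norm (conjugate_derivative_kernel w z) * norm (z - z0) \<le> 8 * poisson w z"
          unfolding w_def by (rule conjugate_derivative_kernel_bound[OF z z0 r])
        have *: "norm (g z * conjugate_derivative_kernel w z) \<le> c * (8 * poisson w z)" if "norm (g z) \<le> c * norm (z - z0)" "0 \<le> c" for c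
        proof -
          have "norm (g z * conjugate_derivative_kernel w z) \<le> c * norm (z - z0) * norm (conjugate_derivative_kernel w z)"
            unfolding norm_mult by (intro mult_right_mono that) auto
          also have "\<dots> \<le> c * (8 * poisson w z)" using mult_left_mono[OF kb that(2)] by (simp add: mult_ac)
          finally show ?thesis .
        qed
        show "norm (g z * conjugate_derivative_kernel w z) \<le> e / 2 * poisson w z + C * (1 - r\<^sup>2)"
        proof (cases "norm (z - z0) < d")
          case True
          then show ?thesis using *[OF d(2)[OF z True]] e C0 by simp
        next
          case False
          have "norm (g z) \<le> B / d * norm (z - z0)"
          proof -
            have "norm (g z) \<le> B" using B z by simp
            also have "\<dots> = B / d * d" using d by simp
            also have "\<dots> \<le> B / d * norm (z - z0)" using False B0 d by (intro mult_left_mono) auto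
            finally show ?thesis .
          qed
          then have "norm (g z * conjugate_derivative_kernel w z) \<le> B / d * (8 * poisson w z)"
            by (rule *) (use B0 d in simp)
          also have "\<dots> \<le> B / d * (8 * ((1 - r\<^sup>2) / (d / 2)\<^sup>2))"
          proof (intro mult_left_mono)
            have "norm (w - z0) = 1 - r"
            proof -
              have "w - z0 = of_real (r - 1) * z0" by (simp add: w_def algebra_simps)
              then show ?thesis using z0 r by (simp only: norm_mult norm_of_real) simp
            qed
            moreover have "1 - r \<le> norm (z - w)" using norm_triangle_ineq2[of z w] z z0 r by (simp add: w_def norm_mult)
            moreover have "norm (z - z0) \<le> norm (z - w) + norm (w - z0)" using norm_triangle_ineq[of "z - w" "w - z0"] by simp
            ultimately have "d / 2 \<le> norm (z - w)" using False by simp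
            then show "poisson w z \<le> (1 - r\<^sup>2) / (d / 2)\<^sup>2"
              using poisson_le_far[of w "d / 2" z] w1 d r z0 by (simp add: w_def norm_mult)
          qed (use B0 d in auto)
          also have "\<dots> = C * (1 - r\<^sup>2)" by (simp add: C_def power2_eq_square)
          finally show ?thesis using P0 e by (simp add: add_increasing)
        qed
      qed simp
      also have "\<dots> = e / 2 + C * (1 - r\<^sup>2)"
      proof -
        have "circle_mean 1 (\<lambda>z. e / 2 * poisson w z + C * (1 - r\<^sup>2)) = circle_mean 1 (\<lambda>z. e / 2 * poisson w z) + circle_mean 1 (\<lambda>z. C * (1 - r\<^sup>2))"
          by (rule circle_mean_add) (auto intro!: continuous_intros cP)
        then show ?thesis unfolding circle_mean_cmult circle_mean_const poisson_mean[OF w1] by simp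
      qed
      also have "\<dots> < e" using elim by simp
      finally show ?case using dg[of w] w1 by (simp add: w_def)
    qed
  qed
  have "((\<lambda>r. of_real r * z0 * (deriv G (of_real r * z0) - a)) \<longlongrightarrow> 0) (at_left 1)"
    unfolding tendsto_iff using est by simp
  moreover have "((\<lambda>r. inverse (complex_of_real r * z0)) \<longlongrightarrow> inverse (complex_of_real 1 * z0)) (at_left 1)"
    by (intro tendsto_intros) (use z0 in auto)
  ultimately have "((\<lambda>r. inverse (of_real r * z0) * (of_real r * z0 * (deriv G (of_real r * z0) - a)) + a) \<longlongrightarrow> inverse (of_real 1 * z0) * 0 + a) (at_left 1)"
    by (intro tendsto_mult tendsto_add tendsto_const)
  then have "((\<lambda>r. inverse (of_real r * z0) * (of_real r * z0 * (deriv G (of_real r * z0) - a)) + a) \<longlongrightarrow> a) (at_left 1)" by simp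
  moreover have "\<forall>\<^sub>F r::real in at_left 1. inverse (of_real r * z0) * (of_real r * z0 * (deriv G (of_real r * z0) - a)) + a = deriv G (of_real r * z0)"
  proof -
    have "\<forall>\<^sub>F r::real in at_left 1. 0 < r \<and> r < 1"
      unfolding eventually_at_left_field by (intro exI[of _ 0]) auto
    then show ?thesis
    proof eventually_elim
      case (elim r)
      then have "of_real r * z0 \<noteq> 0" using z0 by auto
      moreover have "inverse c * (c * x) = x" if "c \<noteq> 0" for c x :: complex
        using that by (simp flip: mult.assoc)
      ultimately have "inverse (of_real r * z0) * (of_real r * z0 * (deriv G (of_real r * z0) - a)) = deriv G (of_real r * z0) - a"
        by blast
      then show ?case by (simp only: diff_add_cancel)
    qed
  qed
  ultimately show ?thesis by (rule Lim_transform_eventually)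
qed

section \<open>Normalised arc length and integrals over the circle\<close>

interpretation circle_measure: prob_space circle_measure
  by (rule prob_space_circle_measure)

lemma borel_measurable_circle_continuous:
  fixes f :: "complex \<Rightarrow> 'a::topological_space"
  assumes "continuous_on (sphere 0 1) f"
  shows "f \<in> borel_measurable circle_measure"
  using borel_measurable_continuous_on_restrict[OF assms]
  by (simp add: measurable_cong_sets[OF sets_circle_measure refl])

lemma AE_circle_measureD:
  assumes "AE z in circle_measure. P z"
  shows "AE t in lborel. t \<in> {0..2*pi} \<longrightarrow> P (cis t)"
proof -
  have "AE t in uniform_measure lborel {0..2*pi}. P (cis t)"
    using AE_distrD[OF measurable_cis_circle] assms unfolding circle_measure_def by blast
  then have "AE t in lborel. 0 < indicator {0..2*pi} t / emeasure lborel {0..2*pi} \<longrightarrow> P (cis t)"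
    unfolding uniform_measure_def by (subst (asm) AE_density) auto
  then show ?thesis
    by eventually_elim (auto simp: ennreal_zero_less_divide)
qed

lemma cis_Arg2pi: "norm z = 1 \<Longrightarrow> cis (Arg2pi z) = z"
  using Arg2pi_eq[of z] by (simp add: cis_conv_exp)

lemma Arg2pi_cis: "0 \<le> t \<Longrightarrow> t < 2 * pi \<Longrightarrow> Arg2pi (cis t) = t"
  by (rule Arg2pi_unique[of 1]) (simp_all add: cis_conv_exp)

lemma nonneg_Reals_unit: "norm (z::complex) = 1 \<Longrightarrow> z \<in> \<real>\<^sub>\<ge>\<^sub>0 \<Longrightarrow> z = 1"
  by (auto simp: nonneg_Reals_def)

lemma cis_not_nonneg_Reals: "0 < t \<Longrightarrow> t < 2 * pi \<Longrightarrow> cis t \<notin> \<real>\<^sub>\<ge>\<^sub>0"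
proof
  assume t: "0 < t" "t < 2 * pi" "cis t \<in> \<real>\<^sub>\<ge>\<^sub>0"
  then have "cis t = cis 0" using nonneg_Reals_unit[of "cis t"] by simp
  then have "Arg2pi (cis t) = Arg2pi (cis 0)" by simp
  then show False using t Arg2pi_cis[of t] Arg2pi_cis[of 0] by (simp del: cis_zero)
qed

text \<open>The property need not be measurable, so an explicit Borel null set on the circle is
  built: the points whose argument lies in a null set of angles. The point 1, where the argument
  jumps, is included.\<close>

lemma AE_circle_measureI:
  assumes "AE t in lborel. t \<in> {0<..<2*pi} \<longrightarrow> P (cis t)"
  shows "AE z in circle_measure. P z"
proof -
  obtain N where N: "{t. \<not> (t \<in> {0<..<2*pi} \<longrightarrow> P (cis t))} \<subseteq> N" "emeasure lborel N = 0" "N \<in> sets lborel"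
    using AE_E[OF assms] by auto
  \<comment> \<open>Cutting off the branch line makes the argument Borel measurable on the whole
    plane.\<close>
  define a where "a = (\<lambda>z. indicator (- \<real>\<^sub>\<ge>\<^sub>0) z *\<^sub>R Arg2pi z)"
  have "continuous_on (- \<real>\<^sub>\<ge>\<^sub>0) Arg2pi"
    using continuous_at_Arg2pi by (auto intro: continuous_at_imp_continuous_on)
  then have a: "a \<in> borel_measurable borel"
    unfolding a_def by (intro borel_measurable_continuous_on_indicator) auto
  define A where "A = sphere 0 1 \<inter> ({1} \<union> a -` N)"
  have Ab: "A \<in> sets borel"
    unfolding A_def using measurable_sets_borel[OF a, of N] N(3) by auto
  have As: "{z \<in> space (restrict_space borel (sphere 0 1)). z \<notin> A} \<in> sets (restrict_space borel (sphere (0::complex) 1))"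
    using Ab by (auto simp: sets_restrict_space_iff space_restrict_space Collect_conj_eq)
  have "AE t in lborel. t \<notin> N" using N by (intro AE_not_in) (auto simp: null_sets_def)
  then have "AE t in lborel. t \<in> {0..2*pi} \<longrightarrow> cis t \<notin> A"
    using AE_lborel_singleton[of 0] AE_lborel_singleton[of "2*pi"]
  proof eventually_elim
    case (elim t)
    show ?case
    proof
      assume "t \<in> {0..2*pi}"
      then have t: "0 < t" "t < 2 * pi" using elim by auto
      have "a (cis t) = t" using cis_not_nonneg_Reals[OF t] Arg2pi_cis[of t] t by (simp add: a_def)
      moreover have "cis t \<noteq> 1" using cis_not_nonneg_Reals[OF t] by auto
      ultimately show "cis t \<notin> A" using elim by (simp add: A_def)
    qed
  qed
  then have "AE t in uniform_measure lborel {0..2*pi}. cis t \<notin> A"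
    by (intro AE_uniform_measureI) auto
  then have "AE z in circle_measure. z \<notin> A"
    unfolding circle_measure_def by (subst AE_distr_iff[OF measurable_cis_circle As])
  then show ?thesis
  proof (rule AE_mp, intro AE_I2 impI)
    fix z assume z: "z \<in> space circle_measure" "z \<notin> A"
    then have z1: "norm z = 1" "z \<noteq> 1" by (auto simp: A_def)
    have "0 < Arg2pi z"
    proof -
      have "Arg2pi z \<noteq> 0" using cis_Arg2pi[OF z1(1)] z1(2) by auto
      then show ?thesis using Arg2pi_ge_0[of z] by simp
    qed
    moreover have "a z = Arg2pi z" using nonneg_Reals_unit[of z] z1 by (auto simp: a_def indicator_def)
    moreover have "a z \<notin> N" using z(2) z1 by (simp add: A_def)
    ultimately show "P z" using N(1) Arg2pi_lt_2pi[of z] cis_Arg2pi[OF z1(1)] by fastforce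
  qed
qed

lemma integral_circle_measure:
  fixes f :: "complex \<Rightarrow> 'a::{banach, second_countable_topology}"
  assumes f: "f \<in> borel_measurable circle_measure"
  shows "integral\<^sup>L circle_measure f = (LINT t:{0..2*pi}|lborel. f (cis t)) /\<^sub>R (2*pi)"
proof -
  have m: "(\<lambda>t. f (cis t)) \<in> borel_measurable (uniform_measure lborel {0..2*pi})"
    using f unfolding circle_measure_def by (intro measurable_compose[OF measurable_cis_circle]) simp
  have u: "uniform_measure lborel {0..2*pi} = density lborel (\<lambda>t. ennreal (indicator {0..2*pi} t / (2*pi)))"
    unfolding uniform_measure_def
    by (intro density_cong) (auto simp: indicator_def divide_ennreal[symmetric])
  have "integral\<^sup>L circle_measure f = integral\<^sup>L (uniform_measure lborel {0..2*pi}) (\<lambda>t. f (cis t))"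
    unfolding circle_measure_def
    by (rule integral_distr[OF measurable_cis_circle]) (use f in \<open>simp add: circle_measure_def\<close>)
  also have "\<dots> = integral\<^sup>L lborel (\<lambda>t. (indicator {0..2*pi} t / (2*pi)) *\<^sub>R f (cis t))"
    unfolding u by (rule integral_density) (use m in \<open>auto simp: measurable_cong_sets[OF sets_uniform_measure refl]\<close>)
  also have "\<dots> = integral\<^sup>L lborel (\<lambda>t. inverse (2*pi) *\<^sub>R (indicator {0..2*pi} t *\<^sub>R f (cis t)))"
    unfolding scaleR_scaleR divide_inverse by (simp only: mult.commute)
  also have "\<dots> = (LINT t:{0..2*pi}|lborel. f (cis t)) /\<^sub>R (2*pi)"
    unfolding set_lebesgue_integral_def by (rule integral_scaleR_right)
  finally show ?thesis .
qed

lemma integral_circle_continuous: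
  fixes f :: "complex \<Rightarrow> 'a::euclidean_space"
  assumes f: "continuous_on (sphere 0 1) f"
  shows "integral\<^sup>L circle_measure f = circle_mean 1 f"
proof -
  have "continuous_on {0..2*pi} (\<lambda>t. f (cis t))"
    by (intro continuous_on_compose2[OF f] continuous_intros) auto
  from set_borel_integral_eq_integral(2)[OF borel_integrable_atLeastAtMost'[OF this]]
  show ?thesis
    by (simp add: integral_circle_measure[OF borel_measurable_circle_continuous[OF f]] circle_mean_def)
qed

section \<open>Dilations of bounded analytic functions\<close>

lemma dilation_continuous:
  assumes "h holomorphic_on ball 0 1" "0 \<le> r" "r < 1"
  shows "continuous_on (sphere 0 1) (\<lambda>z. h (of_real r * z))"
  by (intro continuous_on_compose2[OF holomorphic_on_imp_continuous_on[OF assms(1)]] continuous_intros)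
     (use assms in \<open>auto simp: norm_mult\<close>)

text \<open>The identity that orthogonality of powers would give, obtained without series:
  \<open>h z * cnj (h (q / cnj z))\<close> is holomorphic in the annulus between the radii
  \<open>q = r * s\<close> and 1, so its circular means agree. At radius \<open>r\<close> they give
  the product of dilations; at radius \<open>sqrt q\<close> the reflection fixes the circle and the
  squared modulus appears.\<close>

lemma circle_mean_dilation_product:
  assumes h: "h holomorphic_on ball 0 1" and r: "0 < r" "r < 1" and s: "0 < s" "s < 1"
  shows "circle_mean 1 (\<lambda>z. h (of_real r * z) * cnj (h (of_real s * z))) =
    of_real (circle_mean (sqrt (r * s)) (\<lambda>z. (norm (h z))\<^sup>2))"
proof -
  define q where "q = r * s"
  have q: "0 < q" "q < 1" "q < r" using r s by (auto simp: q_def mult_less_cancel_left1 intro: less_trans[of _ "r * 1"])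
  define S where "S = ball 0 1 - cball (0::complex) q"
  define F where "F = (\<lambda>z. h z * cnj (h (of_real q / cnj z)))"
  define Fz where "Fz = (\<lambda>z. deriv h z * cnj (h (of_real q / cnj z)) + h z * cnj (deriv h (of_real q / cnj z) * (- (of_real q / (cnj z)\<^sup>2))))"
  have in1: "of_real q / cnj z \<in> ball 0 1" "z \<noteq> 0" "z \<in> ball 0 1" if "z \<in> S" for z
  proof -
    have z: "q < norm z" "norm z < 1" using that by (auto simp: S_def)
    then show "z \<noteq> 0" "z \<in> ball 0 1" using q by auto
    have "0 < norm z" using z q by linarith
    then have "q / norm z < 1" using z by simp
    then show "of_real q / cnj z \<in> ball 0 1" using q by (simp add: norm_divide)
  qed
  have w: "has_wirtinger F (Fz z) 0 z" if z: "z \<in> S" for z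
  proof -
    have zb: "has_wirtinger cnj 0 1 z"
      using has_wirtinger_cnj[OF has_wirtinger_holomorphic[OF DERIV_ident]] by simp
    have "((\<lambda>x. of_real q / x) has_field_derivative - (of_real q / (cnj z)\<^sup>2)) (at (cnj z))"
      using in1[OF z] by (auto intro!: derivative_eq_intros simp: power2_eq_square)
    from has_wirtinger_chain[OF this zb]
    have 1: "has_wirtinger (\<lambda>z. of_real q / cnj z) 0 (- (of_real q / (cnj z)\<^sup>2)) z" by simp
    have 2: "has_wirtinger (\<lambda>z. cnj (h (of_real q / cnj z))) (cnj (deriv h (of_real q / cnj z) * (- (of_real q / (cnj z)\<^sup>2)))) 0 z"
      using has_wirtinger_cnj[OF has_wirtinger_chain[OF holomorphic_derivI[OF h open_ball in1(1)[OF z]] 1]] by simp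
    have 3: "has_wirtinger h (deriv h z) 0 z"
      by (intro has_wirtinger_holomorphic holomorphic_derivI[OF h open_ball in1(3)[OF z]])
    show ?thesis unfolding F_def Fz_def by (rule has_wirtinger_eq_rhs[OF has_wirtinger_mult[OF 3 2]]) simp_all
  qed
  have c: "continuous_on S Fz"
  proof -
    have ch: "continuous_on (ball 0 1) h" "continuous_on (ball 0 1) (deriv h)"
      using h by (auto intro!: holomorphic_on_imp_continuous_on holomorphic_deriv)
    have cq: "continuous_on S (\<lambda>z. of_real q / cnj z)" by (intro continuous_intros) (use in1(2) in auto)
    have cc: "continuous_on S (\<lambda>z. h (of_real q / cnj z))" "continuous_on S (\<lambda>z. deriv h (of_real q / cnj z))"
      by (rule continuous_on_compose2[OF ch(1) cq] continuous_on_compose2[OF ch(2) cq]; use in1(1) in blast)+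
    have "continuous_on S h" "continuous_on S (deriv h)"
      by (rule continuous_on_subset[OF ch(1)] continuous_on_subset[OF ch(2)]; auto simp: S_def)+
    then show ?thesis unfolding Fz_def by (intro continuous_intros cc) (use in1(2) in auto)
  qed
  define M where "M = (\<lambda>\<rho>. integral {0..2*pi} (\<lambda>t. F (of_real \<rho> * cis t)))"
  have inS: "of_real \<rho> * cis t \<in> S" if "q < \<rho>" "\<rho> < 1" for \<rho> t
    using that q by (auto simp: S_def norm_mult)
  have "(M has_vector_derivative 0) (at \<rho> within {q<..<1})" if "\<rho> \<in> {q<..<1}" for \<rho>
  proof -
    have "(M has_vector_derivative 2 * integral {0..2*pi} (\<lambda>t. 0 * cis (-t))) (at \<rho>)"
      unfolding M_def
      by (rule radial_derivative_mean(1)[where a=q and b=1 and S=S and fz=Fz and fb="\<lambda>_. 0"]) (use that q inS w c in auto)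
    then show ?thesis by (auto intro: has_vector_derivative_at_within)
  qed
  then obtain C where C: "\<And>\<rho>. \<rho> \<in> {q<..<1} \<Longrightarrow> M \<rho> = C"
    using has_vector_derivative_zero_constant[of "{q<..<1}" M] by auto
  have "q < sqrt q" using q real_sqrt_less_mono[of "q\<^sup>2" q] by (simp add: power2_eq_square)
  then have "M r = M (sqrt q)" using C[of r] C[of "sqrt q"] q r by auto
  then have eq: "circle_mean r F = circle_mean (sqrt q) F" by (simp add: circle_mean_def M_def)
  have "circle_mean r F = circle_mean 1 (\<lambda>z. h (of_real r * z) * cnj (h (of_real s * z)))"
    unfolding circle_mean_rescale[of r]
  proof (rule circle_mean_cong)
    fix z :: complex assume z: "norm z = 1"
    then have zz: "z * cnj z = 1" "cnj z \<noteq> 0" using complex_norm_square[of z] by auto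
    have "of_real q / cnj (of_real r * z) = of_real s / cnj z" using r by (simp add: q_def)
    also have "\<dots> = of_real s * z" using zz by (simp add: field_simps)
    finally show "F (of_real r * z) = h (of_real r * z) * cnj (h (of_real s * z))" by (simp add: F_def)
  qed simp
  moreover have "circle_mean (sqrt q) F = circle_mean (sqrt q) (\<lambda>z. of_real ((norm (h z))\<^sup>2))"
  proof (rule circle_mean_cong)
    fix z :: complex assume z: "norm z = sqrt q"
    then have "z * cnj z = of_real q" using complex_norm_square[of z] q by simp
    moreover have "cnj z \<noteq> 0" using z q by auto
    ultimately have "of_real q / cnj z = z" by (metis nonzero_mult_div_cancel_right)
    then show "F z = of_real ((norm (h z))\<^sup>2)" unfolding F_def by (metis complex_norm_square)
  qed (use q in simp)
  moreover have "circle_mean (sqrt q) (\<lambda>z. complex_of_real ((norm (h z))\<^sup>2)) = of_real (circle_mean (sqrt q) (\<lambda>z. (norm (h z))\<^sup>2))"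
  proof (rule circle_mean_of_real)
    show "continuous_on (sphere 0 (sqrt q)) (\<lambda>z. (norm (h z))\<^sup>2)"
      by (intro continuous_intros continuous_on_subset[OF holomorphic_on_imp_continuous_on[OF h]]) (use q in auto)
  qed (use q in simp)
  ultimately show ?thesis using eq by (simp add: q_def)
qed

text \<open>The mean \<open>m r\<close> of the squared modulus at radius \<open>r\<close> is
  increasing and bounded, and the squared distance of two dilations is
  \<open>m r + m s - 2 * m (sqrt (r * s))\<close>. All three radii lie beyond \<open>t\<close>,
  where \<open>m\<close> is within \<open>e / 4\<close> of its supremum.\<close>

lemma dilations_L2_Cauchy:
  assumes h: "h holomorphic_on ball 0 1" and B: "\<And>z. z \<in> ball 0 1 \<Longrightarrow> norm (h z) \<le> B" and e: "0 < e"
  obtains t where "0 < t" "t < 1"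
    "\<And>r s. t \<le> r \<Longrightarrow> r < 1 \<Longrightarrow> t \<le> s \<Longrightarrow> s < 1 \<Longrightarrow> circle_mean 1 (\<lambda>z. (norm (h (of_real r * z) - h (of_real s * z)))\<^sup>2) < e"
proof -
  define m where "m = (\<lambda>r. circle_mean r (\<lambda>z. (norm (h z))\<^sup>2))"
  have ch: "continuous_on (sphere 0 r) h" if "0 \<le> r" "r < 1" for r
    by (rule continuous_on_subset[OF holomorphic_on_imp_continuous_on[OF h]]) (use that in auto)
  have mono: "m r \<le> m s" if rs: "0 \<le> r" "r \<le> s" "s < 1" for r s
  proof -
    have wh: "has_wirtinger h (deriv h z) 0 z" "has_wirtinger (\<lambda>z. cnj (h z)) 0 (cnj (deriv h z)) z"
      "has_wirtinger (\<lambda>z. cnj (deriv h z)) 0 (cnj (deriv (deriv h) z)) z" if "z \<in> ball 0 1" for z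
    proof -
      have 1: "has_wirtinger h (deriv h z) 0 z" "has_wirtinger (deriv h) (deriv (deriv h) z) 0 z"
        using that h by (auto intro!: has_wirtinger_holomorphic holomorphic_derivI[of _ "ball 0 1"] holomorphic_deriv)
      then show "has_wirtinger h (deriv h z) 0 z" "has_wirtinger (\<lambda>z. cnj (h z)) 0 (cnj (deriv h z)) z"
        "has_wirtinger (\<lambda>z. cnj (deriv h z)) 0 (cnj (deriv (deriv h) z)) z"
        using has_wirtinger_cnj[OF 1(1)] has_wirtinger_cnj[OF 1(2)] by simp_all
    qed
    have cc: "continuous_on (ball 0 1) h" "continuous_on (ball 0 1) (deriv h)" "continuous_on (ball 0 1) (deriv (deriv h))"
      using h by (auto intro!: holomorphic_on_imp_continuous_on holomorphic_deriv)
    have "Re (circle_mean r (\<lambda>z. h z * cnj (h z))) \<le> Re (circle_mean s (\<lambda>z. h z * cnj (h z)))"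
    proof (rule circle_mean_subharmonic_mono[OF rs(1,2), of 1 _ "\<lambda>z. deriv h z * cnj (h z)" "\<lambda>z. h z * cnj (deriv h z)"
        "\<lambda>z. deriv h z * cnj (deriv h z)" "\<lambda>z. h z * cnj (deriv (deriv h) z)"])
      show "has_wirtinger (\<lambda>z. h z * cnj (h z)) (deriv h z * cnj (h z)) (h z * cnj (deriv h z)) z" if "z \<in> ball 0 1" for z
        by (rule has_wirtinger_eq_rhs[OF has_wirtinger_mult[OF wh(1,2)[OF that]]]) simp_all
      show "has_wirtinger (\<lambda>z. h z * cnj (deriv h z)) (deriv h z * cnj (deriv h z)) (h z * cnj (deriv (deriv h) z)) z" if "z \<in> ball 0 1" for z
        by (rule has_wirtinger_eq_rhs[OF has_wirtinger_mult[OF wh(1,3)[OF that]]]) simp_all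
      show "0 \<le> Re (deriv h z * cnj (deriv h z))" for z by simp
    qed (use rs in \<open>auto intro!: continuous_intros cc\<close>)
    moreover have "Re (circle_mean r (\<lambda>z. h z * cnj (h z))) = m r" if "0 \<le> r" "r < 1" for r
      using circle_mean_Re[of r "\<lambda>z. h z * cnj (h z)"] ch[OF that] that unfolding m_def complex_norm_square[symmetric]
      by (simp add: continuous_intros)
    ultimately show ?thesis using rs by simp
  qed
  have bdd: "m r \<le> B\<^sup>2" if "0 \<le> r" "r < 1" for r
  proof -
    have "m r \<le> circle_mean r (\<lambda>z. B\<^sup>2)"
      unfolding m_def by (intro circle_mean_mono continuous_intros ch that power_mono B) (use that in auto)
    then show ?thesis by simp
  qed
  define L where "L = Sup (m ` {0..<1})"
  have bd: "bdd_above (m ` {0..<1})" using bdd by (auto intro!: bdd_aboveI2[of _ _ "B\<^sup>2"])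
  have mL: "m r \<le> L" if "0 \<le> r" "r < 1" for r unfolding L_def by (rule cSUP_upper[OF _ bd]) (use that in auto)
  have "\<exists>r\<in>{0..<1}. L - e / 4 < m r"
    using less_cSUP_iff[OF _ bd, of "L - e / 4"] e by (auto simp: L_def)
  then obtain t0 where t0: "0 \<le> t0" "t0 < 1" "L - e / 4 < m t0" by auto
  \<comment> \<open>1/2 keeps the radii positive, as the product formula demands.\<close>
  define t where "t = max t0 (1/2)"
  have t: "0 < t" "t < 1" "t0 \<le> t" using t0 by (auto simp: t_def)
  have near: "L - e / 4 < m r" if "t \<le> r" "r < 1" for r
    using mono[of t0 r] t t0 that by auto
  show thesis
  proof (rule that[OF t(1,2)])
    fix r s assume rs: "t \<le> r" "r < 1" "t \<le> s" "s < 1"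
    then have rs0: "0 < r" "0 < s" using t by auto
    define hr where "hr = (\<lambda>z. h (of_real r * z))"
    define hs where "hs = (\<lambda>z. h (of_real s * z))"
    have cr: "continuous_on (sphere 0 1) hr" "continuous_on (sphere 0 1) hs"
      unfolding hr_def hs_def by (rule dilation_continuous[OF h]; use rs rs0 in simp)+
    have tt: "t \<le> sqrt (r * s)" "sqrt (r * s) < 1"
    proof -
      have "t * t \<le> r * s" using rs t by (intro mult_mono) auto
      then show "t \<le> sqrt (r * s)" using t by (intro real_le_rsqrt) (simp add: power2_eq_square)
      have "r * s < 1 * 1" using rs rs0 by (intro mult_strict_mono) auto
      then show "sqrt (r * s) < 1" by simp
    qed
    have n2: "circle_mean 1 (\<lambda>z. (norm (g z))\<^sup>2) = Re (circle_mean 1 (\<lambda>z. g z * cnj (g z)))" if "continuous_on (sphere 0 1) g" for g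
      using circle_mean_Re[of 1 "\<lambda>z. g z * cnj (g z)"] that unfolding complex_norm_square[symmetric] by (simp add: continuous_intros)
    have "circle_mean 1 (\<lambda>z. (norm (hr z - hs z))\<^sup>2) = Re (circle_mean 1 (\<lambda>z. (hr z * cnj (hr z) + hs z * cnj (hs z)) - (hr z * cnj (hs z) + hs z * cnj (hr z))))"
      using n2[of "\<lambda>z. hr z - hs z"] cr by (simp add: continuous_intros algebra_simps)
    also have "circle_mean 1 (\<lambda>z. (hr z * cnj (hr z) + hs z * cnj (hs z)) - (hr z * cnj (hs z) + hs z * cnj (hr z))) =
      (circle_mean 1 (\<lambda>z. hr z * cnj (hr z)) + circle_mean 1 (\<lambda>z. hs z * cnj (hs z))) -
      (circle_mean 1 (\<lambda>z. hr z * cnj (hs z)) + circle_mean 1 (\<lambda>z. hs z * cnj (hr z)))"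
    proof -
      have c: "continuous_on (sphere 0 1) (\<lambda>z. x z * cnj (y z))" if "continuous_on (sphere 0 1) x" "continuous_on (sphere 0 1) y" for x y
        by (intro continuous_intros that)
      note cs = c[OF cr(1) cr(1)] c[OF cr(2) cr(2)] c[OF cr(1) cr(2)] c[OF cr(2) cr(1)]
      show ?thesis
        unfolding circle_mean_diff[OF zero_le_one continuous_on_add[OF cs(1,2)] continuous_on_add[OF cs(3,4)]]
          circle_mean_add[OF zero_le_one cs(1,2)] circle_mean_add[OF zero_le_one cs(3,4)] ..
    qed
    also have "\<dots> = of_real (m r + m s - 2 * m (sqrt (r * s)))"
      unfolding hr_def hs_def m_def
      using circle_mean_dilation_product[OF h rs0(1) rs(2) rs0(1) rs(2)] circle_mean_dilation_product[OF h rs0(2) rs(4) rs0(2) rs(4)]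
        circle_mean_dilation_product[OF h rs0(1) rs(2) rs0(2) rs(4)] circle_mean_dilation_product[OF h rs0(2) rs(4) rs0(1) rs(2)] rs0
      by (simp add: mult.commute)
    finally have "circle_mean 1 (\<lambda>z. (norm (hr z - hs z))\<^sup>2) = m r + m s - 2 * m (sqrt (r * s))" by simp
    also have "\<dots> < e"
      using mL[of r] mL[of s] near[OF tt] rs rs0 e by simp
    finally show "circle_mean 1 (\<lambda>z. (norm (h (of_real r * z) - h (of_real s * z)))\<^sup>2) < e" by (simp add: hr_def hs_def)
  qed
qed

text \<open>Mean square convergence controls the mean of the modulus through
  \<open>x \<le> e / 2 + x^2 / (2 * e)\<close>, and convergence in mean has an almost everywhere
  convergent subsequence. This gives candidates for boundary values before radial limits are known
  to exist.\<close>

lemma dilations_AE_convergent: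
  assumes h: "h holomorphic_on ball 0 1" and B: "\<And>z. z \<in> ball 0 1 \<Longrightarrow> norm (h z) \<le> B"
  obtains \<rho> :: "nat \<Rightarrow> real" where "\<And>k. 0 < \<rho> k" "\<And>k. \<rho> k < 1" "\<rho> \<longlonglongrightarrow> 1"
    "AE z in circle_measure. convergent (\<lambda>k. h (of_real (\<rho> k) * z))"
proof -
  define \<rho>' where "\<rho>' = (\<lambda>n. 1 - inverse (real (Suc (Suc n))))"
  have \<rho>': "0 < \<rho>' n" "\<rho>' n < 1" for n by (auto simp: \<rho>'_def inverse_eq_divide)
  have \<rho>1: "\<rho>' \<longlonglongrightarrow> 1"
    using tendsto_diff[OF tendsto_const[of 1] LIMSEQ_Suc[OF LIMSEQ_inverse_real_of_nat]] by (simp add: \<rho>'_def)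
  define s where "s = (\<lambda>n z. h (of_real (\<rho>' n) * z))"
  have cs: "continuous_on (sphere 0 1) (s n)" for n
    unfolding s_def by (rule dilation_continuous[OF h]) (use \<rho>'[of n] in auto)
  have sB: "norm (s n z) \<le> B" if "norm z = 1" for n z
    unfolding s_def by (rule B) (use \<rho>'[of n] that in \<open>simp add: norm_mult\<close>)
  have int: "integrable circle_measure (s n)" for n
    by (rule circle_measure.integrable_const_bound[where B=B])
       (use sB in \<open>auto intro!: borel_measurable_circle_continuous cs\<close>)
  obtain \<phi> where \<phi>: "strict_mono \<phi>" "AE z in circle_measure. Cauchy (\<lambda>i. s (\<phi> i) z)"
  proof (rule cauchy_L1_AE_cauchy_subseq[OF int])
    fix e :: real assume e: "0 < e"
    obtain t where t: "0 < t" "t < 1" "\<And>r s. t \<le> r \<Longrightarrow> r < 1 \<Longrightarrow> t \<le> s \<Longrightarrow> s < 1 \<Longrightarrow> circle_mean 1 (\<lambda>z. (norm (h (of_real r * z) - h (of_real s * z)))\<^sup>2) < e\<^sup>2"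
      using dilations_L2_Cauchy[OF h B zero_less_power[OF e, of 2]] by blast
    have "\<forall>\<^sub>F n in sequentially. t < \<rho>' n" using order_tendstoD(1)[OF \<rho>1 t(2)] .
    then obtain N where N: "\<And>n. N \<le> n \<Longrightarrow> t < \<rho>' n" unfolding eventually_sequentially by blast
    show "\<exists>N. \<forall>i\<ge>N. \<forall>j\<ge>N. LINT z|circle_measure. norm (s i z - s j z) < e"
    proof (intro exI allI impI)
      fix i j assume ij: "N \<le> i" "N \<le> j"
      have "LINT z|circle_measure. norm (s i z - s j z) = circle_mean 1 (\<lambda>z. norm (s i z - s j z))"
        by (intro integral_circle_continuous continuous_intros cs)
      also have "\<dots> \<le> circle_mean 1 (\<lambda>z. e / 2 + 1 / (2 * e) * (norm (s i z - s j z))\<^sup>2)"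
      proof (rule circle_mean_mono)
        fix z
        define x where "x = norm (s i z - s j z)"
        have "2 * e * x \<le> e\<^sup>2 + x\<^sup>2" by (rule sum_squares_bound)
        then have "x \<le> (e\<^sup>2 + x\<^sup>2) / (2 * e)" using e by (simp add: field_simps)
        then show "norm (s i z - s j z) \<le> e / 2 + 1 / (2 * e) * (norm (s i z - s j z))\<^sup>2"
          using e by (simp add: x_def[symmetric] add_divide_distrib power2_eq_square)
      qed (use e in \<open>auto intro!: continuous_intros cs\<close>)
      also have "\<dots> = e / 2 + 1 / (2 * e) * circle_mean 1 (\<lambda>z. (norm (s i z - s j z))\<^sup>2)"
      proof -
        have "circle_mean 1 (\<lambda>z. e / 2 + 1 / (2 * e) * (norm (s i z - s j z))\<^sup>2) =
          circle_mean 1 (\<lambda>z. e / 2) + circle_mean 1 (\<lambda>z. 1 / (2 * e) * (norm (s i z - s j z))\<^sup>2)"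
          by (rule circle_mean_add) (use e in \<open>auto intro!: continuous_intros cs\<close>)
        then show ?thesis unfolding circle_mean_cmult circle_mean_const .
      qed
      also have "\<dots> < e / 2 + 1 / (2 * e) * e\<^sup>2"
        using t(3)[of "\<rho>' i" "\<rho>' j"] N[OF ij(1)] N[OF ij(2)] \<rho>'(2) e
        by (intro add_strict_left_mono mult_strict_left_mono) (auto simp: s_def)
      also have "\<dots> = e" using e by (simp add: power2_eq_square)
      finally show "LINT z|circle_measure. norm (s i z - s j z) < e" .
    qed
  qed blast
  show thesis
  proof (rule that[of "\<rho>' \<circ> \<phi>"])
    show "(\<rho>' \<circ> \<phi>) \<longlonglongrightarrow> 1" by (rule LIMSEQ_subseq_LIMSEQ[OF \<rho>1 \<phi>(1)])
    show "AE z in circle_measure. convergent (\<lambda>k. h (of_real ((\<rho>' \<circ> \<phi>) k) * z))"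
      using \<phi>(2) by (simp add: s_def Cauchy_convergent_iff)
  qed (use \<rho>' in auto)
qed

section \<open>Differentiation on the boundary and radial limits\<close>

lemma AE_lborel_notin_negligible:
  assumes "negligible N"
  shows "AE t in lborel. t \<notin> N"
proof -
  have "N \<in> null_sets lebesgue" using assms by (simp add: negligible_iff_null_sets)
  then have "AE t in lebesgue. t \<notin> N" by (rule AE_not_in)
  then show ?thesis by (simp add: AE_completion_iff)
qed

text \<open>Lebesgue differentiation from the right, applied to \<open>f\<close> and to its
  reflection; the second gives the left side, and reflection preserves null sets.\<close>

lemma differentiable_indefinite_integral_AE:
  fixes f :: "real \<Rightarrow> complex"
  assumes f: "f integrable_on UNIV"
  shows "AE x in lborel. \<forall>e>0. \<exists>d>0. \<forall>y. \<bar>y - x\<bar> < d \<longrightarrow>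
    (x \<le> y \<longrightarrow> norm (integral {x..y} f - (y - x) *\<^sub>R f x) \<le> e * (y - x)) \<and>
    (y \<le> x \<longrightarrow> norm (integral {y..x} f - (x - y) *\<^sub>R f x) \<le> e * (x - y))"
proof -
  have i: "g integrable_on cbox a b" if "g integrable_on UNIV" for g :: "real \<Rightarrow> complex" and a b
    by (rule integrable_on_subcbox[OF that]) simp
  define f' where "f' = (\<lambda>x. f (- x))"
  have f': "f' integrable_on cbox a b" for a b
    unfolding f'_def using i[OF f, of "- b" "- a"] Henstock_Kurzweil_Integration.integrable_reflect_real[where f=f and a="- b" and b="- a"] by (simp only: box_real minus_minus)
  have one: "(h *\<^sub>R One :: real) = h" for h :: real by simp
  obtain N1 where N1: "negligible N1" "\<And>x e. \<lbrakk>x \<notin> N1; 0 < e\<rbrakk> \<Longrightarrow>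
    \<exists>d>0. \<forall>h. 0 < h \<and> h < d \<longrightarrow> norm (integral {x..x + h} f /\<^sub>R h - f x) < e"
    using integrable_ccontinuous_explicit[of f, OF i[OF f]] unfolding one by auto
  obtain N2 where N2: "negligible N2" "\<And>x e. \<lbrakk>x \<notin> N2; 0 < e\<rbrakk> \<Longrightarrow>
    \<exists>d>0. \<forall>h. 0 < h \<and> h < d \<longrightarrow> norm (integral {x..x + h} f' /\<^sub>R h - f' x) < e"
    using integrable_ccontinuous_explicit[of f', OF f'] unfolding one by auto
  have A2: "AE x in lborel. - x \<notin> N2"
  proof -
    have "AE x in distr lborel borel uminus. x \<notin> N2"
      unfolding lborel_distr_uminus by (rule AE_lborel_notin_negligible[OF N2(1)])
    then show ?thesis by (rule AE_distrD[rotated]) simp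
  qed
  have q: "norm (D - h *\<^sub>R F) \<le> e * h" if "norm (D /\<^sub>R h - F) < e" "0 < h" for D F :: complex and h e :: real
  proof -
    have "D - h *\<^sub>R F = h *\<^sub>R (D /\<^sub>R h - F)" using that(2) by (simp add: scaleR_right_diff_distrib)
    then have "norm (D - h *\<^sub>R F) = h * norm (D /\<^sub>R h - F)" using that(2) by simp
    then show ?thesis using that by (simp add: mult.commute)
  qed
  show ?thesis
    using A2 AE_lborel_notin_negligible[OF N1(1)]
  proof eventually_elim
    case (elim x)
    show ?case
    proof (intro allI impI)
      fix e :: real assume e: "0 < e"
      obtain d1 where d1: "0 < d1" "\<And>h. 0 < h \<Longrightarrow> h < d1 \<Longrightarrow> norm (integral {x..x + h} f /\<^sub>R h - f x) < e"
        using N1(2)[OF elim(2) e] by blast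
      obtain d2 where d2: "0 < d2" "\<And>h. 0 < h \<Longrightarrow> h < d2 \<Longrightarrow> norm (integral {- x..- x + h} f' /\<^sub>R h - f' (- x)) < e"
        using N2(2)[OF elim(1) e] by blast
      show "\<exists>d>0. \<forall>y. \<bar>y - x\<bar> < d \<longrightarrow>
        (x \<le> y \<longrightarrow> norm (integral {x..y} f - (y - x) *\<^sub>R f x) \<le> e * (y - x)) \<and>
        (y \<le> x \<longrightarrow> norm (integral {y..x} f - (x - y) *\<^sub>R f x) \<le> e * (x - y))"
      proof (intro exI[of _ "min d1 d2"] conjI allI impI)
        fix y assume y: "\<bar>y - x\<bar> < min d1 d2"
        show "norm (integral {x..y} f - (y - x) *\<^sub>R f x) \<le> e * (y - x)" if "x \<le> y"
        proof (cases "x = y")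
          case False
          then show ?thesis using q[OF d1(2)[of "y - x"]] that y by simp
        qed simp
        show "norm (integral {y..x} f - (x - y) *\<^sub>R f x) \<le> e * (x - y)" if "y \<le> x"
        proof (cases "x = y")
          case False
          have "integral {- x..- x + (x - y)} f' = integral {y..x} f"
            unfolding f'_def using integral_reflect_real[of x y f] by simp
          then show ?thesis using q[OF d2(2)[of "x - y"]] that False y by (simp add: f'_def)
        qed simp
      qed (use d1 d2 in auto)
    qed
  qed
qed

text \<open>A primitive of \<open>h\<close> is Lipschitz and extends continuously to the closed
  disc. On the circle it is the indefinite integral of an almost everywhere limit of dilations,
  hence differentiable at almost every boundary point; there the radial limit of its derivative
  \<open>h\<close> exists.\<close>

theorem Fatou_radial_limit:
  assumes h: "h holomorphic_on ball 0 1" and B: "\<And>z. z \<in> ball 0 1 \<Longrightarrow> norm (h z) \<le> B"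
  shows "AE z in circle_measure. \<exists>l. ((\<lambda>r. h (of_real r * z)) \<longlongrightarrow> l) (at_left 1)"
proof -
  have B0: "0 \<le> B" by (rule order_trans[OF norm_ge_zero B[of 0]]) simp
  obtain H where H: "\<And>x. x \<in> ball 0 1 \<Longrightarrow> (H has_field_derivative h x) (at x within ball 0 1)"
    using holomorphic_convex_primitive'[OF convex_ball open_ball h] by blast
  have H': "(H has_field_derivative h x) (at x)" if "x \<in> ball 0 1" for x
    using H[OF that] at_within_open[OF that open_ball] by simp
  have "B-lipschitz_on (ball 0 1) H"
  proof (rule lipschitz_onI[OF _ B0])
    fix x y :: complex assume "x \<in> ball 0 1" "y \<in> ball 0 1"
    then show "dist (H x) (H y) \<le> B * dist x y"
      unfolding dist_norm by (intro field_differentiable_bound[OF convex_ball H B]) auto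
  qed
  from lipschitz_extend_closure[OF this] obtain G where "B-lipschitz_on (closure (ball 0 1)) G"
    and GH: "\<And>x. x \<in> ball 0 1 \<Longrightarrow> G x = H x" by blast
  then have cG: "continuous_on (cball 0 1) G"
    using lipschitz_on_continuous_on[of B "cball 0 1" G] by simp
  have G': "(G has_field_derivative h x) (at x)" if "x \<in> ball 0 1" for x
    by (rule has_field_derivative_transform_within_open[OF H'[OF that] open_ball that]) (use GH in auto)
  have hG: "G holomorphic_on ball 0 1"
    unfolding holomorphic_on_open[OF open_ball] using G' by blast
  have dG: "deriv G x = h x" if "x \<in> ball 0 1" for x by (rule DERIV_imp_deriv[OF G'[OF that]])
  obtain \<rho> where \<rho>: "\<And>k. 0 < \<rho> k" "\<And>k. \<rho> k < 1" "\<rho> \<longlonglongrightarrow> 1"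
    and AEc: "AE z in circle_measure. convergent (\<lambda>k. h (of_real (\<rho> k) * z))"
    using dilations_AE_convergent[OF h B] by metis
  obtain N where N: "{t. \<not> (t \<in> {0..2*pi} \<longrightarrow> convergent (\<lambda>k. h (of_real (\<rho> k) * cis t)))} \<subseteq> N" "emeasure lborel N = 0" "N \<in> sets lborel"
    using AE_E[OF AE_circle_measureD[OF AEc]] by auto
  have nN: "negligible N"
    unfolding negligible_iff_null_sets by (rule null_sets_completionI) (use N in \<open>auto simp: null_sets_def\<close>)
  have inb: "of_real (\<rho> k) * cis t \<in> ball 0 1" for k t using \<rho>(1,2)[of k] by (simp add: norm_mult)
  define g where "g = (\<lambda>k t. \<i> * of_real (\<rho> k) * (h (of_real (\<rho> k) * cis t) * cis t))"
  \<comment> \<open>The limit of the angular derivatives \<open>g k\<close>, set to 0 off the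
    interval and on the exceptional null set so that it is integrable on the whole line.\<close>
  define f where "f = (\<lambda>t. if t \<in> {0..2*pi} - N then \<i> * (lim (\<lambda>k. h (of_real (\<rho> k) * cis t)) * cis t) else 0)"
  have rl: "(\<lambda>k. complex_of_real (\<rho> k)) \<longlonglongrightarrow> 1" using tendsto_of_real[OF \<rho>(3)] by simp
  have fint: "f integrable_on {a..b}" "integral {a..b} f = G (cis b) - G (cis a)" if ab: "0 \<le> a" "a \<le> b" "b \<le> 2*pi" for a b
  proof -
    define g' where "g' = (\<lambda>k t. if t \<in> N then 0 else g k t)"
    have g: "(g k has_integral G (of_real (\<rho> k) * cis b) - G (of_real (\<rho> k) * cis a)) {a..b}" for k
    proof (rule fundamental_theorem_of_calculus[OF ab(2)])
      fix t
      have "has_wirtinger G (h (of_real (\<rho> k) * cis t)) 0 (of_real (\<rho> k) * cis t)"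
        by (intro has_wirtinger_holomorphic G' inb)
      from vector_derivative_wirtinger_angular[OF this]
      show "((\<lambda>t. G (of_real (\<rho> k) * cis t)) has_vector_derivative g k t) (at t within {a..b})"
        by (simp add: g_def)
    qed
    have g': "(g' k has_integral G (of_real (\<rho> k) * cis b) - G (of_real (\<rho> k) * cis a)) {a..b}" for k
      by (rule has_integral_spike[OF nN _ g]) (simp add: g'_def)
    have "f integrable_on {a..b} \<and> (\<lambda>k. integral {a..b} (g' k)) \<longlonglongrightarrow> integral {a..b} f"
    proof -
      have d1: "g' k integrable_on {a..b}" for k using g' by (auto simp: integrable_on_def)
      have d2: "(\<lambda>_. B) integrable_on {a..b}" by (rule integrable_const_ivl)
      have d3: "norm (g' k t) \<le> B" for k t
        using mult_mono[OF less_imp_le[OF \<rho>(2)[of k]] B[OF inb[of k t]]] \<rho>(1,2)[of k] B0 by (simp add: g'_def g_def norm_mult)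
      have d4: "(\<lambda>k. g' k t) \<longlonglongrightarrow> f t" if "t \<in> {a..b}" for t
      proof (cases "t \<in> N")
        case False
        moreover have "t \<in> {0..2*pi}" using that ab by auto
        ultimately have "convergent (\<lambda>k. h (of_real (\<rho> k) * cis t))" using N(1) by blast
        then have "(\<lambda>k. h (of_real (\<rho> k) * cis t)) \<longlonglongrightarrow> lim (\<lambda>k. h (of_real (\<rho> k) * cis t))"
          by (simp add: convergent_LIMSEQ_iff)
        then have "(\<lambda>k. g k t) \<longlonglongrightarrow> \<i> * 1 * (lim (\<lambda>k. h (of_real (\<rho> k) * cis t)) * cis t)"
          unfolding g_def by (intro tendsto_intros rl)
        then show ?thesis using False that ab by (simp add: g'_def f_def)
      qed (simp add: g'_def f_def)
      show ?thesis
        by (rule conjI[OF dominated_convergence(1)[OF d1 d2 d3 d4] dominated_convergence(2)[OF d1 d2 d3 d4]])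
    qed
    moreover have "(\<lambda>k. integral {a..b} (g' k)) \<longlonglongrightarrow> G (cis b) - G (cis a)"
    proof -
      have "(\<lambda>k. G (of_real (\<rho> k) * cis t)) \<longlonglongrightarrow> G (cis t)" for t
      proof (rule continuous_on_tendsto_compose[OF cG])
        have "(\<lambda>k. of_real (\<rho> k) * cis t) \<longlonglongrightarrow> 1 * cis t" by (intro tendsto_intros rl)
        then show "(\<lambda>k. of_real (\<rho> k) * cis t) \<longlonglongrightarrow> cis t" by simp
        show "\<forall>\<^sub>F k in sequentially. of_real (\<rho> k) * cis t \<in> cball 0 1"
          using inb ball_subset_cball by (intro always_eventually allI) blast
      qed simp
      then have "(\<lambda>k. G (of_real (\<rho> k) * cis b) - G (of_real (\<rho> k) * cis a)) \<longlonglongrightarrow> G (cis b) - G (cis a)"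
        by (intro tendsto_intros)
      then show ?thesis unfolding integral_unique[OF g'] .
    qed
    ultimately show "f integrable_on {a..b}" "integral {a..b} f = G (cis b) - G (cis a)"
      by (auto intro: LIMSEQ_unique)
  qed
  have "f integrable_on UNIV"
  proof -
    have "(\<lambda>x. if x \<in> {0..2*pi} then f x else 0) = f" by (auto simp: f_def)
    then show ?thesis using integrable_restrict_UNIV[of "{0..2*pi}" f] fint(1)[of 0 "2*pi"] by simp
  qed
  from differentiable_indefinite_integral_AE[OF this]
  have "AE x in lborel. x \<in> {0<..<2*pi} \<longrightarrow> (\<exists>l. ((\<lambda>r. h (of_real r * cis x)) \<longlongrightarrow> l) (at_left 1))"
  proof eventually_elim
    case (elim x)
    show ?case
    proof
      assume "x \<in> {0<..<2*pi}"
      then have x: "0 < x" "x < 2*pi" by auto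
      \<comment> \<open>Dividing the derivative in the angle by that of \<open>cis\<close> gives the
        derivative along the circle in the complex variable.\<close>
      define a where "a = f x / (\<i> * cis x)"
      have fa: "f x = a * (\<i> * cis x)" by (simp add: a_def)
      have der: "\<exists>d>0. \<forall>y\<in>{0..2*pi}. \<bar>y - x\<bar> < d \<longrightarrow> norm (G (cis y) - G (cis x) - (y - x) *\<^sub>R f x) \<le> e * \<bar>y - x\<bar>" if e: "0 < e" for e
      proof -
        obtain d where d: "0 < d" "\<And>y. \<bar>y - x\<bar> < d \<Longrightarrow>
          (x \<le> y \<longrightarrow> norm (integral {x..y} f - (y - x) *\<^sub>R f x) \<le> e * (y - x)) \<and>
          (y \<le> x \<longrightarrow> norm (integral {y..x} f - (x - y) *\<^sub>R f x) \<le> e * (x - y))"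
          using elim e by blast
        show ?thesis
        proof (intro exI conjI ballI impI)
          fix y assume y: "y \<in> {0..2*pi}" "\<bar>y - x\<bar> < d"
          show "norm (G (cis y) - G (cis x) - (y - x) *\<^sub>R f x) \<le> e * \<bar>y - x\<bar>"
          proof (cases "x \<le> y")
            case True
            then show ?thesis using d(2)[OF y(2)] fint(2)[of x y] x y by simp
          next
            case False
            have "G (cis y) - G (cis x) - (y - x) *\<^sub>R f x = - (integral {y..x} f - (x - y) *\<^sub>R f x)"
              using fint(2)[of y x] x y False by (simp add: scaleR_left_diff_distrib)
            then have "norm (G (cis y) - G (cis x) - (y - x) *\<^sub>R f x) = norm (integral {y..x} f - (x - y) *\<^sub>R f x)"
              by (simp only: norm_minus_cancel)
            then show ?thesis using d(2)[OF y(2)] False by simp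
          qed
        qed (rule d(1))
      qed
      have "((\<lambda>r. deriv G (of_real r * cis x)) \<longlongrightarrow> a) (at_left 1)"
      proof (rule radial_limit_of_derivative[OF cG hG])
        fix e :: real assume e: "0 < e"
        \<comment> \<open>The bound 1/2 makes the arc at most twice as long as the chord; the other
          bound absorbs \<open>norm a\<close> when the tangent is replaced by the chord.\<close>
        define \<kappa> where "\<kappa> = min (1/2) (e / (4 * (1 + norm a)))"
        have \<kappa>: "0 < \<kappa>" "\<kappa> \<le> 1/2" "norm a * \<kappa> \<le> e / 4"
        proof -
          have a1: "0 < 1 + norm a" by (simp add: add_pos_nonneg)
          then show "0 < \<kappa>" using e by (simp add: \<kappa>_def)
          show "\<kappa> \<le> 1/2" unfolding \<kappa>_def by (rule min.cobounded1)
          have "norm a * \<kappa> \<le> norm a * (e / (4 * (1 + norm a)))" unfolding \<kappa>_def by (intro mult_left_mono) auto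
          also have "\<dots> \<le> (1 + norm a) * (e / (4 * (1 + norm a)))" using e a1 by (intro mult_right_mono) auto
          also have "\<dots> = e / 4" using a1 by (subst times_divide_eq_right, subst mult.commute, subst mult_divide_mult_cancel_right) auto
          finally show "norm a * \<kappa> \<le> e / 4" .
        qed
        obtain d1 where d1: "0 < d1" "\<And>y. y \<in> {0..2*pi} \<Longrightarrow> \<bar>y - x\<bar> < d1 \<Longrightarrow> norm (G (cis y) - G (cis x) - (y - x) *\<^sub>R f x) \<le> e / 4 * \<bar>y - x\<bar>"
          using der[of "e / 4"] e by auto
        have "(cis has_derivative (\<lambda>h. h *\<^sub>R (\<i> * cis x))) (at x)"
          by (auto intro!: derivative_eq_intros)
        then obtain d2 where d2: "0 < d2" "\<And>y. norm (y - x) < d2 \<Longrightarrow> norm (cis y - cis x - (y - x) *\<^sub>R (\<i> * cis x)) \<le> \<kappa> * norm (y - x)"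
          unfolding has_derivative_at_alt using \<kappa>(1) by blast
        have "isCont Arg2pi (cis x)" by (rule continuous_at_Arg2pi[OF cis_not_nonneg_Reals[OF x]])
        then obtain d where d: "0 < d" "\<And>z. dist z (cis x) < d \<Longrightarrow> dist (Arg2pi z) (Arg2pi (cis x)) < min d1 d2"
          unfolding continuous_at_eps_delta using d1(1) d2(1) by (metis min_less_iff_conj)
        show "\<exists>d>0. \<forall>z. norm z = 1 \<longrightarrow> norm (z - cis x) < d \<longrightarrow> norm (G z - G (cis x) - a * (z - cis x)) \<le> e * norm (z - cis x)"
        proof (intro exI conjI allI impI)
          fix z :: complex assume z: "norm z = 1" "norm (z - cis x) < d"
          define y where "y = Arg2pi z"
          have zy: "z = cis y" using cis_Arg2pi[OF z(1)] by (simp add: y_def)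
          have y: "\<bar>y - x\<bar> < d1" "norm (y - x) < d2" "y \<in> {0..2*pi}"
            using d(2)[of z] z Arg2pi_cis[of x] x Arg2pi_ge_0[of z] Arg2pi_lt_2pi[of z] by (auto simp: y_def dist_norm)
          have c: "norm (cis y - cis x - (y - x) *\<^sub>R (\<i> * cis x)) \<le> \<kappa> * \<bar>y - x\<bar>" using d2(2)[OF y(2)] by simp
          have dist: "\<bar>y - x\<bar> \<le> 2 * norm (z - cis x)"
          proof -
            have "\<bar>y - x\<bar> = norm ((y - x) *\<^sub>R (\<i> * cis x))" by (simp add: norm_mult)
            also have "\<dots> \<le> norm (cis y - cis x) + norm (cis y - cis x - (y - x) *\<^sub>R (\<i> * cis x))"
              using norm_triangle_ineq4[of "cis y - cis x" "cis y - cis x - (y - x) *\<^sub>R (\<i> * cis x)"] by simp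
            also have "\<dots> \<le> norm (z - cis x) + 1/2 * \<bar>y - x\<bar>"
              using c mult_right_mono[OF \<kappa>(2), of "\<bar>y - x\<bar>"] by (simp add: zy)
            finally show ?thesis by simp
          qed
          have "G z - G (cis x) - a * (z - cis x) = (G (cis y) - G (cis x) - (y - x) *\<^sub>R f x) - a * (cis y - cis x - (y - x) *\<^sub>R (\<i> * cis x))"
            by (simp add: zy fa scaleR_conv_of_real algebra_simps)
          also have "norm \<dots> \<le> e / 4 * \<bar>y - x\<bar> + norm a * (\<kappa> * \<bar>y - x\<bar>)"
            using d1(2)[OF y(3,1)] mult_left_mono[OF c norm_ge_zero[of a]]
            by (intro order_trans[OF norm_triangle_ineq4 add_mono]) (simp_all add: norm_mult)
          also have "\<dots> \<le> e / 4 * \<bar>y - x\<bar> + e / 4 * \<bar>y - x\<bar>"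
            using mult_right_mono[OF \<kappa>(3), of "\<bar>y - x\<bar>"] by (simp add: mult.assoc)
          also have "\<dots> = e / 2 * \<bar>y - x\<bar>" by simp
          also have "\<dots> \<le> e / 2 * (2 * norm (z - cis x))" using e by (intro mult_left_mono dist) auto
          finally show "norm (G z - G (cis x) - a * (z - cis x)) \<le> e * norm (z - cis x)" by simp
        qed (rule d(1))
      qed simp
      moreover have "\<forall>\<^sub>F r::real in at_left 1. deriv G (of_real r * cis x) = h (of_real r * cis x)"
      proof -
        have "\<forall>\<^sub>F r::real in at_left 1. 0 < r \<and> r < 1"
          unfolding eventually_at_left_field by (intro exI[of _ 0]) auto
        then show ?thesis by eventually_elim (auto intro!: dG simp: norm_mult)
      qed
      ultimately have "((\<lambda>r. h (of_real r * cis x)) \<longlongrightarrow> a) (at_left 1)" by (rule Lim_transform_eventually)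
      then show "\<exists>l. ((\<lambda>r. h (of_real r * cis x)) \<longlongrightarrow> l) (at_left 1)" by blast
    qed
  qed
  then show ?thesis by (rule AE_circle_measureI)
qed

section \<open>Boundary functions and Poisson integrals\<close>

lemma linf_norm_leI:
  assumes "F \<in> borel_measurable circle_measure" "AE z in circle_measure. norm (F z) \<le> B"
  shows "linf_norm F \<le> ereal B"
  unfolding linf_norm_def by (rule esssup_I) (use assms in auto)

lemma linf_norm_leD:
  assumes "linf_norm F \<le> ereal B"
  shows "AE z in circle_measure. norm (F z) \<le> B"
proof -
  have "AE z in circle_measure. ereal (norm (F z)) \<le> linf_norm F"
    unfolding linf_norm_def by (rule esssup_AE)
  then show ?thesis by eventually_elim (use assms order_trans in fastforce)
qed

lemma Linf_iff: "F \<in> Linf \<longleftrightarrow> F \<in> borel_measurable circle_measure \<and> (\<exists>B. AE z in circle_measure. norm (F z) \<le> B)"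
proof
  assume F: "F \<in> Linf"
  then obtain n :: nat where "linf_norm F < ereal (real n)"
    by (auto simp: Linf_def less_PInf_Ex_of_nat)
  then show "F \<in> borel_measurable circle_measure \<and> (\<exists>B. AE z in circle_measure. norm (F z) \<le> B)"
    using F linf_norm_leD[of F "real n"] less_imp_le[of "linf_norm F" "ereal (real n)"] unfolding Linf_def by blast
next
  assume "F \<in> borel_measurable circle_measure \<and> (\<exists>B. AE z in circle_measure. norm (F z) \<le> B)"
  then obtain B where "F \<in> borel_measurable circle_measure" "AE z in circle_measure. norm (F z) \<le> B" by blast
  then show "F \<in> Linf" using linf_norm_leI[of F B] by (auto simp: Linf_def)
qed

lemma tendsto_at_left_sequentially:
  fixes f :: "real \<Rightarrow> 'a::topological_space"
  assumes "(f \<longlongrightarrow> l) (at_left 1)" "\<rho> \<longlonglongrightarrow> 1" "\<And>k. \<rho> k < 1"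
  shows "(\<lambda>k. f (\<rho> k)) \<longlonglongrightarrow> l"
proof -
  have "filterlim \<rho> (at_left 1) sequentially"
    unfolding filterlim_at using assms(2,3) by (auto simp: less_imp_neq)
  then show ?thesis using assms(1) by (rule filterlim_compose[rotated])
qed

text \<open>A limit along one fixed sequence of dilations is Borel measurable on the whole circle,
  and Fatou's theorem identifies it with the radial limit almost everywhere.\<close>

lemma boundary_function_exists:
  assumes h: "h holomorphic_on ball 0 1" and B: "\<And>z. z \<in> ball 0 1 \<Longrightarrow> norm (h z) \<le> B"
  obtains F where "F \<in> Hinf" "AE z in circle_measure. ((\<lambda>r. h (of_real r * z)) \<longlongrightarrow> F z) (at_left 1)"
    "AE z in circle_measure. norm (F z) \<le> B"
proof -
  define \<rho> where "\<rho> = (\<lambda>n. 1 - inverse (real (Suc (Suc n))))"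
  have \<rho>: "0 < \<rho> n" "\<rho> n < 1" for n by (auto simp: \<rho>_def inverse_eq_divide)
  have \<rho>1: "\<rho> \<longlonglongrightarrow> 1"
    using tendsto_diff[OF tendsto_const[of 1] LIMSEQ_Suc[OF LIMSEQ_inverse_real_of_nat]] by (simp add: \<rho>_def)
  define F where "F = (\<lambda>z. lim (\<lambda>n. h (of_real (\<rho> n) * z)))"
  have F: "F \<in> borel_measurable circle_measure"
    unfolding F_def
    by (intro borel_measurable_lim_metric borel_measurable_circle_continuous dilation_continuous[OF h]) (use \<rho> in \<open>auto intro: less_imp_le\<close>)
  have lim: "AE z in circle_measure. ((\<lambda>r. h (of_real r * z)) \<longlongrightarrow> F z) (at_left 1)"
  proof -
    have "AE z in circle_measure. \<exists>l. ((\<lambda>r. h (of_real r * z)) \<longlongrightarrow> l) (at_left 1)"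
      by (rule Fatou_radial_limit[OF h]) (rule B)
    then show ?thesis
    proof eventually_elim
    case (elim z)
    then obtain l where l: "((\<lambda>r. h (of_real r * z)) \<longlongrightarrow> l) (at_left 1)" by blast
    have "F z = l" unfolding F_def by (rule limI[OF tendsto_at_left_sequentially[OF l \<rho>1 \<rho>(2)]])
    then show ?case using l by simp
    qed
  qed
  have bd: "AE z in circle_measure. norm (F z) \<le> B"
    using lim AE_space
  proof eventually_elim
    case (elim z)
    have "(\<lambda>n. h (of_real (\<rho> n) * z)) \<longlonglongrightarrow> F z" by (rule tendsto_at_left_sequentially[OF elim(1) \<rho>1 \<rho>(2)])
    then have "(\<lambda>n. norm (h (of_real (\<rho> n) * z))) \<longlonglongrightarrow> norm (F z)" by (rule tendsto_norm)
    then show ?case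
    proof (rule LIMSEQ_le_const2, intro exI allI impI)
      fix n show "norm (h (of_real (\<rho> n) * z)) \<le> B"
        by (rule B) (use elim(2) \<rho>[of n] in \<open>simp add: norm_mult\<close>)
    qed
  qed
  have "F \<in> Linf" unfolding Linf_iff using F bd by blast
  moreover have "bounded (h ` ball 0 1)" unfolding bounded_iff by (rule exI[of _ B]) (use B in blast)
  ultimately have "F \<in> Hinf" unfolding Hinf_def using h lim by blast
  then show thesis using that lim bd by blast
qed

definition poisson_integral :: "(complex \<Rightarrow> complex) \<Rightarrow> complex \<Rightarrow> complex"
  where "poisson_integral F w = (LINT z|circle_measure. of_real (poisson w z) * F z)"

lemma continuous_poisson_right: "norm w < 1 \<Longrightarrow> continuous_on (sphere 0 1) (poisson w)"
  by (intro continuous_on_poisson continuous_intros) auto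

lemma poisson_integrable:
  assumes w: "norm w < 1" and F: "F \<in> Linf"
  shows "integrable circle_measure (\<lambda>z. of_real (poisson w z) * F z)"
proof -
  obtain B where B: "AE z in circle_measure. norm (F z) \<le> B" and [measurable]: "F \<in> borel_measurable circle_measure"
    using F unfolding Linf_iff by blast
  obtain C where "\<forall>x\<in>poisson w ` sphere 0 1. norm x \<le> C"
    using compact_imp_bounded[OF compact_continuous_image[OF continuous_poisson_right[OF w] compact_sphere]] unfolding bounded_iff by blast
  then have C: "\<bar>poisson w z\<bar> \<le> C" if "norm z = 1" for z using that by auto
  have C0: "0 \<le> C" using C[of 1] by simp
  have [measurable]: "poisson w \<in> borel_measurable circle_measure"
    by (rule borel_measurable_circle_continuous[OF continuous_poisson_right[OF w]])
  show ?thesis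
  proof (rule circle_measure.integrable_const_bound[where B="C * B"])
    show "AE z in circle_measure. norm (of_real (poisson w z) * F z) \<le> C * B"
      using B AE_space
    proof eventually_elim
      case (elim z)
      then show ?case using C[of z] C0 by (auto simp: norm_mult intro!: mult_mono)
    qed
  qed measurable
qed

lemma poisson_integral_norm_le:
  assumes w: "norm w < 1" and F: "F \<in> Linf" "AE z in circle_measure. norm (F z) \<le> B"
  shows "norm (poisson_integral F w) \<le> B"
proof -
  have iP: "integrable circle_measure (poisson w)"
    using poisson_integrable[OF w, of "\<lambda>_. 1"] integrable_Re[of circle_measure "\<lambda>z. of_real (poisson w z) * 1"]
    by (simp add: Linf_iff exI[of _ 1])
  have "norm (poisson_integral F w) \<le> (LINT z|circle_measure. norm (of_real (poisson w z) * F z))"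
    unfolding poisson_integral_def by (rule integral_norm_bound)
  also have "\<dots> \<le> (LINT z|circle_measure. B * poisson w z)"
  proof (rule integral_mono_AE)
    show "AE z in circle_measure. norm (of_real (poisson w z) * F z) \<le> B * poisson w z"
      using F(2)
    proof eventually_elim
      case (elim z)
      have "norm (of_real (poisson w z) * F z) = norm (F z) * poisson w z"
        using poisson_nonneg[of w z] w by (simp add: norm_mult)
      also have "\<dots> \<le> B * poisson w z" using elim poisson_nonneg[of w z] w by (intro mult_right_mono) auto
      finally show ?case .
    qed
  qed (use poisson_integrable[OF w F(1)] iP in auto)
  also have "\<dots> = B * circle_mean 1 (poisson w)"
    using integral_circle_continuous[OF continuous_poisson_right[OF w]] by simp
  finally show ?thesis by (simp add: poisson_mean[OF w])
qed

lemma poisson_integral_cong_AE: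
  assumes "F \<in> Linf" "G \<in> Linf" "AE z in circle_measure. F z = G z" "norm w < 1"
  shows "poisson_integral F w = poisson_integral G w"
  unfolding poisson_integral_def
proof (rule integral_cong_AE)
  show "AE z in circle_measure. of_real (poisson w z) * F z = of_real (poisson w z) * G z"
    using assms(3) by eventually_elim simp
qed (use poisson_integrable[OF assms(4)] assms(1,2) in auto)

lemma poisson_integral_add:
  assumes "F \<in> Linf" "G \<in> Linf" "norm w < 1"
  shows "poisson_integral (\<lambda>z. F z + G z) w = poisson_integral F w + poisson_integral G w"
  unfolding poisson_integral_def distrib_left
  by (intro Bochner_Integration.integral_add poisson_integrable assms)

lemma poisson_integral_cmult:
  shows "poisson_integral (\<lambda>z. c * F z) w = c * poisson_integral F w"
  unfolding poisson_integral_def mult.left_commute[of _ c] by simp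

text \<open>Poisson's formula for the dilations, which are holomorphic beyond the closed disc,
  followed by dominated convergence at the circle.\<close>

lemma poisson_integral_Hinf:
  assumes F: "F \<in> Linf" and h: "h holomorphic_on ball 0 1" "bounded (h ` ball 0 1)"
    and lim: "AE z in circle_measure. ((\<lambda>r. h (of_real r * z)) \<longlongrightarrow> F z) (at_left 1)" and w: "norm w < 1"
  shows "poisson_integral F w = h w"
proof -
  define \<rho> where "\<rho> = (\<lambda>n. 1 - inverse (real (Suc (Suc n))))"
  have \<rho>: "0 < \<rho> n" "\<rho> n < 1" for n by (auto simp: \<rho>_def inverse_eq_divide)
  have \<rho>1: "\<rho> \<longlonglongrightarrow> 1"
    using tendsto_diff[OF tendsto_const[of 1] LIMSEQ_Suc[OF LIMSEQ_inverse_real_of_nat]] by (simp add: \<rho>_def)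
  obtain B where "\<forall>x\<in>h ` ball 0 1. norm x \<le> B" using h(2) unfolding bounded_iff by blast
  then have B: "norm (h z) \<le> B" if "z \<in> ball 0 1" for z using that by auto
  have B0: "0 \<le> B" by (rule order_trans[OF norm_ge_zero B[of 0]]) simp
  have inb: "of_real (\<rho> n) * z \<in> ball 0 1" if "norm z \<le> 1" for n and z :: complex
  proof -
    have "\<rho> n * norm z \<le> \<rho> n * 1" using \<rho>[of n] that by (intro mult_left_mono) auto
    then have "\<rho> n * norm z < 1" using \<rho>(2)[of n] by linarith
    then show ?thesis using \<rho>[of n] by (simp add: norm_mult)
  qed
  have iP: "integrable circle_measure (poisson w)"
    using poisson_integrable[OF w, of "\<lambda>_. 1"] integrable_Re[of circle_measure "\<lambda>z. of_real (poisson w z) * 1"]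
    by (simp add: Linf_iff exI[of _ 1])
  have cP: "continuous_on (sphere 0 1) (\<lambda>z. complex_of_real (poisson w z))"
    by (intro continuous_intros continuous_poisson_right w)
  have cd: "continuous_on (sphere 0 1) (\<lambda>z. h (of_real (\<rho> n) * z))" for n
    by (rule dilation_continuous[OF h(1)]) (use \<rho>[of n] in auto)
  have L1: "(\<lambda>n. LINT z|circle_measure. of_real (poisson w z) * h (of_real (\<rho> n) * z)) \<longlonglongrightarrow> poisson_integral F w"
    unfolding poisson_integral_def
  proof (rule integral_dominated_convergence[where w="\<lambda>z. B * poisson w z"])
    show "AE z in circle_measure. (\<lambda>n. of_real (poisson w z) * h (of_real (\<rho> n) * z)) \<longlonglongrightarrow> of_real (poisson w z) * F z"
      using lim by eventually_elim (intro tendsto_intros tendsto_at_left_sequentially[OF _ \<rho>1 \<rho>(2)])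
    show "AE z in circle_measure. norm (of_real (poisson w z) * h (of_real (\<rho> n) * z)) \<le> B * poisson w z" for n
    proof (rule AE_I2)
      fix z assume "z \<in> space circle_measure"
      then have "norm (h (of_real (\<rho> n) * z)) \<le> B" by (intro B inb) simp
      then have "norm (h (of_real (\<rho> n) * z)) * poisson w z \<le> B * poisson w z" using poisson_nonneg[of w z] w by (intro mult_right_mono) auto
      then show "norm (of_real (poisson w z) * h (of_real (\<rho> n) * z)) \<le> B * poisson w z"
        using poisson_nonneg[of w z] w by (simp add: norm_mult mult.commute)
    qed
    show "(\<lambda>z. of_real (poisson w z) * h (of_real (\<rho> n) * z)) \<in> borel_measurable circle_measure" for n
      by (intro borel_measurable_circle_continuous continuous_intros cP cd)
  qed (use poisson_integrable[OF w F] iP in auto)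
  have L2: "(LINT z|circle_measure. of_real (poisson w z) * h (of_real (\<rho> n) * z)) = h (of_real (\<rho> n) * w)" for n
  proof -
    have "(LINT z|circle_measure. of_real (poisson w z) * h (of_real (\<rho> n) * z)) = circle_mean 1 (\<lambda>z. of_real (poisson w z) * h (of_real (\<rho> n) * z))"
      by (intro integral_circle_continuous continuous_intros cP cd)
    also have "\<dots> = h (of_real (\<rho> n) * w)"
    proof (rule poisson_formula[where R="1 / \<rho> n"])
      show "(\<lambda>z. h (of_real (\<rho> n) * z)) holomorphic_on ball 0 (1 / \<rho> n)"
        by (intro holomorphic_on_compose_gen[of "\<lambda>z. of_real (\<rho> n) * z" _ h "ball 0 1", unfolded o_def] holomorphic_intros h(1))
           (use \<rho>[of n] in \<open>auto simp: norm_mult field_simps\<close>)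
    qed (use \<rho>[of n] w in auto)
    finally show ?thesis .
  qed
  have L3: "(\<lambda>n. h (of_real (\<rho> n) * w)) \<longlonglongrightarrow> h w"
  proof -
    have "(\<lambda>n. complex_of_real (\<rho> n)) \<longlonglongrightarrow> 1" using tendsto_of_real[OF \<rho>1] by simp
    then have "(\<lambda>n. of_real (\<rho> n) * w) \<longlonglongrightarrow> 1 * w" by (intro tendsto_intros)
    moreover have "isCont h w" by (rule DERIV_isCont[OF holomorphic_derivI[OF h(1) open_ball]]) (use w in simp)
    ultimately show ?thesis by (intro isCont_tendsto_compose[of w h]) auto
  qed
  show ?thesis by (rule LIMSEQ_unique[OF L1[unfolded L2] L3])
qed

section \<open>Bounded functions and Poisson integrals near the circle\<close>

lemma LinfI:
  assumes "F \<in> borel_measurable circle_measure" "AE z in circle_measure. norm (F z) \<le> B"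
  shows "F \<in> Linf"
  unfolding Linf_iff using assms by blast

lemma LinfE:
  assumes "F \<in> Linf"
  obtains B where "0 < B" "AE z in circle_measure. norm (F z) \<le> B"
proof -
  obtain B where B: "AE z in circle_measure. norm (F z) \<le> B" using assms unfolding Linf_iff by blast
  have "AE z in circle_measure. norm (F z) \<le> max B 1" using B by eventually_elim simp
  then show thesis by (intro that[of "max B 1"]) auto
qed

lemma Linf_measurable: "F \<in> Linf \<Longrightarrow> F \<in> borel_measurable circle_measure"
  unfolding Linf_iff by blast

lemma Linf_add:
  assumes "F \<in> Linf" "G \<in> Linf"
  shows "(\<lambda>z. F z + G z) \<in> Linf"
proof -
  obtain A where A: "0 < A" "AE z in circle_measure. norm (F z) \<le> A" by (rule LinfE[OF assms(1)])
  obtain B where B: "0 < B" "AE z in circle_measure. norm (G z) \<le> B" by (rule LinfE[OF assms(2)])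
  have "AE z in circle_measure. norm (F z + G z) \<le> A + B"
    using A(2) B(2) by eventually_elim (rule norm_triangle_le, rule add_mono)
  then show ?thesis by (rule LinfI[rotated]) (intro borel_measurable_add Linf_measurable assms)
qed

lemma Linf_mult:
  assumes "F \<in> Linf" "G \<in> Linf"
  shows "(\<lambda>z. F z * G z) \<in> Linf"
proof -
  obtain A where A: "0 < A" "AE z in circle_measure. norm (F z) \<le> A" by (rule LinfE[OF assms(1)])
  obtain B where B: "0 < B" "AE z in circle_measure. norm (G z) \<le> B" by (rule LinfE[OF assms(2)])
  have "AE z in circle_measure. norm (F z * G z) \<le> A * B"
    using A(2) B(2)
  proof eventually_elim
    case (elim z)
    then show ?case unfolding norm_mult using A(1) by (intro mult_mono) auto
  qed
  then show ?thesis by (rule LinfI[rotated]) (intro borel_measurable_times Linf_measurable assms)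
qed

lemma Linf_continuous:
  fixes g :: "complex \<Rightarrow> complex"
  assumes g: "continuous_on (sphere 0 1) g"
  shows "g \<in> Linf"
proof -
  obtain C where "\<forall>x\<in>g ` sphere 0 1. norm x \<le> C"
    using compact_imp_bounded[OF compact_continuous_image[OF g compact_sphere]] unfolding bounded_iff by blast
  then have "norm (g z) \<le> C" if "z \<in> space circle_measure" for z using that by auto
  then have "AE z in circle_measure. norm (g z) \<le> C" by (rule AE_I2)
  then show ?thesis by (rule LinfI[OF borel_measurable_circle_continuous[OF g]])
qed

lemma poisson_integral_sub:
  assumes "F \<in> Linf" "G \<in> Linf" "norm w < 1"
  shows "poisson_integral (\<lambda>z. F z - G z) w = poisson_integral F w - poisson_integral G w"
  unfolding poisson_integral_def right_diff_distrib
  by (intro Bochner_Integration.integral_diff poisson_integrable assms)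

lemma Linf_sub:
  assumes "F \<in> Linf" "G \<in> Linf"
  shows "(\<lambda>z. F z - G z) \<in> Linf"
  using Linf_add[OF assms(1) Linf_mult[OF Linf_continuous[of "\<lambda>_. - 1"] assms(2)]] by simp

lemma poisson_kernel_integral:
  assumes w: "norm w < 1"
  shows "integrable circle_measure (poisson w)" "(LINT z|circle_measure. poisson w z) = 1"
proof -
  show "integrable circle_measure (poisson w)"
    using poisson_integrable[OF w Linf_continuous[of "\<lambda>_. 1"]] integrable_Re[of circle_measure "\<lambda>z. of_real (poisson w z) * 1"]
    by simp
  show "(LINT z|circle_measure. poisson w z) = 1"
    using integral_circle_continuous[OF continuous_poisson_right[OF w]] poisson_mean[OF w] by simp
qed

lemma poisson_integral_one: "norm w < 1 \<Longrightarrow> poisson_integral (\<lambda>_. 1) w = 1"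
  unfolding poisson_integral_def using poisson_kernel_integral(2) by simp

text \<open>\<open>sgn w\<close> is the boundary point nearest to \<open>w\<close>. The additive
  \<open>e / 2\<close> covers boundary points far from it, where the kernel itself is small. The
  estimate is pointwise so that it can be multiplied by a bounded function before
  integration.\<close>

lemma poisson_oscillation_near_circle:
  fixes g :: "complex \<Rightarrow> complex"
  assumes g: "continuous_on (sphere 0 1) g" and e: "0 < e"
  obtains s where "0 \<le> s" "s < 1" "\<And>w z. \<lbrakk>s < norm w; norm w < 1; norm z = 1\<rbrakk> \<Longrightarrow>
    poisson w z * norm (g z - g (sgn w)) \<le> e / 2 * poisson w z + e / 2"
proof -
  obtain C where "\<forall>x\<in>g ` sphere 0 1. norm x \<le> C"
    using compact_imp_bounded[OF compact_continuous_image[OF g compact_sphere]] unfolding bounded_iff by blast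
  then have C: "norm (g z) \<le> C" if "norm z = 1" for z using that by auto
  have C0: "0 \<le> C" using order_trans[OF norm_ge_zero C[of 1]] by simp
  have "uniformly_continuous_on (sphere 0 1) g" by (rule compact_uniformly_continuous[OF g compact_sphere])
  then obtain d where d: "0 < d" "\<And>x y. \<lbrakk>x \<in> sphere 0 1; y \<in> sphere 0 1; dist y x < d\<rbrakk> \<Longrightarrow> dist (g y) (g x) < e / 2"
    unfolding uniformly_continuous_on_def using half_gt_zero[OF e] by metis
  \<comment> \<open>\<open>d / 2\<close> keeps \<open>w\<close> close to \<open>sgn w\<close>; the
    last entry makes the kernel at most \<open>e / (4 * (C + 1))\<close> away from
    \<open>sgn w\<close>, where \<open>g\<close> oscillates by at most
    \<open>2 * (C + 1)\<close>.\<close>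
  define \<kappa> where "\<kappa> = min (d / 2) (min (1/2) (e * d\<^sup>2 / (32 * (C + 1))))"
  have \<kappa>: "0 < \<kappa>" "\<kappa> \<le> d / 2" "\<kappa> \<le> 1/2" "\<kappa> \<le> e * d\<^sup>2 / (32 * (C + 1))"
  proof -
    show "0 < \<kappa>" using d(1) e C0 by (simp add: \<kappa>_def)
    show "\<kappa> \<le> d / 2" unfolding \<kappa>_def by (rule min.cobounded1)
    show "\<kappa> \<le> 1/2" unfolding \<kappa>_def by (rule min.coboundedI2[OF min.cobounded1])
    show "\<kappa> \<le> e * d\<^sup>2 / (32 * (C + 1))" unfolding \<kappa>_def by (rule min.coboundedI2[OF min.cobounded2])
  qed
  show thesis
  proof (rule that[of "1 - \<kappa>"])
    fix w z :: complex assume w: "1 - \<kappa> < norm w" "norm w < 1" and z: "norm z = 1"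
    have w0: "w \<noteq> 0" using w \<kappa>(3) by auto
    have \<zeta>: "norm (sgn w) = 1" using w0 by (simp add: norm_sgn)
    have P0: "0 \<le> poisson w z" using w by (intro poisson_nonneg) simp
    show "poisson w z * norm (g z - g (sgn w)) \<le> e / 2 * poisson w z + e / 2"
    proof (cases "dist z (sgn w) < d")
      case True
      then have "norm (g z - g (sgn w)) \<le> e / 2" using d(2)[of "sgn w" z] z \<zeta> by (simp add: dist_norm)
      from mult_left_mono[OF this P0] show ?thesis using e by (simp add: mult.commute)
    next
      case False
      have "of_real (norm w) * sgn w = w" using w0 by (simp add: sgn_eq)
      then have "w - sgn w = of_real (norm w - 1) * sgn w" by (simp only: of_real_diff of_real_1 left_diff_distrib mult_1)
      then have "norm (w - sgn w) = \<bar>norm w - 1\<bar> * 1" by (simp only: norm_mult norm_of_real \<zeta>)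
      then have "norm (w - sgn w) \<le> d / 2" using w \<kappa>(2) by simp
      moreover have "norm (z - sgn w) \<le> norm (z - w) + norm (w - sgn w)"
        using norm_triangle_ineq[of "z - w" "w - sgn w"] by simp
      ultimately have far: "d / 2 \<le> norm (z - w)" using False by (simp add: dist_norm)
      have "1 - (norm w)\<^sup>2 = (1 - norm w) * (1 + norm w)" by (simp add: power2_eq_square algebra_simps)
      also have "\<dots> \<le> \<kappa> * 2" using w \<kappa>(1) by (intro mult_mono) auto
      finally have k2: "1 - (norm w)\<^sup>2 \<le> \<kappa> * 2" .
      have "poisson w z \<le> (1 - (norm w)\<^sup>2) / (d / 2)\<^sup>2" using w d(1) far by (intro poisson_le_far) auto
      also have "\<dots> \<le> (\<kappa> * 2) / (d / 2)\<^sup>2" using k2 by (intro divide_right_mono) auto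
      also have "\<dots> \<le> (e * d\<^sup>2 / (32 * (C + 1)) * 2) / (d / 2)\<^sup>2" using \<kappa>(4) by (intro divide_right_mono mult_right_mono) auto
      also have "\<dots> = e / (4 * (C + 1))"
      proof -
        have "(e * x / (32 * D) * 2) / (x / 4) = e / (4 * D)" if "0 < x" "0 < D" for x D :: real
          using that by (simp add: field_simps)
        from this[of "d\<^sup>2" "C + 1"] show ?thesis using d(1) C0 by (simp add: power_divide)
      qed
      finally have p: "poisson w z \<le> e / (4 * (C + 1))" .
      have "norm (g z - g (sgn w)) \<le> C + C" by (rule order_trans[OF norm_triangle_ineq4 add_mono[OF C[OF z] C[OF \<zeta>]]])
      then have g2: "norm (g z - g (sgn w)) \<le> 2 * (C + 1)" by simp
      have "poisson w z * norm (g z - g (sgn w)) \<le> e / (4 * (C + 1)) * (2 * (C + 1))"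
        using p g2 e C0 by (intro mult_mono) auto
      also have "\<dots> = e / 2" using C0 by (simp add: field_simps)
      finally show ?thesis using mult_nonneg_nonneg[OF _ P0, of "e / 2"] e by simp
    qed
  qed (use \<kappa> in auto)
qed

text \<open>The kernel concentrates at \<open>sgn w\<close>, so a continuous factor can be pulled
  out as its value there. This is what makes powers of \<open>cnj z\<close> harmless: they come out
  with modulus 1.\<close>

lemma poisson_integral_multiplier:
  fixes g :: "complex \<Rightarrow> complex"
  assumes F: "F \<in> Linf" "AE z in circle_measure. norm (F z) \<le> B" "0 \<le> B"
    and g: "continuous_on (sphere 0 1) g" and e: "0 < e"
  obtains s where "0 \<le> s" "s < 1" "\<And>w. \<lbrakk>s < norm w; norm w < 1\<rbrakk> \<Longrightarrow>
    norm (poisson_integral (\<lambda>z. F z * g z) w - g (sgn w) * poisson_integral F w) \<le> B * e"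
proof -
  obtain s where s: "0 \<le> s" "s < 1" "\<And>w z. \<lbrakk>s < norm w; norm w < 1; norm z = 1\<rbrakk> \<Longrightarrow>
    poisson w z * norm (g z - g (sgn w)) \<le> e / 2 * poisson w z + e / 2"
    by (rule poisson_oscillation_near_circle[OF g e]) blast
  show thesis
  proof (rule that[OF s(1,2)])
    fix w :: complex assume w: "s < norm w" "norm w < 1"
    define a where "a = g (sgn w)"
    have L: "(\<lambda>z. F z * g z) \<in> Linf" "(\<lambda>z. a * F z) \<in> Linf"
      by (intro Linf_mult F Linf_continuous g continuous_intros)+
    have "poisson_integral (\<lambda>z. F z * g z) w - a * poisson_integral F w = poisson_integral (\<lambda>z. F z * g z - a * F z) w"
      by (simp only: poisson_integral_sub[OF L w(2)] poisson_integral_cmult)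
    also have "norm \<dots> \<le> (LINT z|circle_measure. norm (of_real (poisson w z) * (F z * g z - a * F z)))"
      unfolding poisson_integral_def by (rule integral_norm_bound)
    also have "\<dots> \<le> (LINT z|circle_measure. B * (e / 2 * poisson w z + e / 2))"
    proof (rule integral_mono_AE)
      show "AE z in circle_measure. norm (of_real (poisson w z) * (F z * g z - a * F z)) \<le> B * (e / 2 * poisson w z + e / 2)"
        using F(2) AE_space
      proof eventually_elim
        case (elim z)
        then have z: "norm z = 1" by simp
        have P0: "0 \<le> poisson w z" using w by (intro poisson_nonneg) simp
        have "of_real (poisson w z) * (F z * g z - a * F z) = F z * (of_real (poisson w z) * (g z - a))"
          by (simp add: algebra_simps)
        then have "norm (of_real (poisson w z) * (F z * g z - a * F z)) = norm (F z) * (poisson w z * norm (g z - a))"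
          using P0 by (simp only: norm_mult norm_of_real abs_of_nonneg)
        also have "\<dots> \<le> B * (e / 2 * poisson w z + e / 2)"
          using elim(1) s(3)[OF w z] P0 F(3) by (intro mult_mono) (auto simp: a_def)
        finally show ?case .
      qed
      show "integrable circle_measure (\<lambda>z. B * (e / 2 * poisson w z + e / 2))"
        by (intro Bochner_Integration.integrable_mult_right Bochner_Integration.integrable_add poisson_kernel_integral(1) w(2) circle_measure.integrable_const)
      show "integrable circle_measure (\<lambda>z. norm (of_real (poisson w z) * (F z * g z - a * F z)))"
        by (intro integrable_norm poisson_integrable w(2) Linf_sub L)
    qed
    also have "\<dots> = B * (e / 2 * 1 + e / 2)"
    proof -
      have "(LINT z|circle_measure. e / 2 * poisson w z + e / 2) = (LINT z|circle_measure. e / 2 * poisson w z) + (LINT z|circle_measure. e / 2)"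
        by (intro Bochner_Integration.integral_add Bochner_Integration.integrable_mult_right poisson_kernel_integral(1) w(2) circle_measure.integrable_const)
      then show ?thesis using poisson_kernel_integral(2)[OF w(2)] circle_measure.prob_space by simp
    qed
    finally show "norm (poisson_integral (\<lambda>z. F z * g z) w - g (sgn w) * poisson_integral F w) \<le> B * e"
      by (simp add: a_def)
  qed
qed

section \<open>The algebra of bounded analytic functions\<close>

lemma eventually_at_left_unit: "\<forall>\<^sub>F r::real in at_left 1. 0 < r \<and> r < 1"
  unfolding eventually_at_left_field by (intro exI[of _ 0]) auto

lemma HinfI:
  assumes "F \<in> Linf" "h holomorphic_on ball 0 1" "\<And>z. norm z < 1 \<Longrightarrow> norm (h z) \<le> B"
    and "AE z in circle_measure. ((\<lambda>r. h (of_real r * z)) \<longlongrightarrow> F z) (at_left 1)"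
  shows "F \<in> Hinf"
proof -
  have "bounded (h ` ball 0 1)" unfolding bounded_iff by (rule exI[of _ B]) (use assms(3) in auto)
  then show ?thesis unfolding Hinf_def using assms(1,2,4) by blast
qed

lemma Hinf_Linf: "F \<in> Hinf \<Longrightarrow> F \<in> Linf"
  by (simp add: Hinf_def)

lemma Hinf_poisson_integral:
  assumes F: "F \<in> Hinf"
  shows "poisson_integral F holomorphic_on ball 0 1"
    and "AE z in circle_measure. ((\<lambda>r. poisson_integral F (of_real r * z)) \<longlongrightarrow> F z) (at_left 1)"
proof -
  obtain h where h: "h holomorphic_on ball 0 1" "bounded (h ` ball 0 1)"
    "AE z in circle_measure. ((\<lambda>r. h (of_real r * z)) \<longlongrightarrow> F z) (at_left 1)"
    using F unfolding Hinf_def by blast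
  have eq: "poisson_integral F w = h w" if "norm w < 1" for w
    by (rule poisson_integral_Hinf[OF Hinf_Linf[OF F] h that])
  show "poisson_integral F holomorphic_on ball 0 1"
    by (rule holomorphic_transform[OF h(1)]) (simp add: eq)
  show "AE z in circle_measure. ((\<lambda>r. poisson_integral F (of_real r * z)) \<longlongrightarrow> F z) (at_left 1)"
    using h(3) AE_space
  proof eventually_elim
    case (elim z)
    have "\<forall>\<^sub>F r in at_left 1. h (of_real r * z) = poisson_integral F (of_real r * z)"
      using eventually_at_left_unit by eventually_elim (use elim(2) in \<open>auto simp: norm_mult intro!: eq[symmetric]\<close>)
    then show ?case by (rule Lim_transform_eventually[OF elim(1)])
  qed
qed

lemma Hinf_boundary:
  assumes F: "F \<in> Linf" and h: "h holomorphic_on ball 0 1" "\<And>z. norm z < 1 \<Longrightarrow> norm (h z) \<le> B"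
    and lim: "AE z in circle_measure. ((\<lambda>r. h (of_real r * z)) \<longlongrightarrow> F z) (at_left 1)" and w: "norm w < 1"
  shows "poisson_integral F w = h w"
proof (rule poisson_integral_Hinf[OF F h(1) _ lim w])
  show "bounded (h ` ball 0 1)" unfolding bounded_iff by (rule exI[of _ B]) (use h(2) in auto)
qed

lemma poisson_integral_bounded:
  assumes "F \<in> Linf"
  obtains B where "0 < B" "\<And>w. norm w < 1 \<Longrightarrow> norm (poisson_integral F w) \<le> B"
proof -
  obtain B where B: "0 < B" "AE z in circle_measure. norm (F z) \<le> B" by (rule LinfE[OF assms])
  show thesis by (rule that[OF B(1) poisson_integral_norm_le[OF _ assms B(2)]])
qed

lemma Hinf_add:
  assumes F: "F \<in> Hinf" and G: "G \<in> Hinf"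
  shows "(\<lambda>z. F z + G z) \<in> Hinf"
proof -
  obtain A where A: "0 < A" "\<And>w. norm w < 1 \<Longrightarrow> norm (poisson_integral F w) \<le> A"
    by (rule poisson_integral_bounded[OF Hinf_Linf[OF F]]) blast
  obtain B where B: "0 < B" "\<And>w. norm w < 1 \<Longrightarrow> norm (poisson_integral G w) \<le> B"
    by (rule poisson_integral_bounded[OF Hinf_Linf[OF G]]) blast
  show ?thesis
  proof (rule HinfI[where h="\<lambda>w. poisson_integral F w + poisson_integral G w" and B="A + B"])
    show "AE z in circle_measure. ((\<lambda>r. poisson_integral F (of_real r * z) + poisson_integral G (of_real r * z)) \<longlongrightarrow> F z + G z) (at_left 1)"
      using Hinf_poisson_integral(2)[OF F] Hinf_poisson_integral(2)[OF G] by eventually_elim (rule tendsto_add)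
    show "norm (poisson_integral F z + poisson_integral G z) \<le> A + B" if "norm z < 1" for z
      by (rule norm_triangle_le[OF add_mono[OF A(2)[OF that] B(2)[OF that]]])
  qed (intro Linf_add Hinf_Linf F G holomorphic_intros Hinf_poisson_integral(1))+
qed

lemma Hinf_mult:
  assumes F: "F \<in> Hinf" and G: "G \<in> Hinf"
  shows "(\<lambda>z. F z * G z) \<in> Hinf"
    and "norm w < 1 \<Longrightarrow> poisson_integral (\<lambda>z. F z * G z) w = poisson_integral F w * poisson_integral G w"
proof -
  obtain A where A: "0 < A" "\<And>w. norm w < 1 \<Longrightarrow> norm (poisson_integral F w) \<le> A"
    by (rule poisson_integral_bounded[OF Hinf_Linf[OF F]]) blast
  obtain B where B: "0 < B" "\<And>w. norm w < 1 \<Longrightarrow> norm (poisson_integral G w) \<le> B"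
    by (rule poisson_integral_bounded[OF Hinf_Linf[OF G]]) blast
  have lim: "AE z in circle_measure. ((\<lambda>r. poisson_integral F (of_real r * z) * poisson_integral G (of_real r * z)) \<longlongrightarrow> F z * G z) (at_left 1)"
    using Hinf_poisson_integral(2)[OF F] Hinf_poisson_integral(2)[OF G] by eventually_elim (rule tendsto_mult)
  have bd: "norm (poisson_integral F z * poisson_integral G z) \<le> A * B" if "norm z < 1" for z
    unfolding norm_mult using A(1) by (intro mult_mono A(2) B(2) that) auto
  have hol: "(\<lambda>w. poisson_integral F w * poisson_integral G w) holomorphic_on ball 0 1"
    by (intro holomorphic_intros Hinf_poisson_integral(1) F G)
  have L: "(\<lambda>z. F z * G z) \<in> Linf" by (intro Linf_mult Hinf_Linf F G)
  show "(\<lambda>z. F z * G z) \<in> Hinf" by (rule HinfI[OF L hol bd lim])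
  show "norm w < 1 \<Longrightarrow> poisson_integral (\<lambda>z. F z * G z) w = poisson_integral F w * poisson_integral G w"
    by (rule Hinf_boundary[OF L hol bd lim])
qed

lemma disc_algebra_Hinf:
  assumes h: "h holomorphic_on ball 0 1" "continuous_on (cball 0 1) h"
  shows "h \<in> Hinf"
proof -
  obtain B where "\<forall>x\<in>h ` cball 0 1. norm x \<le> B"
    using compact_imp_bounded[OF compact_continuous_image[OF h(2) compact_cball]] unfolding bounded_iff by blast
  then have B: "norm (h z) \<le> B" if "norm z < 1" for z using that by auto
  have "((\<lambda>r. h (of_real r * z)) \<longlongrightarrow> h z) (at_left 1)" if "z \<in> space circle_measure" for z
  proof (rule continuous_on_tendsto_compose[OF h(2)])
    have "((\<lambda>r. complex_of_real r) \<longlongrightarrow> of_real 1) (at_left 1)" by (intro tendsto_intros)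
    then have "((\<lambda>r. complex_of_real r * z) \<longlongrightarrow> of_real 1 * z) (at_left 1)" by (intro tendsto_intros)
    then show "((\<lambda>r. complex_of_real r * z) \<longlongrightarrow> z) (at_left 1)" by simp
    show "\<forall>\<^sub>F r in at_left 1. complex_of_real r * z \<in> cball 0 1"
      using eventually_at_left_unit by eventually_elim (use that in \<open>auto simp: norm_mult\<close>)
    show "z \<in> cball 0 1" using that by simp
  qed
  then have lim: "AE z in circle_measure. ((\<lambda>r. h (of_real r * z)) \<longlongrightarrow> h z) (at_left 1)" by (rule AE_I2)
  have "continuous_on (sphere 0 1) h" by (rule continuous_on_subset[OF h(2)]) auto
  then show ?thesis using HinfI[OF Linf_continuous h(1) B lim] by blast
qed

text \<open>Poisson integration does not increase norms, so the extensions converge uniformly on the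
  disc and the limit is holomorphic. Radial limits follow by an \<open>e / 3\<close> argument at the
  points where all countably many approximants behave.\<close>

lemma Hinf_closed:
  fixes \<epsilon> :: "nat \<Rightarrow> real"
  assumes F: "F \<in> Linf" and G: "\<And>k. G k \<in> Hinf" "\<And>k. AE z in circle_measure. norm (F z - G k z) \<le> \<epsilon> k"
    and \<epsilon>: "\<epsilon> \<longlonglongrightarrow> 0"
  shows "F \<in> Hinf"
proof -
  have close: "norm (poisson_integral F w - poisson_integral (G k) w) \<le> \<epsilon> k" if "norm w < 1" for k w
    using poisson_integral_norm_le[OF that Linf_sub[OF F Hinf_Linf[OF G(1)]] G(2)]
    unfolding poisson_integral_sub[OF F Hinf_Linf[OF G(1)] that] .
  have hol: "poisson_integral F holomorphic_on ball 0 1"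
  proof (rule holomorphic_uniform_sequence[where f="\<lambda>k. poisson_integral (G k)", OF open_ball])
    show "poisson_integral (G k) holomorphic_on ball 0 1" for k by (rule Hinf_poisson_integral(1)[OF G(1)])
    fix x :: complex assume "x \<in> ball 0 1"
    then obtain d where d: "0 < d" "cball x d \<subseteq> ball 0 1" using open_contains_cball[of "ball (0::complex) 1"] open_ball by blast
    have "uniform_limit (cball x d) (\<lambda>k. poisson_integral (G k)) (poisson_integral F) sequentially"
    proof (rule uniform_limitI)
      fix e :: real assume "0 < e"
      then have "\<forall>\<^sub>F k in sequentially. \<epsilon> k < e" using \<epsilon> by (rule order_tendstoD(2)[rotated])
      then show "\<forall>\<^sub>F k in sequentially. \<forall>y\<in>cball x d. dist (poisson_integral (G k) y) (poisson_integral F y) < e"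
      proof eventually_elim
        case (elim k)
        show ?case
        proof
          fix y assume "y \<in> cball x d"
          then have "norm y < 1" using d(2) by (auto dest: subsetD)
          from close[OF this, of k] elim
          show "dist (poisson_integral (G k) y) (poisson_integral F y) < e" by (simp add: dist_norm norm_minus_commute)
        qed
      qed
    qed
    then show "\<exists>d>0. cball x d \<subseteq> ball 0 1 \<and> uniform_limit (cball x d) (\<lambda>k. poisson_integral (G k)) (poisson_integral F) sequentially"
      using d by blast
  qed
  obtain B where B: "0 < B" "\<And>w. norm w < 1 \<Longrightarrow> norm (poisson_integral F w) \<le> B"
    by (rule poisson_integral_bounded[OF F]) blast
  have "AE z in circle_measure. \<forall>k. norm (F z - G k z) \<le> \<epsilon> k"
    unfolding AE_all_countable using G(2) by blast
  moreover have "AE z in circle_measure. \<forall>k. ((\<lambda>r. poisson_integral (G k) (of_real r * z)) \<longlongrightarrow> G k z) (at_left 1)"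
    unfolding AE_all_countable using Hinf_poisson_integral(2)[OF G(1)] by blast
  ultimately have "AE z in circle_measure. ((\<lambda>r. poisson_integral F (of_real r * z)) \<longlongrightarrow> F z) (at_left 1)"
    using AE_space
  proof eventually_elim
    case (elim z)
    show ?case
    proof (rule tendstoI)
      fix e :: real assume e: "0 < e"
      then have "\<forall>\<^sub>F k in sequentially. \<epsilon> k < e / 3" using \<epsilon> by (intro order_tendstoD(2)[of \<epsilon> 0]) auto
      then obtain k where k: "\<epsilon> k < e / 3" using eventually_happens'[OF sequentially_bot] by blast
      have "\<forall>\<^sub>F r in at_left 1. dist (poisson_integral (G k) (of_real r * z)) (G k z) < e / 3"
        using elim(2) e by (intro tendstoD) auto
      then show "\<forall>\<^sub>F r in at_left 1. dist (poisson_integral F (of_real r * z)) (F z) < e"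
        using eventually_at_left_unit
      proof eventually_elim
        case r: (elim r)
        have "norm (of_real r * z) < 1" using r(2) elim(3) by (simp add: norm_mult)
        from close[OF this, of k] k
        have 1: "dist (poisson_integral F (of_real r * z)) (poisson_integral (G k) (of_real r * z)) < e / 3"
          by (simp add: dist_norm)
        have 2: "dist (G k z) (F z) < e / 3" using elim(1)[rule_format, of k] k by (simp add: dist_norm norm_minus_commute)
        show ?case
          using dist_triangle[of "poisson_integral F (of_real r * z)" "F z" "poisson_integral (G k) (of_real r * z)"]
            dist_triangle[of "poisson_integral (G k) (of_real r * z)" "F z" "G k z"] 1 2 r(1) by linarith
      qed
    qed
  qed
  then show ?thesis using HinfI[OF F hol B(2)] by blast
qed

section \<open>The Sarason algebra\<close>

lemma unit_mult_cnj: "norm z = 1 \<Longrightarrow> cnj z * z = 1"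
  using complex_norm_square[of z] by (simp add: mult.commute)

text \<open>The trigonometric polynomials: since \<open>cnj z\<close> is the inverse of
  \<open>z\<close> on the circle, the negative powers are collected in a single factor that a power
  of \<open>z\<close> cancels.\<close>

definition laurent_on_circle :: "(complex \<Rightarrow> complex) \<Rightarrow> bool"
  where "laurent_on_circle g \<longleftrightarrow> (\<exists>N p. \<forall>z. norm z = 1 \<longrightarrow> g z = cnj z ^ N * poly p z)"

lemma laurent_on_circle_add:
  assumes "laurent_on_circle f" "laurent_on_circle g"
  shows "laurent_on_circle (\<lambda>z. f z + g z)"
proof -
  obtain N p M q where f: "\<And>z. norm z = 1 \<Longrightarrow> f z = cnj z ^ N * poly p z"
    and g: "\<And>z. norm z = 1 \<Longrightarrow> g z = cnj z ^ M * poly q z"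
    using assms unfolding laurent_on_circle_def by metis
  have "f z + g z = cnj z ^ (N + M) * poly (monom 1 M * p + monom 1 N * q) z" if z: "norm z = 1" for z
  proof -
    have c: "cnj z ^ K * z ^ K = 1" for K using unit_mult_cnj[OF z] by (simp flip: power_mult_distrib)
    have "cnj z ^ (N + M) * poly (monom 1 M * p + monom 1 N * q) z =
      cnj z ^ N * (cnj z ^ M * z ^ M) * poly p z + cnj z ^ M * (cnj z ^ N * z ^ N) * poly q z"
      by (simp add: poly_monom power_add algebra_simps)
    then show ?thesis unfolding c f[OF z] g[OF z] by simp
  qed
  then show ?thesis unfolding laurent_on_circle_def by blast
qed

lemma laurent_on_circle_mult:
  assumes "laurent_on_circle f" "laurent_on_circle g"
  shows "laurent_on_circle (\<lambda>z. f z * g z)"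
proof -
  obtain N p M q where f: "\<And>z. norm z = 1 \<Longrightarrow> f z = cnj z ^ N * poly p z"
    and g: "\<And>z. norm z = 1 \<Longrightarrow> g z = cnj z ^ M * poly q z"
    using assms unfolding laurent_on_circle_def by metis
  have "f z * g z = cnj z ^ (N + M) * poly (p * q) z" if z: "norm z = 1" for z
    unfolding f[OF z] g[OF z] by (simp add: power_add)
  then show ?thesis unfolding laurent_on_circle_def by blast
qed

lemma laurent_on_circle_const: "laurent_on_circle (\<lambda>z. c)"
  unfolding laurent_on_circle_def by (intro exI[of _ 0] exI[of _ "[:c:]"]) simp

lemma laurent_on_circle_real_polynomial:
  assumes "real_polynomial_function f"
  shows "laurent_on_circle (\<lambda>z. of_real (f z))"
  using assms
proof induction
  case (linear f)
  have "complex_of_real (f z) = cnj z ^ 1 * poly [:(of_real (f 1) + \<i> * of_real (f \<i>)) / 2, 0, (of_real (f 1) - \<i> * of_real (f \<i>)) / 2:] z"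
    if z: "norm z = 1" for z
  proof -
    have "z = Re z *\<^sub>R 1 + Im z *\<^sub>R \<i>" by (simp add: complex_eq_iff)
    then have "f z = f (Re z *\<^sub>R 1 + Im z *\<^sub>R \<i>)" by simp
    also have "\<dots> = Re z * f 1 + Im z * f \<i>"
      by (simp only: bounded_linear.linear[OF linear] linear_add linear_scale real_scaleR_def)
    finally have fz: "f z = Re z * f 1 + Im z * f \<i>" .
    have re: "complex_of_real (Re z) = (z + cnj z) / 2" and im: "complex_of_real (Im z) = (z - cnj z) / (2 * \<i>)"
      by (simp_all add: complex_eq_iff)
    have "cnj z ^ 1 * poly [:(of_real (f 1) + \<i> * of_real (f \<i>)) / 2, 0, (of_real (f 1) - \<i> * of_real (f \<i>)) / 2:] z =
      cnj z * ((of_real (f 1) + \<i> * of_real (f \<i>)) / 2) + (cnj z * z) * z * ((of_real (f 1) - \<i> * of_real (f \<i>)) / 2)"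
      by (simp add: algebra_simps)
    also have "\<dots> = of_real (f z)"
      unfolding unit_mult_cnj[OF z] fz of_real_add of_real_mult re im by (simp add: field_simps)
    finally show ?thesis by simp
  qed
  then show ?case unfolding laurent_on_circle_def by blast
next
  case (const c)
  show ?case by (rule laurent_on_circle_const)
next
  case (add f g)
  then show ?case unfolding of_real_add by (intro laurent_on_circle_add)
next
  case (mult f g)
  then show ?case unfolding of_real_mult by (intro laurent_on_circle_mult)
qed

lemma laurent_approximation:
  fixes g :: "complex \<Rightarrow> complex"
  assumes g: "continuous_on (sphere 0 1) g" and e: "0 < e"
  obtains N p where "\<And>z. norm z = 1 \<Longrightarrow> norm (g z - cnj z ^ N * poly p z) < e"
proof -
  obtain q where q: "polynomial_function q" "\<forall>x\<in>sphere 0 1. norm (g x - q x) < e"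
    using Stone_Weierstrass_polynomial_function[OF compact_sphere g e] by blast
  have "real_polynomial_function (Re \<circ> q)" "real_polynomial_function (Im \<circ> q)"
    using q(1) bounded_linear_Re bounded_linear_Im unfolding polynomial_function_def by blast+
  then have "laurent_on_circle (\<lambda>z. of_real ((Re \<circ> q) z) + \<i> * of_real ((Im \<circ> q) z))"
    by (intro laurent_on_circle_add laurent_on_circle_mult[of "\<lambda>_. \<i>"] laurent_on_circle_const laurent_on_circle_real_polynomial)
  also have "(\<lambda>z. of_real ((Re \<circ> q) z) + \<i> * of_real ((Im \<circ> q) z)) = q"
    by (simp add: o_def complex_eq[symmetric])
  finally have "laurent_on_circle q" .
  then show thesis using q(2) that unfolding laurent_on_circle_def by (metis mem_sphere_0)
qed

section \<open>Closedness, products and inverses in the Sarason algebra\<close>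

lemma Hinf_plus_CI:
  assumes "F \<in> Linf" "f \<in> Hinf" "continuous_on (sphere 0 1) g" "AE z in circle_measure. F z = f z + g z"
  shows "F \<in> Hinf_plus_C"
  unfolding Hinf_plus_C_def using assms by blast

lemma Hinf_plus_CE:
  assumes "F \<in> Hinf_plus_C"
  obtains f g where "f \<in> Hinf" "continuous_on (sphere 0 1) g" "AE z in circle_measure. F z = f z + g z"
  using assms unfolding Hinf_plus_C_def by blast

lemma Hinf_plus_C_Linf: "F \<in> Hinf_plus_C \<Longrightarrow> F \<in> Linf"
  by (simp add: Hinf_plus_C_def)

lemma Hinf_const: "(\<lambda>z. c) \<in> Hinf"
  by (intro disc_algebra_Hinf holomorphic_intros continuous_intros)

lemma Hinf_subset_Hinf_plus_C: "f \<in> Hinf \<Longrightarrow> f \<in> Hinf_plus_C"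
  by (rule Hinf_plus_CI[of _ f "\<lambda>_. 0"]) (auto intro: Hinf_Linf)

lemma continuous_Hinf_plus_C: "continuous_on (sphere 0 1) g \<Longrightarrow> g \<in> Hinf_plus_C"
  by (rule Hinf_plus_CI[OF Linf_continuous Hinf_const[of 0]]) auto

lemma Hinf_plus_C_add:
  assumes F: "F \<in> Hinf_plus_C" and G: "G \<in> Hinf_plus_C"
  shows "(\<lambda>z. F z + G z) \<in> Hinf_plus_C"
proof -
  obtain f g where f: "f \<in> Hinf" "continuous_on (sphere 0 1) g" "AE z in circle_measure. F z = f z + g z"
    by (rule Hinf_plus_CE[OF F])
  obtain f' g' where f': "f' \<in> Hinf" "continuous_on (sphere 0 1) g'" "AE z in circle_measure. G z = f' z + g' z"
    by (rule Hinf_plus_CE[OF G])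
  show ?thesis
  proof (rule Hinf_plus_CI[OF _ Hinf_add[OF f(1) f'(1)] continuous_on_add[OF f(2) f'(2)]])
    show "AE z in circle_measure. F z + G z = f z + f' z + (g z + g' z)"
      using f(3) f'(3) by eventually_elim simp
  qed (intro Linf_add Hinf_plus_C_Linf F G)
qed

lemma Hinf_plus_C_cmult:
  assumes F: "F \<in> Hinf_plus_C"
  shows "(\<lambda>z. c * F z) \<in> Hinf_plus_C"
proof -
  obtain f g where f: "f \<in> Hinf" "continuous_on (sphere 0 1) g" "AE z in circle_measure. F z = f z + g z"
    by (rule Hinf_plus_CE[OF F])
  show ?thesis
  proof (rule Hinf_plus_CI[OF _ Hinf_mult(1)[OF Hinf_const f(1)] continuous_on_mult[OF continuous_on_const f(2)]])
    show "AE z in circle_measure. c * F z = c * f z + c * g z"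
      using f(3) by eventually_elim (simp add: distrib_left)
  qed (intro Linf_mult Linf_continuous continuous_intros Hinf_plus_C_Linf F)
qed

text \<open>Moving the dilation of the analytic part into the continuous summand leaves
  \<open>g + f\<^sub>r = (g - g\<^sub>r) + u\<^sub>r\<close>, where the index \<open>r\<close> denotes Poisson means: the first term is small
  and the second is bounded by the norm of \<open>u\<close>.\<close>

lemma Hinf_plus_C_bounded_decomposition:
  assumes u: "u \<in> Hinf_plus_C" and B: "AE z in circle_measure. norm (u z) \<le> B" "0 < B"
  obtains f g where "f \<in> Hinf" "continuous_on (sphere 0 1) g" "AE z in circle_measure. u z = f z + g z"
    "\<And>z. norm z = 1 \<Longrightarrow> norm (g z) \<le> 2 * B"
proof -
  obtain f g where f: "f \<in> Hinf" and g: "continuous_on (sphere 0 1) g" and ae: "AE z in circle_measure. u z = f z + g z"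
    by (rule Hinf_plus_CE[OF u])
  have L: "f \<in> Linf" "g \<in> Linf" "u \<in> Linf" by (intro Hinf_Linf f Linf_continuous g Hinf_plus_C_Linf u)+
  obtain s where s: "0 \<le> s" "s < 1" "\<And>w. \<lbrakk>s < norm w; norm w < 1\<rbrakk> \<Longrightarrow>
    norm (poisson_integral (\<lambda>z. 1 * g z) w - g (sgn w) * poisson_integral (\<lambda>_. 1) w) \<le> 1 * B"
    using poisson_integral_multiplier[of "\<lambda>_. 1" 1, OF Linf_continuous _ _ g B(2)] by (auto simp: continuous_on_const)
  \<comment> \<open>Any radius between \<open>s\<close> and 1 serves: there the Poisson integral of
    \<open>g\<close> differs from \<open>g\<close> by at most \<open>B\<close>.\<close>
  define r where "r = (1 + s) / 2"
  have r: "s < r" "0 < r" "r < 1" using s by (auto simp: r_def)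
  have rz: "norm (of_real r * z) < 1" "s < norm (of_real r * z)" if "norm z = 1" for z :: complex
    using r that by (auto simp: norm_mult)
  define fr where "fr = (\<lambda>z. poisson_integral f (of_real r * z))"
  have inb: "of_real r * z \<in> ball 0 1" if "norm z \<le> 1" for z :: complex
  proof -
    have "r * norm z \<le> r * 1" using r that by (intro mult_left_mono) auto
    then have "r * norm z < 1" using r by linarith
    then show ?thesis using r by (simp add: norm_mult)
  qed
  have frc: "continuous_on (cball 0 1) fr"
    unfolding fr_def by (rule continuous_on_compose2[OF holomorphic_on_imp_continuous_on[OF Hinf_poisson_integral(1)[OF f]]])
      (use inb in \<open>auto intro!: continuous_intros\<close>)
  have "poisson_integral f \<circ> (\<lambda>z. of_real r * z) holomorphic_on ball 0 1"
    by (rule holomorphic_on_compose_gen[OF _ Hinf_poisson_integral(1)[OF f]]) (use inb in \<open>auto intro!: holomorphic_intros\<close>)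
  then have frh: "fr holomorphic_on ball 0 1" by (simp add: fr_def o_def)
  have frH: "fr \<in> Hinf" by (rule disc_algebra_Hinf[OF frh frc])
  show thesis
  proof (rule that)
    show "(\<lambda>z. f z + (- 1) * fr z) \<in> Hinf" by (intro Hinf_add f Hinf_mult(1)[OF Hinf_const] frH)
    show "continuous_on (sphere 0 1) (\<lambda>z. g z + fr z)"
      by (intro continuous_on_add g continuous_on_subset[OF frc]) auto
    show "AE z in circle_measure. u z = f z + (- 1) * fr z + (g z + fr z)" using ae by eventually_elim simp
    fix z :: complex assume z: "norm z = 1"
    define w where "w = of_real r * z"
    have w: "norm w < 1" "s < norm w" using rz[OF z] by (auto simp: w_def)
    have "sgn w = z" using r z by (simp add: w_def sgn_mult sgn_of_real) (simp add: sgn_eq)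
    then have 1: "norm (poisson_integral g w - g z) \<le> B" using s(3)[OF w(2,1)] poisson_integral_one[OF w(1)] by simp
    have "poisson_integral u w = poisson_integral (\<lambda>z. f z + g z) w"
      by (rule poisson_integral_cong_AE[OF L(3) Linf_add[OF L(1,2)] ae w(1)])
    also have "\<dots> = fr z + poisson_integral g w" unfolding poisson_integral_add[OF L(1,2) w(1)] by (simp add: fr_def w_def)
    finally have "g z + fr z = poisson_integral u w - (poisson_integral g w - g z)" by simp
    also have "norm \<dots> \<le> B + B"
      by (rule order_trans[OF norm_triangle_ineq4 add_mono[OF poisson_integral_norm_le[OF w(1) L(3) B(1)] 1]])
    finally show "norm (g z + fr z) \<le> 2 * B" by simp
  qed
qed

text \<open>Sarason's closedness theorem. Consecutive differences of a fast approximating sequence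
  are decomposed with continuous parts bounded in proportion to their norms. These parts sum
  uniformly, and what is left after subtracting the sum is a uniform limit of bounded analytic
  functions.\<close>

lemma Hinf_plus_C_closed:
  assumes F: "F \<in> Linf" and approx: "\<And>e. 0 < e \<Longrightarrow> \<exists>G\<in>Hinf_plus_C. AE z in circle_measure. norm (F z - G z) \<le> e"
  shows "F \<in> Hinf_plus_C"
proof -
  have "\<forall>k. \<exists>G. G \<in> Hinf_plus_C \<and> (AE z in circle_measure. norm (F z - G z) \<le> (1/2) ^ k)"
  proof
    fix k show "\<exists>G. G \<in> Hinf_plus_C \<and> (AE z in circle_measure. norm (F z - G z) \<le> (1/2) ^ k)"
      using approx[of "(1/2) ^ k"] by auto
  qed
  then obtain G where G: "\<And>k. G k \<in> Hinf_plus_C" "\<And>k. AE z in circle_measure. norm (F z - G k z) \<le> (1/2) ^ k"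
    by metis
  define Q where "Q = (\<lambda>k q. fst q \<in> Hinf \<and> continuous_on (sphere 0 1) (snd q) \<and>
    (AE z in circle_measure. G (Suc k) z + (- 1) * G k z = fst q z + snd q z) \<and>
    (\<forall>z. norm z = 1 \<longrightarrow> norm (snd q z) \<le> 2 * (2 * (1/2) ^ k)))"
  have "\<forall>k. \<exists>q. Q k q"
  proof
    fix k
    have D: "(\<lambda>z. G (Suc k) z + (- 1) * G k z) \<in> Hinf_plus_C" by (intro Hinf_plus_C_add Hinf_plus_C_cmult G(1))
    have "AE z in circle_measure. norm (G (Suc k) z + (- 1) * G k z) \<le> 2 * (1/2) ^ k"
      using G(2)[of k] G(2)[of "Suc k"]
    proof eventually_elim
      case (elim z)
      have "norm (G (Suc k) z + (- 1) * G k z) = norm ((F z - G k z) - (F z - G (Suc k) z))" by simp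
      also have "\<dots> \<le> (1/2) ^ k + (1/2) ^ Suc k" by (rule order_trans[OF norm_triangle_ineq4 add_mono[OF elim]])
      also have "\<dots> \<le> 2 * (1/2) ^ k" by simp
      finally show ?case .
    qed
    moreover have "(0::real) < 2 * (1/2) ^ k" by simp
    ultimately obtain f g where "f \<in> Hinf" "continuous_on (sphere 0 1) g"
      "AE z in circle_measure. G (Suc k) z + (- 1) * G k z = f z + g z" "\<And>z. norm z = 1 \<Longrightarrow> norm (g z) \<le> 2 * (2 * (1/2) ^ k)"
      by (rule Hinf_plus_C_bounded_decomposition[OF D]) blast
    then show "\<exists>q. Q k q" unfolding Q_def by (intro exI[of _ "(f, g)"]) simp
  qed
  from choice[OF this] obtain q where q: "\<forall>k. Q k (q k)" by (rule exE)
  define f g where "f = (\<lambda>k. fst (q k))" and "g = (\<lambda>k. snd (q k))"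
  have f: "\<And>k. f k \<in> Hinf" and g: "\<And>k. continuous_on (sphere 0 1) (g k)"
    and ae: "\<And>k. AE z in circle_measure. G (Suc k) z + (- 1) * G k z = f k z + g k z"
    and gb: "\<And>k z. norm z = 1 \<Longrightarrow> norm (g k z) \<le> 2 * (2 * (1/2) ^ k)"
    using q unfolding Q_def f_def g_def by simp_all
  obtain f0 g0 where f0: "f0 \<in> Hinf" and g0: "continuous_on (sphere 0 1) g0" and ae0: "AE z in circle_measure. G 0 z = f0 z + g0 z"
    by (rule Hinf_plus_CE[OF G(1)[of 0]])
  have sm: "summable (\<lambda>k. 2 * (2 * (1/2) ^ (k + n)) :: real)" for n
    unfolding power_add by (intro summable_mult summable_mult2) simp
  define gs where "gs = (\<lambda>z. \<Sum>k. g k z)"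
  have "uniform_limit (sphere 0 1) (\<lambda>n z. \<Sum>k<n. g k z) gs sequentially"
    unfolding gs_def by (rule Weierstrass_m_test[where M="\<lambda>k. 2 * (2 * (1/2) ^ k)"]) (use gb sm[of 0] in auto)
  then have cgs: "continuous_on (sphere 0 1) gs"
    by (rule uniform_limit_theorem[rotated]) (auto intro!: always_eventually continuous_intros g)
  have tail: "norm (gs z - (\<Sum>k<n. g k z)) \<le> 8 * (1/2) ^ n" if z: "norm z = 1" for n z
  proof -
    have sg: "summable (\<lambda>k. g k z)"
      by (rule summable_comparison_test'[OF sm[of 0, unfolded add_0_right]]) (rule gb[OF z])
    have "gs z - (\<Sum>k<n. g k z) = (\<Sum>k. g (k + n) z)"
      unfolding gs_def using suminf_minus_initial_segment[OF sg] by simp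
    also have "norm \<dots> \<le> (\<Sum>k. 2 * (2 * (1/2) ^ (k + n)))" by (rule norm_suminf_le[OF _ sm]) (rule gb[OF z])
    also have "\<dots> = 8 * (1/2) ^ n"
    proof -
      have "(\<Sum>k. 2 * (2 * (1/2) ^ (k + n))) = (\<Sum>k. (4 * (1/2) ^ n) * (1/2) ^ k :: real)"
        by (rule arg_cong[of _ _ suminf]) (simp add: power_add mult_ac)
      also have "\<dots> = (4 * (1/2) ^ n) * (\<Sum>k. (1/2) ^ k)" by (rule suminf_mult) simp
      also have "(\<Sum>k. (1/2::real) ^ k) = 2" using suminf_geometric[of "1/2::real"] by simp
      finally show ?thesis by simp
    qed
    finally show ?thesis .
  qed
  define \<Phi> where "\<Phi> = (\<lambda>n z. f0 z + (\<Sum>k<n. f k z))"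
  have \<Phi>: "\<Phi> n \<in> Hinf" for n
  proof (induction n)
    case (Suc n)
    from Hinf_add[OF Suc f[of n]] show ?case by (simp add: \<Phi>_def add.assoc)
  qed (simp add: \<Phi>_def f0)
  have Fs: "(\<lambda>z. F z - (g0 z + gs z)) \<in> Linf" by (intro Linf_sub F Linf_continuous continuous_on_add g0 cgs)
  have "(\<lambda>z. F z - (g0 z + gs z)) \<in> Hinf"
  proof (rule Hinf_closed[OF Fs \<Phi>])
    \<comment> \<open>9 is 1 for the distance from \<open>F\<close> to \<open>G n\<close> plus 8 for
      the tail of the continuous parts.\<close>
    have "(\<lambda>n. 9 * (1/2::real) ^ n) \<longlonglongrightarrow> 9 * 0" by (intro tendsto_intros LIMSEQ_power_zero) simp
    then show "(\<lambda>n. 9 * (1/2::real) ^ n) \<longlonglongrightarrow> 0" by simp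
    fix n
    have "AE z in circle_measure. \<forall>k. G (Suc k) z + (- 1) * G k z = f k z + g k z"
      unfolding AE_all_countable using ae by blast
    then show "AE z in circle_measure. norm (F z - (g0 z + gs z) - \<Phi> n z) \<le> 9 * (1/2) ^ n"
      using ae0 G(2)[of n] AE_space
    proof eventually_elim
      case (elim z)
      then have z: "norm z = 1" by simp
      have Gn: "G n z = f0 z + g0 z + (\<Sum>k<n. f k z) + (\<Sum>k<n. g k z)"
      proof -
        have "(\<Sum>k<n. G (Suc k) z - G k z) = (\<Sum>k<n. f k z + g k z)" by (rule sum.cong) (use elim(1) in auto)
        then show ?thesis using elim(2) unfolding sum_lessThan_telescope[of "\<lambda>k. G k z" n] by (simp add: sum.distrib algebra_simps)
      qed
      have "F z - (g0 z + gs z) - \<Phi> n z = (F z - G n z) - (gs z - (\<Sum>k<n. g k z))" by (simp add: Gn \<Phi>_def)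
      also have "norm \<dots> \<le> (1/2) ^ n + 8 * (1/2) ^ n"
        by (rule order_trans[OF norm_triangle_ineq4 add_mono[OF elim(3) tail[OF z]]])
      finally show ?case by simp
    qed
  qed
  then show ?thesis by (rule Hinf_plus_CI[OF F _ continuous_on_add[OF g0 cgs]]) simp
qed

text \<open>Subtracting the value \<open>c\<close> at 0 and dividing by \<open>z\<close> in the disc
  gives a bounded analytic function with boundary values \<open>cnj z * (f z - c)\<close>; the
  remaining \<open>c * cnj z\<close> is continuous.\<close>

lemma cnj_mult_Hinf:
  assumes f: "f \<in> Hinf"
  shows "(\<lambda>z. cnj z * f z) \<in> Hinf_plus_C"
proof -
  define c where "c = poisson_integral f 0"
  define k where "k = (\<lambda>z. if z = 0 then deriv (poisson_integral f) 0 else (poisson_integral f z - poisson_integral f 0) / (z - 0))"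
  have k: "k holomorphic_on ball 0 1"
    unfolding k_def by (rule pole_lemma_open[OF Hinf_poisson_integral(1)[OF f] open_ball])
  obtain A where A: "0 < A" "\<And>w. norm w < 1 \<Longrightarrow> norm (poisson_integral f w) \<le> A"
    by (rule poisson_integral_bounded[OF Hinf_Linf[OF f]]) blast
  have ck: "continuous_on (cball 0 (1/2)) k"
    by (rule continuous_on_subset[OF holomorphic_on_imp_continuous_on[OF k]]) auto
  obtain C where "\<forall>x\<in>k ` cball 0 (1/2). norm x \<le> C"
    using compact_imp_bounded[OF compact_continuous_image[OF ck compact_cball]] unfolding bounded_iff by blast
  then have C: "norm (k z) \<le> C" if "norm z \<le> 1/2" for z using that by auto
  \<comment> \<open>On the half disc compactness bounds \<open>k\<close>; outside it division by
    \<open>z\<close> costs at most a factor 2.\<close>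
  have kb: "norm (k z) \<le> max C (4 * A)" if z: "norm z < 1" for z
  proof (cases "norm z \<le> 1/2")
    case True
    then show ?thesis using C[OF True] by simp
  next
    case False
    have "norm (poisson_integral f z - poisson_integral f 0) \<le> A + A"
      by (rule order_trans[OF norm_triangle_ineq4 add_mono[OF A(2)[OF z] A(2)]]) simp
    moreover have "A * 1 \<le> A * (2 * norm z)" using A(1) False by (intro mult_left_mono) auto
    ultimately have "norm (poisson_integral f z - poisson_integral f 0) \<le> 4 * A * norm z" by simp
    moreover have "z \<noteq> 0" using False by auto
    ultimately have "norm (k z) \<le> 4 * A" by (simp add: k_def norm_divide pos_divide_le_eq)
    then show ?thesis by simp
  qed
  have L: "(\<lambda>z. cnj z * (f z - c)) \<in> Linf"
    by (intro Linf_mult Linf_sub Hinf_Linf f Linf_continuous continuous_intros)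
  have lim: "AE z in circle_measure. ((\<lambda>r. k (of_real r * z)) \<longlongrightarrow> cnj z * (f z - c)) (at_left 1)"
    using Hinf_poisson_integral(2)[OF f] AE_space
  proof eventually_elim
    case (elim z)
    then have z: "norm z = 1" "z \<noteq> 0" by auto
    have rl: "((\<lambda>r. complex_of_real r) \<longlongrightarrow> of_real 1) (at_left 1)" by (intro tendsto_intros)
    have "((\<lambda>r. (poisson_integral f (of_real r * z) - c) / (of_real r * z)) \<longlongrightarrow> (f z - c) / (of_real 1 * z)) (at_left 1)"
      by (intro tendsto_intros rl elim(1)) (use z in simp)
    moreover have "(f z - c) / (of_real 1 * z) = cnj z * (f z - c)"
      using unit_mult_cnj[OF z(1)] z(2) by (simp add: field_simps)
    moreover have "\<forall>\<^sub>F r in at_left 1. (poisson_integral f (of_real r * z) - c) / (of_real r * z) = k (of_real r * z)"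
      using eventually_at_left_unit by eventually_elim (use z in \<open>simp add: k_def c_def\<close>)
    ultimately show ?case by (simp only:) (erule Lim_transform_eventually)
  qed
  have "(\<lambda>z. cnj z * (f z - c)) \<in> Hinf" by (rule HinfI[OF L k kb lim])
  from Hinf_plus_C_add[OF Hinf_subset_Hinf_plus_C[OF this] continuous_Hinf_plus_C[of "\<lambda>z. c * cnj z"]]
  have "(\<lambda>z. cnj z * (f z - c) + c * cnj z) \<in> Hinf_plus_C" by (simp add: continuous_intros)
  then show ?thesis by (simp add: algebra_simps)
qed

lemma cnj_power_mult_Hinf:
  assumes f: "f \<in> Hinf"
  shows "(\<lambda>z. cnj z ^ M * f z) \<in> Hinf_plus_C"
proof (induction M)
  case 0
  then show ?case using Hinf_subset_Hinf_plus_C[OF f] by simp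
next
  case (Suc M)
  obtain f' g' where f': "f' \<in> Hinf" and g': "continuous_on (sphere 0 1) g'"
    and ae: "AE z in circle_measure. cnj z ^ M * f z = f' z + g' z"
    by (rule Hinf_plus_CE[OF Suc])
  have c: "continuous_on (sphere 0 1) (\<lambda>z. cnj z * g' z)" by (intro continuous_intros g')
  have "(\<lambda>z. cnj z * f' z + cnj z * g' z) \<in> Hinf_plus_C"
    by (rule Hinf_plus_C_add[OF cnj_mult_Hinf[OF f'] continuous_Hinf_plus_C[OF c]])
  then obtain f2 g2 where f2: "f2 \<in> Hinf" "continuous_on (sphere 0 1) g2"
    "AE z in circle_measure. cnj z * f' z + cnj z * g' z = f2 z + g2 z"
    by (rule Hinf_plus_CE)
  show ?case
  proof (rule Hinf_plus_CI[OF _ f2(1,2)])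
    show "(\<lambda>z. cnj z ^ Suc M * f z) \<in> Linf"
      by (intro Linf_mult Linf_continuous Hinf_Linf f continuous_intros)
    show "AE z in circle_measure. cnj z ^ Suc M * f z = f2 z + g2 z"
      using ae f2(3)
    proof eventually_elim
      case (elim z)
      have "cnj z ^ Suc M * f z = cnj z * (cnj z ^ M * f z)" by (simp add: mult.assoc)
      also have "\<dots> = f2 z + g2 z" unfolding elim(1) using elim(2) by (simp add: distrib_left)
      finally show ?case .
    qed
  qed
qed

text \<open>Laurent polynomials are dense in the continuous functions, and taking
  \<open>cnj z ^ N\<close> out of \<open>f z + cnj z ^ N * poly p z\<close> leaves an analytic
  function.\<close>

lemma Hinf_plus_C_approximation:
  assumes F: "F \<in> Hinf_plus_C" and e: "0 < e"
  obtains M f where "f \<in> Hinf" "AE z in circle_measure. norm (F z - cnj z ^ M * f z) \<le> e"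
proof -
  obtain f g where f: "f \<in> Hinf" and g: "continuous_on (sphere 0 1) g" and ae: "AE z in circle_measure. F z = f z + g z"
    by (rule Hinf_plus_CE[OF F])
  obtain N p where p: "\<And>z. norm z = 1 \<Longrightarrow> norm (g z - cnj z ^ N * poly p z) < e"
    by (rule laurent_approximation[OF g e]) blast
  have "(\<lambda>z. z ^ N * f z + poly p z) \<in> Hinf"
    by (intro Hinf_add Hinf_mult(1) f disc_algebra_Hinf holomorphic_intros continuous_intros)
  moreover have "AE z in circle_measure. norm (F z - cnj z ^ N * (z ^ N * f z + poly p z)) \<le> e"
    using ae AE_space
  proof eventually_elim
    case (elim z)
    then have z: "norm z = 1" by simp
    have "cnj z ^ N * z ^ N = 1" using unit_mult_cnj[OF z] by (simp flip: power_mult_distrib)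
    then have "cnj z ^ N * (z ^ N * f z + poly p z) = f z + cnj z ^ N * poly p z"
      by (simp add: distrib_left mult.assoc[symmetric])
    then show ?case using p[OF z] elim(1) by simp
  qed
  ultimately show thesis by (rule that)
qed

text \<open>The product of an analytic and a continuous factor has no evident decomposition. Both
  factors are approximated by powers of \<open>cnj z\<close> times analytic functions, a form that
  is stable under products, and closedness does the rest.\<close>

lemma Hinf_plus_C_mult:
  assumes F: "F \<in> Hinf_plus_C" and G: "G \<in> Hinf_plus_C"
  shows "(\<lambda>z. F z * G z) \<in> Hinf_plus_C"
proof (rule Hinf_plus_C_closed)
  show "(\<lambda>z. F z * G z) \<in> Linf" by (intro Linf_mult Hinf_plus_C_Linf F G)
  fix e :: real assume e: "0 < e"
  obtain A where A: "0 < A" "AE z in circle_measure. norm (F z) \<le> A" by (rule LinfE[OF Hinf_plus_C_Linf[OF F]])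
  obtain B where B: "0 < B" "AE z in circle_measure. norm (G z) \<le> B" by (rule LinfE[OF Hinf_plus_C_Linf[OF G]])
  \<comment> \<open>At most 1, so that the approximant of \<open>G\<close> stays bounded by
    \<open>B + 1\<close>.\<close>
  define e2 where "e2 = min 1 (e / (2 * A))"
  have e2: "0 < e2" "e2 \<le> 1" "A * e2 \<le> e / 2"
  proof -
    show "0 < e2" "e2 \<le> 1" using e A by (auto simp: e2_def)
    have "A * e2 \<le> A * (e / (2 * A))" unfolding e2_def using A by (intro mult_left_mono) auto
    then show "A * e2 \<le> e / 2" using A by simp
  qed
  define e1 where "e1 = e / (2 * (B + 1))"
  have e1: "0 < e1" "e1 * (B + 1) = e / 2"
  proof -
    have "e / (2 * D) * D = e / 2" if "D \<noteq> 0" for D :: real using that by simp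
    from this[of "B + 1"] show "e1 * (B + 1) = e / 2" using B by (simp only: e1_def)
    show "0 < e1" using e B by (simp add: e1_def)
  qed
  obtain M f where f: "f \<in> Hinf" "AE z in circle_measure. norm (F z - cnj z ^ M * f z) \<le> e1"
    by (rule Hinf_plus_C_approximation[OF F e1(1)])
  obtain N g where g: "g \<in> Hinf" "AE z in circle_measure. norm (G z - cnj z ^ N * g z) \<le> e2"
    by (rule Hinf_plus_C_approximation[OF G e2(1)])
  have "AE z in circle_measure. norm (F z * G z - cnj z ^ (M + N) * (f z * g z)) \<le> e"
    using f(2) g(2) A(2) B(2)
  proof eventually_elim
    case (elim z)
    have "F z * G z - cnj z ^ (M + N) * (f z * g z) =
      F z * (G z - cnj z ^ N * g z) + (F z - cnj z ^ M * f z) * (cnj z ^ N * g z)"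
      by (simp add: power_add algebra_simps)
    also have "norm \<dots> \<le> A * e2 + e1 * (B + 1)"
    proof (rule norm_triangle_le[OF add_mono])
      show "norm (F z * (G z - cnj z ^ N * g z)) \<le> A * e2"
        unfolding norm_mult[of "F z"] using elim A e2 by (intro mult_mono) auto
      have "norm (cnj z ^ N * g z) \<le> norm (G z) + norm (G z - cnj z ^ N * g z)"
        using norm_triangle_ineq4[of "G z" "G z - cnj z ^ N * g z"] by simp
      then have "norm (cnj z ^ N * g z) \<le> B + 1" using elim e2 by linarith
      then show "norm ((F z - cnj z ^ M * f z) * (cnj z ^ N * g z)) \<le> e1 * (B + 1)"
        unfolding norm_mult[of "F z - cnj z ^ M * f z"] using elim e1 by (intro mult_mono) auto
    qed
    also have "\<dots> \<le> e" using e1 e2 by simp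
    finally show ?case .
  qed
  then show "\<exists>H\<in>Hinf_plus_C. AE z in circle_measure. norm (F z * G z - H z) \<le> e"
    by (intro bexI[OF _ cnj_power_mult_Hinf[OF Hinf_mult(1)[OF f(1) g(1)]]])
qed

lemma Hinf_plus_C_sum:
  assumes "finite I" "\<And>i. i \<in> I \<Longrightarrow> F i \<in> Hinf_plus_C"
  shows "(\<lambda>z. \<Sum>i\<in>I. F i z) \<in> Hinf_plus_C"
  using assms
proof (induction I rule: finite_induct)
  case empty
  show ?case by (simp add: continuous_Hinf_plus_C)
next
  case (insert i I)
  then show ?case by (simp add: Hinf_plus_C_add)
qed

lemma Hinf_plus_C_power: "F \<in> Hinf_plus_C \<Longrightarrow> (\<lambda>z. F z ^ k) \<in> Hinf_plus_C"
proof (induction k)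
  case 0
  show ?case by (simp add: continuous_Hinf_plus_C)
next
  case (Suc k)
  from Hinf_plus_C_mult[OF Suc.prems Suc.IH[OF Suc.prems]] show ?case by simp
qed

text \<open>The partial sums of the Neumann series in \<open>1 - S\<close> belong to the algebra and
  approach the inverse at a geometric rate; closedness concludes.\<close>

lemma Hinf_plus_C_inverse:
  assumes S: "S \<in> Hinf_plus_C" and near: "AE z in circle_measure. norm (S z - 1) \<le> 1/2"
  shows "(\<lambda>z. inverse (S z)) \<in> Hinf_plus_C" "AE z in circle_measure. inverse (S z) * S z = 1"
    "AE z in circle_measure. norm (inverse (S z)) \<le> 2"
proof -
  have low: "AE z in circle_measure. 1/2 \<le> norm (S z)"
    using near
  proof eventually_elim
    case (elim z)
    then show ?case using norm_triangle_ineq2[of 1 "1 - S z"] by (simp add: norm_minus_commute)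
  qed
  then show "AE z in circle_measure. inverse (S z) * S z = 1"
  proof eventually_elim
    case (elim z)
    then have "S z \<noteq> 0" by auto
    then show ?case by simp
  qed
  show le2: "AE z in circle_measure. norm (inverse (S z)) \<le> 2"
    using low
  proof eventually_elim
    case (elim z)
    from le_imp_inverse_le[OF elim] show ?case by (simp add: norm_inverse)
  qed
  have L: "(\<lambda>z. inverse (S z)) \<in> Linf"
    by (rule LinfI[OF borel_measurable_inverse[OF Linf_measurable[OF Hinf_plus_C_Linf[OF S]]] le2])
  have E: "(\<lambda>z. 1 + (- 1) * S z) \<in> Hinf_plus_C"
    by (intro Hinf_plus_C_add Hinf_plus_C_cmult S continuous_Hinf_plus_C continuous_intros)
  show "(\<lambda>z. inverse (S z)) \<in> Hinf_plus_C"
  proof (rule Hinf_plus_C_closed[OF L])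
    fix e :: real assume e: "0 < e"
    obtain n where n: "(1/2::real) ^ n < e / 2" using real_arch_pow_inv[of "e / 2" "1/2"] e by auto
    have "AE z in circle_measure. norm (inverse (S z) - (\<Sum>k<n. (1 + (- 1) * S z) ^ k)) \<le> e"
      using near low le2
    proof eventually_elim
      case (elim z)
      have "S z \<noteq> 0" using elim(2) by auto
      define x where "x = 1 - S z"
      have x: "S z = 1 - x" "norm x \<le> 1/2" using elim(1) by (auto simp: x_def norm_minus_commute)
      have "(1 - x) * (\<Sum>k<n. x ^ k) = 1 - x ^ n" by (rule one_diff_power_eq[symmetric])
      then have "inverse (S z) * (S z * (\<Sum>k<n. x ^ k)) = inverse (S z) * (1 - x ^ n)" by (simp only: x(1))
      then have "(\<Sum>k<n. x ^ k) = inverse (S z) * (1 - x ^ n)" using \<open>S z \<noteq> 0\<close> by (simp add: mult.assoc[symmetric])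
      then have "inverse (S z) - (\<Sum>k<n. x ^ k) = inverse (S z) * x ^ n" by (simp add: right_diff_distrib)
      also have "norm \<dots> \<le> 2 * (1/2) ^ n"
        unfolding norm_mult norm_power using elim(3) x(2) by (intro mult_mono power_mono) auto
      finally show ?case using n by (simp add: x_def)
    qed
    then show "\<exists>G\<in>Hinf_plus_C. AE z in circle_measure. norm (inverse (S z) - G z) \<le> e"
      by (intro bexI[of _ "\<lambda>z. \<Sum>k<n. (1 + (- 1) * S z) ^ k"] Hinf_plus_C_sum Hinf_plus_C_power E) auto
  qed
qed

section \<open>Characters of the Sarason algebra as limits of Poisson means\<close>

lemma poisson_integral_multiplier_tendsto:
  fixes g :: "complex \<Rightarrow> complex"
  assumes F: "F \<in> Linf" and g: "continuous_on (sphere 0 1) g"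
    and w: "\<And>k. norm (w k) < 1" "(\<lambda>k. norm (w k)) \<longlonglongrightarrow> 1"
  shows "(\<lambda>k. poisson_integral (\<lambda>z. F z * g z) (w k) - g (sgn (w k)) * poisson_integral F (w k)) \<longlonglongrightarrow> 0"
proof (rule tendstoI)
  fix e :: real assume e: "0 < e"
  obtain B where B: "0 < B" "AE z in circle_measure. norm (F z) \<le> B" by (rule LinfE[OF F])
  have e0: "0 < e / (2 * B)" using e B by simp
  obtain s where s: "0 \<le> s" "s < 1" "\<And>w. \<lbrakk>s < norm w; norm w < 1\<rbrakk> \<Longrightarrow>
    norm (poisson_integral (\<lambda>z. F z * g z) w - g (sgn w) * poisson_integral F w) \<le> B * (e / (2 * B))"
    by (rule poisson_integral_multiplier[OF F B(2) less_imp_le[OF B(1)] g e0]) blast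
  have "\<forall>\<^sub>F k in sequentially. s < norm (w k)" by (rule order_tendstoD(1)[OF w(2) s(2)])
  then show "\<forall>\<^sub>F k in sequentially.
    dist (poisson_integral (\<lambda>z. F z * g z) (w k) - g (sgn (w k)) * poisson_integral F (w k)) 0 < e"
  proof eventually_elim
    case (elim k)
    have "B * (e / (2 * B)) = e / 2" using B by simp
    then show ?case using s(3)[OF elim w(1)] e by simp
  qed
qed

lemma poisson_integral_continuous_asymptotically_multiplicative:
  fixes g :: "complex \<Rightarrow> complex"
  assumes F: "F \<in> Linf" and g: "continuous_on (sphere 0 1) g"
    and w: "\<And>k. norm (w k) < 1" "(\<lambda>k. norm (w k)) \<longlonglongrightarrow> 1"
  shows "(\<lambda>k. poisson_integral (\<lambda>z. F z * g z) (w k) - poisson_integral F (w k) * poisson_integral g (w k)) \<longlonglongrightarrow> 0"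
proof -
  obtain B where B: "0 < B" "\<And>w. norm w < 1 \<Longrightarrow> norm (poisson_integral F w) \<le> B"
    by (rule poisson_integral_bounded[OF F]) blast
  have "(\<lambda>k. poisson_integral (\<lambda>z. 1 * g z) (w k) - g (sgn (w k)) * poisson_integral (\<lambda>_. 1) (w k)) \<longlonglongrightarrow> 0"
    by (rule poisson_integral_multiplier_tendsto[OF Linf_continuous[OF continuous_on_const] g w])
  then have l: "(\<lambda>k. poisson_integral g (w k) - g (sgn (w k))) \<longlonglongrightarrow> 0"
    using poisson_integral_one[OF w(1)] by simp
  have "(\<lambda>k. (poisson_integral g (w k) - g (sgn (w k))) * poisson_integral F (w k)) \<longlonglongrightarrow> 0"
  proof (rule Lim_null_comparison)
    show "\<forall>\<^sub>F k in sequentially. norm ((poisson_integral g (w k) - g (sgn (w k))) * poisson_integral F (w k))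
        \<le> norm (poisson_integral g (w k) - g (sgn (w k))) * B"
      unfolding norm_mult by (intro always_eventually allI mult_left_mono B(2) w(1)) auto
    show "(\<lambda>k. norm (poisson_integral g (w k) - g (sgn (w k))) * B) \<longlonglongrightarrow> 0"
      using tendsto_mult_right[OF tendsto_norm[OF l], of B] by simp
  qed
  from tendsto_diff[OF poisson_integral_multiplier_tendsto[OF F g w] this] show ?thesis
    by (simp add: algebra_simps)
qed

text \<open>Expand the product as \<open>f * f' + f * g' + G * g\<close>. On the first term Poisson
  integration is exactly multiplicative, and the other two contain a continuous factor that is
  asymptotically pulled out.\<close>

lemma poisson_integral_asymptotically_multiplicative:
  assumes F: "F \<in> Hinf_plus_C" and G: "G \<in> Hinf_plus_C"
    and w: "\<And>k. norm (w k) < 1" "(\<lambda>k. norm (w k)) \<longlonglongrightarrow> 1"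
  shows "(\<lambda>k. poisson_integral (\<lambda>z. F z * G z) (w k) - poisson_integral F (w k) * poisson_integral G (w k)) \<longlonglongrightarrow> 0"
proof -
  obtain f g where f: "f \<in> Hinf" and g: "continuous_on (sphere 0 1) g" and aeF: "AE z in circle_measure. F z = f z + g z"
    by (rule Hinf_plus_CE[OF F])
  obtain f' g' where f': "f' \<in> Hinf" and g': "continuous_on (sphere 0 1) g'" and aeG: "AE z in circle_measure. G z = f' z + g' z"
    by (rule Hinf_plus_CE[OF G])
  have L: "f \<in> Linf" "f' \<in> Linf" "g \<in> Linf" "g' \<in> Linf" "F \<in> Linf" "G \<in> Linf"
    by (intro Hinf_Linf Linf_continuous Hinf_plus_C_Linf f f' g g' F G)+
  have PF: "poisson_integral F (w k) = poisson_integral f (w k) + poisson_integral g (w k)" for k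
    using poisson_integral_cong_AE[OF L(5) Linf_add[OF L(1,3)] aeF w(1)] poisson_integral_add[OF L(1,3) w(1)] by simp
  have PG: "poisson_integral G (w k) = poisson_integral f' (w k) + poisson_integral g' (w k)" for k
    using poisson_integral_cong_AE[OF L(6) Linf_add[OF L(2,4)] aeG w(1)] poisson_integral_add[OF L(2,4) w(1)] by simp
  have ae: "AE z in circle_measure. F z * G z = (f z * f' z + f z * g' z) + G z * g z"
    using aeF aeG by eventually_elim (simp add: algebra_simps)
  have PFG: "poisson_integral (\<lambda>z. F z * G z) (w k) = (poisson_integral f (w k) * poisson_integral f' (w k) +
      poisson_integral (\<lambda>z. f z * g' z) (w k)) + poisson_integral (\<lambda>z. G z * g z) (w k)" for k
  proof -
    have "poisson_integral (\<lambda>z. F z * G z) (w k) = poisson_integral (\<lambda>z. (f z * f' z + f z * g' z) + G z * g z) (w k)"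
      by (rule poisson_integral_cong_AE[OF _ _ ae w(1)]) (intro Linf_add Linf_mult L)+
    also have "\<dots> = poisson_integral (\<lambda>z. f z * f' z + f z * g' z) (w k) + poisson_integral (\<lambda>z. G z * g z) (w k)"
      by (rule poisson_integral_add[OF _ _ w(1)]) (intro Linf_add Linf_mult L)+
    also have "poisson_integral (\<lambda>z. f z * f' z + f z * g' z) (w k) =
        poisson_integral (\<lambda>z. f z * f' z) (w k) + poisson_integral (\<lambda>z. f z * g' z) (w k)"
      by (rule poisson_integral_add[OF _ _ w(1)]) (intro Linf_add Linf_mult L)+
    finally show ?thesis by (simp only: Hinf_mult(2)[OF f f' w(1)])
  qed
  have "(\<lambda>k. (poisson_integral (\<lambda>z. f z * g' z) (w k) - poisson_integral f (w k) * poisson_integral g' (w k)) +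
      (poisson_integral (\<lambda>z. G z * g z) (w k) - poisson_integral G (w k) * poisson_integral g (w k))) \<longlonglongrightarrow> 0 + 0"
    by (intro tendsto_add poisson_integral_continuous_asymptotically_multiplicative L g g' w)
  moreover have "(poisson_integral (\<lambda>z. f z * g' z) (w k) - poisson_integral f (w k) * poisson_integral g' (w k)) +
      (poisson_integral (\<lambda>z. G z * g z) (w k) - poisson_integral G (w k) * poisson_integral g (w k)) =
      poisson_integral (\<lambda>z. F z * G z) (w k) - poisson_integral F (w k) * poisson_integral G (w k)" for k
    unfolding PFG PF PG by (simp add: algebra_simps)
  ultimately show ?thesis by simp
qed

text \<open>If the bound failed on every annulus, evaluations at points \<open>w k\<close> tending
  to the circle would have a cluster point in a product of discs, one disc for each function of the
  algebra. The algebraic relations hold for the evaluations in the limit, so the cluster point is a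
  character, and the hypothesis at it contradicts the failure.\<close>

lemma gelfand_lower_bound_near_circle:
  fixes F :: "nat \<Rightarrow> complex \<Rightarrow> complex"
  assumes F: "\<And>j. j \<in> J \<Longrightarrow> F j \<in> Hinf_plus_C"
    and lower: "\<And>\<phi>. \<phi> \<in> maximal_ideal_space circle_measure Hinf_plus_C \<Longrightarrow> \<delta> \<le> (\<Sum>j\<in>J. norm (gelfand (F j) \<phi>))"
    and \<eta>: "\<eta> < \<delta>"
  obtains \<rho> where "0 < \<rho>" "\<rho> < 1" "\<And>w. \<lbrakk>\<rho> \<le> norm w; norm w < 1\<rbrakk> \<Longrightarrow> \<eta> \<le> (\<Sum>j\<in>J. norm (poisson_integral (F j) w))"
proof (rule ccontr)
  assume no: "\<not> thesis"
  define r where "r = (\<lambda>k. 1 - inverse (real (Suc (Suc k))))"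
  have r: "0 < r k" "r k < 1" for k by (auto simp: r_def inverse_eq_divide)
  have r1: "r \<longlonglongrightarrow> 1"
    using tendsto_diff[OF tendsto_const[of 1] LIMSEQ_Suc[OF LIMSEQ_inverse_real_of_nat]] by (simp add: r_def)
  have "\<forall>k. \<exists>w. r k \<le> norm w \<and> norm w < 1 \<and> (\<Sum>j\<in>J. norm (poisson_integral (F j) w)) < \<eta>"
  proof (rule allI, rule ccontr)
    fix k assume "\<nexists>w. r k \<le> norm w \<and> norm w < 1 \<and> (\<Sum>j\<in>J. norm (poisson_integral (F j) w)) < \<eta>"
    then have "\<eta> \<le> (\<Sum>j\<in>J. norm (poisson_integral (F j) w))" if "r k \<le> norm w" "norm w < 1" for w
      using that not_le_imp_less by blast
    then show False using no that[OF r(1,2)] by blast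
  qed
  then obtain w :: "nat \<Rightarrow> complex" where w: "\<And>k. r k \<le> norm (w k)" "\<And>k. norm (w k) < 1"
    "\<And>k. (\<Sum>j\<in>J. norm (poisson_integral (F j) (w k))) < \<eta>" by metis
  have w1: "(\<lambda>k. norm (w k)) \<longlonglongrightarrow> 1"
    by (rule tendsto_sandwich[OF always_eventually always_eventually r1 tendsto_const]) (use w(1) less_imp_le[OF w(2)] in auto)
  have "\<forall>F. \<exists>c. F \<in> Hinf_plus_C \<longrightarrow> (\<forall>k. norm (poisson_integral F (w k)) \<le> c)"
  proof
    fix F show "\<exists>c. F \<in> Hinf_plus_C \<longrightarrow> (\<forall>k. norm (poisson_integral F (w k)) \<le> c)"
    proof (cases "F \<in> Hinf_plus_C")
      case True
      obtain B where "0 < B" "\<And>w. norm w < 1 \<Longrightarrow> norm (poisson_integral F w) \<le> B"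
        by (rule poisson_integral_bounded[OF Hinf_plus_C_Linf[OF True]]) blast
      then show ?thesis using w(2) by blast
    qed simp
  qed
  then obtain c where c: "\<And>F k. F \<in> Hinf_plus_C \<Longrightarrow> norm (poisson_integral F (w k)) \<le> c F" by metis
  define x where "x = (\<lambda>k F. if F \<in> Hinf_plus_C then poisson_integral F (w k) else undefined)"
  \<comment> \<open>Coordinates outside the algebra are frozen at \<open>undefined\<close>, which
    makes the cluster point extensional, as membership in the maximal ideal space demands.\<close>
  define S where "S = (\<lambda>F. if F \<in> Hinf_plus_C then cball (0::complex) (c F) else {undefined})"
  have cS: "compact (S F)" for F by (simp add: S_def)
  have "compactin (product_topology (\<lambda>_. euclidean) UNIV) (PiE UNIV S)"
    unfolding compactin_PiE using cS by simp
  then have "compact (PiE UNIV S)" by (simp only: euclidean_product_topology compactin_euclidean_iff)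
  moreover have "filtermap x sequentially \<noteq> bot" by (simp add: filtermap_bot_iff)
  moreover have "eventually (\<lambda>y. y \<in> PiE UNIV S) (filtermap x sequentially)"
    unfolding eventually_filtermap by (intro always_eventually allI) (auto simp: x_def S_def c)
  ultimately obtain \<phi> where \<phi>: "\<phi> \<in> PiE UNIV S" "inf (nhds \<phi>) (filtermap x sequentially) \<noteq> bot"
    unfolding compact_filter by blast
  \<comment> \<open>Compactness of so large a product does not provide convergent subsequences in
    general, so limits are taken along a filter finer than the sequence and converging to
    \<open>\<phi>\<close>.\<close>
  define L where "L = inf (nhds \<phi>) (filtermap x sequentially)"
  have L0: "L \<noteq> bot" using \<phi>(2) by (simp add: L_def)
  have coord: "((\<lambda>y. y F) \<longlongrightarrow> \<phi> F) L" for F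
  proof (rule topological_tendstoI)
    fix T :: "complex set" assume T: "open T" "\<phi> F \<in> T"
    have "open ((\<lambda>y. y F) -` T)" by (rule open_vimage[OF T(1) continuous_on_product_coordinates])
    then have "eventually (\<lambda>y. y \<in> (\<lambda>y. y F) -` T) (nhds \<phi>)" using T(2) by (intro eventually_nhds_in_open) auto
    then have "eventually (\<lambda>y. y \<in> (\<lambda>y. y F) -` T) L" unfolding L_def by (rule filter_leD[OF inf_le1])
    then show "eventually (\<lambda>y. y F \<in> T) L" by simp
  qed
  have seq: "(Q \<longlongrightarrow> b) L" if "(\<lambda>k. Q (x k)) \<longlonglongrightarrow> b" for Q :: "_ \<Rightarrow> complex" and b
    by (rule tendsto_mono[of _ "filtermap x sequentially"]) (use that in \<open>auto simp: L_def filterlim_filtermap\<close>)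
  have eq: "a = b" if "(Q \<longlongrightarrow> a) L" "(\<lambda>k. Q (x k)) \<longlonglongrightarrow> b" for Q :: "_ \<Rightarrow> complex" and a b
    by (rule tendsto_unique[OF L0 that(1) seq[OF that(2)]])
  have "\<phi> \<in> maximal_ideal_space circle_measure Hinf_plus_C"
    unfolding maximal_ideal_space_def
  proof (intro CollectI conjI ballI allI impI)
    have "\<phi> F = undefined" if "F \<notin> Hinf_plus_C" for F
    proof -
      have "\<phi> F \<in> S F" using \<phi>(1) by (auto simp: PiE_def Pi_def)
      then show ?thesis using that by (simp add: S_def)
    qed
    then show "\<phi> \<in> extensional Hinf_plus_C" by (simp add: extensional_def)
  next
    fix F G assume F: "F \<in> Hinf_plus_C" and G: "G \<in> Hinf_plus_C"
    have "poisson_integral F (w k) = poisson_integral G (w k)" if "AE z in circle_measure. F z = G z" for k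
      by (rule poisson_integral_cong_AE[OF Hinf_plus_C_Linf[OF F] Hinf_plus_C_Linf[OF G] that w(2)])
    then have "\<phi> F - \<phi> G = 0" if "AE z in circle_measure. F z = G z"
      using that by (intro eq[OF tendsto_diff[OF coord coord]]) (simp add: x_def F G)
    then show "\<phi> F = \<phi> G" if "AE z in circle_measure. F z = G z" using that by simp
    have "\<phi> (\<lambda>z. F z + G z) - (\<phi> F + \<phi> G) = 0"
      by (rule eq[OF tendsto_diff[OF coord tendsto_add[OF coord coord]]])
        (simp add: x_def F G Hinf_plus_C_add poisson_integral_add Hinf_plus_C_Linf w(2))
    then show "\<phi> (\<lambda>z. F z + G z) = \<phi> F + \<phi> G" by simp
    have "\<phi> (\<lambda>z. F z * G z) - \<phi> F * \<phi> G = 0"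
      by (rule eq[OF tendsto_diff[OF coord tendsto_mult[OF coord coord]]])
        (simp add: x_def F G Hinf_plus_C_mult poisson_integral_asymptotically_multiplicative w(2) w1)
    then show "\<phi> (\<lambda>z. F z * G z) = \<phi> F * \<phi> G" by simp
  next
    fix a F assume F: "F \<in> Hinf_plus_C"
    have "\<phi> (\<lambda>z. a * F z) - a * \<phi> F = 0"
      by (rule eq[OF tendsto_diff[OF coord tendsto_mult[OF tendsto_const coord]]])
        (simp add: x_def F Hinf_plus_C_cmult poisson_integral_cmult)
    then show "\<phi> (\<lambda>z. a * F z) = a * \<phi> F" by simp
  next
    have one: "(\<lambda>_. 1) \<in> Hinf_plus_C" by (intro continuous_Hinf_plus_C continuous_on_const)
    have "\<phi> (\<lambda>_. 1) = 1" by (rule eq[OF coord]) (simp add: x_def one poisson_integral_one w(2))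
    then show "\<exists>F\<in>Hinf_plus_C. \<phi> F \<noteq> 0" by (intro bexI[OF _ one]) simp
  qed
  from lower[OF this] have "\<delta> \<le> (\<Sum>j\<in>J. norm (\<phi> (F j)))" by (simp add: gelfand_def)
  also have "\<dots> \<le> \<eta>"
  proof (rule tendsto_upperbound[OF _ _ L0])
    show "((\<lambda>y. \<Sum>j\<in>J. norm (y (F j))) \<longlongrightarrow> (\<Sum>j\<in>J. norm (\<phi> (F j)))) L"
      by (intro tendsto_sum tendsto_norm coord)
    have "(\<Sum>j\<in>J. norm (x k (F j))) \<le> \<eta>" for k
      using less_imp_le[OF w(3)[of k]] F by (simp add: x_def cong: sum.cong)
    then have "eventually (\<lambda>y. (\<Sum>j\<in>J. norm (y (F j))) \<le> \<eta>) (filtermap x sequentially)"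
      unfolding eventually_filtermap by (intro always_eventually allI)
    then show "eventually (\<lambda>y. (\<Sum>j\<in>J. norm (y (F j))) \<le> \<eta>) L"
      unfolding L_def by (rule filter_leD[OF inf_le2])
  qed
  finally show False using \<eta> by simp
qed

section \<open>The corona theorem with bounds\<close>

lemma AE_nat_ballI:
  fixes I :: "nat set"
  assumes "\<And>i. i \<in> I \<Longrightarrow> AE z in M. P i z"
  shows "AE z in M. \<forall>i\<in>I. P i z"
proof -
  have "AE z in M. i \<in> I \<longrightarrow> P i z" for i using assms[of i] by (cases "i \<in> I") auto
  then have "AE z in M. \<forall>i. i \<in> I \<longrightarrow> P i z" unfolding AE_all_countable by blast
  then show ?thesis by (simp add: Ball_def)
qed

text \<open>A single exponent lets the power of \<open>cnj z\<close> be cancelled for all functions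
  together. The sum of the individual exponents is at least each of them, and the surplus is
  compensated by a power of \<open>z\<close>.\<close>

lemma Hinf_plus_C_common_approximation:
  fixes F :: "nat \<Rightarrow> complex \<Rightarrow> complex"
  assumes J: "finite J" and F: "\<And>j. j \<in> J \<Longrightarrow> F j \<in> Hinf_plus_C" and e: "0 < e"
  obtains M f where "\<And>j. j \<in> J \<Longrightarrow> f j \<in> Hinf"
    "\<And>j. j \<in> J \<Longrightarrow> AE z in circle_measure. norm (F j z - cnj z ^ M * f j z) \<le> e"
proof -
  define Q where "Q = (\<lambda>j q. j \<in> J \<longrightarrow> snd q \<in> Hinf \<and> (AE z in circle_measure. norm (F j z - cnj z ^ fst q * snd q z) \<le> e))"
  have "\<forall>j. \<exists>q. Q j q"
  proof
    fix j show "\<exists>q. Q j q"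
    proof (cases "j \<in> J")
      case True
      obtain M f where "f \<in> Hinf" "AE z in circle_measure. norm (F j z - cnj z ^ M * f z) \<le> e"
        by (rule Hinf_plus_C_approximation[OF F[OF True] e])
      then show ?thesis unfolding Q_def by (intro exI[of _ "(M, f)"]) simp
    qed (simp add: Q_def)
  qed
  from choice[OF this] obtain q where q: "\<forall>j. Q j (q j)" by (rule exE)
  define N f where "N = (\<lambda>j. fst (q j))" and "f = (\<lambda>j. snd (q j))"
  have f: "f j \<in> Hinf" "AE z in circle_measure. norm (F j z - cnj z ^ N j * f j z) \<le> e" if "j \<in> J" for j
    using q that unfolding Q_def N_def f_def by simp_all
  define M where "M = sum N J"
  have M: "M = (M - N j) + N j" if "j \<in> J" for j
    using member_le_sum[OF that _ J, of N] by (simp add: M_def)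
  show thesis
  proof (rule that[of "\<lambda>j z. z ^ (M - N j) * f j z" M])
    fix j assume j: "j \<in> J"
    show "(\<lambda>z. z ^ (M - N j) * f j z) \<in> Hinf"
      by (intro Hinf_mult(1) f(1)[OF j] disc_algebra_Hinf holomorphic_intros continuous_intros)
    show "AE z in circle_measure. norm (F j z - cnj z ^ M * (z ^ (M - N j) * f j z)) \<le> e"
      using f(2)[OF j] AE_space
    proof eventually_elim
      case (elim z)
      then have z: "norm z = 1" by simp
      have c: "cnj z ^ k * z ^ k = 1" for k using unit_mult_cnj[OF z] by (simp flip: power_mult_distrib)
      have "cnj z ^ M = cnj z ^ (M - N j) * cnj z ^ N j" unfolding power_add[symmetric] using M[OF j] by simp
      then have "cnj z ^ M * (z ^ (M - N j) * f j z) = (cnj z ^ (M - N j) * z ^ (M - N j)) * (cnj z ^ N j * f j z)"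
        by (simp only: mult_ac)
      also have "\<dots> = cnj z ^ N j * f j z" by (simp only: c mult_1)
      finally show ?case using elim(1) by (simp only:)
    qed
  qed
qed

text \<open>Near the circle \<open>cnj z ^ M\<close> acts as a number of modulus 1, so
  \<open>F j\<close> and \<open>f j\<close> have nearly equal moduli. If all \<open>f j\<close> were
  below \<open>\<delta> / (4 * n)\<close>, each \<open>F j\<close> would be below
  \<open>\<delta> / (2 * n)\<close>, two errors of \<open>\<delta> / (8 * n)\<close> included, and
  the sum below \<open>\<delta> / 2\<close>.\<close>

lemma analytic_lower_bound_near_circle:
  fixes F f :: "nat \<Rightarrow> complex \<Rightarrow> complex"
  assumes n: "1 \<le> (n::nat)" and \<delta>: "0 < \<delta>" and F: "\<And>j. j \<in> {1..n} \<Longrightarrow> F j \<in> Hinf_plus_C"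
    and lower: "\<And>\<phi>. \<phi> \<in> maximal_ideal_space circle_measure Hinf_plus_C \<Longrightarrow> \<delta> \<le> (\<Sum>j=1..n. norm (gelfand (F j) \<phi>))"
    and f: "\<And>j. j \<in> {1..n} \<Longrightarrow> f j \<in> Hinf"
    and fb: "\<And>j. j \<in> {1..n} \<Longrightarrow> AE z in circle_measure. norm (f j z) \<le> 2"
    and close: "\<And>j. j \<in> {1..n} \<Longrightarrow> AE z in circle_measure. norm (F j z - cnj z ^ M * f j z) \<le> \<delta> / (8 * real n)"
  obtains \<rho> where "0 < \<rho>" "\<rho> < 1" "\<And>w. \<lbrakk>\<rho> \<le> norm w; norm w < 1\<rbrakk> \<Longrightarrow>
    \<exists>j\<in>{1..n}. \<delta> / (4 * real n) \<le> norm (poisson_integral (f j) w)"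
proof -
  have n0: "0 < real n" using n by simp
  have half: "\<delta> / 2 < \<delta>" using \<delta> by simp
  obtain \<rho>1 where \<rho>1: "0 < \<rho>1" "\<rho>1 < 1"
    "\<And>w. \<lbrakk>\<rho>1 \<le> norm w; norm w < 1\<rbrakk> \<Longrightarrow> \<delta> / 2 \<le> (\<Sum>j=1..n. norm (poisson_integral (F j) w))"
    by (rule gelfand_lower_bound_near_circle[OF F lower half]) blast+
  have cc: "continuous_on (sphere 0 1) (\<lambda>z. cnj z ^ M)" by (intro continuous_intros)
  \<comment> \<open>With the bound 2 on the \<open>f j\<close> this makes the error of pulling out
    \<open>cnj z ^ M\<close> at most \<open>\<delta> / (8 * n)\<close>.\<close>
  have e0: "0 < \<delta> / (16 * real n)" using \<delta> n0 by simp
  have "\<forall>j. \<exists>s. j \<in> {1..n} \<longrightarrow> s < 1 \<and> (\<forall>w. s < norm w \<longrightarrow> norm w < 1 \<longrightarrow>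
    norm (poisson_integral (\<lambda>z. f j z * cnj z ^ M) w - cnj (sgn w) ^ M * poisson_integral (f j) w) \<le> 2 * (\<delta> / (16 * real n)))"
  proof
    fix j show "\<exists>s. j \<in> {1..n} \<longrightarrow> s < 1 \<and> (\<forall>w. s < norm w \<longrightarrow> norm w < 1 \<longrightarrow>
      norm (poisson_integral (\<lambda>z. f j z * cnj z ^ M) w - cnj (sgn w) ^ M * poisson_integral (f j) w) \<le> 2 * (\<delta> / (16 * real n)))"
    proof (cases "j \<in> {1..n}")
      case True
      obtain s where s: "0 \<le> s" "s < 1" "\<And>w. \<lbrakk>s < norm w; norm w < 1\<rbrakk> \<Longrightarrow>
        norm (poisson_integral (\<lambda>z. f j z * cnj z ^ M) w - cnj (sgn w) ^ M * poisson_integral (f j) w) \<le> 2 * (\<delta> / (16 * real n))"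
        by (rule poisson_integral_multiplier[OF Hinf_Linf[OF f[OF True]] fb[OF True] zero_le_numeral cc e0]) blast
      then show ?thesis by blast
    next
      case False
      then show ?thesis by blast
    qed
  qed
  from choice[OF this] obtain s where s: "\<forall>j. j \<in> {1..n} \<longrightarrow> s j < 1 \<and> (\<forall>w. s j < norm w \<longrightarrow> norm w < 1 \<longrightarrow>
    norm (poisson_integral (\<lambda>z. f j z * cnj z ^ M) w - cnj (sgn w) ^ M * poisson_integral (f j) w) \<le> 2 * (\<delta> / (16 * real n)))"
    by (rule exE)
  define t where "t = Max (s ` {1..n})"
  have fin: "finite (s ` {1..n})" "s ` {1..n} \<noteq> {}" using n by auto
  have t: "t < 1" "\<And>j. j \<in> {1..n} \<Longrightarrow> s j \<le> t"
    using s fin by (auto simp: t_def)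
  show thesis
  proof (rule that[of "max \<rho>1 ((1 + t) / 2)"])
    show "0 < max \<rho>1 ((1 + t) / 2)" "max \<rho>1 ((1 + t) / 2) < 1" using \<rho>1 t by auto
    fix w :: complex assume w: "max \<rho>1 ((1 + t) / 2) \<le> norm w" "norm w < 1"
    then have w1: "\<rho>1 \<le> norm w" "t < norm w" using t(1) by auto
    have "w \<noteq> 0" using w1(1) \<rho>1(1) by auto
    then have c1: "norm (cnj (sgn w) ^ M) = 1" by (simp add: norm_power norm_sgn)
    show "\<exists>j\<in>{1..n}. \<delta> / (4 * real n) \<le> norm (poisson_integral (f j) w)"
    proof (rule ccontr)
      assume "\<not> ?thesis"
      then have small: "norm (poisson_integral (f j) w) < \<delta> / (4 * real n)" if "j \<in> {1..n}" for j
        using that not_le_imp_less by blast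
      have "norm (poisson_integral (F j) w) < \<delta> / (2 * real n)" if j: "j \<in> {1..n}" for j
      proof -
        have L: "(\<lambda>z. cnj z ^ M * f j z) \<in> Linf" by (intro Linf_mult Linf_continuous cc Hinf_Linf f[OF j])
        have 1: "norm (poisson_integral (F j) w - poisson_integral (\<lambda>z. cnj z ^ M * f j z) w) \<le> \<delta> / (8 * real n)"
          unfolding poisson_integral_sub[OF Hinf_plus_C_Linf[OF F[OF j]] L w(2), symmetric]
          by (rule poisson_integral_norm_le[OF w(2) Linf_sub[OF Hinf_plus_C_Linf[OF F[OF j]] L] close[OF j]])
        have "s j < norm w" using t(2)[OF j] w1(2) by simp
        then have "norm (poisson_integral (\<lambda>z. f j z * cnj z ^ M) w - cnj (sgn w) ^ M * poisson_integral (f j) w) \<le> 2 * (\<delta> / (16 * real n))"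
          using s j w(2) by blast
        then have 2: "norm (poisson_integral (\<lambda>z. cnj z ^ M * f j z) w - cnj (sgn w) ^ M * poisson_integral (f j) w) \<le> \<delta> / (8 * real n)"
          by (simp add: mult.commute)
        have 3: "norm (cnj (sgn w) ^ M * poisson_integral (f j) w) < \<delta> / (4 * real n)"
          unfolding norm_mult c1 using small[OF j] by simp
        have "norm (poisson_integral (F j) w) < \<delta> / (8 * real n) + \<delta> / (8 * real n) + \<delta> / (4 * real n)"
          using norm_triangle_ineq2[of "poisson_integral (F j) w" "poisson_integral (\<lambda>z. cnj z ^ M * f j z) w"]
            norm_triangle_ineq2[of "poisson_integral (\<lambda>z. cnj z ^ M * f j z) w" "cnj (sgn w) ^ M * poisson_integral (f j) w"] 1 2 3
          by linarith
        also have "\<dots> = \<delta> / (2 * real n)" by (simp add: field_simps)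
        finally show ?thesis .
      qed
      then have "(\<Sum>j=1..n. norm (poisson_integral (F j) w)) < (\<Sum>j=1..n. \<delta> / (2 * real n))"
        using n by (intro sum_strict_mono) auto
      also have "\<dots> = \<delta> / 2" using n0 by simp
      finally show False using \<rho>1(3)[OF w1(1) w(2)] by simp
    qed
  qed
qed

text \<open>\<open>K\<close> is obtained from \<open>n\<close> and \<delta> before \<tau> and the
  functions are known. It belongs to lists of \<open>n + 1\<close> functions: the halves of the
  \<open>f j\<close>, so as to be bounded by 1, and the constant \<tau>. The identity in the disc
  passes to the circle by radial limits.\<close>

lemma corona_power_boundary:
  fixes n :: nat and \<delta> :: real
  assumes n: "1 \<le> n" and \<delta>: "0 < \<delta>" "\<delta> \<le> 1"
  obtains K where "0 < K" and
    "\<And>\<tau> F f M. \<lbrakk>0 < \<tau>; \<tau> \<le> 1; \<And>j. j \<in> {1..n} \<Longrightarrow> F j \<in> Hinf_plus_C;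
      \<And>\<phi>. \<phi> \<in> maximal_ideal_space circle_measure Hinf_plus_C \<Longrightarrow> \<delta> \<le> (\<Sum>j=1..n. norm (gelfand (F j) \<phi>));
      \<And>j. j \<in> {1..n} \<Longrightarrow> f j \<in> Hinf; \<And>j. j \<in> {1..n} \<Longrightarrow> AE z in circle_measure. norm (f j z) \<le> 2;
      \<And>j. j \<in> {1..n} \<Longrightarrow> AE z in circle_measure. norm (F j z - cnj z ^ M * f j z) \<le> \<delta> / (8 * real n)\<rbrakk> \<Longrightarrow>
      \<exists>N q. (\<forall>i\<le>n. q i \<in> Hinf \<and> (AE z in circle_measure. norm (q i z) \<le> K)) \<and>
        (AE z in circle_measure. (\<Sum>i<n. q i z * (f (Suc i) z / 2)) + of_real \<tau> * q n z = z ^ N)"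
proof -
  \<comment> \<open>Half of \<open>\<delta> / (4 * n)\<close>, since the functions are halved; one
    large function suffices for the sum of squares.\<close>
  define \<delta>' where "\<delta>' = \<delta> / (8 * real n)"
  have n0: "1 \<le> real n" using n by simp
  have \<delta>': "0 < \<delta>'" "\<delta>' \<le> 1" using \<delta> n0 by (auto simp: \<delta>'_def divide_le_eq)
  obtain K where K: "0 < K" and corona:
    "\<And>\<tau> \<rho> f. \<lbrakk>0 < \<tau>; \<tau> \<le> 1; 0 < \<rho>; \<rho> < 1;
      \<And>i. i < Suc n \<Longrightarrow> f i holomorphic_on ball 0 1; \<And>i z. i < Suc n \<Longrightarrow> z \<in> ball 0 1 \<Longrightarrow> norm (f i z) \<le> 1;
      \<And>z. z \<in> ball 0 1 \<Longrightarrow> \<tau>\<^sup>2 \<le> (\<Sum>i<Suc n. (norm (f i z))\<^sup>2);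
      \<And>z. z \<in> ball 0 1 \<Longrightarrow> \<rho> \<le> norm z \<Longrightarrow> \<delta>'\<^sup>2 \<le> (\<Sum>i<Suc n. (norm (f i z))\<^sup>2)\<rbrakk> \<Longrightarrow>
      \<exists>N p. (\<forall>i<Suc n. p i holomorphic_on ball 0 1 \<and> (\<forall>z\<in>ball 0 1. norm (p i z) \<le> K)) \<and>
        (\<forall>z\<in>ball 0 1. (\<Sum>i<Suc n. p i z * f i z) = z ^ N)"
    by (rule corona_power[OF \<delta>', of "Suc n"]) blast
  show thesis
  proof (rule that[OF K])
    fix \<tau> F f M
    assume \<tau>: "0 < \<tau>" "\<tau> \<le> (1::real)" and F: "\<And>j. j \<in> {1..n} \<Longrightarrow> F j \<in> Hinf_plus_C"
      and lower: "\<And>\<phi>. \<phi> \<in> maximal_ideal_space circle_measure Hinf_plus_C \<Longrightarrow> \<delta> \<le> (\<Sum>j=1..n. norm (gelfand (F j) \<phi>))"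
      and f: "\<And>j. j \<in> {1..n} \<Longrightarrow> f j \<in> Hinf" and fb: "\<And>j. j \<in> {1..n} \<Longrightarrow> AE z in circle_measure. norm (f j z) \<le> 2"
      and close: "\<And>j. j \<in> {1..n} \<Longrightarrow> AE z in circle_measure. norm (F j z - cnj z ^ M * f j z) \<le> \<delta> / (8 * real n)"
    obtain \<rho> where \<rho>: "0 < \<rho>" "\<rho> < 1" "\<And>w. \<lbrakk>\<rho> \<le> norm w; norm w < 1\<rbrakk> \<Longrightarrow>
      \<exists>j\<in>{1..n}. \<delta> / (4 * real n) \<le> norm (poisson_integral (f j) w)"
      by (rule analytic_lower_bound_near_circle[OF n \<delta>(1) F lower f fb close]) blast+
    \<comment> \<open>The indices are shifted to start at 0, and place \<open>n\<close> holds the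
      constant.\<close>
    define h where "h = (\<lambda>i. if i < n then (\<lambda>z. poisson_integral (f (Suc i)) z / 2) else (\<lambda>z. of_real \<tau>))"
    have Suc: "Suc i \<in> {1..n}" if "i < n" for i using that by auto
    have hs: "(\<Sum>i<Suc n. (norm (h i z))\<^sup>2) = (\<Sum>i<n. (norm (poisson_integral (f (Suc i)) z / 2))\<^sup>2) + \<tau>\<^sup>2" for z
    proof -
      have "(\<Sum>i<n. (norm (h i z))\<^sup>2) = (\<Sum>i<n. (norm (poisson_integral (f (Suc i)) z / 2))\<^sup>2)"
        by (rule sum.cong) (auto simp: h_def)
      then show ?thesis by (simp add: h_def)
    qed
    have "\<exists>N p. (\<forall>i<Suc n. p i holomorphic_on ball 0 1 \<and> (\<forall>z\<in>ball 0 1. norm (p i z) \<le> K)) \<and>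
        (\<forall>z\<in>ball 0 1. (\<Sum>i<Suc n. p i z * h i z) = z ^ N)"
    proof (rule corona[OF \<tau> \<rho>(1,2)])
      show "h i holomorphic_on ball 0 1" for i
      proof (cases "i < n")
        case True
        then show ?thesis using Hinf_poisson_integral(1)[OF f[OF Suc[OF True]]] by (auto simp: h_def intro!: holomorphic_intros)
      qed (simp add: h_def)
      show "norm (h i z) \<le> 1" if "z \<in> ball 0 1" for i z
      proof (cases "i < n")
        case True
        have "norm z < 1" using that by simp
        from poisson_integral_norm_le[OF this Hinf_Linf[OF f[OF Suc[OF True]]] fb[OF Suc[OF True]]] True
        show ?thesis by (simp add: h_def norm_divide)
      qed (use \<tau> in \<open>simp add: h_def\<close>)
      show "\<tau>\<^sup>2 \<le> (\<Sum>i<Suc n. (norm (h i z))\<^sup>2)" for z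
        unfolding hs using sum_nonneg[of "{..<n}" "\<lambda>i. (norm (poisson_integral (f (Suc i)) z / 2))\<^sup>2"] by simp
      fix z :: complex assume z: "z \<in> ball 0 1" "\<rho> \<le> norm z"
      then obtain j where j: "j \<in> {1..n}" "\<delta> / (4 * real n) \<le> norm (poisson_integral (f j) z)"
        using \<rho>(3)[of z] by auto
      define i where "i = j - 1"
      have i: "i < n" "j = Suc i" using j(1) by (auto simp: i_def)
      have "\<delta>' = \<delta> / (4 * real n) / 2" by (simp add: \<delta>'_def)
      also have "\<dots> \<le> norm (poisson_integral (f (Suc i)) z / 2)" using j(2) unfolding i(2) norm_divide by simp
      finally have "\<delta>'\<^sup>2 \<le> (norm (poisson_integral (f (Suc i)) z / 2))\<^sup>2" using \<delta>'(1) by (intro power_mono) auto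
      also have "\<dots> \<le> (\<Sum>i<n. (norm (poisson_integral (f (Suc i)) z / 2))\<^sup>2)"
        by (rule member_le_sum[where f="\<lambda>i. (norm (poisson_integral (f (Suc i)) z / 2))\<^sup>2"]) (use i in auto)
      finally show "\<delta>'\<^sup>2 \<le> (\<Sum>i<Suc n. (norm (h i z))\<^sup>2)" unfolding hs using zero_le_power2[of \<tau>] by linarith
    qed
    then obtain N p where p: "\<And>i. i < Suc n \<Longrightarrow> p i holomorphic_on ball 0 1" "\<And>i z. i < Suc n \<Longrightarrow> z \<in> ball 0 1 \<Longrightarrow> norm (p i z) \<le> K"
      and eq: "\<And>z. z \<in> ball 0 1 \<Longrightarrow> (\<Sum>i<Suc n. p i z * h i z) = z ^ N" by blast
    have "\<forall>i. \<exists>Q. i < Suc n \<longrightarrow> Q \<in> Hinf \<and> (AE z in circle_measure. ((\<lambda>r. p i (of_real r * z)) \<longlongrightarrow> Q z) (at_left 1)) \<and>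
      (AE z in circle_measure. norm (Q z) \<le> K)"
    proof
      fix i show "\<exists>Q. i < Suc n \<longrightarrow> Q \<in> Hinf \<and> (AE z in circle_measure. ((\<lambda>r. p i (of_real r * z)) \<longlongrightarrow> Q z) (at_left 1)) \<and>
        (AE z in circle_measure. norm (Q z) \<le> K)"
      proof (cases "i < Suc n")
        case True
        obtain Q where "Q \<in> Hinf" "AE z in circle_measure. ((\<lambda>r. p i (of_real r * z)) \<longlongrightarrow> Q z) (at_left 1)"
          "AE z in circle_measure. norm (Q z) \<le> K"
          by (rule boundary_function_exists[OF p(1)[OF True] p(2)[OF True]]) blast+
        then show ?thesis by blast
      qed simp
    qed
    from choice[OF this] obtain q where q: "\<forall>i. i < Suc n \<longrightarrow> q i \<in> Hinf \<and>
      (AE z in circle_measure. ((\<lambda>r. p i (of_real r * z)) \<longlongrightarrow> q i z) (at_left 1)) \<and> (AE z in circle_measure. norm (q i z) \<le> K)"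
      by (rule exE)
    have qlim: "AE z in circle_measure. \<forall>i\<in>{..<Suc n}. ((\<lambda>r. p i (of_real r * z)) \<longlongrightarrow> q i z) (at_left 1)"
      by (rule AE_nat_ballI) (use q in blast)
    have flim: "AE z in circle_measure. \<forall>j\<in>{1..n}. ((\<lambda>r. poisson_integral (f j) (of_real r * z)) \<longlongrightarrow> f j z) (at_left 1)"
      by (rule AE_nat_ballI) (rule Hinf_poisson_integral(2)[OF f])
    have "AE z in circle_measure. (\<Sum>i<n. q i z * (f (Suc i) z / 2)) + of_real \<tau> * q n z = z ^ N"
      using qlim flim AE_space
    proof eventually_elim
      case (elim z)
      have "((\<lambda>r. (\<Sum>i<n. p i (of_real r * z) * (poisson_integral (f (Suc i)) (of_real r * z) / 2)) + of_real \<tau> * p n (of_real r * z)) \<longlongrightarrow>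
        (\<Sum>i<n. q i z * (f (Suc i) z / 2)) + of_real \<tau> * q n z) (at_left 1)"
        by (intro tendsto_add tendsto_sum tendsto_mult tendsto_divide tendsto_const elim(1)[rule_format] elim(2)[rule_format]) auto
      moreover have "\<forall>\<^sub>F r in at_left 1. (\<Sum>i<n. p i (of_real r * z) * (poisson_integral (f (Suc i)) (of_real r * z) / 2)) + of_real \<tau> * p n (of_real r * z)
        = (of_real r * z) ^ N"
        using eventually_at_left_unit
      proof eventually_elim
        case r: (elim r)
        have "of_real r * z \<in> ball 0 1" using r elim(3) by (simp add: norm_mult)
        from eq[OF this] have "(\<Sum>i<n. p i (of_real r * z) * h i (of_real r * z)) + p n (of_real r * z) * h n (of_real r * z) = (of_real r * z) ^ N"
          by simp
        moreover have "(\<Sum>i<n. p i (of_real r * z) * h i (of_real r * z)) = (\<Sum>i<n. p i (of_real r * z) * (poisson_integral (f (Suc i)) (of_real r * z) / 2))"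
          by (rule sum.cong) (auto simp: h_def)
        moreover have "h n (of_real r * z) = of_real \<tau>" by (simp add: h_def)
        ultimately show ?case by (simp only: mult.commute[of "complex_of_real \<tau>"])
      qed
      ultimately have l1: "((\<lambda>r. (complex_of_real r * z) ^ N) \<longlongrightarrow> (\<Sum>i<n. q i z * (f (Suc i) z / 2)) + of_real \<tau> * q n z) (at_left 1)"
        by (rule Lim_transform_eventually)
      have "((\<lambda>r. complex_of_real r) \<longlongrightarrow> of_real 1) (at_left 1)" by (intro tendsto_intros)
      then have "((\<lambda>r. (complex_of_real r * z) ^ N) \<longlongrightarrow> (of_real 1 * z) ^ N) (at_left 1)" by (intro tendsto_intros)
      from tendsto_unique[OF trivial_limit_at_left_real l1 this] show ?case by simp
    qed
    moreover have "\<forall>i\<le>n. q i \<in> Hinf \<and> (AE z in circle_measure. norm (q i z) \<le> K)" using q by (simp add: less_Suc_eq_le)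
    ultimately show "\<exists>N q. (\<forall>i\<le>n. q i \<in> Hinf \<and> (AE z in circle_measure. norm (q i z) \<le> K)) \<and>
        (AE z in circle_measure. (\<Sum>i<n. q i z * (f (Suc i) z / 2)) + of_real \<tau> * q n z = z ^ N)" by blast
  qed
qed

text \<open>The analytic constant survives unchanged: halving the functions halves the coefficients
  \<open>H j\<close>, and dividing by the sum \<open>S\<close>, which is within 1/2 of 1, costs a
  factor 2.\<close>

lemma corona_Hinf_plus_C:
  fixes n :: nat and \<delta> :: real
  assumes n: "1 \<le> n" and \<delta>: "0 < \<delta>" "\<delta> \<le> 1"
  obtains K where "\<And>F. \<lbrakk>\<And>j. j \<in> {1..n} \<Longrightarrow> F j \<in> Hinf_plus_C; \<And>j. j \<in> {1..n} \<Longrightarrow> linf_norm (F j) \<le> 1;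
      \<And>\<phi>. \<phi> \<in> maximal_ideal_space circle_measure Hinf_plus_C \<Longrightarrow> \<delta> \<le> (\<Sum>j=1..n. norm (gelfand (F j) \<phi>))\<rbrakk> \<Longrightarrow>
      \<exists>G. (\<forall>j\<in>{1..n}. G j \<in> Hinf_plus_C \<and> linf_norm (G j) \<le> ereal K) \<and>
        (AE z in circle_measure. (\<Sum>j=1..n. G j z * F j z) = 1)"
proof -
  obtain K where K: "0 < K" and corona:
    "\<And>\<tau> F f M. \<lbrakk>0 < \<tau>; \<tau> \<le> 1; \<And>j. j \<in> {1..n} \<Longrightarrow> F j \<in> Hinf_plus_C;
      \<And>\<phi>. \<phi> \<in> maximal_ideal_space circle_measure Hinf_plus_C \<Longrightarrow> \<delta> \<le> (\<Sum>j=1..n. norm (gelfand (F j) \<phi>));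
      \<And>j. j \<in> {1..n} \<Longrightarrow> f j \<in> Hinf; \<And>j. j \<in> {1..n} \<Longrightarrow> AE z in circle_measure. norm (f j z) \<le> 2;
      \<And>j. j \<in> {1..n} \<Longrightarrow> AE z in circle_measure. norm (F j z - cnj z ^ M * f j z) \<le> \<delta> / (8 * real n)\<rbrakk> \<Longrightarrow>
      \<exists>N q. (\<forall>i\<le>n. q i \<in> Hinf \<and> (AE z in circle_measure. norm (q i z) \<le> K)) \<and>
        (AE z in circle_measure. (\<Sum>i<n. q i z * (f (Suc i) z / 2)) + of_real \<tau> * q n z = z ^ N)"
    by (rule corona_power_boundary[OF n \<delta>]) blast
  have n0: "0 < real n" using n by simp
  \<comment> \<open>Half of the admissible error 1/2 of \<open>S\<close> is allotted to \<tau>, the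
    other half to \<epsilon>. \<open>K\<close> is already fixed, so neither choice is
    circular.\<close>
  define \<tau> where "\<tau> = min 1 (1 / (4 * K))"
  have \<tau>: "0 < \<tau>" "\<tau> \<le> 1" "\<tau> * K \<le> 1/4"
  proof -
    show "0 < \<tau>" "\<tau> \<le> 1" using K by (auto simp: \<tau>_def)
    have "\<tau> * K \<le> 1 / (4 * K) * K" unfolding \<tau>_def using K by (intro mult_right_mono) auto
    then show "\<tau> * K \<le> 1/4" using K by simp
  qed
  \<comment> \<open>The entry 1 keeps the approximants bounded by 2, the second is the accuracy that
    the lower bound near the circle requires, and the third makes the \<open>n\<close> approximation
    errors add up to at most 1/4.\<close>
  define \<epsilon> where "\<epsilon> = min (min 1 (\<delta> / (8 * real n))) (1 / (2 * real n * K))"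
  have \<epsilon>: "0 < \<epsilon>" "\<epsilon> \<le> 1" "\<epsilon> \<le> \<delta> / (8 * real n)" "real n * (K / 2 * \<epsilon>) \<le> 1/4"
  proof -
    show "0 < \<epsilon>" using K n0 \<delta> by (simp add: \<epsilon>_def)
    show "\<epsilon> \<le> 1" unfolding \<epsilon>_def by (rule min.coboundedI1[OF min.cobounded1])
    show "\<epsilon> \<le> \<delta> / (8 * real n)" unfolding \<epsilon>_def by (rule min.coboundedI1[OF min.cobounded2])
    have "\<epsilon> \<le> 1 / (2 * real n * K)" unfolding \<epsilon>_def by (rule min.cobounded2)
    then have "real n * (K / 2 * \<epsilon>) \<le> real n * (K / 2 * (1 / (2 * real n * K)))"
      using K n0 by (intro mult_left_mono) auto
    also have "\<dots> = 1/4" using K n0 by simp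
    finally show "real n * (K / 2 * \<epsilon>) \<le> 1/4" .
  qed
  show thesis
  proof (rule that[of K])
    fix F :: "nat \<Rightarrow> complex \<Rightarrow> complex"
    assume F: "\<And>j. j \<in> {1..n} \<Longrightarrow> F j \<in> Hinf_plus_C" and F1: "\<And>j. j \<in> {1..n} \<Longrightarrow> linf_norm (F j) \<le> 1"
      and lower: "\<And>\<phi>. \<phi> \<in> maximal_ideal_space circle_measure Hinf_plus_C \<Longrightarrow> \<delta> \<le> (\<Sum>j=1..n. norm (gelfand (F j) \<phi>))"
    obtain M f where f: "\<And>j. j \<in> {1..n} \<Longrightarrow> f j \<in> Hinf"
      and close: "\<And>j. j \<in> {1..n} \<Longrightarrow> AE z in circle_measure. norm (F j z - cnj z ^ M * f j z) \<le> \<epsilon>"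
      by (rule Hinf_plus_C_common_approximation[OF finite_atLeastAtMost F \<epsilon>(1)]) blast+
    have fb: "AE z in circle_measure. norm (f j z) \<le> 2" if j: "j \<in> {1..n}" for j
    proof -
      have "AE z in circle_measure. norm (F j z) \<le> 1" by (rule linf_norm_leD) (use F1[OF j] in \<open>simp add: one_ereal_def\<close>)
      then show ?thesis using close[OF j] AE_space
      proof eventually_elim
        case (elim z)
        then have "norm (cnj z ^ M * f j z) = norm (f j z)" by (simp add: norm_mult norm_power)
        then show ?case using norm_triangle_ineq2[of "cnj z ^ M * f j z" "F j z"] elim \<epsilon>(2)
          by (simp add: norm_minus_commute)
      qed
    qed
    have close': "AE z in circle_measure. norm (F j z - cnj z ^ M * f j z) \<le> \<delta> / (8 * real n)" if "j \<in> {1..n}" for j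
      using close[OF that] by eventually_elim (use \<epsilon>(3) in linarith)
    obtain N q where q: "\<And>i. i \<le> n \<Longrightarrow> q i \<in> Hinf" "\<And>i. i \<le> n \<Longrightarrow> AE z in circle_measure. norm (q i z) \<le> K"
      and eq: "AE z in circle_measure. (\<Sum>i<n. q i z * (f (Suc i) z / 2)) + of_real \<tau> * q n z = z ^ N"
      using corona[OF \<tau>(1,2) F lower f fb close'] by blast
    \<comment> \<open>\<open>z ^ M\<close> cancels the factor \<open>cnj z ^ M\<close> of the
      approximants, and \<open>cnj z ^ N\<close> inverts the right-hand side \<open>z ^ N\<close>;
      the 1/2 is the one in \<open>f / 2\<close>, and the shift of \<open>j\<close> returns to
      indices starting at 0.\<close>
    define H where "H = (\<lambda>j z. cnj z ^ N * (1 / 2 * (z ^ M * q (j - 1) z)))"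
    have H: "H j \<in> Hinf_plus_C" if "j \<in> {1..n}" for j
      unfolding H_def
      by (intro cnj_power_mult_Hinf Hinf_mult(1) Hinf_const q disc_algebra_Hinf holomorphic_intros continuous_intros) (use that in auto)
    define S where "S = (\<lambda>z. \<Sum>j=1..n. H j z * F j z)"
    have S: "S \<in> Hinf_plus_C" unfolding S_def by (intro Hinf_plus_C_sum Hinf_plus_C_mult H F) auto
    have qb: "AE z in circle_measure. \<forall>i\<in>{..n}. norm (q i z) \<le> K" by (rule AE_nat_ballI) (use q(2) in auto)
    have closeb: "AE z in circle_measure. \<forall>j\<in>{1..n}. norm (F j z - cnj z ^ M * f j z) \<le> \<epsilon>"
      by (rule AE_nat_ballI) (rule close)
    have near: "AE z in circle_measure. norm (S z - 1) \<le> 1/2"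
      using eq qb closeb AE_space
    proof eventually_elim
      case (elim z)
      then have z: "norm z = 1" by simp
      have c: "cnj z ^ k * z ^ k = 1" for k using unit_mult_cnj[OF z] by (simp flip: power_mult_distrib)
      have nz: "norm (cnj z ^ k) = 1" "norm (z ^ k) = 1" for k using z by (simp_all add: norm_power)
      define d where "d = (\<lambda>i. cnj z ^ N * (1/2 * (z ^ M * q i z)) * (F (Suc i) z - cnj z ^ M * f (Suc i) z))"
      have d: "H (Suc i) z * F (Suc i) z = cnj z ^ N * (q i z * (f (Suc i) z / 2)) + d i" for i
      proof -
        have "H (Suc i) z * F (Suc i) z = cnj z ^ N * (q i z * (f (Suc i) z / 2)) * (cnj z ^ M * z ^ M) + d i"
          by (simp add: H_def d_def right_diff_distrib diff_divide_distrib mult_ac)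
        then show ?thesis unfolding c by simp
      qed
      have "S z = (\<Sum>i<n. H (Suc i) z * F (Suc i) z)"
        unfolding S_def using sum.atLeast1_atMost_eq[of "\<lambda>j. H j z * F j z" n] by simp
      also have "\<dots> = cnj z ^ N * (\<Sum>i<n. q i z * (f (Suc i) z / 2)) + (\<Sum>i<n. d i)"
        unfolding d sum.distrib sum_distrib_left ..
      also have "(\<Sum>i<n. q i z * (f (Suc i) z / 2)) = z ^ N - of_real \<tau> * q n z" using elim(1) by (simp add: eq_diff_eq)
      finally have "S z - 1 = (\<Sum>i<n. d i) - cnj z ^ N * (of_real \<tau> * q n z)" by (simp add: right_diff_distrib c)
      also have "norm \<dots> \<le> real n * (K / 2 * \<epsilon>) + \<tau> * K"
      proof (rule order_trans[OF norm_triangle_ineq4 add_mono])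
        have "norm (d i) \<le> K / 2 * \<epsilon>" if "i \<in> {..<n}" for i
        proof -
          have "norm (d i) = norm (q i z) / 2 * norm (F (Suc i) z - cnj z ^ M * f (Suc i) z)"
            unfolding d_def norm_mult nz by simp
          also have "\<dots> \<le> K / 2 * \<epsilon>" using elim(2,3) that K by (intro mult_mono divide_right_mono) auto
          finally show ?thesis .
        qed
        then show "norm (\<Sum>i<n. d i) \<le> real n * (K / 2 * \<epsilon>)"
          using sum_norm_bound[of "{..<n}" d "K / 2 * \<epsilon>"] by simp
        show "norm (cnj z ^ N * (of_real \<tau> * q n z)) \<le> \<tau> * K"
          unfolding norm_mult nz using \<tau>(1) elim(2) by (simp add: mult_left_mono)
      qed
      also have "\<dots> \<le> 1/2" using \<epsilon>(4) \<tau>(3) by linarith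
      finally show ?case .
    qed
    note V = Hinf_plus_C_inverse[OF S near]
    show "\<exists>G. (\<forall>j\<in>{1..n}. G j \<in> Hinf_plus_C \<and> linf_norm (G j) \<le> ereal K) \<and>
        (AE z in circle_measure. (\<Sum>j=1..n. G j z * F j z) = 1)"
    proof (intro exI[of _ "\<lambda>j z. inverse (S z) * H j z"] conjI ballI)
      fix j assume j: "j \<in> {1..n}"
      show G: "(\<lambda>z. inverse (S z) * H j z) \<in> Hinf_plus_C" by (rule Hinf_plus_C_mult[OF V(1) H[OF j]])
      have "AE z in circle_measure. norm (inverse (S z) * H j z) \<le> K"
        using V(3) qb AE_space
      proof eventually_elim
        case (elim z)
        have "norm (H j z) = norm (q (j - 1) z) / 2" unfolding H_def norm_mult norm_power using elim(3) by simp
        also have "\<dots> \<le> K / 2" using elim(2) j by (intro divide_right_mono) auto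
        finally have "norm (inverse (S z) * H j z) \<le> 2 * (K / 2)"
          unfolding norm_mult using elim(1) K by (intro mult_mono) auto
        then show ?case by simp
      qed
      then show "linf_norm (\<lambda>z. inverse (S z) * H j z) \<le> ereal K"
        by (rule linf_norm_leI[OF Linf_measurable[OF Hinf_plus_C_Linf[OF G]]])
    next
      show "AE z in circle_measure. (\<Sum>j=1..n. inverse (S z) * H j z * F j z) = 1"
        using V(2) by eventually_elim (simp add: S_def sum_distrib_left mult.assoc)
    qed
  qed
qed

theorem theorem1p1:
  shows "\<forall>n::nat. \<forall>\<delta>::real. n \<ge> 1 \<and> 0 < \<delta> \<and> \<delta> \<le> 1 \<longrightarrow>
    (\<exists>K::real. \<forall>F :: nat \<Rightarrow> complex \<Rightarrow> complex.
      (\<forall>j\<in>{1..n}. F j \<in> Hinf_plus_C \<and> linf_norm (F j) \<le> 1) \<and>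
      (\<forall>t \<in> maximal_ideal_space circle_measure Hinf_plus_C.
        (\<Sum>j=1..n. norm (gelfand (F j) t)) \<ge> \<delta>) \<longrightarrow>
      (\<exists>G :: nat \<Rightarrow> complex \<Rightarrow> complex.
        (\<forall>j\<in>{1..n}. G j \<in> Hinf_plus_C) \<and>
        (AE z in circle_measure. (\<Sum>j=1..n. G j z * F j z) = 1) \<and>
        Max ((\<lambda>j. linf_norm (G j)) ` {1..n}) \<le> ereal K))"
proof (intro allI impI)
  fix n :: nat and \<delta> :: real
  assume "n \<ge> 1 \<and> 0 < \<delta> \<and> \<delta> \<le> 1"
  then have n: "1 \<le> n" and \<delta>: "0 < \<delta>" "\<delta> \<le> 1" by auto
  obtain K where K: "\<And>F. \<lbrakk>\<And>j. j \<in> {1..n} \<Longrightarrow> F j \<in> Hinf_plus_C; \<And>j. j \<in> {1..n} \<Longrightarrow> linf_norm (F j) \<le> 1;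
      \<And>\<phi>. \<phi> \<in> maximal_ideal_space circle_measure Hinf_plus_C \<Longrightarrow> \<delta> \<le> (\<Sum>j=1..n. norm (gelfand (F j) \<phi>))\<rbrakk> \<Longrightarrow>
      \<exists>G. (\<forall>j\<in>{1..n}. G j \<in> Hinf_plus_C \<and> linf_norm (G j) \<le> ereal K) \<and>
        (AE z in circle_measure. (\<Sum>j=1..n. G j z * F j z) = 1)"
    by (rule corona_Hinf_plus_C[OF n \<delta>]) blast
  show "\<exists>K::real. \<forall>F :: nat \<Rightarrow> complex \<Rightarrow> complex.
      (\<forall>j\<in>{1..n}. F j \<in> Hinf_plus_C \<and> linf_norm (F j) \<le> 1) \<and>
      (\<forall>t \<in> maximal_ideal_space circle_measure Hinf_plus_C.
        (\<Sum>j=1..n. norm (gelfand (F j) t)) \<ge> \<delta>) \<longrightarrow>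
      (\<exists>G :: nat \<Rightarrow> complex \<Rightarrow> complex.
        (\<forall>j\<in>{1..n}. G j \<in> Hinf_plus_C) \<and>
        (AE z in circle_measure. (\<Sum>j=1..n. G j z * F j z) = 1) \<and>
        Max ((\<lambda>j. linf_norm (G j)) ` {1..n}) \<le> ereal K)"
  proof (intro exI[of _ K] allI impI)
    fix F :: "nat \<Rightarrow> complex \<Rightarrow> complex"
    assume "(\<forall>j\<in>{1..n}. F j \<in> Hinf_plus_C \<and> linf_norm (F j) \<le> 1) \<and>
      (\<forall>t \<in> maximal_ideal_space circle_measure Hinf_plus_C. (\<Sum>j=1..n. norm (gelfand (F j) t)) \<ge> \<delta>)"
    then have "\<exists>G. (\<forall>j\<in>{1..n}. G j \<in> Hinf_plus_C \<and> linf_norm (G j) \<le> ereal K) \<and>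
        (AE z in circle_measure. (\<Sum>j=1..n. G j z * F j z) = 1)"
      by (intro K) auto
    then obtain G where G: "\<forall>j\<in>{1..n}. G j \<in> Hinf_plus_C \<and> linf_norm (G j) \<le> ereal K"
      "AE z in circle_measure. (\<Sum>j=1..n. G j z * F j z) = 1" by blast
    have "Max ((\<lambda>j. linf_norm (G j)) ` {1..n}) \<le> ereal K" using G(1) n by (subst Max_le_iff) auto
    then show "\<exists>G :: nat \<Rightarrow> complex \<Rightarrow> complex.
        (\<forall>j\<in>{1..n}. G j \<in> Hinf_plus_C) \<and>
        (AE z in circle_measure. (\<Sum>j=1..n. G j z * F j z) = 1) \<and>
        Max ((\<lambda>j. linf_norm (G j)) ` {1..n}) \<le> ereal K" using G by blast
  qed
qed

end
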